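(* Let $S(\lambda)$ be the differential operator function defined below, and assume: (i) the subspace $\ker(U(\lambda_0)-1)$ does not depend on $\lambda_0\in(\sigma,\tau)$; (ii) the functions $p_k(x,\lambda)$, $k=0,\dots,n$, are differentiable in $\lambda$ and the derivatives $\partial_\lambda p_k(x,\lambda)$ are continuous on $[a,b]\times(\sigma,\tau)$; (iii) $U(\lambda)$ is continuously differentiable; (iv) for every eigenpair $\{\lambda_0,y_0\}$ of $S$ (i.e. $\lambda_0\in(\sigma,\tau)$, $0\neq y_0\in\mathfrak D(S(\lambda_0))$, $S(\lambda_0)y_0=0$), \[ \sum_{k=0}^n\int_a^b \partial_\lambda p_k(x,\lambda)\big|_{\lambda=\lambda_0}\,|y_0^{(n-k)}(x)|^2\,dx+\langle A'(\lambda_0)y_0^{\wedge},y_0^{\wedge}\rangle_{\mathbb C^{2n}}<0, \] where $A$ is defined below and $A'$ is its derivative. Then for every half-open interval $[\xi_1,\xi_2)$ with $[\xi_1,\xi_2]\subset(\sigma,\tau)$, \[ \mathcal N_S(\xi_1,\xi_2)=\nu_S(\xi_2)-\nu_S(\xi_1). \]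
   Context: Setting: $p_k(x,\lambda)$, $k=0,\dots,n$, are continuous real functions on $[a,b]\times(\sigma,\tau)$; for each fixed $\lambda_0$, $p_0(\cdot,\lambda_0)>0$ and $p_0(\cdot,\lambda_0)\in C^n[a,b]$, and $p_k(\cdot,\lambda_0)\in C^{n-k}[a,b]$ for $k=1,\dots,n-1$. $U(\lambda)$ is a continuous function on $(\sigma,\tau)$ with values in unitary complex $2n\times 2n$ matrices. For fixed $\lambda_0$ define quasi-derivatives $y^{[n+m]}(x)=\sum_{k=0}^m(-1)^{m-k}\big(p_k(x,\lambda_0)y^{(n-k)}(x)\big)^{(m-k)}$, $m=0,\dots,n$, and vectors $y^{\wedge}=(y(a),y'(a),\dots,y^{(n-1)}(a),y(b),\dots,y^{(n-1)}(b))^T$, $y^{\vee}=(y^{[2n-1]}(a),y^{[2n-2]}(a),\dots,y^{[n]}(a),-y^{[2n-1]}(b),\dots,-y^{[n]}(b))^T$ in $\mathbb C^{2n}$. $S(\lambda_0)$ is the operator in $L_2[a,b]$ with domain $\{y\in W_2^{2n}[a,b]:(U(\lambda_0)-1)y^{\vee}+i(U(\lambda_0)+1)y^{\wedge}=0\}$ acting by $S(\lambda_0)y=\sum_{k=0}^n(-1)^{n-k}\big(p_k(x,\lambda_0)y^{(n-k)}\big)^{(n-k)}$. $A(\lambda_0)=\frac{1}{2\pi}\int_{\Gamma}\frac{z+1}{z-1}(U(\lambda_0)-z)^{-1}dz$, where $\Gamma$ is a positively oriented contour whose interior does not contain $1$ but contains all eigenvalues of $U(\lambda_0)$ other than $1$.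 A number $\lambda_0$ is an eigenvalue of multiplicity $m$ of $S$ if $0$ is an eigenvalue of multiplicity $m$ of $S(\lambda_0)$; $\mathcal N_S(\xi_1,\xi_2)$ is the number of eigenvalues of $S$ in $[\xi_1,\xi_2)$ counted with multiplicity; $\nu_S(\lambda_0)$ is the number of negative eigenvalues of $S(\lambda_0)$ counted with multiplicity. *)

theory Defs
  imports "HOL-Complex_Analysis.Complex_Analysis" "HOL-Library.Function_Algebras"
    "Jordan_Normal_Form.Schur_Decomposition" "Jordan_Normal_Form.Matrix_Kernel"
begin

fun dw :: "real \<Rightarrow> real \<Rightarrow> nat \<Rightarrow> (real \<Rightarrow> 'a::real_normed_vector) \<Rightarrow> real \<Rightarrow> 'a" where
  "dw a b 0 f = f"
| "dw a b (Suc i) f = (\<lambda>x. vector_derivative (dw a b i f) (at x within {a..b}))"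

definition Ck_on :: "real \<Rightarrow> real \<Rightarrow> nat \<Rightarrow> (real \<Rightarrow> 'a::real_normed_vector) \<Rightarrow> bool" where
  "Ck_on a b k f \<longleftrightarrow>
     (\<forall>i\<le>k. continuous_on {a..b} (dw a b i f)) \<and>
     (\<forall>i<k. \<forall>x\<in>{a..b}. (dw a b i f has_vector_derivative dw a b (Suc i) f x) (at x within {a..b}))"

text \<open>Sobolev space W_2^N[a,b] (N \<ge> 1): y in C^(N-1)[a,b], y^(N-1) absolutely continuous
  with derivative in L_2[a,b].\<close>
definition W2 :: "real \<Rightarrow> real \<Rightarrow> nat \<Rightarrow> (real \<Rightarrow> complex) \<Rightarrow> bool" where
  "W2 a b N y \<longleftrightarrow> Ck_on a b (N - 1) y \<and>
     (\<exists>g::real \<Rightarrow> complex. set_borel_measurable lborel {a..b} g \<and>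
        set_integrable lborel {a..b} (\<lambda>t. (cmod (g t))\<^sup>2) \<and>
        (\<forall>x\<in>{a..b}. dw a b (N - 1) y x = dw a b (N - 1) y a + (LINT t:{a..x}|lborel. g t)))"

text \<open>quasi-derivative y^[n+m](x) for the fixed lambda0\<close>
definition quasi_deriv ::
  "nat \<Rightarrow> real \<Rightarrow> real \<Rightarrow> (nat \<Rightarrow> real \<Rightarrow> real \<Rightarrow> real) \<Rightarrow> real \<Rightarrow> nat \<Rightarrow> (real \<Rightarrow> complex) \<Rightarrow> real \<Rightarrow> complex" where
  "quasi_deriv n a b p l0 m y x =
     (\<Sum>k=0..m. (-1) ^ (m - k) *
        dw a b (m - k) (\<lambda>t. complex_of_real (p k t l0) * dw a b (n - k) y t) x)"

definition bv_wedge :: "nat \<Rightarrow> real \<Rightarrow> real \<Rightarrow> (real \<Rightarrow> complex) \<Rightarrow> complex vec" where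
  "bv_wedge n a b y = vec (2 * n) (\<lambda>i. if i < n then dw a b i y a else dw a b (i - n) y b)"

definition bv_vee ::
  "nat \<Rightarrow> real \<Rightarrow> real \<Rightarrow> (nat \<Rightarrow> real \<Rightarrow> real \<Rightarrow> real) \<Rightarrow> real \<Rightarrow> (real \<Rightarrow> complex) \<Rightarrow> complex vec" where
  "bv_vee n a b p l0 y = vec (2 * n) (\<lambda>i.
      if i < n then quasi_deriv n a b p l0 (n - 1 - i) y a
      else - quasi_deriv n a b p l0 (n - 1 - (i - n)) y b)"

definition dom_S ::
  "nat \<Rightarrow> real \<Rightarrow> real \<Rightarrow> (nat \<Rightarrow> real \<Rightarrow> real \<Rightarrow> real) \<Rightarrow> (real \<Rightarrow> complex mat) \<Rightarrow> real \<Rightarrow> (real \<Rightarrow> complex) \<Rightarrow> bool" where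
  "dom_S n a b p U l0 y \<longleftrightarrow> W2 a b (2 * n) y \<and>
     (U l0 - 1\<^sub>m (2 * n)) *\<^sub>v bv_vee n a b p l0 y
       + \<i> \<cdot>\<^sub>v ((U l0 + 1\<^sub>m (2 * n)) *\<^sub>v bv_wedge n a b y) = 0\<^sub>v (2 * n)"

definition S_op ::
  "nat \<Rightarrow> real \<Rightarrow> real \<Rightarrow> (nat \<Rightarrow> real \<Rightarrow> real \<Rightarrow> real) \<Rightarrow> real \<Rightarrow> (real \<Rightarrow> complex) \<Rightarrow> real \<Rightarrow> complex" where
  "S_op n a b p l0 y x =
     (\<Sum>k=0..n. (-1) ^ (n - k) *
        dw a b (n - k) (\<lambda>t. complex_of_real (p k t l0) * dw a b (n - k) y t) x)"

text \<open>Eigenspace of S(lambda0) for eigenvalue mu, as a subspace of L_2[a,b]: elements are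
  represented by functions vanishing outside [a,b]; S y = mu y means equality in L_2,
  i.e. almost everywhere on [a,b].\<close>
definition eigsp ::
  "nat \<Rightarrow> real \<Rightarrow> real \<Rightarrow> (nat \<Rightarrow> real \<Rightarrow> real \<Rightarrow> real) \<Rightarrow> (real \<Rightarrow> complex mat) \<Rightarrow> real \<Rightarrow> complex \<Rightarrow> (real \<Rightarrow> complex) set" where
  "eigsp n a b p U l0 \<mu> = {y. dom_S n a b p U l0 y \<and> (\<forall>x. x \<notin> {a..b} \<longrightarrow> y x = 0) \<and>
      (AE x in lborel. x \<in> {a..b} \<longrightarrow> S_op n a b p l0 y x = \<mu> * y x)}"

definition fscale :: "complex \<Rightarrow> (real \<Rightarrow> complex) \<Rightarrow> (real \<Rightarrow> complex)" where
  "fscale c f = (\<lambda>x. c * f x)"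

definition eig_mult ::
  "nat \<Rightarrow> real \<Rightarrow> real \<Rightarrow> (nat \<Rightarrow> real \<Rightarrow> real \<Rightarrow> real) \<Rightarrow> (real \<Rightarrow> complex mat) \<Rightarrow> real \<Rightarrow> complex \<Rightarrow> nat" where
  "eig_mult n a b p U l0 \<mu> = vector_space.dim fscale (eigsp n a b p U l0 \<mu>)"

definition is_eig ::
  "nat \<Rightarrow> real \<Rightarrow> real \<Rightarrow> (nat \<Rightarrow> real \<Rightarrow> real \<Rightarrow> real) \<Rightarrow> (real \<Rightarrow> complex mat) \<Rightarrow> real \<Rightarrow> complex \<Rightarrow> bool" where
  "is_eig n a b p U l0 \<mu> \<longleftrightarrow> eigsp n a b p U l0 \<mu> \<noteq> {0}"

definition nu_S ::
  "nat \<Rightarrow> real \<Rightarrow> real \<Rightarrow> (nat \<Rightarrow> real \<Rightarrow> real \<Rightarrow> real) \<Rightarrow> (real \<Rightarrow> complex mat) \<Rightarrow> real \<Rightarrow> nat" where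
  "nu_S n a b p U l0 = (\<Sum>\<mu>\<in>{\<mu>::real. \<mu> < 0 \<and> is_eig n a b p U l0 (complex_of_real \<mu>)}.
        eig_mult n a b p U l0 (complex_of_real \<mu>))"

definition N_S ::
  "nat \<Rightarrow> real \<Rightarrow> real \<Rightarrow> (nat \<Rightarrow> real \<Rightarrow> real \<Rightarrow> real) \<Rightarrow> (real \<Rightarrow> complex mat) \<Rightarrow> real \<Rightarrow> real \<Rightarrow> nat" where
  "N_S n a b p U \<xi>1 \<xi>2 = (\<Sum>l\<in>{l. l \<in> {\<xi>1..<\<xi>2} \<and> is_eig n a b p U l 0}. eig_mult n a b p U l 0)"

definition unitary_mat :: "nat \<Rightarrow> complex mat \<Rightarrow> bool" where
  "unitary_mat m V \<longleftrightarrow> V \<in> carrier_mat m m \<and> V * mat_adjoint V = 1\<^sub>m m"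

definition mat_resolvent :: "nat \<Rightarrow> complex mat \<Rightarrow> complex \<Rightarrow> complex mat" where
  "mat_resolvent m V z = (THE B. B \<in> carrier_mat m m \<and> (V - z \<cdot>\<^sub>m 1\<^sub>m m) * B = 1\<^sub>m m)"

definition adm_contour :: "complex mat \<Rightarrow> (real \<Rightarrow> complex) \<Rightarrow> bool" where
  "adm_contour V \<gamma> \<longleftrightarrow> valid_path \<gamma> \<and> simple_path \<gamma> \<and> pathfinish \<gamma> = pathstart \<gamma> \<and>
     1 \<notin> path_image \<gamma> \<and> winding_number \<gamma> 1 = 0 \<and>
     (\<forall>\<omega>. eigenvalue V \<omega> \<longrightarrow> \<omega> \<notin> path_image \<gamma> \<and> (\<omega> \<noteq> 1 \<longrightarrow> winding_number \<gamma> \<omega> = 1))"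

definition A_mat :: "nat \<Rightarrow> complex mat \<Rightarrow> complex mat" where
  "A_mat m V = (let \<gamma> = (SOME \<gamma>. adm_contour V \<gamma>) in
     mat m m (\<lambda>(i, j). (1 / (2 * pi)) *
        contour_integral \<gamma> (\<lambda>z. (z + 1) / (z - 1) * mat_resolvent m V z $$ (i, j))))"

definition A_deriv :: "nat \<Rightarrow> (real \<Rightarrow> complex mat) \<Rightarrow> real \<Rightarrow> complex mat" where
  "A_deriv m U l0 = mat m m (\<lambda>(i, j). vector_derivative (\<lambda>l. A_mat m (U l) $$ (i, j)) (at l0))"

definition inner_cvec :: "complex vec \<Rightarrow> complex vec \<Rightarrow> complex" where
  "inner_cvec v w = (\<Sum>i<dim_vec v. v $ i * cnj (w $ i))"

end

theory Submission imports Defs begin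

text \<open>Green's formula identifies \<open>S(\<lambda>)\<close> with the quadratic form
  \<open>\<Sum>k \<integral> p\<^sub>k |y\<^sup>(\<^sup>n\<^sup>-\<^sup>k\<^sup>)|\<^sup>2 + \<langle>A(\<lambda>) y\<^sup>\<and>, y\<^sup>\<and>\<rangle>\<close> on the classical functions whose boundary vector is orthogonal
  to \<open>ker (U(\<lambda>) - 1)\<close>, a space independent of \<open>\<lambda>\<close>. The index of the form is the largest dimension of a
  subspace on which it is negative definite. At a degenerate parameter the space splits into a finite-dimensional
  part, on which the form is diagonal, and a complement on which it is coercive; the derivative of the form is negative
  on the kernel, so the index increases, immediately after the parameter, by the multiplicity of the eigenvalue. Hence the
  index difference between two parameters counts the eigenvalues in between. The same argument applied to the family
  \<open>S(\<lambda>\<^sub>0) - \<mu>\<close>, whose index vanishes for very negative \<open>\<mu>\<close> by Garding's inequality, shows that the index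
  of \<open>S(\<lambda>\<^sub>0)\<close> is the number of its negative eigenvalues.\<close>

section \<open>Iterated derivatives on an interval\<close>

text \<open>The form domain consists of C^n functions and is not complete in the Sobolev norm, so
  neither compact resolvents nor a spectral theorem for the form are at hand on it. Finitely many
  continuous bump functions replace them: if \<open>y\<close> is orthogonal to all of them, a
  Poincare inequality on small cells makes its L2 norm small against the first derivative, and
  Garding's inequality becomes coercivity. Functions dual to the bumps arise by solving the
  differential equation with the boundary conditions; \<open>S\<close> maps them into the span of
  the bumps, so Green's formula makes them orthogonal, in the form, to the coercive complement. What
  remains is the diagonalisation of one finite Hermitian matrix, and no eigenvalue branch in
  \<lambda> has to be followed. Two more obstacles shape the proof. The contour in
  \<open>A_mat\<close> is an arbitrary choice at each parameter, so A is differentiated through an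
  algebraic formula and not under the integral. Eigenfunctions are given in the Sobolev class by
  almost everywhere equations and must be reduced to classical solutions, after which all integrals
  are those of continuous functions.\<close>

lemma dw_cong:
  assumes "\<And>x. x \<in> {a..b} \<Longrightarrow> f x = g x" "x \<in> {a..b}"
  shows "dw a b i f x = dw a b i g x"
  using assms(2)
proof (induction i arbitrary: x)
  case 0
  then show ?case using assms(1) by simp
next
  case (Suc i)
  have "(dw a b i f has_vector_derivative d) (at x within {a..b}) \<longleftrightarrow>
        (dw a b i g has_vector_derivative d) (at x within {a..b})" for d
    using Suc by (metis has_vector_derivative_transform)
  then show ?case by (simp add: vector_derivative_def)
qed

lemma dw_dw: "dw a b i (dw a b j f) = dw a b (i + j) f"
  by (induction i) auto

text \<open>Derivatives within a nondegenerate interval are unique even at the endpoints, so any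
  explicit chain \<open>F\<close> of successive derivatives coincides with the iterated one. The
  calculus rules below reduce to exhibiting such a chain.\<close>

lemma dw_eqI:
  assumes "a < b" "\<And>x. x \<in> {a..b} \<Longrightarrow> F 0 x = f x"
    and d: "\<And>i x. i < k \<Longrightarrow> x \<in> {a..b} \<Longrightarrow> (F i has_vector_derivative F (Suc i) x) (at x within {a..b})"
    and "i \<le> k" "x \<in> {a..b}"
  shows "dw a b i f x = F i x"
  using assms(4,5)
proof (induction i arbitrary: x)
  case 0
  then show ?case using assms(2) by simp
next
  case (Suc i)
  have "(dw a b i f has_vector_derivative F (Suc i) x) (at x within {a..b})"
    using d[of i x] Suc by (auto intro: has_vector_derivative_transform[rotated 2])
  then show ?case
    using vector_derivative_within_cbox[of a b x "dw a b i f" "F (Suc i) x"] assms(1) Suc.prems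
    by (simp add: cbox_interval)
qed

text \<open>Continuity is asked of the last member only: the lower ones are differentiable, hence
  continuous.\<close>

lemma Ck_onI:
  assumes "a < b" "\<And>x. x \<in> {a..b} \<Longrightarrow> F 0 x = f x"
    and d: "\<And>i x. i < k \<Longrightarrow> x \<in> {a..b} \<Longrightarrow> (F i has_vector_derivative F (Suc i) x) (at x within {a..b})"
    and c: "continuous_on {a..b} (F k)"
  shows "Ck_on a b k f"
proof -
  have eq: "dw a b i f x = F i x" if "i \<le> k" "x \<in> {a..b}" for i x
    using dw_eqI[of a b F f k i x] assms that by auto
  have "continuous_on {a..b} (F i)" if "i \<le> k" for i
  proof (cases "i = k")
    case False
    then show ?thesis using that d[of i] 
      by (intro continuous_on_vector_derivative[of _ _ "F (Suc i)"]) auto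
  qed (use c in simp)
  then have "continuous_on {a..b} (dw a b i f)" if "i \<le> k" for i
    using that eq continuous_on_cong[of "{a..b}" "{a..b}" "dw a b i f" "F i"] by auto
  moreover have "(dw a b i f has_vector_derivative dw a b (Suc i) f x) (at x within {a..b})"
    if "i < k" "x \<in> {a..b}" for i x
  proof (rule has_vector_derivative_transform[OF that(2)])
    show "(F i has_vector_derivative dw a b (Suc i) f x) (at x within {a..b})"
      using d[OF that] eq[of "Suc i" x] that by simp
  qed (use eq that in auto)
  ultimately show ?thesis unfolding Ck_on_def by blast
qed

lemma Ck_on_cont: "Ck_on a b k f \<Longrightarrow> i \<le> k \<Longrightarrow> continuous_on {a..b} (dw a b i f)"
  by (simp add: Ck_on_def)

lemma Ck_on_deriv: "Ck_on a b k f \<Longrightarrow> i < k \<Longrightarrow> x \<in> {a..b} \<Longrightarrow>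
    (dw a b i f has_vector_derivative dw a b (Suc i) f x) (at x within {a..b})"
  unfolding Ck_on_def by blast

lemma Ck_on_mono: "Ck_on a b k f \<Longrightarrow> j \<le> k \<Longrightarrow> Ck_on a b j f"
  by (auto simp: Ck_on_def)

lemma Ck_on_cong:
  assumes "\<And>x. x \<in> {a..b} \<Longrightarrow> f x = g x"
  shows "Ck_on a b k f \<longleftrightarrow> Ck_on a b k g"
proof -
  have "Ck_on a b k g" if "Ck_on a b k f" "\<And>x. x \<in> {a..b} \<Longrightarrow> f x = g x" for f g :: "real \<Rightarrow> 'a"
  proof -
    have eq: "dw a b i f x = dw a b i g x" if "x \<in> {a..b}" for i x
      using dw_cong[of a b f g x i] that \<open>\<And>x. x \<in> {a..b} \<Longrightarrow> f x = g x\<close> by auto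
    have "continuous_on {a..b} (dw a b i g)" if "i \<le> k" for i
      using Ck_on_cont[OF \<open>Ck_on a b k f\<close> that] eq continuous_on_cong by metis
    moreover have "(dw a b i g has_vector_derivative dw a b (Suc i) g x) (at x within {a..b})"
      if "i < k" "x \<in> {a..b}" for i x
      using Ck_on_deriv[OF \<open>Ck_on a b k f\<close> that] eq that by (metis has_vector_derivative_transform)
    ultimately show ?thesis unfolding Ck_on_def by blast
  qed
  then show ?thesis using assms by (metis (full_types))
qed

section \<open>Linear combinations and products of C^k functions\<close>

lemma Ck_on_dw:
  assumes "Ck_on a b (k + j) f"
  shows "Ck_on a b k (dw a b j f)"
  unfolding Ck_on_def dw_dw
proof (intro conjI allI impI ballI)
  show "continuous_on {a..b} (dw a b (i + j) f)" if "i \<le> k" for i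
    using assms that by (intro Ck_on_cont) auto
  show "(dw a b (i + j) f has_vector_derivative dw a b (Suc i + j) f x) (at x within {a..b})"
    if "i < k" "x \<in> {a..b}" for i x
    using Ck_on_deriv[OF assms, of "i + j" x] that by simp
qed

lemma
  assumes "a < b" "Ck_on a b k f" "Ck_on a b k g"
  shows Ck_on_add: "Ck_on a b k (\<lambda>x. f x + g x)"
    and dw_add: "i \<le> k \<Longrightarrow> x \<in> {a..b} \<Longrightarrow> dw a b i (\<lambda>x. f x + g x) x = dw a b i f x + dw a b i g x"
proof -
  let ?F = "\<lambda>i x. dw a b i f x + dw a b i g x"
  have d: "(?F i has_vector_derivative ?F (Suc i) x) (at x within {a..b})" if "i < k" "x \<in> {a..b}" for i x
    using Ck_on_deriv[OF assms(2) that] Ck_on_deriv[OF assms(3) that]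
    by (rule has_vector_derivative_add)
  show "Ck_on a b k (\<lambda>x. f x + g x)"
    using d assms by (intro Ck_onI[where F = ?F]) (auto intro!: continuous_intros Ck_on_cont)
  show "i \<le> k \<Longrightarrow> x \<in> {a..b} \<Longrightarrow> dw a b i (\<lambda>x. f x + g x) x = dw a b i f x + dw a b i g x"
    using dw_eqI[where F = ?F, OF assms(1) _ d] by auto
qed

lemma
  fixes f :: "real \<Rightarrow> complex"
  assumes "a < b" "Ck_on a b k f"
  shows Ck_on_cmult: "Ck_on a b k (\<lambda>x. c * f x)"
    and dw_cmult: "i \<le> k \<Longrightarrow> x \<in> {a..b} \<Longrightarrow> dw a b i (\<lambda>x. c * f x) x = c * dw a b i f x"
proof -
  let ?F = "\<lambda>i x. c * dw a b i f x"
  have d: "(?F i has_vector_derivative ?F (Suc i) x) (at x within {a..b})" if "i < k" "x \<in> {a..b}" for i x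
    using has_vector_derivative_mult_right[OF Ck_on_deriv[OF assms(2) that]] .
  show "Ck_on a b k (\<lambda>x. c * f x)"
    using d assms by (intro Ck_onI[where F = ?F]) (auto intro!: continuous_intros Ck_on_cont)
  show "i \<le> k \<Longrightarrow> x \<in> {a..b} \<Longrightarrow> dw a b i (\<lambda>x. c * f x) x = c * dw a b i f x"
    using dw_eqI[where F = ?F, OF assms(1) _ d] by auto
qed

lemma
  fixes f :: "real \<Rightarrow> 'a::real_normed_vector"
  assumes "a < b"
  shows Ck_on_zero: "Ck_on a b k (\<lambda>x. 0::'a)"
    and dw_zero: "x \<in> {a..b} \<Longrightarrow> dw a b i (\<lambda>x. 0::'a) x = 0"
  using Ck_onI[where F = "\<lambda>i x. 0::'a" and f = "\<lambda>x. 0", OF assms]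
    dw_eqI[where F = "\<lambda>i x. 0::'a" and f = "\<lambda>x. 0" and k = i, OF assms, of i x]
  by auto

lemma
  fixes f :: "'i \<Rightarrow> real \<Rightarrow> complex"
  assumes "a < b" "finite J" "\<And>j. j \<in> J \<Longrightarrow> Ck_on a b k (f j)"
  shows Ck_on_lincomb: "Ck_on a b k (\<lambda>x. \<Sum>j\<in>J. c j * f j x)"
    and dw_lincomb: "i \<le> k \<Longrightarrow> x \<in> {a..b} \<Longrightarrow>
        dw a b i (\<lambda>x. \<Sum>j\<in>J. c j * f j x) x = (\<Sum>j\<in>J. c j * dw a b i (f j) x)"
proof -
  have "Ck_on a b k (\<lambda>x. \<Sum>j\<in>J. c j * f j x) \<and>
     (\<forall>i\<le>k. \<forall>x\<in>{a..b}. dw a b i (\<lambda>x. \<Sum>j\<in>J. c j * f j x) x = (\<Sum>j\<in>J. c j * dw a b i (f j) x))"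
    using assms(2,3)
  proof (induction J rule: finite_induct)
    case empty
    then show ?case using assms(1) by (simp add: Ck_on_zero dw_zero)
  next
    case (insert j J)
    have 1: "Ck_on a b k (\<lambda>x. c j * f j x)" using insert.prems assms(1) by (intro Ck_on_cmult) auto
    have 2: "Ck_on a b k (\<lambda>x. \<Sum>j\<in>J. c j * f j x)" using insert by auto
    show ?case
      using insert Ck_on_add[OF assms(1) 1 2] dw_add[OF assms(1) 1 2] dw_cmult[OF assms(1), of k "f j"]
      by auto
  qed
  then show "Ck_on a b k (\<lambda>x. \<Sum>j\<in>J. c j * f j x)"
    "i \<le> k \<Longrightarrow> x \<in> {a..b} \<Longrightarrow>
        dw a b i (\<lambda>x. \<Sum>j\<in>J. c j * f j x) x = (\<Sum>j\<in>J. c j * dw a b i (f j) x)" by auto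
qed

text \<open>Leibniz' rule written for arbitrary chains \<open>P\<close> and \<open>G\<close> rather
  than for functions: in the expansion of \<open>S\<close> the last member of \<open>G\<close> is a
  derivative known at a single point only.\<close>

definition leibniz :: "(nat \<Rightarrow> real \<Rightarrow> real) \<Rightarrow> (nat \<Rightarrow> real \<Rightarrow> complex) \<Rightarrow> nat \<Rightarrow> real \<Rightarrow> complex" where
  "leibniz P G i x = (\<Sum>j\<le>i. real (i choose j) *\<^sub>R (P j x *\<^sub>R G (i - j) x))"

lemma leibniz_deriv:
  assumes "\<And>j. j \<le> i \<Longrightarrow> (P j has_vector_derivative P (Suc j) x) (at x within S)"
    and "\<And>j. j \<le> i \<Longrightarrow> (G j has_vector_derivative G (Suc j) x) (at x within S)"
  shows "(leibniz P G i has_vector_derivative leibniz P G (Suc i) x) (at x within S)"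
proof -
  have d: "((\<lambda>x. leibniz P G i x) has_vector_derivative
      (\<Sum>j\<le>i. real (i choose j) *\<^sub>R (P j x *\<^sub>R G (Suc (i - j)) x + P (Suc j) x *\<^sub>R G (i - j) x))) (at x within S)"
    unfolding leibniz_def
  proof (intro has_vector_derivative_sum)
    fix j assume "j \<in> {..i}"
    then have "((\<lambda>x. P j x *\<^sub>R G (i - j) x) has_vector_derivative
        P j x *\<^sub>R G (Suc (i - j)) x + P (Suc j) x *\<^sub>R G (i - j) x) (at x within S)"
      using assms by (intro has_vector_derivative_scaleR) (auto simp: has_real_derivative_iff_has_vector_derivative)
    then show "((\<lambda>x. real (i choose j) *\<^sub>R (P j x *\<^sub>R G (i - j) x)) has_vector_derivative
      real (i choose j) *\<^sub>R (P j x *\<^sub>R G (Suc (i - j)) x + P (Suc j) x *\<^sub>R G (i - j) x)) (at x within S)"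
      by (rule bounded_linear.has_vector_derivative[OF bounded_linear_scaleR_right])
  qed
  \<comment> \<open>The summand for \<open>Suc i\<close> carries the coefficient
    \<open>i choose Suc i\<close>, which is 0; both sums can therefore run up to
    \<open>Suc i\<close> and be merged by Pascal's rule.\<close>
  have 1: "(\<Sum>j\<le>i. real (i choose j) *\<^sub>R (P j x *\<^sub>R G (Suc (i - j)) x))
     = (\<Sum>j\<le>Suc i. real (i choose j) *\<^sub>R (P j x *\<^sub>R G (Suc i - j) x))"
    by (simp add: Suc_diff_le)
  have 2: "(\<Sum>j\<le>i. real (i choose j) *\<^sub>R (P (Suc j) x *\<^sub>R G (i - j) x))
     = (\<Sum>j\<le>Suc i. (if j = 0 then 0 else real (i choose (j - 1))) *\<^sub>R (P j x *\<^sub>R G (Suc i - j) x))"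
    by (subst sum.atMost_Suc_shift) simp
  have "leibniz P G (Suc i) x = (\<Sum>j\<le>Suc i. (real (i choose j) + (if j = 0 then 0 else real (i choose (j - 1)))) *\<^sub>R (P j x *\<^sub>R G (Suc i - j) x))"
    unfolding leibniz_def
  proof (rule sum.cong[OF refl])
    fix j
    show "real (Suc i choose j) *\<^sub>R P j x *\<^sub>R G (Suc i - j) x =
         (real (i choose j) + (if j = 0 then 0 else real (i choose (j - 1)))) *\<^sub>R P j x *\<^sub>R G (Suc i - j) x"
      by (cases j) auto
  qed
  also have "\<dots> = (\<Sum>j\<le>i. real (i choose j) *\<^sub>R (P j x *\<^sub>R G (Suc (i - j)) x + P (Suc j) x *\<^sub>R G (i - j) x))"
    by (simp only: scaleR_add_left scaleR_add_right sum.distrib 1 2)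
  finally show ?thesis using d by simp
qed

lemma
  fixes p :: "real \<Rightarrow> real" and g :: "real \<Rightarrow> complex"
  assumes "a < b" "Ck_on a b k p" "Ck_on a b k g"
  shows Ck_on_prod: "Ck_on a b k (\<lambda>x. complex_of_real (p x) * g x)"
    and dw_prod: "i \<le> k \<Longrightarrow> x \<in> {a..b} \<Longrightarrow>
       dw a b i (\<lambda>x. complex_of_real (p x) * g x) x = leibniz (\<lambda>j. dw a b j p) (\<lambda>j. dw a b j g) i x"
proof -
  let ?F = "leibniz (\<lambda>j. dw a b j p) (\<lambda>j. dw a b j g)"
  have d: "(?F i has_vector_derivative ?F (Suc i) x) (at x within {a..b})" if "i < k" "x \<in> {a..b}" for i x
    using that assms(2,3) by (intro leibniz_deriv Ck_on_deriv) auto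
  have 0: "?F 0 x = complex_of_real (p x) * g x" for x by (simp add: leibniz_def scaleR_conv_of_real)
  have "continuous_on {a..b} (?F k)"
    unfolding leibniz_def using assms by (auto intro!: continuous_intros Ck_on_cont)
  then show "Ck_on a b k (\<lambda>x. complex_of_real (p x) * g x)"
    using d assms 0 by (intro Ck_onI[where F = ?F]) auto
  show "i \<le> k \<Longrightarrow> x \<in> {a..b} \<Longrightarrow>
       dw a b i (\<lambda>x. complex_of_real (p x) * g x) x = ?F i x"
    using dw_eqI[where F = ?F, OF assms(1) _ d] 0 by auto
qed

section \<open>Linear differential equations\<close>

text \<open>Picard iteration written as a Volterra series: \<open>Y k\<close> is the k-th correction
  and \<open>D k\<close> its derivative. Factorial bounds on the corrections allow termwise
  differentiation on all of [a,b], so the solution is global without any continuation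
  argument.\<close>

lemma linear_ode_system:
  fixes A :: "nat \<Rightarrow> nat \<Rightarrow> real \<Rightarrow> complex"
  assumes ab: "a < b"
    and A: "\<And>i j. i < m \<Longrightarrow> j < m \<Longrightarrow> continuous_on {a..b} (A i j)"
    and g: "\<And>i. i < m \<Longrightarrow> continuous_on {a..b} (g i)"
  shows "\<exists>Y. (\<forall>i<m. Y i a = \<eta> i) \<and> (\<forall>i<m. \<forall>x\<in>{a..b}.
      (Y i has_vector_derivative (\<Sum>j<m. A i j x * Y j x) + g i x) (at x within {a..b}))"
proof -
  define T where "T y i x = integral {a..x} (\<lambda>t. \<Sum>j<m. A i j t * y j t)" for y i x
  define Y where "Y = rec_nat (\<lambda>i x. \<eta> i + integral {a..x} (g i)) (\<lambda>_ y. T y)"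
  have Y0: "Y 0 = (\<lambda>i x. \<eta> i + integral {a..x} (g i))" by (simp add: Y_def)
  have YS: "Y (Suc k) = T (Y k)" for k by (simp add: Y_def)
  define D where "D k i x = (case k of 0 \<Rightarrow> g i x | Suc k \<Rightarrow> \<Sum>j<m. A i j x * Y k j x)" for k i x
  have cD: "\<forall>i<m. continuous_on {a..b} (D k i) \<and> continuous_on {a..b} (Y k i) \<and>
      (\<forall>x\<in>{a..b}. (Y k i has_vector_derivative D k i x) (at x within {a..b}))" for k
  proof (induction k)
    case 0
    have "(Y 0 i has_vector_derivative D 0 i x) (at x within {a..b})" if "i < m" "x \<in> {a..b}" for i x
      using integral_has_vector_derivative[OF g[OF that(1)] that(2)]
      by (auto simp: Y0 D_def intro!: derivative_eq_intros)
    moreover from this have "continuous_on {a..b} (Y 0 i)" if "i < m" for i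
      using that by (intro continuous_on_vector_derivative) auto
    ultimately show ?case using g by (auto simp: D_def)
  next
    case (Suc k)
    have c: "continuous_on {a..b} (D (Suc k) i)" if "i < m" for i
      using Suc A that by (auto simp: D_def intro!: continuous_intros)
    then have "(Y (Suc k) i has_vector_derivative D (Suc k) i x) (at x within {a..b})" if "i < m" "x \<in> {a..b}" for i x
      using integral_has_vector_derivative[OF c[OF that(1)] that(2)] by (simp add: YS T_def[abs_def] D_def[abs_def])
    moreover from this have "continuous_on {a..b} (Y (Suc k) i)" if "i < m" for i
      using that by (intro continuous_on_vector_derivative) auto
    ultimately show ?case using c by auto
  qed
  have "\<exists>K. \<forall>x\<in>{a..b}. \<forall>i<m. \<forall>j<m. cmod (A i j x) \<le> K"
  proof -
    have "\<forall>i j. \<exists>K. i < m \<longrightarrow> j < m \<longrightarrow> (\<forall>x\<in>{a..b}. cmod (A i j x) \<le> K)"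
      using compact_continuous_image[OF A] bounded_iff compact_imp_bounded by (metis compact_Icc imageI)
    then obtain K where K: "\<And>i j x. i < m \<Longrightarrow> j < m \<Longrightarrow> x \<in> {a..b} \<Longrightarrow> cmod (A i j x) \<le> K i j" by metis
    have "cmod (A i j x) \<le> (\<Sum>i<m. \<Sum>j<m. \<bar>K i j\<bar>)" if "i < m" "j < m" "x \<in> {a..b}" for i j x
    proof -
      have "cmod (A i j x) \<le> \<bar>K i j\<bar>" using K[OF that] by linarith
      also have "\<dots> \<le> (\<Sum>j<m. \<bar>K i j\<bar>)" using that by (intro member_le_sum) auto
      also have "\<dots> \<le> (\<Sum>i<m. \<Sum>j<m. \<bar>K i j\<bar>)"
        using that by (intro member_le_sum[of i _ "\<lambda>i. \<Sum>j<m. \<bar>K i j\<bar>"]) (auto intro: sum_nonneg)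
      finally show ?thesis .
    qed
    then show ?thesis by blast
  qed
  then obtain K where K0: "\<And>i j x. i < m \<Longrightarrow> j < m \<Longrightarrow> x \<in> {a..b} \<Longrightarrow> cmod (A i j x) \<le> K" by blast
  have "\<exists>B\<ge>0. \<forall>i<m. \<forall>x\<in>{a..b}. cmod (Y 0 i x) \<le> B \<and> cmod (D 0 i x) \<le> B"
  proof -
    have "\<forall>i. \<exists>K. i < m \<longrightarrow> (\<forall>x\<in>{a..b}. cmod (Y 0 i x) \<le> K)"
      "\<forall>i. \<exists>K. i < m \<longrightarrow> (\<forall>x\<in>{a..b}. cmod (D 0 i x) \<le> K)"
      using compact_continuous_image[of "{a..b}"] cD[of 0] bounded_iff compact_imp_bounded
      by (metis compact_Icc imageI)+
    then obtain B B' where B: "\<And>i x. i < m \<Longrightarrow> x \<in> {a..b} \<Longrightarrow> cmod (Y 0 i x) \<le> B i"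
       "\<And>i x. i < m \<Longrightarrow> x \<in> {a..b} \<Longrightarrow> cmod (D 0 i x) \<le> B' i" by metis
    have le: "\<bar>B i\<bar> + \<bar>B' i\<bar> \<le> (\<Sum>i<m. \<bar>B i\<bar> + \<bar>B' i\<bar>)" if "i < m" for i
      using that by (intro member_le_sum[of i _ "\<lambda>i. \<bar>B i\<bar> + \<bar>B' i\<bar>"]) auto
    show ?thesis
    proof (intro exI[of _ "(\<Sum>i<m. \<bar>B i\<bar> + \<bar>B' i\<bar>)"] conjI allI impI ballI)
      fix i x assume h: "i < m" "x \<in> {a..b}"
      show "cmod (Y 0 i x) \<le> (\<Sum>i<m. \<bar>B i\<bar> + \<bar>B' i\<bar>)" "cmod (D 0 i x) \<le> (\<Sum>i<m. \<bar>B i\<bar> + \<bar>B' i\<bar>)"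
        using B(1)[OF h] B(2)[OF h] le[OF h(1)] by linarith+
    qed (auto intro: sum_nonneg)
  qed
  then obtain B where B: "B \<ge> 0" "\<And>i x. i < m \<Longrightarrow> x \<in> {a..b} \<Longrightarrow> cmod (Y 0 i x) \<le> B"
     "\<And>i x. i < m \<Longrightarrow> x \<in> {a..b} \<Longrightarrow> cmod (D 0 i x) \<le> B" by blast
  define L where "L = real m * \<bar>K\<bar>"
  have L: "L \<ge> 0" by (simp add: L_def)
  \<comment> \<open>Each integration contributes a factor \<open>L\<close> and raises the power of x
    - a, divided by the new exponent; this produces the terms of an exponential series.\<close>
  define M where "M k x = B * (L * (x - a)) ^ k / fact k" for k x
  have AY: "cmod (\<Sum>j<m. A i j x * y j) \<le> L * M" if "i < m" "x \<in> {a..b}" "\<And>j. j < m \<Longrightarrow> cmod (y j) \<le> M" for i x y M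
  proof -
    have "cmod (\<Sum>j<m. A i j x * y j) \<le> (\<Sum>j<m. \<bar>K\<bar> * M)"
    proof (rule sum_norm_le)
      fix j assume "j \<in> {..<m}"
      then show "cmod (A i j x * y j) \<le> \<bar>K\<bar> * M"
        unfolding norm_mult using K0[of i j x] that by (intro mult_mono) (auto intro: order_trans)
    qed
    then show ?thesis by (simp add: L_def algebra_simps)
  qed
  have bY: "\<forall>i<m. \<forall>x\<in>{a..b}. cmod (Y k i x) \<le> M k x" for k
  proof (induction k)
    case 0
    then show ?case using B by (simp add: M_def)
  next
    case (Suc k)
    show ?case
    proof (intro allI impI ballI)
      fix i x assume i: "i < m" and x: "x \<in> {a..b}"
      have der: "((\<lambda>t. B * L ^ Suc k * (t - a) ^ Suc k / fact (Suc k)) has_vector_derivative L * M k t) (at t within {a..x})" for t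
      proof -
        have "((\<lambda>t. B * L ^ Suc k * (t - a) ^ Suc k / fact (Suc k)) has_real_derivative
            B * L ^ Suc k * (real (Suc k) * (t - a) ^ k) / fact (Suc k)) (at t within {a..x})"
          by (rule derivative_eq_intros refl | simp)+
        also have "B * L ^ Suc k * (real (Suc k) * (t - a) ^ k) / fact (Suc k) = L * M k t"
          unfolding M_def power_mult_distrib power_Suc fact_Suc by (simp add: field_simps del: of_nat_Suc)
        finally show ?thesis by (simp add: has_real_derivative_iff_has_vector_derivative)
      qed
      have hi: "((\<lambda>t. L * M k t) has_integral M (Suc k) x) {a..x}"
        using fundamental_theorem_of_calculus[of a x, OF _ der] x
        by (simp add: M_def power_mult_distrib mult_ac)
      have "cmod (Y (Suc k) i x) \<le> integral {a..x} (\<lambda>t. L * M k t)"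
        unfolding YS T_def
      proof (rule integral_norm_bound_integral)
        have "continuous_on {a..x} (D (Suc k) i)"
          using cD[of "Suc k"] i x by (auto intro: continuous_on_subset)
        then show "(\<lambda>t. \<Sum>j<m. A i j t * Y k j t) integrable_on {a..x}"
          by (intro integrable_continuous_real) (simp add: D_def)
        show "(\<lambda>t. L * M k t) integrable_on {a..x}" using hi by blast
        show "cmod (\<Sum>j<m. A i j t * Y k j t) \<le> L * M k t" if "t \<in> {a..x}" for t
          using Suc that x i by (intro AY) auto
      qed
      then show "cmod (Y (Suc k) i x) \<le> M (Suc k) x" by (simp only: integral_unique[OF hi])
    qed
  qed
  have Mmono: "M k x \<le> M k b" if "x \<in> {a..b}" for k x
    unfolding M_def using that B(1) L by (intro divide_right_mono mult_left_mono power_mono) auto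
  have sM: "summable (\<lambda>k. M k b)"
    unfolding M_def using summable_exp[of "L * (b - a)"]
    by (auto simp: divide_inverse mult_ac intro!: summable_mult[of "\<lambda>n. (L*(b-a))^n * inverse (fact n)" B, simplified mult_ac])
  have bY': "cmod (Y k i x) \<le> M k b" if "i < m" "x \<in> {a..b}" for k i x
    using bY Mmono[OF that(2)] that by (meson order_trans)
  have sY: "summable (\<lambda>k. Y k i x)" if "i < m" "x \<in> {a..b}" for i x
    by (rule summable_comparison_test'[OF sM, of 0]) (rule bY'[OF that])
  \<comment> \<open>Majorants for the derivatives are shifted by one, because
    \<open>D (Suc k)\<close> is the coefficient matrix applied to \<open>Y k\<close>.\<close>
  define N where "N k = (case k of 0 \<Rightarrow> B | Suc k \<Rightarrow> L * M k b)" for k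
  have sN: "summable N"
    using summable_mult[OF sM, of L] by (subst summable_Suc_iff[symmetric]) (simp add: N_def)
  have bD: "cmod (D k i x) \<le> N k" if "i < m" "x \<in> {a..b}" for k i x
    using B(3)[OF that] AY[OF that, of "\<lambda>j. Y (k-1) j x" "M (k-1) b"] bY'[OF _ that(2)]
    by (auto simp: N_def D_def split: nat.splits)
  define Z where "Z i x = (\<Sum>k. Y k i x)" for i x
  have ul: "uniform_limit {a..b} (\<lambda>n x. \<Sum>k<n. D k i x) (\<lambda>x. \<Sum>k. D k i x) sequentially" if "i < m" for i
    using bD[OF that] sN by (intro Weierstrass_m_test) auto
  have sumD: "(\<Sum>k. D k i x) = (\<Sum>j<m. A i j x * Z j x) + g i x" if "i < m" "x \<in> {a..b}" for i x
  proof -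
    have "summable (\<lambda>k. D k i x)" by (rule summable_comparison_test'[OF sN, of 0]) (rule bD[OF that])
    from suminf_split_head[OF this] have "(\<Sum>k. D k i x) = (\<Sum>k. D (Suc k) i x) + D 0 i x"
      by simp
    also have "(\<Sum>k. D (Suc k) i x) = (\<Sum>j<m. \<Sum>k. A i j x * Y k j x)"
    proof -
      have "(\<Sum>k. D (Suc k) i x) = (\<Sum>k. \<Sum>j<m. A i j x * Y k j x)" by (simp add: D_def)
      also have "\<dots> = (\<Sum>j<m. \<Sum>k. A i j x * Y k j x)"
        using sY[OF _ that(2)] by (intro suminf_sum summable_mult) auto
      finally show ?thesis .
    qed
    also have "\<dots> = (\<Sum>j<m. A i j x * Z j x)"
      unfolding Z_def using sY[OF _ that(2)] by (simp add: suminf_mult)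
    finally show ?thesis by (simp add: D_def)
  qed
  have der: "(Z i has_vector_derivative (\<Sum>j<m. A i j x * Z j x) + g i x) (at x within {a..b})"
    if i: "i < m" and x: "x \<in> {a..b}" for i x
  proof -
    have "\<exists>G. \<forall>x\<in>{a..b}. (\<lambda>k. Y k i x) sums G x \<and>
       (G has_derivative (\<lambda>h. h *\<^sub>R (\<Sum>k. D k i x))) (at x within {a..b})"
    proof (rule has_derivative_series[where f' = "\<lambda>k x h. h *\<^sub>R D k i x"])
      show "(Y k i has_derivative (\<lambda>h. h *\<^sub>R D k i x)) (at x within {a..b})" if "x \<in> {a..b}" for k x
        using cD[of k] i that by (auto simp: has_vector_derivative_def)
      show "(\<lambda>k. Y k i a) sums Z i a" unfolding Z_def using sY[OF i, of a] ab by (simp add: summable_sums)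
      show "\<forall>\<^sub>F n in sequentially. \<forall>x\<in>{a..b}. \<forall>h.
          cmod ((\<Sum>k<n. h *\<^sub>R D k i x) - h *\<^sub>R (\<Sum>k. D k i x)) \<le> e * norm h" if e: "e > 0" for e
        using ul[OF i, unfolded uniform_limit_iff, rule_format, OF e]
      proof eventually_elim
        case (elim n)
        have "cmod ((\<Sum>k<n. h *\<^sub>R D k i x) - h *\<^sub>R (\<Sum>k. D k i x)) \<le> e * norm h" if "x \<in> {a..b}" for x h
        proof -
          have "(\<Sum>k<n. h *\<^sub>R D k i x) - h *\<^sub>R (\<Sum>k. D k i x) = h *\<^sub>R ((\<Sum>k<n. D k i x) - (\<Sum>k. D k i x))"
            by (simp add: scaleR_right.sum scaleR_diff_right)
          moreover have "cmod ((\<Sum>k<n. D k i x) - (\<Sum>k. D k i x)) \<le> e"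
            using elim that by (auto simp: dist_norm intro: less_imp_le)
          ultimately have "cmod ((\<Sum>k<n. h *\<^sub>R D k i x) - h *\<^sub>R (\<Sum>k. D k i x)) \<le> \<bar>h\<bar> * e"
            by (simp add: mult_left_mono)
          then show ?thesis by (simp only: mult.commute[of e] real_norm_def)
        qed
        then show ?case by blast
      qed
    qed (use ab in auto)
    then obtain G where G: "\<And>x. x \<in> {a..b} \<Longrightarrow> (\<lambda>k. Y k i x) sums G x"
       "\<And>x. x \<in> {a..b} \<Longrightarrow> (G has_derivative (\<lambda>h. h *\<^sub>R (\<Sum>k. D k i x))) (at x within {a..b})" by blast
    have "Z i t = G t" if "t \<in> {a..b}" for t using G(1)[OF that] by (simp add: Z_def sums_iff)
    then have "(Z i has_vector_derivative (\<Sum>k. D k i x)) (at x within {a..b})"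
      using G(2)[OF x] x by (auto simp: has_vector_derivative_def intro: has_derivative_transform)
    then show ?thesis using sumD[OF i x] by simp
  qed
  have Za: "Z i a = \<eta> i" if "i < m" for i
  proof -
    have "Y (Suc k) i a = 0" for k by (simp add: YS T_def)
    moreover have "Y 0 i a = \<eta> i" by (simp add: Y0)
    ultimately show ?thesis using suminf_split_head[OF sY[OF that, of a]] ab by (simp add: Z_def)
  qed
  show ?thesis using der Za by blast
qed

text \<open>Companion system: the components of the first-order system are the successive
  derivatives of the solution.\<close>

lemma linear_ode_scalar:
  fixes c :: "nat \<Rightarrow> real \<Rightarrow> complex"
  assumes ab: "a < b" and m: "m > 0"
    and c: "\<And>i. i < m \<Longrightarrow> continuous_on {a..b} (c i)"
    and f: "continuous_on {a..b} f"
  shows "\<exists>y. Ck_on a b m y \<and> (\<forall>i<m. dw a b i y a = \<eta> i) \<and>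
     (\<forall>x\<in>{a..b}. dw a b m y x = (\<Sum>i<m. c i x * dw a b i y x) + f x)"
proof -
  define A where "A i j x = (if Suc i < m then (if j = Suc i then 1 else 0) else c j x)" for i j x
  define g where "g i x = (if Suc i < m then 0 else f x)" for i x
  have "\<exists>Y. (\<forall>i<m. Y i a = \<eta> i) \<and> (\<forall>i<m. \<forall>x\<in>{a..b}.
      (Y i has_vector_derivative (\<Sum>j<m. A i j x * Y j x) + g i x) (at x within {a..b}))"
  proof (rule linear_ode_system[OF ab])
    show "continuous_on {a..b} (A i j)" if "i < m" "j < m" for i j
      using c[OF that(2)] by (cases "Suc i < m"; cases "j = Suc i") (simp_all add: A_def[abs_def])
    show "continuous_on {a..b} (g i)" if "i < m" for i
      using f by (cases "Suc i < m") (simp_all add: g_def[abs_def])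
  qed
  then obtain Y where Ya: "\<And>i. i < m \<Longrightarrow> Y i a = \<eta> i" and Y: "\<And>i x. i < m \<Longrightarrow> x \<in> {a..b} \<Longrightarrow>
      (Y i has_vector_derivative (\<Sum>j<m. A i j x * Y j x) + g i x) (at x within {a..b})" by blast
  \<comment> \<open>The right-hand side of the equation is appended as member number
    \<open>m\<close>, so that the chain of derivatives reaches order \<open>m\<close>.\<close>
  define F where "F i x = (if i < m then Y i x else (\<Sum>i<m. c i x * Y i x) + f x)" for i x
  have FY: "F i = Y i" if "i < m" for i using that by (auto simp: F_def)
  have d: "(F i has_vector_derivative F (Suc i) x) (at x within {a..b})" if "i < m" "x \<in> {a..b}" for i x
  proof -
    have "(\<Sum>j<m. A i j x * Y j x) + g i x = F (Suc i) x"
    proof (cases "Suc i < m")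
      case True
      have "(\<Sum>j<m. A i j x * Y j x) = (\<Sum>j<m. if j = Suc i then Y j x else 0)"
        using True by (intro sum.cong) (auto simp: A_def)
      then show ?thesis using True by (simp add: g_def F_def)
    next
      case False
      then show ?thesis using that by (simp add: g_def F_def A_def)
    qed
    then show ?thesis using Y[OF that] that by (simp add: FY)
  qed
  have cY: "continuous_on {a..b} (Y i)" if "i < m" for i
    using Y[OF that] by (intro continuous_on_vector_derivative) auto
  have F0: "F 0 = Y 0" using m by (simp add: FY)
  have eq: "dw a b i (F 0) x = F i x" if "i \<le> m" "x \<in> {a..b}" for i x
    using dw_eqI[of a b F "F 0" m i x, OF ab refl d] that by auto
  have "continuous_on {a..b} (F m)"
    unfolding F_def using c f cY by (auto intro!: continuous_intros)
  then have "Ck_on a b m (F 0)" using d by (intro Ck_onI[where F = F]) (auto simp: ab)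
  moreover have "dw a b i (F 0) a = \<eta> i" if "i < m" for i
    using eq[of i a] that ab Ya by (simp add: FY)
  moreover have "dw a b m (F 0) x = (\<Sum>i<m. c i x * dw a b i (F 0) x) + f x" if "x \<in> {a..b}" for x
  proof -
    have "(\<Sum>i<m. c i x * dw a b i (F 0) x) = (\<Sum>i<m. c i x * Y i x)"
      using eq[OF _ that] by (intro sum.cong) (auto simp: FY)
    then show ?thesis using eq[OF _ that, of m] by (simp add: F_def)
  qed
  ultimately show ?thesis by blast
qed

section \<open>Finite-dimensional linear algebra\<close>

text \<open>The \<open>k\<close> equations are padded with zero rows to a square matrix. Its
  transpose annihilates the k-th unit vector, so the determinant vanishes and a kernel vector
  exists.\<close>

lemma homogeneous_nontrivial:
  fixes A :: "nat \<Rightarrow> nat \<Rightarrow> complex"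
  assumes "k < N"
  shows "\<exists>c. (\<exists>j<N. c j \<noteq> 0) \<and> (\<forall>i<k. (\<Sum>j<N. A i j * c j) = 0)"
proof -
  define M where "M = mat N N (\<lambda>(i, j). if i < k then A i j else 0)"
  have M: "M \<in> carrier_mat N N" by (simp add: M_def)
  have "transpose_mat M *\<^sub>v unit_vec N k = 0\<^sub>v N"
    using assms by (intro eq_vecI) (auto simp: M_def scalar_prod_def)
  moreover have "unit_vec N k \<noteq> (0\<^sub>v N :: complex vec)" using assms by (metis index_unit_vec(1) index_zero_vec(1) zero_neq_one)
  ultimately have "det (transpose_mat M) = 0"
    using det_0_iff_vec_prod_zero[of "transpose_mat M" N] M
    by (metis transpose_carrier_mat unit_vec_carrier)
  then have "det M = 0" using det_transpose[OF M] by simp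
  then obtain v where v: "v \<in> carrier_vec N" "v \<noteq> 0\<^sub>v N" "M *\<^sub>v v = 0\<^sub>v N"
    using det_0_iff_vec_prod_zero[OF M] by blast
  have "\<exists>j<N. v $ j \<noteq> 0" using v(1,2) by (metis eq_vecI carrier_vecD index_zero_vec)
  moreover have "(\<Sum>j<N. A i j * v $ j) = 0" if "i < k" for i
  proof -
    have "(M *\<^sub>v v) $ i = 0" using v(3) that assms by simp
    then show ?thesis using that assms v(1) by (simp add: M_def scalar_prod_def atLeast0LessThan)
  qed
  ultimately show ?thesis by (intro exI[of _ "\<lambda>j. v $ j"]) auto
qed

text \<open>Injectivity makes the determinant nonzero, and the adjugate divided by it gives the
  solution explicitly.\<close>

lemma square_system_solvable:
  fixes A :: "nat \<Rightarrow> nat \<Rightarrow> complex"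
  assumes inj: "\<And>x. (\<And>i. i < N \<Longrightarrow> (\<Sum>j<N. A i j * x j) = 0) \<Longrightarrow> (\<And>j. j < N \<Longrightarrow> x j = 0)"
  shows "\<exists>x. \<forall>i<N. (\<Sum>j<N. A i j * x j) = b i"
proof -
  define M where "M = mat N N (\<lambda>(i, j). A i j)"
  have M: "M \<in> carrier_mat N N" by (simp add: M_def)
  have Mv: "(M *\<^sub>v v) $ i = (\<Sum>j<N. A i j * v $ j)" if "v \<in> carrier_vec N" "i < N" for v i
    using that by (simp add: M_def scalar_prod_def atLeast0LessThan)
  have "det M \<noteq> 0"
  proof
    assume "det M = 0"
    then obtain v where v: "v \<in> carrier_vec N" "v \<noteq> 0\<^sub>v N" "M *\<^sub>v v = 0\<^sub>v N"
      using det_0_iff_vec_prod_zero[OF M] by blast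
    have "(\<Sum>j<N. A i j * v $ j) = 0" if "i < N" for i using Mv[OF v(1) that] v(3) that by simp
    then have "v $ j = 0" if "j < N" for j using inj[of "\<lambda>j. v $ j"] that by blast
    then show False using v(1,2) by (metis eq_vecI carrier_vecD index_zero_vec)
  qed
  define w where "w = (1 / det M) \<cdot>\<^sub>v (adj_mat M *\<^sub>v vec N b)"
  have adj: "adj_mat M \<in> carrier_mat N N" "M * adj_mat M = det M \<cdot>\<^sub>m 1\<^sub>m N" using adj_mat[OF M] by auto
  have w: "w \<in> carrier_vec N" using adj(1) by (simp add: w_def)
  have "M *\<^sub>v w = (1 / det M) \<cdot>\<^sub>v (M *\<^sub>v (adj_mat M *\<^sub>v vec N b))"
    unfolding w_def using M adj(1) by (intro mult_mat_vec[of _ N N]) auto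
  also have "M *\<^sub>v (adj_mat M *\<^sub>v vec N b) = (M * adj_mat M) *\<^sub>v vec N b"
    using M adj(1) by (intro assoc_mult_mat_vec[symmetric]) auto
  also have "(1 / det M) \<cdot>\<^sub>v ((M * adj_mat M) *\<^sub>v vec N b) = vec N b"
    using \<open>det M \<noteq> 0\<close> unfolding adj(2)
    by (intro eq_vecI) (auto simp: scalar_prod_def if_distrib[of "\<lambda>x. _ * x * _"] sum.delta cong: if_cong)
  finally have "(\<Sum>j<N. A i j * w $ j) = b i" if "i < N" for i
    using Mv[OF w that] that by simp
  then show ?thesis by blast
qed

section \<open>The spectral theorem for normal matrices\<close>

definition ipn :: "nat \<Rightarrow> (nat \<Rightarrow> complex) \<Rightarrow> (nat \<Rightarrow> complex) \<Rightarrow> complex" where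
  "ipn N x y = (\<Sum>i<N. x i * cnj (y i))"

text \<open>As in \<open>ipn\<close>, vectors are functions of which only the entries below
  \<open>N\<close> are read. Linear combinations stay pointwise and no carrier conditions
  arise.\<close>

definition mvn :: "nat \<Rightarrow> (nat \<Rightarrow> nat \<Rightarrow> complex) \<Rightarrow> (nat \<Rightarrow> complex) \<Rightarrow> nat \<Rightarrow> complex" where
  "mvn N A x i = (\<Sum>j<N. A i j * x j)"

lemma mvn_diff: "mvn N A (\<lambda>i. x i - c * y i) i = mvn N A x i - c * mvn N A y i"
  by (simp add: mvn_def algebra_simps sum_subtractf sum_distrib_left)

lemma ipn_cong: "(\<And>i. i < N \<Longrightarrow> x i = x' i) \<Longrightarrow> (\<And>i. i < N \<Longrightarrow> y i = y' i) \<Longrightarrow> ipn N x y = ipn N x' y'"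
  by (simp add: ipn_def)

lemma ipn_adjoint: "ipn N (mvn N A x) y = ipn N x (mvn N (\<lambda>i j. cnj (A j i)) y)"
  unfolding ipn_def mvn_def by (simp add: sum_distrib_left sum_distrib_right, subst sum.swap) (simp add: mult_ac)

lemma cnj_ipn: "cnj (ipn N x y) = ipn N y x"
  by (simp add: ipn_def mult.commute)

lemma ipn_self: "ipn N x x = of_real (\<Sum>i<N. (cmod (x i))\<^sup>2)"
  by (simp add: ipn_def complex_norm_square[symmetric] del: of_real_power)

lemma ipn_self_eq_0: "ipn N x x = 0 \<Longrightarrow> i < N \<Longrightarrow> x i = 0"
  unfolding ipn_self of_real_eq_0_iff by (subst (asm) sum_nonneg_eq_0_iff) auto

lemma ipn_scale_left: "ipn N (\<lambda>i. c * x i) y = c * ipn N x y"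
  by (simp add: ipn_def sum_distrib_left mult_ac)

lemma ipn_scale_right: "ipn N x (\<lambda>i. c * y i) = cnj c * ipn N x y"
  by (simp add: ipn_def sum_distrib_left mult_ac)

lemma ipn_diff_left: "ipn N (\<lambda>i. x i - z i) y = ipn N x y - ipn N z y"
  by (simp add: ipn_def algebra_simps sum_subtractf)

lemma ipn_diff_right: "ipn N y (\<lambda>i. x i - z i) = ipn N y x - ipn N y z"
  by (simp add: ipn_def algebra_simps sum_subtractf)

text \<open>Factoring an annihilating polynomial of \<open>w\<close> into linear factors produces an eigenvector inside any
  invariant subspace containing \<open>w\<close>.\<close>

lemma eigenvector_of_annihilating_poly:
  fixes P :: "complex poly"
  assumes "P \<noteq> 0" "W w" "\<exists>i<N. w i \<noteq> 0"
    and W: "\<And>x z. W x \<Longrightarrow> W (\<lambda>i. mvn N A x i - z * x i)"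
    and "\<And>i. i < N \<Longrightarrow> (\<Sum>j\<le>degree P. coeff P j * (mvn N A ^^ j) w i) = 0"
  shows "\<exists>u z. W u \<and> (\<exists>i<N. u i \<noteq> 0) \<and> (\<forall>i<N. mvn N A u i = z * u i)"
  using assms(1-3,5)
proof (induction "degree P" arbitrary: P w)
  case 0
  then obtain c where "P = [:c:]" "c \<noteq> 0" by (metis degree_eq_zeroE pCons_0_0)
  with 0 show ?case by auto
next
  case (Suc d)
  obtain z where "poly P z = 0"
    using fundamental_theorem_of_algebra[of P] Suc(2) constant_degree[of P] by auto
  then obtain Q where Q: "P = [:-z, 1:] * Q" by (meson poly_eq_0_iff_dvd dvdE)
  with Suc have Q0: "Q \<noteq> 0" by auto
  have dP: "degree P = Suc (degree Q)" using degree_mult_eq[of "[:-z, 1:]" Q] Q Q0 by simp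
  then have dQ: "d = degree Q" using Suc(2) by simp
  \<comment> \<open>Either \<open>w\<close> is itself an eigenvector for the root \<open>z\<close>,
    or \<open>u\<close> is a nonzero vector annihilated by the quotient \<open>Q\<close>, whose
    degree is smaller.\<close>
  define u where "u = (\<lambda>i. mvn N A w i - z * w i)"
  show ?case
  proof (cases "\<exists>i<N. u i \<noteq> 0")
    case False
    then show ?thesis using Suc.prems unfolding u_def by (intro exI[of _ w] exI[of _ z]) auto
  next
    case True
    have pow: "(mvn N A ^^ j) u i = (mvn N A ^^ Suc j) w i - z * (mvn N A ^^ j) w i" for i j
    proof (induction j arbitrary: i)
      case 0
      then show ?case by (simp add: u_def)
    next
      case (Suc j)
      have "(mvn N A ^^ j) u = (\<lambda>i. (mvn N A ^^ Suc j) w i - z * (mvn N A ^^ j) w i)" using Suc by auto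
      then show ?case by (simp only: funpow.simps o_apply mvn_diff)
    qed
    have "(\<Sum>j\<le>degree Q. coeff Q j * (mvn N A ^^ j) u i) = 0" if "i < N" for i
    proof -
      let ?K = "\<lambda>j. (mvn N A ^^ j) w i"
      have cP: "coeff P j = (if j = 0 then 0 else coeff Q (j - 1)) - z * coeff Q j" for j
        unfolding Q by (cases j) auto
      have "0 = (\<Sum>j\<le>Suc (degree Q). coeff P j * ?K j)" using Suc.prems(4)[OF that] dP by simp
      also have "\<dots> = (\<Sum>j\<le>Suc (degree Q). (if j = 0 then 0 else coeff Q (j - 1)) * ?K j)
          - (\<Sum>j\<le>Suc (degree Q). z * coeff Q j * ?K j)"
        by (simp only: cP left_diff_distrib sum_subtractf)
      also have "(\<Sum>j\<le>Suc (degree Q). (if j = 0 then 0 else coeff Q (j - 1)) * ?K j)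
          = (\<Sum>j\<le>degree Q. coeff Q j * ?K (Suc j))"
        by (subst sum.atMost_Suc_shift) simp
      also have "(\<Sum>j\<le>Suc (degree Q). z * coeff Q j * ?K j) = (\<Sum>j\<le>degree Q. z * coeff Q j * ?K j)"
        by (simp add: coeff_eq_0)
      finally show ?thesis unfolding pow by (simp add: algebra_simps sum_subtractf sum_distrib_left)
    qed
    moreover have "W u" unfolding u_def by (intro W Suc.prems)
    ultimately show ?thesis using Suc(1)[OF dQ Q0 _ True] by blast
  qed
qed

text \<open>The N + 1 Krylov vectors of \<open>w\<close> in an N-dimensional space are linearly
  dependent, which yields a nonzero annihilating polynomial.\<close>

lemma eigenvector_in_invariant_subspace:
  assumes "W w" "\<exists>i<N. w i \<noteq> 0" "\<And>x z. W x \<Longrightarrow> W (\<lambda>i. mvn N A x i - z * x i)"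
  shows "\<exists>u z. W u \<and> (\<exists>i<N. u i \<noteq> 0) \<and> (\<forall>i<N. mvn N A u i = z * u i)"
proof -
  obtain c where c: "\<exists>j<Suc N. c j \<noteq> 0"
    "\<And>i. i < N \<Longrightarrow> (\<Sum>j<Suc N. (mvn N A ^^ j) w i * c j) = 0"
    using homogeneous_nontrivial[of N "Suc N" "\<lambda>i j. (mvn N A ^^ j) w i"] by blast
  define P where "P = (\<Sum>j<Suc N. monom (c j) j)"
  have cP: "coeff P j = (if j < Suc N then c j else 0)" for j
    by (simp add: P_def coeff_sum sum.delta' del: sum.lessThan_Suc)
  have "P \<noteq> 0" using c(1) cP by (metis coeff_0)
  moreover have "degree P \<le> N" by (rule degree_le) (simp add: cP)
  moreover have "(\<Sum>j\<le>degree P. coeff P j * (mvn N A ^^ j) w i) = 0" if "i < N" for i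
  proof -
    have "(\<Sum>j\<le>degree P. coeff P j * (mvn N A ^^ j) w i) = (\<Sum>j<Suc N. coeff P j * (mvn N A ^^ j) w i)"
      using \<open>degree P \<le> N\<close> by (intro sum.mono_neutral_left) (auto simp: coeff_eq_0)
    also have "\<dots> = (\<Sum>j<Suc N. (mvn N A ^^ j) w i * c j)" by (intro sum.cong) (auto simp: cP)
    finally show ?thesis using c(2)[OF that] by simp
  qed
  ultimately show ?thesis using assms by (intro eigenvector_of_annihilating_poly[of P W w]) auto
qed

text \<open>The squared norm of the difference of both sides is expanded. Normality turns the norm
  of \<open>B u\<close> into that of \<open>A u\<close>, and the four terms cancel.\<close>

lemma normal_adjoint_eigenvector:
  fixes A :: "nat \<Rightarrow> nat \<Rightarrow> complex"
  defines "B \<equiv> (\<lambda>i j. cnj (A j i))"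
  assumes normal: "\<And>x i. i < N \<Longrightarrow> mvn N A (mvn N B x) i = mvn N B (mvn N A x) i"
    and u: "\<And>i. i < N \<Longrightarrow> mvn N A u i = z * u i"
    and i: "i < N"
  shows "mvn N B u i = cnj z * u i"
proof -
  have BA: "(\<lambda>i j. cnj (B j i)) = A" by (simp add: B_def)
  have 1: "ipn N (mvn N B u) (mvn N B u) = z * cnj z * ipn N u u"
  proof -
    have "ipn N (mvn N B u) (mvn N B u) = ipn N u (mvn N A (mvn N B u))"
      using ipn_adjoint[of N B u] BA by simp
    also have "\<dots> = ipn N u (mvn N B (mvn N A u))" using normal by (intro ipn_cong) auto
    also have "\<dots> = ipn N (mvn N A u) (mvn N A u)" by (simp add: ipn_adjoint B_def)
    also have "\<dots> = ipn N (\<lambda>i. z * u i) (\<lambda>i. z * u i)" using u by (intro ipn_cong) auto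
    finally show ?thesis by (simp add: ipn_scale_left ipn_scale_right)
  qed
  have 2: "ipn N u (mvn N B u) = z * ipn N u u"
  proof -
    have "ipn N u (mvn N B u) = ipn N (mvn N A u) u" by (simp add: ipn_adjoint B_def)
    also have "\<dots> = ipn N (\<lambda>i. z * u i) u" using u by (intro ipn_cong) auto
    finally show ?thesis by (simp add: ipn_scale_left)
  qed
  have 3: "ipn N (mvn N B u) u = cnj z * ipn N u u"
    using 2 by (metis cnj_ipn complex_cnj_mult)
  have "ipn N (\<lambda>i. mvn N B u i - cnj z * u i) (\<lambda>i. mvn N B u i - cnj z * u i) = 0"
    by (simp add: ipn_diff_left ipn_diff_right ipn_scale_left ipn_scale_right 1 2 3)
  from ipn_self_eq_0[OF this i] show ?thesis by simp
qed

text \<open>Orthonormal eigenvectors are split off one at a time. The orthogonal complement of those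
  already found is invariant because they are eigenvectors of the adjoint too, and a dimension count
  shows that it is nonzero as long as fewer than \<open>N\<close> have been found.\<close>

theorem normal_spectral:
  fixes A :: "nat \<Rightarrow> nat \<Rightarrow> complex"
  assumes normal: "\<And>i j. i < N \<Longrightarrow> j < N \<Longrightarrow> (\<Sum>k<N. A i k * cnj (A j k)) = (\<Sum>k<N. cnj (A k i) * A k j)"
  shows "\<exists>v z. (\<forall>k<N. \<forall>l<N. (\<Sum>i<N. v k i * cnj (v l i)) = (if k = l then 1 else 0))
    \<and> (\<forall>i<N. \<forall>j<N. (\<Sum>k<N. v k i * cnj (v k j)) = (if i = j then 1 else 0))
    \<and> (\<forall>i<N. \<forall>j<N. A i j = (\<Sum>k<N. z k * v k i * cnj (v k j)))"
proof -
  define B where "B = (\<lambda>i j. cnj (A j i))"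
  have nrm: "mvn N A (mvn N B x) i = mvn N B (mvn N A x) i" if "i < N" for x i
  proof -
    have "mvn N A (mvn N B x) i = (\<Sum>j<N. (\<Sum>k<N. A i k * cnj (A j k)) * x j)"
      unfolding mvn_def B_def sum_distrib_left sum_distrib_right by (subst sum.swap) (simp add: mult_ac)
    also have "\<dots> = (\<Sum>j<N. (\<Sum>k<N. cnj (A k i) * A k j) * x j)"
      using normal that by (intro sum.cong) auto
    also have "\<dots> = mvn N B (mvn N A x) i"
      unfolding mvn_def B_def sum_distrib_left sum_distrib_right by (subst sum.swap) (simp add: mult_ac)
    finally show ?thesis .
  qed
  have "\<exists>v z. (\<forall>i<k. \<forall>j<k. ipn N (v i) (v j) = (if i = j then 1 else 0)) \<and>
       (\<forall>i<k. \<forall>r<N. mvn N A (v i) r = z i * v i r)" if "k \<le> N" for k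
    using that
  proof (induction k)
    case 0
    then show ?case by simp
  next
    case (Suc k)
    then have "k \<le> N" by simp
    from Suc.IH[OF this] obtain v z where v: "\<And>i j. i < k \<Longrightarrow> j < k \<Longrightarrow> ipn N (v i) (v j) = (if i = j then 1 else 0)"
       "\<And>i r. i < k \<Longrightarrow> r < N \<Longrightarrow> mvn N A (v i) r = z i * v i r" by blast
    define W where "W x \<longleftrightarrow> (\<forall>i<k. ipn N x (v i) = 0)" for x
    obtain w where w: "\<exists>j<N. w j \<noteq> 0" "\<And>i. i < k \<Longrightarrow> (\<Sum>j<N. cnj (v i j) * w j) = 0"
      using homogeneous_nontrivial[of k N "\<lambda>i j. cnj (v i j)"] Suc.prems by auto
    have "W w" using w(2) by (simp add: W_def ipn_def mult.commute)
    moreover have "W (\<lambda>i. mvn N A x i - c * x i)" if "W x" for x c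
      unfolding W_def
    proof (intro allI impI)
      fix i assume i: "i < k"
      have "ipn N (mvn N A x) (v i) = ipn N x (mvn N B (v i))" by (simp add: ipn_adjoint B_def)
      also have "\<dots> = ipn N x (\<lambda>r. cnj (z i) * v i r)"
        using normal_adjoint_eigenvector[of N A "v i" "z i"] nrm v(2) i unfolding B_def by (intro ipn_cong) auto
      also have "\<dots> = 0" using that i by (simp add: ipn_scale_right W_def)
      finally show "ipn N (\<lambda>i. mvn N A x i - c * x i) (v i) = 0"
        using that i by (simp add: ipn_diff_left ipn_scale_left W_def)
    qed
    ultimately obtain u c where u: "W u" "\<exists>i<N. u i \<noteq> 0" "\<And>i. i < N \<Longrightarrow> mvn N A u i = c * u i"
      using eigenvector_in_invariant_subspace[of W w N A] w(1) by blast
    define s where "s = sqrt (\<Sum>i<N. (cmod (u i))\<^sup>2)"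
    have "(\<Sum>i<N. (cmod (u i))\<^sup>2) > 0"
      using u(2) by (auto intro!: sum_pos2)
    then have s: "s > 0" "of_real s * of_real s = ipn N u u"
      by (simp_all add: s_def ipn_self of_real_mult[symmetric] del: of_real_mult)
    define u' where "u' = (\<lambda>i. (1 / of_real s) * u i)"
    have u'1: "ipn N u' u' = 1"
      unfolding u'_def ipn_scale_left ipn_scale_right s(2)[symmetric] using s(1) by simp
    have u'2: "ipn N u' (v i) = 0" if "i < k" for i
      unfolding u'_def ipn_scale_left using u(1) that by (simp add: W_def)
    then have u'3: "ipn N (v i) u' = 0" if "i < k" for i
      using that by (metis cnj_ipn complex_cnj_zero)
    have u'4: "mvn N A u' r = c * u' r" if "r < N" for r
      using u(3)[OF that] by (simp add: u'_def mvn_def sum_divide_distrib[symmetric])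
    show ?case
      using v u'1 u'2 u'3 u'4
      by (intro exI[of _ "v(k := u')"] exI[of _ "z(k := c)"]) (auto simp: less_Suc_eq)
  qed
  from this[OF order_refl] obtain v z where v: "\<And>k l. k < N \<Longrightarrow> l < N \<Longrightarrow> ipn N (v k) (v l) = (if k = l then 1 else 0)"
       "\<And>k r. k < N \<Longrightarrow> r < N \<Longrightarrow> mvn N A (v k) r = z k * v k r" by blast
  \<comment> \<open>Orthonormality says that the conjugate transpose is a left inverse. For square
    matrices it is then a right inverse, and this is the completeness relation.\<close>
  define Q where "Q = mat N N (\<lambda>(i, k). v k i)"
  define R where "R = mat N N (\<lambda>(k, i). cnj (v k i))"
  have "R * Q = 1\<^sub>m N"
    using v(1) by (intro eq_matI) (auto simp: Q_def R_def scalar_prod_def ipn_def atLeast0LessThan mult.commute)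
  then have "Q * R = 1\<^sub>m N"
    by (rule mat_mult_left_right_inverse[rotated 2]) (auto simp: Q_def R_def)
  moreover have "(Q * R) $$ (i, j) = (\<Sum>k<N. v k i * cnj (v k j))" if "i < N" "j < N" for i j
    using that by (simp add: Q_def R_def scalar_prod_def atLeast0LessThan)
  ultimately have comp: "(\<Sum>k<N. v k i * cnj (v k j)) = (if i = j then 1 else 0)" if "i < N" "j < N" for i j
    using that by fastforce
  have "A i j = (\<Sum>k<N. z k * v k i * cnj (v k j))" if "i < N" "j < N" for i j
  proof -
    have "(\<Sum>k<N. z k * v k i * cnj (v k j)) = (\<Sum>k<N. (\<Sum>r<N. A i r * v k r) * cnj (v k j))"
      using v(2) that(1) by (intro sum.cong) (auto simp: mvn_def)
    also have "\<dots> = (\<Sum>r<N. A i r * (\<Sum>k<N. v k r * cnj (v k j)))"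
      unfolding sum_distrib_left sum_distrib_right by (subst sum.swap) (simp add: mult_ac)
    also have "\<dots> = (\<Sum>r<N. if r = j then A i r else 0)" using comp that by (intro sum.cong) auto
    finally show ?thesis using that by simp
  qed
  then show ?thesis using v(1) comp unfolding ipn_def by blast
qed

section \<open>Functional calculus of unitary matrices\<close>

text \<open>Orthonormality contracts products of spectral matrices; completeness identifies the
  spectral matrix of the constant 1 with the identity.\<close>

definition onb :: "nat \<Rightarrow> (nat \<Rightarrow> nat \<Rightarrow> complex) \<Rightarrow> bool" where
  "onb m v \<longleftrightarrow> (\<forall>k<m. \<forall>l<m. (\<Sum>i<m. v k i * cnj (v l i)) = (if k = l then 1 else 0))
    \<and> (\<forall>i<m. \<forall>j<m. (\<Sum>k<m. v k i * cnj (v k j)) = (if i = j then 1 else 0))"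

text \<open>Functional calculus f(V) in an eigenbasis of V. The function is given by its values on
  the index of the eigenvector, so repeated eigenvalues need no separate treatment.\<close>

definition spec_mat :: "nat \<Rightarrow> (nat \<Rightarrow> nat \<Rightarrow> complex) \<Rightarrow> (nat \<Rightarrow> complex) \<Rightarrow> complex mat" where
  "spec_mat m v f = mat m m (\<lambda>(i, j). \<Sum>k<m. f k * v k i * cnj (v k j))"

lemma spec_mat_carrier [simp]: "spec_mat m v f \<in> carrier_mat m m"
  by (simp add: spec_mat_def)

lemma spec_mat_dim [simp]: "dim_row (spec_mat m v f) = m" "dim_col (spec_mat m v f) = m"
  by (simp_all add: spec_mat_def)

lemma spec_mat_index: "i < m \<Longrightarrow> j < m \<Longrightarrow> spec_mat m v f $$ (i, j) = (\<Sum>k<m. f k * v k i * cnj (v k j))"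
  by (simp add: spec_mat_def)

lemma spec_mat_cong: "(\<And>k. k < m \<Longrightarrow> f k = g k) \<Longrightarrow> spec_mat m v f = spec_mat m v g"
  by (auto simp: spec_mat_def intro!: eq_matI sum.cong)

lemma spec_mat_mult:
  assumes "onb m v"
  shows "spec_mat m v f * spec_mat m v g = spec_mat m v (\<lambda>k. f k * g k)"
proof (rule eq_matI)
  fix i j assume "i < dim_row (spec_mat m v (\<lambda>k. f k * g k))" "j < dim_col (spec_mat m v (\<lambda>k. f k * g k))"
  then have ij: "i < m" "j < m" by auto
  have "(spec_mat m v f * spec_mat m v g) $$ (i, j) =
      (\<Sum>r<m. (\<Sum>k<m. f k * v k i * cnj (v k r)) * (\<Sum>l<m. g l * v l r * cnj (v l j)))"
    using ij by (simp add: scalar_prod_def spec_mat_index atLeast0LessThan)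
  also have "\<dots> = (\<Sum>r<m. \<Sum>k<m. \<Sum>l<m. f k * v k i * g l * cnj (v l j) * (v l r * cnj (v k r)))"
    by (simp add: sum_product mult_ac)
  also have "\<dots> = (\<Sum>k<m. \<Sum>r<m. \<Sum>l<m. f k * v k i * g l * cnj (v l j) * (v l r * cnj (v k r)))"
    by (rule sum.swap)
  also have "\<dots> = (\<Sum>k<m. \<Sum>l<m. \<Sum>r<m. f k * v k i * g l * cnj (v l j) * (v l r * cnj (v k r)))"
    by (intro sum.cong[OF refl] sum.swap)
  also have "\<dots> = (\<Sum>k<m. \<Sum>l<m. f k * v k i * g l * cnj (v l j) * (if l = k then 1 else 0))"
    using assms by (intro sum.cong refl) (auto simp: sum_distrib_left[symmetric] onb_def)
  also have "\<dots> = (\<Sum>k<m. f k * g k * v k i * cnj (v k j))"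
    by (intro sum.cong refl) (simp add: if_distrib[of "\<lambda>x. _ * x"] cong: if_cong)
  finally show "(spec_mat m v f * spec_mat m v g) $$ (i, j) = spec_mat m v (\<lambda>k. f k * g k) $$ (i, j)"
    using ij by (simp add: spec_mat_index)
qed auto

lemma spec_mat_one: "onb m v \<Longrightarrow> spec_mat m v (\<lambda>k. 1) = 1\<^sub>m m"
  by (intro eq_matI) (auto simp: spec_mat_index onb_def)

lemma spec_mat_add: "spec_mat m v f + spec_mat m v g = spec_mat m v (\<lambda>k. f k + g k)"
  by (intro eq_matI) (auto simp: spec_mat_index sum.distrib algebra_simps)

lemma spec_mat_diff: "spec_mat m v f - spec_mat m v g = spec_mat m v (\<lambda>k. f k - g k)"
  by (intro eq_matI) (auto simp: spec_mat_index sum_subtractf algebra_simps)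

lemma spec_mat_smult: "c \<cdot>\<^sub>m spec_mat m v f = spec_mat m v (\<lambda>k. c * f k)"
  by (intro eq_matI) (auto simp: spec_mat_index sum_distrib_left algebra_simps)

lemma spec_mat_hermitian:
  assumes "\<And>k. k < m \<Longrightarrow> cnj (f k) = f k" "i < m" "j < m"
  shows "cnj (spec_mat m v f $$ (j, i)) = spec_mat m v f $$ (i, j)"
  using assms by (auto simp: spec_mat_index mult_ac intro!: sum.cong)

lemma spec_mat_eigenvector:
  assumes "onb m v" "k < m"
  shows "spec_mat m v f *\<^sub>v vec m (v k) = f k \<cdot>\<^sub>v vec m (v k)"
proof (rule eq_vecI)
  fix i assume "i < dim_vec (f k \<cdot>\<^sub>v vec m (v k))"
  then have i: "i < m" by simp
  have "(spec_mat m v f *\<^sub>v vec m (v k)) $ i = (\<Sum>j<m. (\<Sum>l<m. f l * v l i * cnj (v l j)) * v k j)"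
    using i by (simp add: scalar_prod_def spec_mat_index atLeast0LessThan)
  also have "\<dots> = (\<Sum>l<m. f l * v l i * (\<Sum>j<m. v k j * cnj (v l j)))"
    unfolding sum_distrib_left sum_distrib_right by (subst sum.swap) (simp add: mult_ac)
  also have "\<dots> = (\<Sum>l<m. f l * v l i * (if k = l then 1 else 0))"
    using assms by (intro sum.cong) (auto simp: onb_def)
  also have "\<dots> = f k * v k i" using assms(2) by (simp add: if_distrib[of "\<lambda>x. _ * x"] cong: if_cong)
  finally show "(spec_mat m v f *\<^sub>v vec m (v k)) $ i = (f k \<cdot>\<^sub>v vec m (v k)) $ i" using i by simp
qed simp

lemma onb_nonzero: "onb m v \<Longrightarrow> k < m \<Longrightarrow> \<exists>i<m. v k i \<noteq> 0"
  unfolding onb_def by (metis (no_types, lifting) lessThan_iff mult_zero_left sum.neutral zero_neq_one)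

lemma mat_adjoint_index:
  "A \<in> carrier_mat m m \<Longrightarrow> i < m \<Longrightarrow> j < m \<Longrightarrow> mat_adjoint A $$ (i, j) = cnj (A $$ (j, i))"
  for A :: "complex mat"
  by (auto simp: mat_adjoint_def mat_of_rows_def conjugate_complex_def)

text \<open>A one-sided inverse of a square matrix is two-sided, so \<open>V\<close> is normal.
  Applying \<open>V * mat_adjoint V\<close> to an eigenvector places the eigenvalues on the unit
  circle.\<close>

lemma unitary_spectral:
  assumes "unitary_mat m V"
  shows "\<exists>v z. onb m v \<and> V = spec_mat m v z \<and> (\<forall>k<m. cmod (z k) = 1)"
proof -
  have V: "V \<in> carrier_mat m m" "V * mat_adjoint V = 1\<^sub>m m" using assms by (auto simp: unitary_mat_def)
  have aV: "mat_adjoint V \<in> carrier_mat m m" using V by (auto simp: mat_adjoint_def)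
  have "mat_adjoint V * V = 1\<^sub>m m" using mat_mult_left_right_inverse[OF V(1) aV V(2)] .
  moreover have "(mat_adjoint V * V) $$ (i, j) = (\<Sum>k<m. cnj (V $$ (k, i)) * V $$ (k, j))"
    "(V * mat_adjoint V) $$ (i, j) = (\<Sum>k<m. V $$ (i, k) * cnj (V $$ (j, k)))" if "i < m" "j < m" for i j
    using that V(1) aV by (simp_all add: scalar_prod_def mat_adjoint_index atLeast0LessThan)
  ultimately have 1: "(\<Sum>k<m. V $$ (i, k) * cnj (V $$ (j, k))) = (if i = j then 1 else 0)"
    and 2: "(\<Sum>k<m. cnj (V $$ (k, i)) * V $$ (k, j)) = (if i = j then 1 else 0)" if "i < m" "j < m" for i j
    using V(2) that by (metis index_one_mat(1))+
  obtain v z where "onb m v" and Vv: "\<forall>i<m. \<forall>j<m. V $$ (i, j) = (\<Sum>k<m. z k * v k i * cnj (v k j))"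
    using normal_spectral[of m "\<lambda>i j. V $$ (i, j)"] 1 2 unfolding onb_def by auto
  have Vs: "V = spec_mat m v z" using V(1) Vv by (intro eq_matI) (auto simp: spec_mat_index)
  have adj: "mat_adjoint V = spec_mat m v (\<lambda>k. cnj (z k))"
    using aV V(1) Vv by (intro eq_matI) (auto simp: spec_mat_index mat_adjoint_index mult_ac)
  have "cmod (z k) = 1" if k: "k < m" for k
  proof -
    obtain i where i: "i < m" "v k i \<noteq> 0" using onb_nonzero[OF \<open>onb m v\<close> k] by blast
    have "spec_mat m v (\<lambda>k. z k * cnj (z k)) = 1\<^sub>m m"
      using V(2) unfolding adj by (simp add: Vs spec_mat_mult[OF \<open>onb m v\<close>])
    then have "1\<^sub>m m *\<^sub>v vec m (v k) = (z k * cnj (z k)) \<cdot>\<^sub>v vec m (v k)"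
      using spec_mat_eigenvector[OF \<open>onb m v\<close> k, of "\<lambda>k. z k * cnj (z k)"] by simp
    then have "(1\<^sub>m m *\<^sub>v vec m (v k)) $ i = ((z k * cnj (z k)) \<cdot>\<^sub>v vec m (v k)) $ i" by simp
    then have "z k * cnj (z k) = 1" using i by simp
    then show ?thesis by (metis complex_mod_mult_cnj norm_one power2_eq_1_iff norm_ge_zero abs_norm_cancel real_sqrt_one real_sqrt_abs)
  qed
  then show ?thesis using \<open>onb m v\<close> Vs by blast
qed

text \<open>If \<open>w\<close> differs from all \<open>z k\<close>, the spectral matrix of 1 / (z k
  - w) inverts V - w, which excludes an eigenvector for \<open>w\<close>.\<close>

lemma eigenvalue_spec_mat:
  assumes "onb m v"
  shows "eigenvalue (spec_mat m v z) w \<longleftrightarrow> (\<exists>k<m. z k = w)"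
proof
  assume "\<exists>k<m. z k = w"
  then obtain k where k: "k < m" "z k = w" by blast
  then obtain i where i: "i < m" "v k i \<noteq> 0" using onb_nonzero[OF assms] by blast
  have "vec m (v k) \<noteq> 0\<^sub>v m" using i by (metis index_vec index_zero_vec(1))
  then show "eigenvalue (spec_mat m v z) w"
    using spec_mat_eigenvector[OF assms k(1), of z] k(2)
    unfolding eigenvalue_def eigenvector_def by (intro exI[of _ "vec m (v k)"]) auto
next
  assume "eigenvalue (spec_mat m v z) w"
  then obtain x where x: "x \<in> carrier_vec m" "x \<noteq> 0\<^sub>v m" "spec_mat m v z *\<^sub>v x = w \<cdot>\<^sub>v x"
    unfolding eigenvalue_def eigenvector_def by auto
  show "\<exists>k<m. z k = w"
  proof (rule ccontr)
    assume c: "\<not> ?thesis"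
    have 1: "spec_mat m v (\<lambda>k. 1 / (z k - w)) * spec_mat m v (\<lambda>k. z k - w) = 1\<^sub>m m"
      unfolding spec_mat_mult[OF assms] spec_mat_one[OF assms, symmetric]
      using c by (intro spec_mat_cong) auto
    have "spec_mat m v (\<lambda>k. z k - w) = spec_mat m v z - spec_mat m v (\<lambda>k. w * 1)"
      by (simp add: spec_mat_diff)
    also have "spec_mat m v (\<lambda>k. w * 1) = w \<cdot>\<^sub>m 1\<^sub>m m"
      by (simp only: spec_mat_smult[symmetric] spec_mat_one[OF assms])
    finally have "spec_mat m v (\<lambda>k. z k - w) *\<^sub>v x = spec_mat m v z *\<^sub>v x - (w \<cdot>\<^sub>m 1\<^sub>m m) *\<^sub>v x"
      using x(1) by (simp add: minus_mult_distrib_mat_vec[of _ m m])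
    also have "(w \<cdot>\<^sub>m 1\<^sub>m m) *\<^sub>v x = w \<cdot>\<^sub>v x"
      using x(1) by (intro eq_vecI) (auto simp: scalar_prod_def if_distrib[of "\<lambda>x. _ * x * _"] cong: if_cong)
    finally have "spec_mat m v (\<lambda>k. z k - w) *\<^sub>v x = 0\<^sub>v m" using x by auto
    then have "1\<^sub>m m *\<^sub>v x = 0\<^sub>v m"
      using x(1) unfolding 1[symmetric] by (subst assoc_mult_mat_vec[of _ m m _ m]) auto
    then show False using x by simp
  qed
qed

section \<open>Resolvent, contour integral and Cayley transform\<close>

lemma mat_resolvent_spec:
  assumes "onb m v" "\<And>k. k < m \<Longrightarrow> z k \<noteq> w"
  shows "mat_resolvent m (spec_mat m v z) w = spec_mat m v (\<lambda>k. 1 / (z k - w))"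
proof -
  let ?M = "spec_mat m v z - w \<cdot>\<^sub>m 1\<^sub>m m" and ?R = "spec_mat m v (\<lambda>k. 1 / (z k - w))"
  have M: "?M = spec_mat m v (\<lambda>k. z k - w)"
    by (simp add: spec_mat_one[OF assms(1), symmetric] spec_mat_smult spec_mat_diff)
  have "?M * ?R = spec_mat m v (\<lambda>k. 1)" "?R * ?M = spec_mat m v (\<lambda>k. 1)"
    unfolding M spec_mat_mult[OF assms(1)] by (rule spec_mat_cong, use assms(2) in simp)+
  then have MR: "?M * ?R = 1\<^sub>m m" and RM: "?R * ?M = 1\<^sub>m m"
    by (simp_all only: spec_mat_one[OF assms(1)])
  show ?thesis unfolding mat_resolvent_def
  proof (rule the_equality)
    fix B assume B: "B \<in> carrier_mat m m \<and> ?M * B = 1\<^sub>m m"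
    then have "B = (?R * ?M) * B" using left_mult_one_mat[of B m m] unfolding RM by simp
    also have "\<dots> = ?R * (?M * B)" using B by (intro assoc_mult_mat[of _ m m _ m _ m]) auto
    finally show "B = ?R" using B by simp
  qed (use MR in simp)
qed

text \<open>A circle around -1 works: points of the unit circle other than 1 lie at distance less
  than 2 from -1, the point 1 at distance exactly 2. The radius is taken strictly between the
  largest distance that occurs and 2.\<close>

lemma adm_contour_exists:
  assumes "onb m v" "\<And>k. k < m \<Longrightarrow> cmod (z k) = 1"
  shows "\<exists>\<gamma>. adm_contour (spec_mat m v z) \<gamma>"
proof -
  \<comment> \<open>Inserting 0 keeps the maximum defined when no eigenvalue differs from 1, and it
    makes the radius positive.\<close>
  define E where "E = insert 0 ((\<lambda>k. cmod (z k + 1)) ` {k. k < m \<and> z k \<noteq> 1})"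
  have "cmod (z k + 1) < 2" if "k < m" "z k \<noteq> 1" for k
  proof -
    have "(Re (z k))\<^sup>2 + (Im (z k))\<^sup>2 = 1" using assms(2)[OF that(1)] by (metis cmod_power2 one_power2)
    moreover have "Re (z k) \<noteq> 1"
    proof
      assume "Re (z k) = 1"
      then have "z k = 1" using calculation by (simp add: complex_eq_iff)
      then show False using that by simp
    qed
    moreover have "(Re (z k))\<^sup>2 \<le> 1" using calculation(1) by (metis le_add_same_cancel1 zero_le_power2)
    ultimately have "Re (z k) < 1" using abs_le_square_iff[of "Re (z k)" 1] by auto
    then have "(cmod (z k + 1))\<^sup>2 < 2\<^sup>2"
      using \<open>(Re (z k))\<^sup>2 + (Im (z k))\<^sup>2 = 1\<close> by (simp add: cmod_power2 power2_sum)
    then show ?thesis by (rule power_less_imp_less_base) simp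
  qed
  moreover have E: "finite E" "E \<noteq> {}" by (auto simp: E_def)
  ultimately have "Max E < 2" by (auto simp: Max_less_iff E_def)
  moreover have "Max E \<ge> 0" using E by (auto simp: E_def intro: Max_ge)
  moreover define r where "r = (Max E + 2) / 2"
  ultimately have r: "Max E < r" "r < 2" "0 < r" by auto
  have in1: "cmod (z k + 1) < r" "dist (-1) (z k) < r" if "k < m" "z k \<noteq> 1" for k
  proof -
    have "cmod (z k + 1) \<le> Max E" using E that by (intro Max_ge) (auto simp: E_def)
    moreover have "dist (-1) (z k) = cmod (z k + 1)" by (metis add.commute diff_minus_eq_add dist_commute dist_norm)
    ultimately show "cmod (z k + 1) < r" "dist (-1) (z k) < r" using r by simp_all
  qed
  let ?g = "circlepath (-1) r"
  have d1: "dist (-1) (1::complex) = 2" by (simp add: dist_norm)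
  have n1: "1 \<notin> path_image ?g" using r d1 by (auto simp: dist_norm)
  have w1: "winding_number ?g 1 = 0"
  proof (rule winding_number_zero_outside[of _ "cball (-1) r"])
    show "(1::complex) \<notin> cball (-1) r" using r d1 by simp
  qed (use r in auto)
  have "adm_contour (spec_mat m v z) ?g"
    unfolding adm_contour_def eigenvalue_spec_mat[OF assms(1)]
  proof (intro conjI allI impI)
    fix w assume w: "\<exists>k<m. z k = w"
    show "w \<notin> path_image ?g" using w n1 in1 r by (cases "w = 1") (auto simp: dist_norm)
    show "winding_number ?g w = 1" if "w \<noteq> 1"
      using w in1 that by (intro winding_number_circlepath) (auto simp: dist_norm norm_minus_commute)
  qed (use r n1 w1 in \<open>auto simp: simple_path_circlepath\<close>)
  then show ?thesis by blast
qed

text \<open>The Cayley transform of the punctured unit circle onto the real line. The value 0 at 1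
  is that of the contour integral for the eigenvalue 1, whose pole lies outside the contour.\<close>

definition cay :: "complex \<Rightarrow> complex" where
  "cay w = (if w = 1 then 0 else - \<i> * (w + 1) / (w - 1))"

lemma cay_real: "cmod w = 1 \<Longrightarrow> cnj (cay w) = cay w"
proof -
  assume "cmod w = 1"
  then have "w * cnj w = 1" by (simp add: complex_norm_square[symmetric])
  moreover from this have "w \<noteq> 0" by auto
  ultimately have c: "cnj w = 1 / w" "w \<noteq> 0" by (simp_all add: nonzero_eq_divide_eq mult.commute)
  show ?thesis
  proof (cases "w = 1")
    case False
    then show ?thesis using c(2) by (simp add: cay_def c(1) divide_simps) (simp add: algebra_simps)
  qed (simp add: cay_def)
qed

text \<open>For w \<noteq> 1 partial fractions leave only the contribution of the pole at
  \<open>w\<close>. For w = 1 the integrand is - 1 / (z - 1) - 2 / (z - 1)^2; the first term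
  integrates to 0 by the winding number, the second because it has a primitive.\<close>

lemma contour_integral_cay:
  assumes g: "valid_path \<gamma>" "pathfinish \<gamma> = pathstart \<gamma>" "1 \<notin> path_image \<gamma>" "winding_number \<gamma> 1 = 0"
    and w: "w \<notin> path_image \<gamma>" "w \<noteq> 1 \<Longrightarrow> winding_number \<gamma> w = 1"
  shows "((\<lambda>z. (z + 1) / (z - 1) * (1 / (w - z))) has_contour_integral 2 * pi * cay w) \<gamma>"
proof (cases "w = 1")
  case True
  have 1: "((\<lambda>z. 1 / (z - 1)) has_contour_integral 0) \<gamma>"
    using has_contour_integral_winding_number[OF g(1,3)] g(4) by simp
  have "((\<lambda>z. - 2 / (z - 1)\<^sup>2) has_contour_integral 2 / (pathfinish \<gamma> - 1) - 2 / (pathstart \<gamma> - 1)) \<gamma>"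
  proof (rule contour_integral_primitive[of "- {1}"])
    fix x :: complex assume "x \<in> - {1}"
    then show "((\<lambda>x. 2 / (x - 1)) has_field_derivative - 2 / (x - 1)\<^sup>2) (at x within - {1})"
      by (auto intro!: derivative_eq_intros simp: power2_eq_square)
  qed (use g in auto)
  then have 2: "((\<lambda>z. - 2 / (z - 1)\<^sup>2) has_contour_integral 0) \<gamma>" using g(2) by simp
  have "((\<lambda>z. - (1 / (z - 1)) + - 2 / (z - 1)\<^sup>2) has_contour_integral - 0 + 0) \<gamma>"
    using 1 2 by (intro has_contour_integral_add has_contour_integral_neg)
  then have "((\<lambda>z. (z + 1) / (z - 1) * (1 / (w - z))) has_contour_integral - 0 + 0) \<gamma>"
  proof (rule has_contour_integral_eq)
    fix z assume "z \<in> path_image \<gamma>"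
    then have "z \<noteq> 1" using g(3) by auto
    then show "- (1 / (z - 1)) + - 2 / (z - 1)\<^sup>2 = (z + 1) / (z - 1) * (1 / (w - z))"
      unfolding True by (simp add: divide_simps power2_eq_square) (simp add: algebra_simps)
  qed
  then show ?thesis by (simp add: True cay_def)
next
  case False
  have 1: "((\<lambda>z. 1 / (z - 1)) has_contour_integral 0) \<gamma>"
    using has_contour_integral_winding_number[OF g(1,3)] g(4) by simp
  have 2: "((\<lambda>z. 1 / (z - w)) has_contour_integral 2 * pi * \<i>) \<gamma>"
    using has_contour_integral_winding_number[OF g(1) w(1)] w(2)[OF False] by simp
  have "((\<lambda>z. 2 / (w - 1) * (1 / (z - 1)) + - (w + 1) / (w - 1) * (1 / (z - w))) has_contour_integral
      2 / (w - 1) * 0 + - (w + 1) / (w - 1) * (2 * pi * \<i>)) \<gamma>"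
    by (intro has_contour_integral_add has_contour_integral_lmul 1 2)
  then have "((\<lambda>z. (z + 1) / (z - 1) * (1 / (w - z))) has_contour_integral
      2 / (w - 1) * 0 + - (w + 1) / (w - 1) * (2 * pi * \<i>)) \<gamma>"
  proof (rule has_contour_integral_eq)
    fix z assume "z \<in> path_image \<gamma>"
    then have "z \<noteq> 1" "z \<noteq> w" using g(3) w(1) by auto
    then show "2 / (w - 1) * (1 / (z - 1)) + - (w + 1) / (w - 1) * (1 / (z - w)) = (z + 1) / (z - 1) * (1 / (w - z))"
      using False by (simp add: divide_simps) (simp add: algebra_simps)
  qed
  moreover have "2 / (w - 1) * 0 + - (w + 1) / (w - 1) * (2 * pi * \<i>) = 2 * pi * cay w"
    using False by (simp add: cay_def divide_simps) (simp add: algebra_simps)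
  ultimately show ?thesis by simp
qed

text \<open>The diagonalised resolvent is integrated entry by entry. The result does not depend on
  which admissible contour the choice operator selects.\<close>

lemma A_mat_spec:
  assumes onb: "onb m v" and z: "\<And>k. k < m \<Longrightarrow> cmod (z k) = 1"
  shows "A_mat m (spec_mat m v z) = spec_mat m v (\<lambda>k. cay (z k))"
proof -
  define g where "g = (SOME \<gamma>. adm_contour (spec_mat m v z) \<gamma>)"
  have g: "adm_contour (spec_mat m v z) g"
    using someI_ex[OF adm_contour_exists[OF onb z]] by (simp add: g_def)
  then have g1: "valid_path g" "pathfinish g = pathstart g" "1 \<notin> path_image g" "winding_number g 1 = 0"
    and g2: "\<And>k. k < m \<Longrightarrow> z k \<notin> path_image g" "\<And>k. k < m \<Longrightarrow> z k \<noteq> 1 \<Longrightarrow> winding_number g (z k) = 1"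
    unfolding adm_contour_def eigenvalue_spec_mat[OF onb] by auto
  have "contour_integral g (\<lambda>w. (w + 1) / (w - 1) * mat_resolvent m (spec_mat m v z) w $$ (i, j)) =
      (\<Sum>k<m. v k i * cnj (v k j) * (2 * pi * cay (z k)))" if ij: "i < m" "j < m" for i j
  proof -
    have "((\<lambda>w. \<Sum>k<m. v k i * cnj (v k j) * ((w + 1) / (w - 1) * (1 / (z k - w)))) has_contour_integral
        (\<Sum>k<m. v k i * cnj (v k j) * (2 * pi * cay (z k)))) g"
      using g1 g2 by (intro has_contour_integral_sum has_contour_integral_lmul contour_integral_cay) auto
    then have "((\<lambda>w. (w + 1) / (w - 1) * mat_resolvent m (spec_mat m v z) w $$ (i, j)) has_contour_integral
        (\<Sum>k<m. v k i * cnj (v k j) * (2 * pi * cay (z k)))) g"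
    proof (rule has_contour_integral_eq)
      fix w assume "w \<in> path_image g"
      then have "\<And>k. k < m \<Longrightarrow> z k \<noteq> w" using g2 by auto
      then show "(\<Sum>k<m. v k i * cnj (v k j) * ((w + 1) / (w - 1) * (1 / (z k - w)))) =
         (w + 1) / (w - 1) * mat_resolvent m (spec_mat m v z) w $$ (i, j)"
        using ij by (simp add: mat_resolvent_spec[OF onb] spec_mat_index sum_distrib_left mult_ac)
    qed
    then show ?thesis by (rule contour_integral_unique)
  qed
  then have "(1 / (2 * pi)) * contour_integral g (\<lambda>w. (w + 1) / (w - 1) * mat_resolvent m (spec_mat m v z) w $$ (i, j)) =
      spec_mat m v (\<lambda>k. cay (z k)) $$ (i, j)" if "i < m" "j < m" for i j
    using that unfolding sum_distrib_left by (auto simp: spec_mat_index sum_distrib_left intro!: sum.cong)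
  then show ?thesis
    unfolding A_mat_def Let_def g_def[symmetric] by (intro eq_matI) auto
qed

section \<open>Interpolation inequalities\<close>

definition energy :: "real \<Rightarrow> real \<Rightarrow> (real \<Rightarrow> complex) \<Rightarrow> real" where
  "energy a b f = integral {a..b} (\<lambda>x. (cmod (f x))\<^sup>2)"

lemma energy_integrable:
  fixes f :: "real \<Rightarrow> complex"
  shows "continuous_on {a..b} f \<Longrightarrow> (\<lambda>x. (cmod (f x))\<^sup>2) integrable_on {a..b}"
  by (intro integrable_continuous_real continuous_intros)

lemma energy_nonneg: "energy a b f \<ge> 0"
  unfolding energy_def by (cases "(\<lambda>x. (cmod (f x))\<^sup>2) integrable_on {a..b}")
    (auto intro: integral_nonneg simp: not_integrable_integral)

lemma young_ineq: "s > 0 \<Longrightarrow> x * y \<le> s * x\<^sup>2 + (1 / s) * y\<^sup>2" for x y s :: real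
proof -
  assume s: "s > 0"
  have "0 \<le> (s * x - y)\<^sup>2" by simp
  then have "2 * (s * x * y) \<le> s\<^sup>2 * x\<^sup>2 + y\<^sup>2" by (simp add: power2_diff power_mult_distrib mult_ac)
  moreover have "0 \<le> (s * x + y)\<^sup>2" by simp
  ultimately have "s * x * y \<le> s\<^sup>2 * x\<^sup>2 + y\<^sup>2" by (simp add: power2_sum power_mult_distrib)
  then show ?thesis using s by (simp add: field_simps power2_eq_square)
qed

lemma integral_norm_prod_le:
  fixes f g :: "real \<Rightarrow> complex"
  assumes "continuous_on {a..b} f" "continuous_on {a..b} g" "s > 0"
  shows "integral {a..b} (\<lambda>x. cmod (f x) * cmod (g x)) \<le> s * energy a b f + (1 / s) * energy a b g"
proof -
  have "integral {a..b} (\<lambda>x. cmod (f x) * cmod (g x))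
     \<le> integral {a..b} (\<lambda>x. s * (cmod (f x))\<^sup>2 + (1 / s) * (cmod (g x))\<^sup>2)"
    using assms by (intro integral_le integrable_continuous_real continuous_intros young_ineq)
  also have "\<dots> = s * energy a b f + (1 / s) * energy a b g"
    unfolding energy_def using assms
    by (subst integral_add) (auto intro!: integrable_continuous_real continuous_intros)
  finally show ?thesis .
qed

text \<open>The squared modulus is compared with its mean over [a,b]. Its oscillation is at most the
  integral of 2 |f'| |f|, which Young's inequality splits with weight \<epsilon>.\<close>

lemma sup_sq_bound:
  fixes f f' :: "real \<Rightarrow> complex"
  assumes ab: "a < b" and d: "\<And>x. x \<in> {a..b} \<Longrightarrow> (f has_vector_derivative f' x) (at x within {a..b})"
    and c: "continuous_on {a..b} f'" and e: "\<epsilon> > 0" and x: "x \<in> {a..b}"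
  shows "(cmod (f x))\<^sup>2 \<le> 2 * \<epsilon> * energy a b f' + (1 / (b - a) + 2 / \<epsilon>) * energy a b f"
proof -
  have cf: "continuous_on {a..b} f" using d by (rule continuous_on_vector_derivative)
  define g where "g s = (cmod (f s))\<^sup>2" for s
  define g' where "g' s = 2 * Re (f' s * cnj (f s))" for s
  have g: "(g has_vector_derivative g' s) (at s within {a..b})" if "s \<in> {a..b}" for s
  proof -
    have "((\<lambda>s. f s * cnj (f s)) has_vector_derivative f s * cnj (f' s) + f' s * cnj (f s)) (at s within {a..b})"
      using d[OF that] by (intro has_vector_derivative_mult has_vector_derivative_cnj) auto
    then have "((\<lambda>s. Re (f s * cnj (f s))) has_vector_derivative Re (f s * cnj (f' s) + f' s * cnj (f s))) (at s within {a..b})"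
      by (rule bounded_linear.has_vector_derivative[OF bounded_linear_Re])
    moreover have "Re (f s * cnj (f' s) + f' s * cnj (f s)) = g' s" by (simp add: g'_def algebra_simps)
    moreover have "(\<lambda>s. Re (f s * cnj (f s))) = g"
      unfolding g_def cmod_power2 by (auto simp: power2_eq_square)
    ultimately show ?thesis by simp
  qed
  define M where "M = 2 * \<epsilon> * energy a b f' + (2 / \<epsilon>) * energy a b f"
  have gi: "(\<lambda>x. 2 * (cmod (f' x) * cmod (f x))) integrable_on {u..w}" if "a \<le> u" "w \<le> b" for u w
    using c cf that by (intro integrable_continuous_real continuous_intros continuous_on_subset[OF c] continuous_on_subset[OF cf]) auto
  have key: "\<bar>g w - g u\<bar> \<le> M" if "a \<le> u" "u \<le> w" "w \<le> b" for u w
  proof -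
    have "(g' has_integral g w - g u) {u..w}"
    proof (rule fundamental_theorem_of_calculus)
      show "(g has_vector_derivative g' s) (at s within {u..w})" if "s \<in> {u..w}" for s
        using g[of s] that \<open>a \<le> u\<close> \<open>w \<le> b\<close> by (auto intro: has_vector_derivative_within_subset)
    qed fact
    then have "\<bar>g w - g u\<bar> = norm (integral {u..w} g')" by (simp add: integral_unique)
    also have "\<dots> \<le> integral {u..w} (\<lambda>x. 2 * (cmod (f' x) * cmod (f x)))"
    proof (rule integral_norm_bound_integral)
      show "g' integrable_on {u..w}" using \<open>(g' has_integral g w - g u) {u..w}\<close> by blast
      show "norm (g' s) \<le> 2 * (cmod (f' s) * cmod (f s))" for s
        using abs_Re_le_cmod[of "f' s * cnj (f s)"] by (simp add: g'_def norm_mult)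
    qed (use gi that in auto)
    also have "\<dots> \<le> integral {a..b} (\<lambda>x. 2 * (cmod (f' x) * cmod (f x)))"
      using that gi by (intro integral_subset_le) auto
    also have "\<dots> = 2 * integral {a..b} (\<lambda>x. cmod (f' x) * cmod (f x))" by simp
    also have "\<dots> \<le> M" using integral_norm_prod_le[OF c cf e] by (simp add: M_def)
    finally show ?thesis .
  qed
  have le: "g x \<le> g s + M" if "s \<in> {a..b}" for s
    using key[of s x] key[of x s] that x by (cases "s \<le> x") auto
  have gint: "g integrable_on {a..b}" unfolding g_def using energy_integrable[OF cf] .
  have "integral {a..b} (\<lambda>s. g x) \<le> integral {a..b} (\<lambda>s. g s + M)"
    using le gint by (intro integral_le integrable_add) auto
  also have "\<dots> = energy a b f + (b - a) * M"
    using gint ab by (subst integral_add) (auto simp: energy_def g_def[abs_def])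
  finally have "(b - a) * g x \<le> energy a b f + (b - a) * M" using ab by simp
  then have "g x \<le> energy a b f / (b - a) + M" using ab by (simp add: field_simps)
  then show ?thesis by (simp add: g_def M_def algebra_simps)
qed

text \<open>Integrating |f'|^2 by parts gives boundary terms and the pairing of f'' with f. The
  boundary terms are controlled by the pointwise bounds for f and f', and the resulting small
  multiple of the middle energy is absorbed on the left.\<close>

lemma energy_interp_C2:
  assumes ab: "a < b" and e: "\<epsilon> > 0"
  shows "\<exists>C\<ge>0. \<forall>f f' f''. (\<forall>x\<in>{a..b}. (f has_vector_derivative f' x) (at x within {a..b})) \<longrightarrow>
     (\<forall>x\<in>{a..b}. (f' has_vector_derivative f'' x) (at x within {a..b})) \<longrightarrow> continuous_on {a..b} f'' \<longrightarrow>
     energy a b f' \<le> \<epsilon> * energy a b f'' + C * energy a b f"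
proof -
  define c where "c = 1 / (b - a) + 2"
  have c: "c > 0" using ab by (simp add: c_def add_pos_pos)
  \<comment> \<open>The final coefficients are 5 s for the top energy and 2 s (c + 2) for the middle
    one; the two bounds on \<open>s\<close> make them at most \<epsilon>/2 and 1/2.\<close>
  define s where "s = min (\<epsilon> / 10) (1 / (4 * (c + 2)))"
  have s: "s > 0" "10 * s \<le> \<epsilon>" "s * (4 * (c + 2)) \<le> 1"
    using e c by (auto simp: s_def min_def field_simps)
  define K where "K = 2 * (1 / s * (1 / (b - a) + 2 / s\<^sup>2)) + 1 / s"
  have K: "K \<ge> 0" using s ab by (simp add: K_def add_nonneg_nonneg)
  show ?thesis
  proof (intro exI[of _ "2 * K"] conjI allI impI)
    show "2 * K \<ge> 0" using K by simp
    fix f f' f'' :: "real \<Rightarrow> complex"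
    assume d1: "\<forall>x\<in>{a..b}. (f has_vector_derivative f' x) (at x within {a..b})"
      and d2: "\<forall>x\<in>{a..b}. (f' has_vector_derivative f'' x) (at x within {a..b})"
      and c2: "continuous_on {a..b} f''"
    have c0: "continuous_on {a..b} f" and c1: "continuous_on {a..b} f'"
      using continuous_on_vector_derivative d1 d2 by blast+
    define E0 E1 E2 where "E0 = energy a b f" and "E1 = energy a b f'" and "E2 = energy a b f''"
    have E: "E0 \<ge> 0" "E1 \<ge> 0" "E2 \<ge> 0" by (simp_all add: E0_def E1_def E2_def energy_nonneg)
    have bd: "cmod (f' x) * cmod (f x) \<le> s * (2 * E2 + c * E1) + (2 * s * E1 + (1 / s * (1 / (b - a) + 2 / s\<^sup>2)) * E0)"
      if "x \<in> {a..b}" for x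
    proof -
      have "cmod (f' x) * cmod (f x) \<le> s * (cmod (f' x))\<^sup>2 + (1 / s) * (cmod (f x))\<^sup>2"
        using s(1) by (rule young_ineq)
      moreover have "s * (cmod (f' x))\<^sup>2 \<le> s * (2 * E2 + c * E1)"
        using sup_sq_bound[OF ab _ c2, of f' 1 x] d2 that s(1) by (simp add: E1_def E2_def c_def)
      \<comment> \<open>With weight s^2 in the pointwise bound, the division by \<open>s\<close>
        still leaves a factor \<open>s\<close> on the middle energy.\<close>
      moreover have "(1 / s) * (cmod (f x))\<^sup>2 \<le> (1 / s) * (2 * s\<^sup>2 * E1 + (1 / (b - a) + 2 / s\<^sup>2) * E0)"
        using sup_sq_bound[OF ab _ c1, of f "s\<^sup>2" x] d1 that s(1)
        by (intro mult_left_mono) (auto simp: E1_def E0_def)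
      moreover have "(1 / s) * (2 * s\<^sup>2 * E1 + (1 / (b - a) + 2 / s\<^sup>2) * E0) = 2 * s * E1 + (1 / s * (1 / (b - a) + 2 / s\<^sup>2)) * E0"
      proof -
        have "(1 / s) * (2 * s\<^sup>2 * E1 + X * E0) = 2 * s * E1 + (1 / s * X) * E0" for X
          using s(1) by (simp add: field_simps power2_eq_square)
        then show ?thesis .
      qed
      ultimately show ?thesis by linarith
    qed
    have hi: "((\<lambda>x. f' x * cnj (f' x) + f'' x * cnj (f x)) has_integral f' b * cnj (f b) - f' a * cnj (f a)) {a..b}"
    proof (rule fundamental_theorem_of_calculus)
      show "((\<lambda>x. f' x * cnj (f x)) has_vector_derivative f' x * cnj (f' x) + f'' x * cnj (f x)) (at x within {a..b})"
        if "x \<in> {a..b}" for x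
        using d1 d2 that by (intro has_vector_derivative_mult has_vector_derivative_cnj) auto
    qed (use ab in simp)
    have i1: "(\<lambda>x. f' x * cnj (f' x)) integrable_on {a..b}" and i2: "(\<lambda>x. f'' x * cnj (f x)) integrable_on {a..b}"
      using c0 c1 c2 by (auto intro!: integrable_continuous_real continuous_intros)
    have "integral {a..b} (\<lambda>x. f' x * cnj (f' x)) = complex_of_real E1"
    proof -
      have "(\<lambda>x. f' x * cnj (f' x)) = (\<lambda>x. complex_of_real ((cmod (f' x))\<^sup>2))"
        by (simp add: complex_norm_square[symmetric] del: of_real_power)
      moreover have "((complex_of_real \<circ> (\<lambda>x. (cmod (f' x))\<^sup>2)) has_integral complex_of_real E1) {a..b}"
        unfolding E1_def energy_def
        by (rule has_integral_linear[OF integrable_integral[OF energy_integrable[OF c1]] bounded_linear_of_real])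
      ultimately show ?thesis by (simp add: o_def integral_unique)
    qed
    then have "complex_of_real E1 = f' b * cnj (f b) - f' a * cnj (f a) - integral {a..b} (\<lambda>x. f'' x * cnj (f x))"
      using hi i1 i2 by (simp add: integral_unique[OF hi, symmetric] integral_add)
    then have "norm (complex_of_real E1) \<le> norm (f' b * cnj (f b)) + norm (f' a * cnj (f a)) + norm (integral {a..b} (\<lambda>x. f'' x * cnj (f x)))"
      by (metis (no_types, lifting) add_mono_thms_linordered_semiring(3) norm_triangle_ineq4 order_trans)
    moreover have "norm (integral {a..b} (\<lambda>x. f'' x * cnj (f x))) \<le> s * E2 + (1 / s) * E0"
    proof -
      have "norm (integral {a..b} (\<lambda>x. f'' x * cnj (f x))) \<le> integral {a..b} (\<lambda>x. cmod (f'' x) * cmod (f x))"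
        using i2 c0 c2 by (intro integral_norm_bound_integral integrable_continuous_real continuous_intros) (auto simp: norm_mult)
      also have "\<dots> \<le> s * E2 + (1 / s) * E0" unfolding E2_def E0_def by (rule integral_norm_prod_le[OF c2 c0 s(1)])
      finally show ?thesis .
    qed
    ultimately have "E1 \<le> cmod (f' b) * cmod (f b) + cmod (f' a) * cmod (f a) + (s * E2 + (1 / s) * E0)"
      using E(2) by (simp add: norm_mult)
    also have "\<dots> \<le> 2 * (s * (2 * E2 + c * E1) + (2 * s * E1 + (1 / s * (1 / (b - a) + 2 / s\<^sup>2)) * E0)) + (s * E2 + (1 / s) * E0)"
      using bd[of a] bd[of b] ab by simp
    also have "\<dots> = 5 * s * E2 + 2 * s * (c + 2) * E1 + K * E0"
      by (simp add: K_def algebra_simps)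
    also have "\<dots> \<le> (\<epsilon> / 2) * E2 + (1 / 2) * E1 + K * E0"
    proof -
      have "4 * (s * (c + 2)) \<le> 1" by (metis mult.left_commute s(3))
      then have "2 * s * (c + 2) \<le> 1 / 2" by linarith
      moreover have "5 * s \<le> \<epsilon> / 2" using s(2) by simp
      ultimately show ?thesis using E by (intro add_mono mult_right_mono order_refl)
    qed
    finally show "energy a b f' \<le> \<epsilon> * energy a b f'' + 2 * K * energy a b f"
      by (simp add: E0_def E1_def E2_def algebra_simps)
  qed
qed

text \<open>Induction with absorption: the inequality for three consecutive derivatives produces the
  next lower energy with a factor \<open>C\<close>, and the induction hypothesis with weight 1 / (2
  (C + 1)) returns at most half of the energy being estimated.\<close>

lemma energy_interp_step:
  assumes ab: "a < b" and "\<epsilon> > 0"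
  shows "\<exists>C\<ge>0. \<forall>y. Ck_on a b (Suc n) y \<longrightarrow>
     energy a b (dw a b n y) \<le> \<epsilon> * energy a b (dw a b (Suc n) y) + C * energy a b y"
  using assms(2)
proof (induction n arbitrary: \<epsilon>)
  case 0
  then show ?case by (intro exI[of _ 1]) (auto intro!: mult_nonneg_nonneg energy_nonneg)
next
  case (Suc n)
  obtain C where C: "C \<ge> 0" "\<And>f f' f''. (\<forall>x\<in>{a..b}. (f has_vector_derivative f' x) (at x within {a..b})) \<Longrightarrow>
     (\<forall>x\<in>{a..b}. (f' has_vector_derivative f'' x) (at x within {a..b})) \<Longrightarrow> continuous_on {a..b} f'' \<Longrightarrow>
     energy a b f' \<le> \<epsilon> / 2 * energy a b f'' + C * energy a b f"
    using energy_interp_C2[OF ab, of "\<epsilon> / 2"] Suc.prems by auto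
  obtain C' where C': "C' \<ge> 0" "\<And>y. Ck_on a b (Suc n) y \<Longrightarrow>
     energy a b (dw a b n y) \<le> 1 / (2 * (C + 1)) * energy a b (dw a b (Suc n) y) + C' * energy a b y"
    using Suc.IH[of "1 / (2 * (C + 1))"] C(1) by auto
  show ?case
  proof (intro exI[of _ "2 * (C * C')"] conjI allI impI)
    show "2 * (C * C') \<ge> 0" using C(1) C'(1) by simp
    fix y :: "real \<Rightarrow> complex" assume y: "Ck_on a b (Suc (Suc n)) y"
    let ?E = "\<lambda>j. energy a b (dw a b j y)"
    have "?E (Suc n) \<le> \<epsilon> / 2 * ?E (Suc (Suc n)) + C * ?E n"
      using Ck_on_deriv[OF y, of n] Ck_on_deriv[OF y, of "Suc n"] Ck_on_cont[OF y, of "Suc (Suc n)"]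
      by (intro C(2)) (auto simp del: dw.simps(2))
    moreover have "C * ?E n \<le> C * (1 / (2 * (C + 1)) * ?E (Suc n) + C' * energy a b y)"
      using C'(2)[of y] Ck_on_mono[OF y] C(1) by (intro mult_left_mono) auto
    moreover have "C * (1 / (2 * (C + 1))) * ?E (Suc n) \<le> 1 / 2 * ?E (Suc n)"
      using C(1) energy_nonneg by (intro mult_right_mono) (auto simp: field_simps)
    moreover have "C * (1 / (2 * (C + 1)) * ?E (Suc n) + C' * energy a b y) = C * (1 / (2 * (C + 1))) * ?E (Suc n) + C * C' * energy a b y"
      by (simp only: distrib_left mult.assoc)
    ultimately have "?E (Suc n) \<le> \<epsilon> / 2 * ?E (Suc (Suc n)) + (1 / 2 * ?E (Suc n) + C * C' * energy a b y)"
      by linarith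
    then show "?E (Suc n) \<le> \<epsilon> * ?E (Suc (Suc n)) + 2 * (C * C') * energy a b y"
      by (simp add: algebra_simps del: dw.simps(2))
  qed
qed

lemma energy_interp:
  assumes ab: "a < b" and "j < n" "\<epsilon> > 0"
  shows "\<exists>C\<ge>0. \<forall>y. Ck_on a b n y \<longrightarrow>
     energy a b (dw a b j y) \<le> \<epsilon> * energy a b (dw a b n y) + C * energy a b y"
  using assms(2,3)
proof (induction n arbitrary: \<epsilon>)
  case 0
  then show ?case by simp
next
  case (Suc n)
  show ?case
  proof (cases "j = n")
    case True
    then show ?thesis using energy_interp_step[OF ab Suc.prems(2)] by simp
  next
    case False
    then obtain C where C: "C \<ge> 0" "\<And>y. Ck_on a b n y \<Longrightarrow>
        energy a b (dw a b j y) \<le> 1 * energy a b (dw a b n y) + C * energy a b y"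
      using Suc.IH[of 1] Suc.prems by auto
    obtain C' where C': "C' \<ge> 0" "\<And>y. Ck_on a b (Suc n) y \<Longrightarrow>
        energy a b (dw a b n y) \<le> \<epsilon> * energy a b (dw a b (Suc n) y) + C' * energy a b y"
      using energy_interp_step[OF ab Suc.prems(2)] by blast
    show ?thesis
    proof (intro exI[of _ "C + C'"] conjI allI impI)
      fix y :: "real \<Rightarrow> complex" assume y: "Ck_on a b (Suc n) y"
      show "energy a b (dw a b j y) \<le> \<epsilon> * energy a b (dw a b (Suc n) y) + (C + C') * energy a b y"
        using C(2)[OF Ck_on_mono[OF y]] C'(2)[OF y] by (simp add: algebra_simps)
    qed (use C C' in simp)
  qed
qed

text \<open>The pointwise bound in terms of the energies of orders j and j + 1 is followed by
  interpolation of both against the top order. With weight \<epsilon>/4 in the first and \<epsilon>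
  / (2 k) in the second, each contributes \<epsilon>/2.\<close>

lemma trace_interp:
  assumes ab: "a < b" and j: "j < n" and e: "\<epsilon> > 0"
  shows "\<exists>C\<ge>0. \<forall>y. Ck_on a b n y \<longrightarrow> (\<forall>x\<in>{a..b}.
     (cmod (dw a b j y x))\<^sup>2 \<le> \<epsilon> * energy a b (dw a b n y) + C * energy a b y)"
proof -
  have "\<exists>C\<ge>0. \<forall>y. Ck_on a b n y \<longrightarrow>
     energy a b (dw a b (Suc j) y) \<le> 1 * energy a b (dw a b n y) + C * energy a b y"
  proof (cases "Suc j = n")
    case True
    then show ?thesis by (intro exI[of _ 0]) auto
  next
    case False
    then show ?thesis using energy_interp[OF ab, of "Suc j" n 1] j by auto
  qed
  then obtain C1 where C1: "C1 \<ge> 0" "\<And>y. Ck_on a b n y \<Longrightarrow>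
     energy a b (dw a b (Suc j) y) \<le> energy a b (dw a b n y) + C1 * energy a b y" by auto
  define s where "s = \<epsilon> / 4"
  define k where "k = 1 / (b - a) + 2 / s"
  have s: "s > 0" using e by (simp add: s_def)
  then have k: "k > 0" using ab by (simp add: k_def add_pos_pos)
  obtain C2 where C2: "C2 \<ge> 0" "\<And>y. Ck_on a b n y \<Longrightarrow>
     energy a b (dw a b j y) \<le> (\<epsilon> / (2 * k)) * energy a b (dw a b n y) + C2 * energy a b y"
    using energy_interp[OF ab j, of "\<epsilon> / (2 * k)"] e k by auto
  show ?thesis
  proof (intro exI[of _ "2 * s * C1 + k * C2"] conjI allI impI ballI)
    show "2 * s * C1 + k * C2 \<ge> 0" using s k C1 C2 by simp
    fix y :: "real \<Rightarrow> complex" and x assume y: "Ck_on a b n y" and x: "x \<in> {a..b}"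
    let ?En = "energy a b (dw a b n y)" and ?E0 = "energy a b y"
    have "(cmod (dw a b j y x))\<^sup>2 \<le> 2 * s * energy a b (dw a b (Suc j) y) + k * energy a b (dw a b j y)"
      unfolding k_def
    proof (rule sup_sq_bound[OF ab _ _ s x])
      show "(dw a b j y has_vector_derivative dw a b (Suc j) y x) (at x within {a..b})" if "x \<in> {a..b}" for x
        using Ck_on_deriv[OF y j that] .
      show "continuous_on {a..b} (dw a b (Suc j) y)" using y j by (intro Ck_on_cont) auto
    qed
    also have "\<dots> \<le> 2 * s * (?En + C1 * ?E0) + k * ((\<epsilon> / (2 * k)) * ?En + C2 * ?E0)"
      using C1(2)[OF y] C2(2)[OF y] s k by (intro add_mono mult_left_mono) auto
    also have "\<dots> = \<epsilon> * ?En + (2 * s * C1 + k * C2) * ?E0"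
      using k by (simp add: s_def algebra_simps)
    finally show "(cmod (dw a b j y x))\<^sup>2 \<le> \<epsilon> * ?En + (2 * s * C1 + k * C2) * ?E0" .
  qed
qed

section \<open>Boundary conditions of Cayley type\<close>

text \<open>\<open>spec_mat m v (ker_proj z)\<close> is the orthogonal projection onto the
  eigenspace of the eigenvalue 1, that is, onto ker (V - 1).\<close>

definition ker_proj :: "(nat \<Rightarrow> complex) \<Rightarrow> nat \<Rightarrow> complex" where
  "ker_proj z k = (if z k = 1 then 1 else 0)"

lemma spec_mat_minus_one:
  "onb m v \<Longrightarrow> spec_mat m v z - 1\<^sub>m m = spec_mat m v (\<lambda>k. z k - 1)"
  by (simp add: spec_mat_one[symmetric] spec_mat_diff)

lemma spec_mat_plus_one:
  "onb m v \<Longrightarrow> spec_mat m v z + 1\<^sub>m m = spec_mat m v (\<lambda>k. z k + 1)"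
  by (simp add: spec_mat_one[symmetric] spec_mat_add)

lemma mat_mult_index:
  "A \<in> carrier_mat m m \<Longrightarrow> B \<in> carrier_mat m m \<Longrightarrow> i < m \<Longrightarrow> j < m \<Longrightarrow>
    (A * B) $$ (i, j) = (\<Sum>k<m. A $$ (i, k) * B $$ (k, j))"
  by (simp add: scalar_prod_def atLeast0LessThan)

lemma spec_mat_index_smult:
  "i < m \<Longrightarrow> j < m \<Longrightarrow> spec_mat m v (\<lambda>k. c * g k) $$ (i, j) = c * spec_mat m v g $$ (i, j)"
  by (simp add: spec_mat_index sum_distrib_left mult.assoc)

lemma spec_mat_vec_carrier [simp]: "x \<in> carrier_vec m \<Longrightarrow> spec_mat m v f *\<^sub>v x \<in> carrier_vec m"
  by (rule mult_mat_vec_carrier[OF spec_mat_carrier])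

lemma spec_mat_mult_vec:
  "onb m v \<Longrightarrow> x \<in> carrier_vec m \<Longrightarrow>
    spec_mat m v f *\<^sub>v (spec_mat m v g *\<^sub>v x) = spec_mat m v (\<lambda>k. f k * g k) *\<^sub>v x"
  by (simp add: assoc_mult_mat_vec[of _ m m _ m, symmetric] spec_mat_mult)

lemma spec_mat_zero: "(\<And>k. k < m \<Longrightarrow> f k = 0) \<Longrightarrow> x \<in> carrier_vec m \<Longrightarrow> spec_mat m v f *\<^sub>v x = 0\<^sub>v m"
  by (intro eq_vecI) (auto simp: scalar_prod_def spec_mat_index)

lemma spec_mat_vec_hermitian:
  assumes "\<And>k. k < m \<Longrightarrow> cnj (f k) = f k" "x \<in> carrier_vec m" "y \<in> carrier_vec m"
  shows "(\<Sum>i<m. vec_index (spec_mat m v f *\<^sub>v x) i * cnj (vec_index y i)) = (\<Sum>i<m. vec_index x i * cnj (vec_index (spec_mat m v f *\<^sub>v y) i))"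
proof -
  let ?M = "\<lambda>i j. spec_mat m v f $$ (i, j)"
  have ix: "vec_index (spec_mat m v f *\<^sub>v x) i = (\<Sum>j<m. ?M i j * vec_index x j)" if "i < m" "x \<in> carrier_vec m" for i x
    using that by (simp add: scalar_prod_def atLeast0LessThan)
  have "(\<Sum>i<m. vec_index (spec_mat m v f *\<^sub>v x) i * cnj (vec_index y i)) = (\<Sum>i<m. \<Sum>j<m. ?M i j * vec_index x j * cnj (vec_index y i))"
    using ix assms by (intro sum.cong) (auto simp: sum_distrib_right)
  also have "\<dots> = (\<Sum>j<m. \<Sum>i<m. ?M i j * vec_index x j * cnj (vec_index y i))" by (rule sum.swap)
  also have "\<dots> = (\<Sum>j<m. vec_index x j * cnj (vec_index (spec_mat m v f *\<^sub>v y) j))"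
  proof (intro sum.cong refl)
    fix j assume j: "j \<in> {..<m}"
    have "cnj (vec_index (spec_mat m v f *\<^sub>v y) j) = (\<Sum>i<m. cnj (?M j i) * cnj (vec_index y i))"
      using ix[of j y] j assms by simp
    also have "\<dots> = (\<Sum>i<m. ?M i j * cnj (vec_index y i))"
      using spec_mat_hermitian[of m f, OF assms(1)] j by (intro sum.cong) auto
    finally show "(\<Sum>i<m. ?M i j * vec_index x j * cnj (vec_index y i)) = vec_index x j * cnj (vec_index (spec_mat m v f *\<^sub>v y) j)"
      by (simp add: sum_distrib_left mult_ac)
  qed
  finally show ?thesis .
qed

text \<open>Off the eigenvalue 1 the matrix V - 1 has a partial inverse. Applied to (V - 1) x = 0 it
  shows that the complementary projection of \<open>x\<close> vanishes.\<close>

lemma kernel_spec: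
  assumes "onb m v" "x \<in> carrier_vec m"
  shows "x \<in> mat_kernel (spec_mat m v z - 1\<^sub>m m) \<longleftrightarrow> spec_mat m v (ker_proj z) *\<^sub>v x = x"
proof
  let ?P = "spec_mat m v (ker_proj z)"
  have mk: "x \<in> mat_kernel (spec_mat m v z - 1\<^sub>m m) \<longleftrightarrow> spec_mat m v (\<lambda>k. z k - 1) *\<^sub>v x = 0\<^sub>v m"
    using assms by (simp add: mat_kernel[of _ m m] spec_mat_minus_one)
  show "x \<in> mat_kernel (spec_mat m v z - 1\<^sub>m m)" if "?P *\<^sub>v x = x"
  proof -
    have "spec_mat m v (\<lambda>k. z k - 1) *\<^sub>v x = spec_mat m v (\<lambda>k. z k - 1) *\<^sub>v (?P *\<^sub>v x)" using that by simp
    also have "\<dots> = 0\<^sub>v m"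
      unfolding spec_mat_mult_vec[OF assms] by (rule spec_mat_zero) (use assms in \<open>auto simp: ker_proj_def\<close>)
    finally show ?thesis using mk by simp
  qed
  show "?P *\<^sub>v x = x" if "x \<in> mat_kernel (spec_mat m v z - 1\<^sub>m m)"
  proof -
    let ?C = "\<lambda>k. if z k = 1 then 0 else 1 / (z k - 1)"
    have "0\<^sub>v m = spec_mat m v ?C *\<^sub>v (spec_mat m v (\<lambda>k. z k - 1) *\<^sub>v x)"
      using mk that by (auto intro!: eq_vecI simp: scalar_prod_def)
    also have "\<dots> = spec_mat m v (\<lambda>k. 1 - ker_proj z k) *\<^sub>v x"
      unfolding spec_mat_mult_vec[OF assms]
      by (rule arg_cong[where f = "\<lambda>M. M *\<^sub>v x"]) (rule spec_mat_cong, auto simp: ker_proj_def)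
    also have "\<dots> = x - ?P *\<^sub>v x"
      using assms by (simp add: spec_mat_diff[symmetric] spec_mat_one minus_mult_distrib_mat_vec[of _ m m])
    finally have "x - ?P *\<^sub>v x = 0\<^sub>v m" by simp
    then have "vec_index x i - vec_index (?P *\<^sub>v x) i = 0" if "i < m" for i using that assms
      by (metis (no_types, lifting) carrier_vecD dim_mult_mat_vec index_minus_vec(1) index_zero_vec(1) spec_mat_dim(1))
    then show ?thesis using assms by (intro eq_vecI) auto
  qed
qed

lemma i_cay: "w \<noteq> 1 \<Longrightarrow> \<i> * cay w = (w + 1) / (w - 1)"
proof -
  assume "w \<noteq> 1"
  then have "\<i> * cay w = (\<i> * (- \<i>)) * ((w + 1) / (w - 1))"
    by (simp only: cay_def if_False times_divide_eq_right mult.assoc)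
  then show ?thesis by simp
qed

text \<open>Multiplying the boundary condition by the spectral projection of \<open>V\<close> at \<open>1\<close>, and by the inverse of
  \<open>V - 1\<close> off that eigenspace, separates the essential and the natural boundary conditions.\<close>

lemma unitary_bc:
  assumes V: "unitary_mat m V" and x: "x \<in> carrier_vec m" and y: "y \<in> carrier_vec m"
    and bc: "(V - 1\<^sub>m m) *\<^sub>v x + \<i> \<cdot>\<^sub>v ((V + 1\<^sub>m m) *\<^sub>v y) = 0\<^sub>v m"
  shows "u \<in> mat_kernel (V - 1\<^sub>m m) \<Longrightarrow> (\<Sum>i<m. vec_index y i * cnj (vec_index u i)) = 0"
    and "w \<in> carrier_vec m \<Longrightarrow> (\<And>u. u \<in> mat_kernel (V - 1\<^sub>m m) \<Longrightarrow> (\<Sum>i<m. vec_index w i * cnj (vec_index u i)) = 0) \<Longrightarrow>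
      (\<Sum>i<m. vec_index x i * cnj (vec_index w i)) = (\<Sum>i<m. vec_index (A_mat m V *\<^sub>v y) i * cnj (vec_index w i))"
proof -
  obtain v z where onb: "onb m v" and Vs: "V = spec_mat m v z" and z: "\<And>k. k < m \<Longrightarrow> cmod (z k) = 1"
    using unitary_spectral[OF V] by blast
  let ?P = "spec_mat m v (ker_proj z)"
  have bc': "spec_mat m v (\<lambda>k. z k - 1) *\<^sub>v x + \<i> \<cdot>\<^sub>v (spec_mat m v (\<lambda>k. z k + 1) *\<^sub>v y) = 0\<^sub>v m"
    using bc by (simp add: Vs spec_mat_minus_one[OF onb] spec_mat_plus_one[OF onb])
  have app: "spec_mat m v (\<lambda>k. f k * (z k - 1)) *\<^sub>v x + \<i> \<cdot>\<^sub>v (spec_mat m v (\<lambda>k. f k * (z k + 1)) *\<^sub>v y) = 0\<^sub>v m" for f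
  proof -
    have "0\<^sub>v m = spec_mat m v f *\<^sub>v (spec_mat m v (\<lambda>k. z k - 1) *\<^sub>v x + \<i> \<cdot>\<^sub>v (spec_mat m v (\<lambda>k. z k + 1) *\<^sub>v y))"
      unfolding bc' by (auto intro!: eq_vecI simp: scalar_prod_def)
    also have "\<dots> = spec_mat m v f *\<^sub>v (spec_mat m v (\<lambda>k. z k - 1) *\<^sub>v x)
       + \<i> \<cdot>\<^sub>v (spec_mat m v f *\<^sub>v (spec_mat m v (\<lambda>k. z k + 1) *\<^sub>v y))"
      using x y by (simp add: mult_add_distrib_mat_vec[of _ m m] mult_mat_vec[of _ m m] smult_carrier_vec)
    finally show ?thesis using x y by (simp add: spec_mat_mult_vec[OF onb])
  qed
  have Py: "?P *\<^sub>v y = 0\<^sub>v m"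
  proof -
    have 1: "spec_mat m v (\<lambda>k. ker_proj z k * (z k - 1)) *\<^sub>v x = 0\<^sub>v m"
      using x by (intro spec_mat_zero) (auto simp: ker_proj_def)
    have 2: "spec_mat m v (\<lambda>k. ker_proj z k * (z k + 1)) = 2 \<cdot>\<^sub>m ?P"
      unfolding spec_mat_smult by (intro spec_mat_cong) (auto simp: ker_proj_def)
    have "0\<^sub>v m + \<i> \<cdot>\<^sub>v ((2 \<cdot>\<^sub>m ?P) *\<^sub>v y) = 0\<^sub>v m" using app[of "ker_proj z"] unfolding 1 2 .
    then have "vec_index (0\<^sub>v m + \<i> \<cdot>\<^sub>v ((2 \<cdot>\<^sub>m ?P) *\<^sub>v y)) i = 0" if "i < m" for i using that by simp
    then have "vec_index (?P *\<^sub>v y) i = 0" if "i < m" for i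
      using that y by (simp add: scalar_prod_def sum_distrib_left[symmetric] mult.assoc)
    then show ?thesis by (intro eq_vecI) auto
  qed
  have Pr: "cnj (ker_proj z k) = ker_proj z k" for k by (simp add: ker_proj_def)
  show "(\<Sum>i<m. vec_index y i * cnj (vec_index u i)) = 0" if "u \<in> mat_kernel (V - 1\<^sub>m m)" for u
  proof -
    have u: "u \<in> carrier_vec m" using that Vs by (auto simp: mat_kernel_def)
    have "?P *\<^sub>v u = u" using kernel_spec[OF onb u, of z] that by (simp add: Vs)
    then have "(\<Sum>i<m. vec_index y i * cnj (vec_index u i)) = (\<Sum>i<m. vec_index (?P *\<^sub>v y) i * cnj (vec_index u i))"
      using spec_mat_vec_hermitian[of m "ker_proj z", OF Pr y u, of v] by (simp del: index_mult_mat_vec)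
    then show ?thesis by (simp add: Py)
  qed
  show "(\<Sum>i<m. vec_index x i * cnj (vec_index w i)) = (\<Sum>i<m. vec_index (A_mat m V *\<^sub>v y) i * cnj (vec_index w i))"
    if w: "w \<in> carrier_vec m" and orth: "\<And>u. u \<in> mat_kernel (V - 1\<^sub>m m) \<Longrightarrow> (\<Sum>i<m. vec_index w i * cnj (vec_index u i)) = 0" for w
  proof -
    have PP: "?P *\<^sub>v (?P *\<^sub>v q) = ?P *\<^sub>v q" if "q \<in> carrier_vec m" for q
      unfolding spec_mat_mult_vec[OF onb that]
      by (rule arg_cong[where f = "\<lambda>M. M *\<^sub>v q"]) (rule spec_mat_cong, auto simp: ker_proj_def)
    have Pw: "(\<Sum>i<m. vec_index (?P *\<^sub>v x) i * cnj (vec_index w i)) = 0"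
    proof -
      have cP: "?P *\<^sub>v x \<in> carrier_vec m" using mult_mat_vec_carrier[OF spec_mat_carrier x] .
      have "?P *\<^sub>v x \<in> mat_kernel (V - 1\<^sub>m m)"
        using kernel_spec[OF onb cP, of z] PP[OF x] Vs by simp
      then have "(\<Sum>i<m. vec_index w i * cnj (vec_index (?P *\<^sub>v x) i)) = 0" by (rule orth)
      then have "cnj (\<Sum>i<m. vec_index w i * cnj (vec_index (?P *\<^sub>v x) i)) = 0" by simp
      then show ?thesis by (simp add: mult.commute)
    qed
    let ?C = "\<lambda>k. if z k = 1 then 0 else 1 / (z k - 1)"
    have 1: "spec_mat m v (\<lambda>k. ?C k * (z k - 1)) = spec_mat m v (\<lambda>k. 1) - ?P"
      unfolding spec_mat_diff by (intro spec_mat_cong) (auto simp: ker_proj_def)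
    have 2: "spec_mat m v (\<lambda>k. ?C k * (z k + 1)) = \<i> \<cdot>\<^sub>m A_mat m V"
    proof -
      have A: "A_mat m V = spec_mat m v (\<lambda>k. cay (z k))" using A_mat_spec[OF onb, of z] z Vs by simp
      have "?C k * (z k + 1) = \<i> * cay (z k)" for k
        by (cases "z k = 1", simp add: cay_def, simp add: i_cay)
      then show ?thesis unfolding A spec_mat_smult by (intro spec_mat_cong)
    qed
    have cA: "A_mat m V \<in> carrier_mat m m" by (simp add: A_mat_def Let_def)
    have "(spec_mat m v (\<lambda>k. 1) - ?P) *\<^sub>v x + \<i> \<cdot>\<^sub>v ((\<i> \<cdot>\<^sub>m A_mat m V) *\<^sub>v y) = 0\<^sub>v m"
      using app[of ?C] unfolding 1 2 .
    then have eq: "x - ?P *\<^sub>v x + \<i> \<cdot>\<^sub>v ((\<i> \<cdot>\<^sub>m A_mat m V) *\<^sub>v y) = 0\<^sub>v m"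
      using x by (simp add: minus_mult_distrib_mat_vec[of _ m m] spec_mat_one[OF onb])
    have xi: "vec_index x i = vec_index (?P *\<^sub>v x) i + vec_index (A_mat m V *\<^sub>v y) i" if "i < m" for i
    proof -
      have "vec_index ((\<i> \<cdot>\<^sub>m A_mat m V) *\<^sub>v y) i = \<i> * vec_index (A_mat m V *\<^sub>v y) i"
        using that y cA by (simp add: scalar_prod_def sum_distrib_left mult.assoc)
      moreover have "vec_index (x - ?P *\<^sub>v x + \<i> \<cdot>\<^sub>v ((\<i> \<cdot>\<^sub>m A_mat m V) *\<^sub>v y)) i =
          vec_index x i - vec_index (?P *\<^sub>v x) i + \<i> * vec_index ((\<i> \<cdot>\<^sub>m A_mat m V) *\<^sub>v y) i"
        using that x y cA by (simp del: index_mult_mat_vec)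
      moreover have "vec_index (x - ?P *\<^sub>v x + \<i> \<cdot>\<^sub>v ((\<i> \<cdot>\<^sub>m A_mat m V) *\<^sub>v y)) i = 0"
        unfolding eq using that by simp
      moreover have "\<i> * (\<i> * c) = - c" for c by (simp add: mult.assoc[symmetric])
      ultimately have "vec_index x i - vec_index (?P *\<^sub>v x) i - vec_index (A_mat m V *\<^sub>v y) i = 0" by (simp del: index_mult_mat_vec)
      then show ?thesis by (metis diff_diff_eq eq_iff_diff_eq_0)
    qed
    have "(\<Sum>i<m. vec_index x i * cnj (vec_index w i)) =
        (\<Sum>i<m. vec_index (?P *\<^sub>v x) i * cnj (vec_index w i) + vec_index (A_mat m V *\<^sub>v y) i * cnj (vec_index w i))"
      by (intro sum.cong refl) (simp only: xi lessThan_iff distrib_right)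
    then have "(\<Sum>i<m. vec_index x i * cnj (vec_index w i)) = (\<Sum>i<m. vec_index (?P *\<^sub>v x) i * cnj (vec_index w i))
        + (\<Sum>i<m. vec_index (A_mat m V *\<^sub>v y) i * cnj (vec_index w i))"
      by (simp only: sum.distrib)
    then show ?thesis using Pw by simp
  qed
qed

lemma A_mat_hermitian:
  assumes "unitary_mat m V" "i < m" "j < m"
  shows "cnj (A_mat m V $$ (j, i)) = A_mat m V $$ (i, j)"
proof -
  obtain v z where onb: "onb m v" and Vs: "V = spec_mat m v z" and z: "\<And>k. k < m \<Longrightarrow> cmod (z k) = 1"
    using unitary_spectral[OF assms(1)] by blast
  have "A_mat m V = spec_mat m v (\<lambda>k. cay (z k))" using A_mat_spec[OF onb, of z] z Vs by simp
  then show ?thesis using assms(2,3) z by (simp add: spec_mat_hermitian cay_real)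
qed

section \<open>Differentiability of the boundary matrix A in the parameter\<close>

lemma differentiable_prod_finite:
  fixes f :: "'i \<Rightarrow> real \<Rightarrow> complex"
  assumes "finite I" "\<And>i. i \<in> I \<Longrightarrow> (f i) differentiable (at l)"
  shows "(\<lambda>t. \<Prod>i\<in>I. f i t) differentiable (at l)"
  using assms by (induction I rule: finite_induct) (auto intro!: differentiable_mult)

lemma differentiable_det:
  fixes M :: "real \<Rightarrow> complex mat"
  assumes "\<And>t. M t \<in> carrier_mat m m"
    and "\<And>i j. i < m \<Longrightarrow> j < m \<Longrightarrow> (\<lambda>t. M t $$ (i, j)) differentiable (at l)"
  shows "(\<lambda>t. det (M t)) differentiable (at l)"
  unfolding det_def'[OF assms(1)]
proof (intro differentiable_sum ballI)
  show "finite {p. p permutes {0..<m}}" by (simp add: finite_permutations)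
  fix p assume "p \<in> {p. p permutes {0..<m}}"
  then have "p i < m" if "i < m" for i using that permutes_in_image[of p "{0..<m}" i] by auto
  then show "(\<lambda>t. signof p * (\<Prod>i = 0..<m. M t $$ (i, p i))) differentiable (at l)"
    using assms(2) by (intro differentiable_mult differentiable_prod_finite) auto
qed

text \<open>The contour is chosen anew at each parameter, so the integral is not differentiated. As
  the kernel is constant, the projection \<open>P\<close> onto it is constant, U - 1 + P is
  invertible, and A equals - i (U + 1) (1 - P) times the inverse of U - 1 + P. Cramer's rule makes
  this rational in the entries of U.\<close>

lemma A_mat_differentiable:
  fixes U :: "real \<Rightarrow> complex mat"
  assumes U: "\<And>t. t \<in> {\<sigma><..<\<tau>} \<Longrightarrow> unitary_mat m (U t)"
    and ker: "\<And>t. t \<in> {\<sigma><..<\<tau>} \<Longrightarrow> mat_kernel (U t - 1\<^sub>m m) = mat_kernel (U l - 1\<^sub>m m)"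
    and diff: "\<And>i j. i < m \<Longrightarrow> j < m \<Longrightarrow> (\<lambda>t. U t $$ (i, j)) differentiable (at l)"
    and l: "l \<in> {\<sigma><..<\<tau>}" and ij: "i < m" "j < m"
  shows "((\<lambda>t. A_mat m (U t) $$ (i, j)) has_vector_derivative A_deriv m U l $$ (i, j)) (at l)"
proof -
  obtain v0 z0 where 0: "onb m v0" "U l = spec_mat m v0 z0" "\<And>k. k < m \<Longrightarrow> cmod (z0 k) = 1"
    using unitary_spectral[OF U[OF l]] by blast
  define P where "P = spec_mat m v0 (ker_proj z0)"
  have P: "P \<in> carrier_mat m m" by (simp add: P_def)
  have P_eq: "spec_mat m v (ker_proj z) = P"
    if onb: "onb m v" and Ut: "U t = spec_mat m v z" and t: "t \<in> {\<sigma><..<\<tau>}" for t v z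
  proof -
    let ?Q = "spec_mat m v (ker_proj z)"
    \<comment> \<open>Columns of the second projection lie in the common kernel, where the first
      projection acts as the identity.\<close>
    have absorb: "spec_mat m v1 (ker_proj z1) * spec_mat m v2 (ker_proj z2) = spec_mat m v2 (ker_proj z2)"
      if "onb m v1" "onb m v2" "mat_kernel (spec_mat m v1 z1 - 1\<^sub>m m) = mat_kernel (spec_mat m v2 z2 - 1\<^sub>m m)" for v1 v2 z1 z2
    proof (rule mat_col_eqI)
      let ?P1 = "spec_mat m v1 (ker_proj z1)" and ?P2 = "spec_mat m v2 (ker_proj z2)"
      fix c assume "c < dim_col ?P2"
      then have c: "c < m" by simp
      have cc: "col ?P2 c \<in> carrier_vec m" by (simp add: carrier_vecI)
      have "?P2 * ?P2 = ?P2"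
        unfolding spec_mat_mult[OF that(2)] by (rule spec_mat_cong) (auto simp: ker_proj_def)
      then have "?P2 *\<^sub>v col ?P2 c = col ?P2 c"
        using c by (metis col_mult2 spec_mat_carrier)
      then have "?P1 *\<^sub>v col ?P2 c = col ?P2 c"
        using kernel_spec[OF that(2) cc, of z2] kernel_spec[OF that(1) cc, of z1] that(3) by simp
      then show "col (?P1 * ?P2) c = col ?P2 c" using c by (metis col_mult2 spec_mat_carrier)
    qed auto
    have ke: "mat_kernel (spec_mat m v z - 1\<^sub>m m) = mat_kernel (spec_mat m v0 z0 - 1\<^sub>m m)"
      using ker[OF t] Ut 0 by simp
    have 1: "?Q * P = P" unfolding P_def by (rule absorb[OF onb 0(1) ke])
    have 2: "P * ?Q = ?Q" unfolding P_def by (rule absorb[OF 0(1) onb ke[symmetric]])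
    show ?thesis
    proof (rule eq_matI)
      fix i j assume "i < dim_row P" "j < dim_col P"
      then have ij: "i < m" "j < m" by (simp_all add: P_def)
      have h: "cnj (ker_proj z k) = ker_proj z k" "cnj (ker_proj z0 k) = ker_proj z0 k" for k
        by (simp_all add: ker_proj_def)
      \<comment> \<open>Adjoints of P Q = Q give Q P = Q, while the other absorption reads Q P = P;
        hence the two projections agree.\<close>
      have "P $$ (i, j) = (\<Sum>k<m. ?Q $$ (i, k) * P $$ (k, j))"
        using arg_cong[OF 1, of "\<lambda>M. M $$ (i, j)"] ij P by (simp add: scalar_prod_def atLeast0LessThan)
      also have "\<dots> = (\<Sum>k<m. cnj (P $$ (j, k) * ?Q $$ (k, i)))"
        using ij spec_mat_hermitian[of m "ker_proj z", OF h(1)] spec_mat_hermitian[of m "ker_proj z0", OF h(2)]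
        by (intro sum.cong) (auto simp: P_def mult.commute)
      also have "\<dots> = cnj (?Q $$ (j, i))"
        using arg_cong[OF 2, of "\<lambda>M. cnj (M $$ (j, i))"] ij P by (simp add: scalar_prod_def atLeast0LessThan)
      also have "\<dots> = ?Q $$ (i, j)" using spec_mat_hermitian[of m "ker_proj z", OF h(1)] ij by simp
      finally show "?Q $$ (i, j) = P $$ (i, j)" by simp
    qed (auto simp: P_def)
  qed
  \<comment> \<open>This matrix acts as 1 on the eigenspace of the eigenvalue 1 and as z - 1 on the
    others, so it is invertible.\<close>
  define B where "B t = mat m m (\<lambda>(i, j). U t $$ (i, j) - (if i = j then 1 else 0) + P $$ (i, j))" for t
  define G where "G t i j = - \<i> * (\<Sum>k<m. (U t $$ (i, k) + (if i = k then 1 else 0)) * ((if k = j then 1 else 0) - P $$ (k, j)))" for t i j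
  have B: "B t \<in> carrier_mat m m" for t by (simp add: B_def)
  have main: "det (B t) \<noteq> 0 \<and> (\<forall>i<m. \<forall>j<m. A_mat m (U t) $$ (i, j) = (\<Sum>k<m. G t i k * cofactor (B t) j k) / det (B t))"
    if t: "t \<in> {\<sigma><..<\<tau>}" for t
  proof -
    obtain v z where onb: "onb m v" and Ut: "U t = spec_mat m v z" and z: "\<And>k. k < m \<Longrightarrow> cmod (z k) = 1"
      using unitary_spectral[OF U[OF t]] by blast
    have Pt: "P = spec_mat m v (ker_proj z)" using P_eq[OF onb Ut t] by simp
    have Bt: "B t = spec_mat m v (\<lambda>k. z k - 1 + ker_proj z k)"
    proof -
      have "B t = U t - 1\<^sub>m m + P" using P unfolding Ut by (intro eq_matI) (auto simp: B_def Ut)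
      then show ?thesis by (simp add: Ut Pt spec_mat_minus_one[OF onb] spec_mat_add)
    qed
    let ?C = "\<lambda>k. 1 / (z k - 1 + ker_proj z k)"
    have ne: "z k - 1 + ker_proj z k \<noteq> 0" for k by (auto simp: ker_proj_def)
    have BC: "B t * spec_mat m v ?C = 1\<^sub>m m"
      unfolding Bt spec_mat_mult[OF onb] spec_mat_one[OF onb, symmetric] using ne by (intro spec_mat_cong) auto
    have d0: "det (B t) \<noteq> 0"
    proof
      assume "det (B t) = 0"
      moreover have "det (B t) * det (spec_mat m v ?C) = 1"
        using det_mult[OF B spec_mat_carrier] BC by (metis det_one)
      ultimately show False by simp
    qed
    have AB: "A_mat m (U t) * B t = spec_mat m v (\<lambda>k. - \<i> * ((z k + 1) * (1 - ker_proj z k)))"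
    proof -
      have A: "A_mat m (U t) = spec_mat m v (\<lambda>k. cay (z k))" using A_mat_spec[OF onb, of z] z Ut by simp
      show ?thesis unfolding A Bt spec_mat_mult[OF onb]
        by (intro spec_mat_cong) (auto simp: cay_def ker_proj_def)
    qed
    also have "\<dots> = mat m m (\<lambda>(i, j). G t i j)"
    proof (rule eq_matI)
      fix i j assume "i < dim_row (mat m m (\<lambda>(i, j). G t i j))" "j < dim_col (mat m m (\<lambda>(i, j). G t i j))"
      then have ij: "i < m" "j < m" by auto
      have "spec_mat m v (\<lambda>k. (z k + 1) * (1 - ker_proj z k)) = (U t + 1\<^sub>m m) * (1\<^sub>m m - P)"
        by (simp only: Ut Pt spec_mat_plus_one[OF onb] spec_mat_mult[OF onb, symmetric] spec_mat_diff[symmetric] spec_mat_one[OF onb])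
      moreover have "((U t + 1\<^sub>m m) * (1\<^sub>m m - P)) $$ (i, j) =
        (\<Sum>k<m. (U t $$ (i, k) + (if i = k then 1 else 0)) * ((if k = j then 1 else 0) - P $$ (k, j)))"
      proof -
        have cU: "U t \<in> carrier_mat m m" by (simp add: Ut)
        have "((U t + 1\<^sub>m m) * (1\<^sub>m m - P)) $$ (i, j) = (\<Sum>k<m. (U t + 1\<^sub>m m) $$ (i, k) * (1\<^sub>m m - P) $$ (k, j))"
          using cU P ij by (intro mat_mult_index) auto
        also have "\<dots> = (\<Sum>k<m. (U t $$ (i, k) + (if i = k then 1 else 0)) * ((if k = j then 1 else 0) - P $$ (k, j)))"
        proof (intro sum.cong refl)
          fix k assume "k \<in> {..<m}"
          then have "(U t + 1\<^sub>m m) $$ (i, k) = U t $$ (i, k) + (if i = k then 1 else 0)"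
            "(1\<^sub>m m - P) $$ (k, j) = (if k = j then 1 else 0) - P $$ (k, j)"
            using ij P cU by simp_all
          then show "(U t + 1\<^sub>m m) $$ (i, k) * (1\<^sub>m m - P) $$ (k, j) =
            (U t $$ (i, k) + (if i = k then 1 else 0)) * ((if k = j then 1 else 0) - P $$ (k, j))" by simp
        qed
        finally show ?thesis .
      qed
      ultimately show "spec_mat m v (\<lambda>k. - \<i> * ((z k + 1) * (1 - ker_proj z k))) $$ (i, j) = mat m m (\<lambda>(i, j). G t i j) $$ (i, j)"
        using ij spec_mat_index_smult[OF ij, of v "- \<i>"] by (simp only: G_def index_mat split)
    qed auto
    finally have AB: "A_mat m (U t) * B t = mat m m (\<lambda>(i, j). G t i j)" .
    have cA: "A_mat m (U t) \<in> carrier_mat m m" by (simp add: A_mat_def Let_def)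
    have adj: "adj_mat (B t) \<in> carrier_mat m m" "B t * adj_mat (B t) = det (B t) \<cdot>\<^sub>m 1\<^sub>m m" using adj_mat[OF B] by auto
    have "mat m m (\<lambda>(i, j). G t i j) * adj_mat (B t) = A_mat m (U t) * (B t * adj_mat (B t))"
      unfolding AB[symmetric] using cA B adj by (intro assoc_mult_mat) auto
    also have "\<dots> = det (B t) \<cdot>\<^sub>m A_mat m (U t)"
      unfolding adj(2) using mult_smult_distrib[OF cA one_carrier_mat, of "det (B t)"] cA by simp
    finally have eq: "mat m m (\<lambda>(i, j). G t i j) * adj_mat (B t) = det (B t) \<cdot>\<^sub>m A_mat m (U t)" .
    have "A_mat m (U t) $$ (i, j) = (\<Sum>k<m. G t i k * cofactor (B t) j k) / det (B t)" if "i < m" "j < m" for i j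
    proof -
      have "det (B t) * A_mat m (U t) $$ (i, j) = (mat m m (\<lambda>(i, j). G t i j) * adj_mat (B t)) $$ (i, j)"
        unfolding eq using that cA by simp
      also have "\<dots> = (\<Sum>k<m. G t i k * cofactor (B t) j k)"
        using that adj(1) B[of t] by (simp add: scalar_prod_def atLeast0LessThan adj_mat_def)
      finally show ?thesis using d0 by (simp add: field_simps)
    qed
    then show ?thesis using d0 by blast
  qed
  have dB: "(\<lambda>t. B t $$ (i, j)) differentiable (at l)" if "i < m" "j < m" for i j
    using that diff[OF that] by (auto simp: B_def intro!: differentiable_add differentiable_diff)
  have dG: "(\<lambda>t. G t i j) differentiable (at l)" if "i < m" "j < m" for i j
    unfolding G_def using that diff
    by (intro differentiable_mult differentiable_sum ballI differentiable_add) auto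
  have dC: "(\<lambda>t. cofactor (B t) i j) differentiable (at l)" if ij: "i < m" "j < m" for i j
    unfolding cofactor_def
  proof (intro differentiable_mult differentiable_const)
    show "(\<lambda>t. det (mat_delete (B t) i j)) differentiable (at l)"
    proof (rule differentiable_det[of _ "m - 1"])
      show "mat_delete (B t) i j \<in> carrier_mat (m - 1) (m - 1)" for t using B[of t] by (simp add: mat_delete_def)
      fix r c assume "r < m - 1" "c < m - 1"
      then show "(\<lambda>t. mat_delete (B t) i j $$ (r, c)) differentiable (at l)"
        using B by (auto simp: mat_delete_def carrier_matD[OF B] intro!: dB)
    qed
  qed
  have dd: "(\<lambda>t. det (B t)) differentiable (at l)" using B dB by (rule differentiable_det)
  have "(\<lambda>t. (\<Sum>k<m. G t i k * cofactor (B t) j k) / det (B t)) differentiable (at l)"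
    using main[OF l] dd dG dC ij
    by (intro differentiable_divide differentiable_sum ballI differentiable_mult) auto
  then obtain D where D: "((\<lambda>t. (\<Sum>k<m. G t i k * cofactor (B t) j k) / det (B t)) has_derivative D) (at l)"
    by (auto simp: differentiable_def)
  have "((\<lambda>t. A_mat m (U t) $$ (i, j)) has_derivative D) (at l)"
    using main ij by (intro has_derivative_transform_within_open[OF D open_greaterThanLessThan l]) auto
  then have "(\<lambda>t. A_mat m (U t) $$ (i, j)) differentiable (at l)" by (auto simp: differentiable_def)
  then show ?thesis using ij by (simp add: A_deriv_def vector_derivative_works)
qed

section \<open>Index of Hermitian forms\<close>

definition csubspace :: "(real \<Rightarrow> complex) set \<Rightarrow> bool" where
  "csubspace D \<longleftrightarrow> (\<lambda>x. 0) \<in> D \<and> (\<forall>f\<in>D. \<forall>g\<in>D. (\<lambda>x. f x + g x) \<in> D) \<and> (\<forall>c. \<forall>f\<in>D. (\<lambda>x. c * f x) \<in> D)"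

definition hform :: "(real \<Rightarrow> complex) set \<Rightarrow> ((real \<Rightarrow> complex) \<Rightarrow> (real \<Rightarrow> complex) \<Rightarrow> complex) \<Rightarrow> bool" where
  "hform D B \<longleftrightarrow> (\<forall>f\<in>D. \<forall>g\<in>D. \<forall>h\<in>D. B (\<lambda>x. f x + g x) h = B f h + B g h) \<and>
     (\<forall>c. \<forall>f\<in>D. \<forall>h\<in>D. B (\<lambda>x. c * f x) h = c * B f h) \<and> (\<forall>f\<in>D. \<forall>g\<in>D. B g f = cnj (B f g))"

text \<open>A k-dimensional negative subspace in coordinates. For a Hermitian form, strict
  negativity for all nonzero coefficients contains linear independence, because the zero function
  has form value 0.\<close>

definition neg_family :: "(real \<Rightarrow> complex) set \<Rightarrow> ((real \<Rightarrow> complex) \<Rightarrow> real) \<Rightarrow> nat \<Rightarrow> (nat \<Rightarrow> real \<Rightarrow> complex) \<Rightarrow> bool" where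
  "neg_family D q k v \<longleftrightarrow> (\<forall>i<k. v i \<in> D) \<and> (\<forall>c. (\<exists>i<k. c i \<noteq> 0) \<longrightarrow> q (\<lambda>x. \<Sum>i<k. c i * v i x) < 0)"

text \<open>A relation rather than a number, since the index might be infinite. Negative families
  can be shortened, so excluding length k + 1 excludes all greater lengths.\<close>

definition has_index :: "(real \<Rightarrow> complex) set \<Rightarrow> ((real \<Rightarrow> complex) \<Rightarrow> real) \<Rightarrow> nat \<Rightarrow> bool" where
  "has_index D q k \<longleftrightarrow> (\<exists>v. neg_family D q k v) \<and> (\<forall>v. \<not> neg_family D q (Suc k) v)"

lemma neg_family_mono:
  assumes "neg_family D q k' v" "k \<le> k'"
  shows "neg_family D q k v"
  unfolding neg_family_def
proof (intro conjI allI impI)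
  show "v i \<in> D" if "i < k" for i using assms that by (auto simp: neg_family_def)
  fix c :: "nat \<Rightarrow> complex" assume c: "\<exists>i<k. c i \<noteq> 0"
  let ?c = "\<lambda>i. if i < k then c i else 0"
  have "q (\<lambda>x. \<Sum>i<k'. ?c i * v i x) < 0"
  proof -
    obtain i where "i < k" "c i \<noteq> 0" using c by blast
    then have "\<exists>i<k'. ?c i \<noteq> 0" using assms(2) by (intro exI[of _ i]) auto
    moreover have "\<forall>c. (\<exists>i<k'. c i \<noteq> 0) \<longrightarrow> q (\<lambda>x. \<Sum>i<k'. c i * v i x) < 0"
      using assms(1) by (simp add: neg_family_def)
    from mp[OF spec[OF this, of ?c]] calculation show ?thesis .
  qed
  moreover have "(\<Sum>i<k'. ?c i * v i x) = (\<Sum>i<k. c i * v i x)" for x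
    using assms(2) by (intro sum.mono_neutral_cong_right) auto
  ultimately show "q (\<lambda>x. \<Sum>i<k. c i * v i x) < 0" by simp
qed

lemma has_index_unique: "has_index D q k \<Longrightarrow> has_index D q k' \<Longrightarrow> k = k'"
proof (rule ccontr)
  assume h: "has_index D q k" "has_index D q k'" "k \<noteq> k'"
  then consider "Suc k \<le> k'" | "Suc k' \<le> k" by linarith
  then show False
  proof cases
    case 1
    then show False using h neg_family_mono[OF _ 1] unfolding has_index_def by blast
  next
    case 2
    then show False using h neg_family_mono[OF _ 2] unfolding has_index_def by blast
  qed
qed

definition index_of :: "(real \<Rightarrow> complex) set \<Rightarrow> ((real \<Rightarrow> complex) \<Rightarrow> real) \<Rightarrow> nat" where
  "index_of D q = (THE k. has_index D q k)"

lemma index_of_eq: "has_index D q k \<Longrightarrow> index_of D q = k"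
  unfolding index_of_def by (rule the_equality) (auto intro: has_index_unique)

section \<open>Algebra of Hermitian forms\<close>

lemma csubspaceD:
  assumes "csubspace D"
  shows "(\<lambda>x. 0) \<in> D" "f \<in> D \<Longrightarrow> g \<in> D \<Longrightarrow> (\<lambda>x. f x + g x) \<in> D" "f \<in> D \<Longrightarrow> (\<lambda>x. c * f x) \<in> D"
  using assms by (auto simp: csubspace_def)

lemma csubspace_lincomb:
  assumes "csubspace D" "finite J" "\<And>i. i \<in> J \<Longrightarrow> v i \<in> D"
  shows "(\<lambda>x. \<Sum>i\<in>J. c i * v i x) \<in> D"
  using assms(2,3)
proof (induction J rule: finite_induct)
  case empty
  then show ?case using csubspaceD(1)[OF assms(1)] by simp
next
  case (insert j J)
  then have "(\<lambda>x. c j * v j x + (\<Sum>i\<in>J. c i * v i x)) \<in> D"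
    by (intro csubspaceD(2)[OF assms(1)] csubspaceD(3)[OF assms(1)]) auto
  then show ?case using insert by simp
qed

lemma hformD:
  assumes "hform D B" "f \<in> D" "g \<in> D" "h \<in> D"
  shows "B (\<lambda>x. f x + g x) h = B f h + B g h" "B (\<lambda>x. c * f x) h = c * B f h" "B g f = cnj (B f g)"
  using assms unfolding hform_def by blast+

lemma hform_scale_right:
  assumes "csubspace D" "hform D B" "f \<in> D" "h \<in> D"
  shows "B h (\<lambda>x. c * f x) = cnj c * B h f"
proof -
  have "(\<lambda>x. c * f x) \<in> D" using csubspaceD(3)[OF assms(1,3)] .
  from hformD(3)[OF assms(2) this assms(4,4)] have "B h (\<lambda>x. c * f x) = cnj (B (\<lambda>x. c * f x) h)" .
  also have "\<dots> = cnj (c * B f h)" using hformD(2)[OF assms(2,3,4,4)] by simp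
  finally show ?thesis using hformD(3)[OF assms(2,3,4,4)] by simp
qed

lemma hform_add_right:
  assumes "csubspace D" "hform D B" "f \<in> D" "g \<in> D" "h \<in> D"
  shows "B h (\<lambda>x. f x + g x) = B h f + B h g"
proof -
  have "(\<lambda>x. f x + g x) \<in> D" using csubspaceD(2)[OF assms(1,3,4)] .
  from hformD(3)[OF assms(2) this assms(5,5)] have "B h (\<lambda>x. f x + g x) = cnj (B (\<lambda>x. f x + g x) h)" .
  also have "\<dots> = cnj (B f h + B g h)" using hformD(1)[OF assms(2,3,4,5)] by simp
  finally show ?thesis using hformD(3)[OF assms(2,3,5,5)] hformD(3)[OF assms(2,4,5,5)] by simp
qed

lemma hform_zero:
  assumes "csubspace D" "hform D B" "h \<in> D"
  shows "B (\<lambda>x. 0) h = 0" "B h (\<lambda>x. 0) = 0"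
  using hformD(2)[OF assms(2) csubspaceD(1)[OF assms(1)] assms(3) assms(3), of 0]
    hform_scale_right[OF assms(1,2) csubspaceD(1)[OF assms(1)] assms(3), of 0] by auto

lemma hform_sum_left:
  assumes "csubspace D" "hform D B" "finite J" "\<And>i. i \<in> J \<Longrightarrow> v i \<in> D" "h \<in> D"
  shows "B (\<lambda>x. \<Sum>i\<in>J. c i * v i x) h = (\<Sum>i\<in>J. c i * B (v i) h)"
  using assms(3,4)
proof (induction J rule: finite_induct)
  case empty
  then show ?case using hform_zero[OF assms(1,2,5)] by simp
next
  case (insert j J)
  have "B (\<lambda>x. c j * v j x + (\<Sum>i\<in>J. c i * v i x)) h = B (\<lambda>x. c j * v j x) h + B (\<lambda>x. \<Sum>i\<in>J. c i * v i x) h"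
    using insert assms(5)
    by (intro hformD(1)[OF assms(2)] csubspaceD(3)[OF assms(1)] csubspace_lincomb[OF assms(1)]) auto
  then show ?case using insert hformD(2)[OF assms(2) _ assms(5) assms(5)] by simp
qed

lemma hform_sum_right:
  assumes "csubspace D" "hform D B" "finite J" "\<And>i. i \<in> J \<Longrightarrow> v i \<in> D" "h \<in> D"
  shows "B h (\<lambda>x. \<Sum>i\<in>J. c i * v i x) = (\<Sum>i\<in>J. cnj (c i) * B h (v i))"
proof -
  have "B h (\<lambda>x. \<Sum>i\<in>J. c i * v i x) = cnj (B (\<lambda>x. \<Sum>i\<in>J. c i * v i x) h)"
    using assms by (intro hformD(3)[OF assms(2)] csubspace_lincomb) auto
  also have "\<dots> = (\<Sum>i\<in>J. cnj (c i) * cnj (B (v i) h))" by (simp add: hform_sum_left[OF assms])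
  also have "\<dots> = (\<Sum>i\<in>J. cnj (c i) * B h (v i))"
    using hformD(3)[OF assms(2) _ assms(5) assms(5)] assms(4) by (intro sum.cong) auto
  finally show ?thesis .
qed

lemma hform_quad_add:
  assumes "csubspace D" "hform D B" "f \<in> D" "g \<in> D"
  shows "Re (B (\<lambda>x. f x + g x) (\<lambda>x. f x + g x)) = Re (B f f) + Re (B g g) + 2 * Re (B f g)"
proof -
  have fg: "(\<lambda>x. f x + g x) \<in> D" using assms csubspaceD by blast
  have "B g f = cnj (B f g)" using hformD(3)[OF assms(2,3,4,4)] .
  then show ?thesis
    using hformD(1)[OF assms(2,3,4) fg] hform_add_right[OF assms(1,2,3,4)] assms(3,4) by simp
qed

lemma hform_quad_scale:
  assumes "csubspace D" "hform D B" "f \<in> D"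
  shows "Re (B (\<lambda>x. c * f x) (\<lambda>x. c * f x)) = (cmod c)\<^sup>2 * Re (B f f)"
proof -
  have "(\<lambda>x. c * f x) \<in> D" using assms csubspaceD by blast
  then have "B (\<lambda>x. c * f x) (\<lambda>x. c * f x) = (c * cnj c) * B f f"
    using hformD(2)[OF assms(2,3,3)] hform_scale_right[OF assms assms(3)] by (simp add: mult_ac)
  then show ?thesis by (simp add: complex_norm_square[symmetric] del: of_real_power)
qed

text \<open>Polarisation together with the parallelogram identity for \<open>M\<close> bounds the
  cross term of \<open>R\<close>. Replacing f by sqrt s f and g by g / sqrt s leaves the cross term
  unchanged and produces the free weight \<open>s\<close>.\<close>

lemma hform_cross_bound:
  assumes D: "csubspace D" and R: "hform D R" and M: "hform D M"
    and b: "\<And>f. f \<in> D \<Longrightarrow> \<bar>Re (R f f)\<bar> \<le> C * Re (M f f)" and fg: "f \<in> D" "g \<in> D" and s: "s > 0"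
  shows "\<bar>Re (R (\<lambda>x. f x + g x) (\<lambda>x. f x + g x)) - Re (R f f) - Re (R g g)\<bar> \<le> C * (s * Re (M f f) + Re (M g g) / s)"
proof -
  have base: "\<bar>2 * Re (R f g)\<bar> \<le> C * (Re (M f f) + Re (M g g))" if fg: "f \<in> D" "g \<in> D" for f g
  proof -
    let ?g = "\<lambda>x. (-1) * g x"
    have g: "?g \<in> D" using csubspaceD(3)[OF D fg(2)] .
    have s1: "(\<lambda>x. f x + g x) \<in> D" "(\<lambda>x. f x + ?g x) \<in> D" using csubspaceD(2)[OF D fg] csubspaceD(2)[OF D fg(1) g] by auto
    have sc: "B f ?g = - B f g" "Re (B ?g ?g) = Re (B g g)" if "hform D B" for B
      using hform_scale_right[OF D that fg(2,1), of "-1"] hform_quad_scale[OF D that fg(2), of "-1"] by simp_all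
    have "4 * Re (R f g) = Re (R (\<lambda>x. f x + g x) (\<lambda>x. f x + g x)) - Re (R (\<lambda>x. f x + ?g x) (\<lambda>x. f x + ?g x))"
      unfolding hform_quad_add[OF D R fg] hform_quad_add[OF D R fg(1) g] sc[OF R] by simp
    then have "\<bar>4 * Re (R f g)\<bar> \<le> C * Re (M (\<lambda>x. f x + g x) (\<lambda>x. f x + g x)) + C * Re (M (\<lambda>x. f x + ?g x) (\<lambda>x. f x + ?g x))"
      using b[OF s1(1)] b[OF s1(2)] by linarith
    also have "\<dots> = 2 * (C * (Re (M f f) + Re (M g g)))"
      unfolding hform_quad_add[OF D M fg] hform_quad_add[OF D M fg(1) g] sc[OF M] by (simp add: algebra_simps)
    finally show ?thesis by simp
  qed
  define u where "u = complex_of_real (sqrt s)"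
  have u: "u * cnj (1 / u) = 1" "(cmod u)\<^sup>2 = s" "(cmod (1 / u))\<^sup>2 = 1 / s"
    using s by (simp_all add: u_def norm_divide power_divide)
  let ?f = "\<lambda>x. u * f x" and ?g = "\<lambda>x. (1 / u) * g x"
  have fD: "?f \<in> D" and gD: "?g \<in> D" using csubspaceD(3)[OF D] fg by blast+
  have "R ?f ?g = u * R f ?g" using hformD(2)[OF R fg(1) gD gD] .
  also have "\<dots> = u * cnj (1 / u) * R f g" using hform_scale_right[OF D R fg(2,1), of "1 / u"] by (simp only: mult.assoc)
  finally have "R ?f ?g = R f g" unfolding u by simp
  then have "\<bar>2 * Re (R f g)\<bar> \<le> C * (s * Re (M f f) + Re (M g g) / s)"
    using base[OF fD gD] unfolding hform_quad_scale[OF D M fg(1)] hform_quad_scale[OF D M fg(2)] u by simp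
  then show ?thesis using hform_quad_add[OF D R fg] by simp
qed

text \<open>Two scales meet. On the part \<open>k\<close> the perturbation gains only \<eta> |h|; on
  the part \<open>p\<close> the unperturbed value already gives a fixed \<epsilon>. The cross term,
  of order |h|, is split with a weight that costs \<open>k\<close> a quarter of \<eta>, and for
  small \<open>h\<close> the rest is paid by \<epsilon>. Abstract \<open>r\<close>, \<open>X\<close>
  and \<open>Q\<close> allow the use both for the form and for its negative.\<close>

lemma perturb_pos:
  fixes N r :: "(real \<Rightarrow> complex) \<Rightarrow> real"
  assumes D: "csubspace D" and pos: "\<epsilon> > 0" "\<eta> > 0" "C \<ge> 0"
    and N: "\<And>f. f \<in> D \<Longrightarrow> N f \<ge> 0" "\<And>f g. f \<in> D \<Longrightarrow> g \<in> D \<Longrightarrow> N (\<lambda>x. f x + g x) \<le> 2 * N f + 2 * N g"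
    and r: "\<And>f. f \<in> D \<Longrightarrow> \<bar>r f\<bar> \<le> C * N f"
    and cross: "\<And>f g s. f \<in> D \<Longrightarrow> g \<in> D \<Longrightarrow> s > 0 \<Longrightarrow> \<bar>r (\<lambda>x. f x + g x) - r f - r g\<bar> \<le> C * (s * N f + N g / s)"
  shows "\<exists>\<delta>>0. \<forall>h k p X Q. \<bar>h\<bar> < \<delta> \<longrightarrow> k \<in> D \<longrightarrow> p \<in> D \<longrightarrow> Q \<ge> \<epsilon> * N p \<longrightarrow> h * r k \<ge> \<eta> * \<bar>h\<bar> * N k \<longrightarrow>
     \<bar>X - Q - h * r (\<lambda>x. k x + p x)\<bar> \<le> \<eta> / 8 * \<bar>h\<bar> * N (\<lambda>x. k x + p x) \<longrightarrow> X \<ge> \<eta> / 2 * \<bar>h\<bar> * N k + \<epsilon> / 2 * N p"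
proof -
  \<comment> \<open>With this weight the cross term takes at most \<eta>/4 |h| N k. The remainder
    takes another quarter, which leaves the claimed half.\<close>
  define s where "s = \<eta> / (4 * (C + 1))"
  have s: "s > 0" "C * s \<le> \<eta> / 4" using pos by (auto simp: s_def field_simps)
  \<comment> \<open>Collects all multiples of |h| N p: those of the cross term, of the perturbation
    on \<open>p\<close> itself and of the remainder.\<close>
  define L where "L = C / s + C + \<eta> / 4"
  have L: "L > 0" using pos s by (simp add: L_def add_nonneg_pos)
  show ?thesis
  proof (intro exI[of _ "\<epsilon> / (2 * L)"] conjI allI impI)
    show "\<epsilon> / (2 * L) > 0" using pos L by simp
    fix h :: real and k p :: "real \<Rightarrow> complex" and X Q :: real
    assume h: "\<bar>h\<bar> < \<epsilon> / (2 * L)" and kp: "k \<in> D" "p \<in> D" and Q: "\<epsilon> * N p \<le> Q"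
      and hk: "\<eta> * \<bar>h\<bar> * N k \<le> h * r k"
      and X: "\<bar>X - Q - h * r (\<lambda>x. k x + p x)\<bar> \<le> \<eta> / 8 * \<bar>h\<bar> * N (\<lambda>x. k x + p x)"
    have n: "N k \<ge> 0" "N p \<ge> 0" using N kp by auto
    have 1: "\<eta> / 8 * \<bar>h\<bar> * N (\<lambda>x. k x + p x) \<le> \<eta> / 8 * \<bar>h\<bar> * (2 * N k + 2 * N p)"
      using N(2)[OF kp] pos by (intro mult_left_mono) auto
    have 2: "h * r (\<lambda>x. k x + p x) \<ge> h * r k - \<bar>h\<bar> * (C * (s * N k + N p / s)) - \<bar>h\<bar> * (C * N p)"
    proof -
      have "h * r (\<lambda>x. k x + p x) = h * r k + h * (r (\<lambda>x. k x + p x) - r k - r p) + h * r p" by (simp add: algebra_simps)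
      moreover have "\<bar>h * (r (\<lambda>x. k x + p x) - r k - r p)\<bar> \<le> \<bar>h\<bar> * (C * (s * N k + N p / s))"
        unfolding abs_mult using cross[OF kp s(1)] by (intro mult_left_mono) auto
      moreover have "\<bar>h * r p\<bar> \<le> \<bar>h\<bar> * (C * N p)"
        unfolding abs_mult using r[OF kp(2)] by (intro mult_left_mono) auto
      ultimately show ?thesis by linarith
    qed
    have "\<bar>h\<bar> * (C * (s * N k + N p / s)) = \<bar>h\<bar> * (C * s * N k) + \<bar>h\<bar> * (C / s * N p)" by (simp add: algebra_simps)
    moreover have "\<bar>h\<bar> * (C * s * N k) \<le> \<bar>h\<bar> * (\<eta> / 4 * N k)" using s(2) n by (intro mult_left_mono mult_right_mono) auto
    ultimately have 3: "\<bar>h\<bar> * (C * (s * N k + N p / s)) \<le> \<bar>h\<bar> * (\<eta> / 4 * N k) + \<bar>h\<bar> * (C / s * N p)" by linarith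
    have 4: "\<bar>h\<bar> * L * N p \<le> \<epsilon> / 2 * N p"
      using h L n by (intro mult_right_mono) (auto simp: field_simps)
    have e1: "\<eta> / 8 * \<bar>h\<bar> * (2 * N k + 2 * N p) = \<eta> / 4 * \<bar>h\<bar> * N k + \<bar>h\<bar> * (\<eta> / 4) * N p" by (simp add: algebra_simps)
    have e2: "\<bar>h\<bar> * L * N p = \<bar>h\<bar> * (C / s * N p) + \<bar>h\<bar> * (C * N p) + \<bar>h\<bar> * (\<eta> / 4) * N p" by (simp add: L_def algebra_simps)
    have e3: "\<bar>h\<bar> * (\<eta> / 4 * N k) = \<eta> / 4 * \<bar>h\<bar> * N k" by simp
    have e4: "\<eta> * \<bar>h\<bar> * N k = \<eta> / 2 * \<bar>h\<bar> * N k + \<eta> / 4 * \<bar>h\<bar> * N k + \<eta> / 4 * \<bar>h\<bar> * N k" by simp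
    show "\<eta> / 2 * \<bar>h\<bar> * N k + \<epsilon> / 2 * N p \<le> X"
    proof -
      have X': "Q + h * r (\<lambda>x. k x + p x) - \<eta> / 8 * \<bar>h\<bar> * N (\<lambda>x. k x + p x) \<le> X"
      proof -
        have gen: "\<bar>X - Q - R\<bar> \<le> E \<Longrightarrow> Q + R - E \<le> X" for X Q R E :: real by linarith
        show ?thesis by (rule gen[OF X])
      qed
      have gen: "Q' + hr - E \<le> X' \<Longrightarrow> E \<le> A + W \<Longrightarrow> hr \<ge> hrk - T - U \<Longrightarrow> T \<le> A + V \<Longrightarrow>
          V + U + W \<le> P / 2 \<Longrightarrow> P \<le> Q' \<Longrightarrow> 4 * A \<le> hrk \<Longrightarrow> 2 * A + P / 2 \<le> X'"
        for Q' hr E X' A W hrk T U V P :: real by linarith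
      have "2 * (\<eta> / 4 * \<bar>h\<bar> * N k) + \<epsilon> * N p / 2 \<le> X"
      proof (rule gen[OF X' _ 2 _ _ Q])
        show "\<eta> / 8 * \<bar>h\<bar> * N (\<lambda>x. k x + p x) \<le> \<eta> / 4 * \<bar>h\<bar> * N k + \<bar>h\<bar> * (\<eta> / 4) * N p"
          using 1 unfolding e1 .
        show "\<bar>h\<bar> * (C * (s * N k + N p / s)) \<le> \<eta> / 4 * \<bar>h\<bar> * N k + \<bar>h\<bar> * (C / s * N p)"
          using 3 unfolding e3 .
        show "\<bar>h\<bar> * (C / s * N p) + \<bar>h\<bar> * (C * N p) + \<bar>h\<bar> * (\<eta> / 4) * N p \<le> \<epsilon> * N p / 2"
          using 4 unfolding e2 by simp
        show "4 * (\<eta> / 4 * \<bar>h\<bar> * N k) \<le> h * r k" using hk by simp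
      qed
      then show ?thesis by simp
    qed
  qed
qed

text \<open>Diagonalisation turns definiteness into finitely many negative eigenvalues, and the one
  closest to 0 gives the uniform bound.\<close>

lemma negdef_matrix_bound:
  fixes A :: "nat \<Rightarrow> nat \<Rightarrow> complex"
  assumes herm: "\<And>i j. i < m \<Longrightarrow> j < m \<Longrightarrow> A j i = cnj (A i j)"
    and neg: "\<And>c. (\<exists>i<m. c i \<noteq> 0) \<Longrightarrow> Re (\<Sum>i<m. \<Sum>j<m. cnj (c i) * A i j * c j) < 0"
  shows "\<exists>\<eta>>0. \<forall>c. Re (\<Sum>i<m. \<Sum>j<m. cnj (c i) * A i j * c j) \<le> - \<eta> * (\<Sum>i<m. (cmod (c i))\<^sup>2)"
proof -
  have nrm: "(\<Sum>k<m. A i k * cnj (A j k)) = (\<Sum>k<m. cnj (A k i) * A k j)" if "i < m" "j < m" for i j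
  proof (intro sum.cong refl)
    fix k assume "k \<in> {..<m}"
    then have k: "k < m" by simp
    show "A i k * cnj (A j k) = cnj (A k i) * A k j"
      unfolding herm[OF that(1) k] herm[OF that(2) k] by simp
  qed
  have "\<exists>v z. (\<forall>k<m. \<forall>l<m. (\<Sum>i<m. v k i * cnj (v l i)) = (if k = l then 1 else 0))
    \<and> (\<forall>i<m. \<forall>j<m. (\<Sum>k<m. v k i * cnj (v k j)) = (if i = j then 1 else 0))
    \<and> (\<forall>i<m. \<forall>j<m. A i j = (\<Sum>k<m. z k * v k i * cnj (v k j)))"
    by (rule normal_spectral) (rule nrm)
  then obtain v z where vz: "(\<forall>k<m. \<forall>l<m. (\<Sum>i<m. v k i * cnj (v l i)) = (if k = l then 1 else 0))
    \<and> (\<forall>i<m. \<forall>j<m. (\<Sum>k<m. v k i * cnj (v k j)) = (if i = j then 1 else 0))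
    \<and> (\<forall>i<m. \<forall>j<m. A i j = (\<Sum>k<m. z k * v k i * cnj (v k j)))"
    by (elim exE) (rule that)
  have o: "(\<Sum>i<m. v k i * cnj (v l i)) = (if k = l then 1 else 0)" if "k < m" "l < m" for k l
    using conjunct1[OF vz, rule_format, OF that] .
  have c: "(\<Sum>k<m. v k i * cnj (v k j)) = (if i = j then 1 else 0)" if "i < m" "j < m" for i j
    using conjunct1[OF conjunct2[OF vz], rule_format, OF that] .
  have A: "A i j = (\<Sum>k<m. z k * v k i * cnj (v k j))" if "i < m" "j < m" for i j
    using conjunct2[OF conjunct2[OF vz], rule_format, OF that] .
  define u where "u x k = (\<Sum>j<m. cnj (v k j) * x j)" for x :: "nat \<Rightarrow> complex" and k
  have quad: "(\<Sum>i<m. \<Sum>j<m. cnj (x i) * (\<Sum>k<m. w k * v k i * cnj (v k j)) * x j) = (\<Sum>k<m. w k * (cmod (u x k))\<^sup>2)" for x w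
  proof -
    have "(\<Sum>i<m. \<Sum>j<m. cnj (x i) * (\<Sum>k<m. w k * v k i * cnj (v k j)) * x j)
       = (\<Sum>i<m. \<Sum>j<m. \<Sum>k<m. w k * (cnj (v k j) * x j * (v k i * cnj (x i))))"
      by (simp add: sum_distrib_left sum_distrib_right mult_ac)
    also have "\<dots> = (\<Sum>i<m. \<Sum>k<m. \<Sum>j<m. w k * (cnj (v k j) * x j * (v k i * cnj (x i))))"
      by (intro sum.cong refl sum.swap)
    also have "\<dots> = (\<Sum>k<m. \<Sum>i<m. \<Sum>j<m. w k * (cnj (v k j) * x j * (v k i * cnj (x i))))" by (rule sum.swap)
    also have "\<dots> = (\<Sum>k<m. w k * (u x k * cnj (u x k)))"
    proof (intro sum.cong refl)
      fix k
      have "u x k * cnj (u x k) = (\<Sum>j<m. \<Sum>i<m. (cnj (v k j) * x j) * (v k i * cnj (x i)))"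
        unfolding u_def by (simp add: sum_product)
      also have "\<dots> = (\<Sum>i<m. \<Sum>j<m. (cnj (v k j) * x j) * (v k i * cnj (x i)))" by (rule sum.swap)
      finally show "(\<Sum>i<m. \<Sum>j<m. w k * (cnj (v k j) * x j * (v k i * cnj (x i)))) = w k * (u x k * cnj (u x k))"
        by (simp add: sum_distrib_left)
    qed
    finally show ?thesis by (simp add: complex_norm_square[symmetric] del: of_real_power)
  qed
  have QA: "(\<Sum>i<m. \<Sum>j<m. cnj (x i) * A i j * x j) = (\<Sum>k<m. z k * (cmod (u x k))\<^sup>2)" for x
    unfolding quad[symmetric] using A by (intro sum.cong refl) auto
  have Q1: "(\<Sum>k<m. (cmod (u x k))\<^sup>2) = (\<Sum>i<m. (cmod (x i))\<^sup>2)" for x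
  proof -
    have "complex_of_real (\<Sum>k<m. (cmod (u x k))\<^sup>2) = (\<Sum>i<m. \<Sum>j<m. cnj (x i) * (\<Sum>k<m. 1 * v k i * cnj (v k j)) * x j)"
      unfolding quad by simp
    also have "\<dots> = (\<Sum>i<m. \<Sum>j<m. if i = j then cnj (x i) * x i else 0)"
      using c by (intro sum.cong refl) auto
    also have "\<dots> = (\<Sum>i<m. cnj (x i) * x i)" by simp
    also have "\<dots> = complex_of_real (\<Sum>i<m. (cmod (x i))\<^sup>2)"
      unfolding of_real_sum complex_norm_square by (simp add: mult.commute)
    finally show ?thesis using of_real_eq_iff by blast
  qed
  \<comment> \<open>The k-th eigenvector is inserted into the form; in eigencoordinates it is the
    k-th unit vector.\<close>
  have zneg: "Re (z k) < 0" if k: "k < m" for k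
  proof -
    have u: "u (v k) l = (if l = k then 1 else 0)" if "l < m" for l
      using o[OF k that] by (simp add: u_def mult.commute)
    have "\<exists>i<m. v k i \<noteq> 0"
    proof (rule ccontr)
      assume "\<not> (\<exists>i<m. v k i \<noteq> 0)"
      then have "(\<Sum>i<m. v k i * cnj (v k i)) = 0" by simp
      then show False using o[OF k k] by simp
    qed
    from neg[OF this] have "Re (\<Sum>l<m. z l * (cmod (u (v k) l))\<^sup>2) < 0" unfolding QA .
    also have "(\<Sum>l<m. z l * (cmod (u (v k) l))\<^sup>2) = (\<Sum>l<m. if l = k then z l else 0)"
      by (intro sum.cong) (auto simp: u)
    finally show ?thesis using k by simp
  qed
  \<comment> \<open>Inserting 1 keeps the minimum defined for m = 0.\<close>
  define \<eta> where "\<eta> = Min (insert 1 ((\<lambda>k. - Re (z k)) ` {..<m}))"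
  have \<eta>: "\<eta> > 0" "\<And>k. k < m \<Longrightarrow> Re (z k) \<le> - \<eta>"
  proof -
    show "\<eta> > 0" unfolding \<eta>_def using zneg by (subst Min_gr_iff) auto
    have "\<eta> \<le> - Re (z k)" if "k < m" for k unfolding \<eta>_def using that by (intro Min_le) auto
    then show "\<And>k. k < m \<Longrightarrow> Re (z k) \<le> - \<eta>" by force
  qed
  show ?thesis
  proof (intro exI[of _ \<eta>] conjI allI)
    fix x
    have "Re (\<Sum>i<m. \<Sum>j<m. cnj (x i) * A i j * x j) = (\<Sum>k<m. Re (z k) * (cmod (u x k))\<^sup>2)"
      unfolding QA by (simp add: Re_sum del: of_real_power)
    also have "\<dots> \<le> (\<Sum>k<m. - \<eta> * (cmod (u x k))\<^sup>2)"
      using \<eta> by (intro sum_mono mult_right_mono) auto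
    also have "\<dots> = - \<eta> * (\<Sum>i<m. (cmod (x i))\<^sup>2)" by (simp only: sum_distrib_left[symmetric] Q1)
    finally show "Re (\<Sum>i<m. \<Sum>j<m. cnj (x i) * A i j * x j) \<le> - \<eta> * (\<Sum>i<m. (cmod (x i))\<^sup>2)" .
  qed fact
qed

text \<open>Bisection: the counting identity is additive over adjacent half-open intervals and holds
  on short intervals around every point, hence on [x,y]. Finiteness of the set of jumps is carried
  along in the same statement.\<close>

theorem index_jump_global:
  fixes ind \<kappa> :: "real \<Rightarrow> nat"
  assumes loc: "\<And>s. s \<in> {\<sigma><..<\<tau>} \<Longrightarrow> \<exists>\<delta>>0. \<forall>t. \<bar>t - s\<bar> < \<delta> \<longrightarrow> ind t = ind s + (if t > s then \<kappa> s else 0)"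
    and xy: "\<sigma> < x" "x \<le> y" "y < \<tau>"
  shows "finite {t. t \<in> {x..<y} \<and> \<kappa> t \<noteq> 0} \<and> ind y = ind x + (\<Sum>t\<in>{t. t \<in> {x..<y} \<and> \<kappa> t \<noteq> 0}. \<kappa> t)"
  using xy(2)
proof (rule Bolzano)
  fix a b c :: real
  assume ab: "finite {t. t \<in> {a..<b} \<and> \<kappa> t \<noteq> 0} \<and> ind b = ind a + (\<Sum>t\<in>{t. t \<in> {a..<b} \<and> \<kappa> t \<noteq> 0}. \<kappa> t)"
    and bc: "finite {t. t \<in> {b..<c} \<and> \<kappa> t \<noteq> 0} \<and> ind c = ind b + (\<Sum>t\<in>{t. t \<in> {b..<c} \<and> \<kappa> t \<noteq> 0}. \<kappa> t)"
    and le: "a \<le> b" "b \<le> c"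
  have un: "{t. t \<in> {a..<c} \<and> \<kappa> t \<noteq> 0} = {t. t \<in> {a..<b} \<and> \<kappa> t \<noteq> 0} \<union> {t. t \<in> {b..<c} \<and> \<kappa> t \<noteq> 0}"
    using le by auto
  have "(\<Sum>t\<in>{t. t \<in> {a..<c} \<and> \<kappa> t \<noteq> 0}. \<kappa> t) =
      (\<Sum>t\<in>{t. t \<in> {a..<b} \<and> \<kappa> t \<noteq> 0}. \<kappa> t) + (\<Sum>t\<in>{t. t \<in> {b..<c} \<and> \<kappa> t \<noteq> 0}. \<kappa> t)"
    unfolding un using ab bc by (intro sum.union_disjoint) auto
  moreover have "finite {t. t \<in> {a..<c} \<and> \<kappa> t \<noteq> 0}" unfolding un using ab bc by simp
  ultimately show "finite {t. t \<in> {a..<c} \<and> \<kappa> t \<noteq> 0} \<and> ind c = ind a + (\<Sum>t\<in>{t. t \<in> {a..<c} \<and> \<kappa> t \<noteq> 0}. \<kappa> t)"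
    using ab bc by linarith
next
  fix s assume "x \<le> s" "s \<le> y"
  then have s: "s \<in> {\<sigma><..<\<tau>}" using xy by auto
  obtain \<delta> where d: "\<delta> > 0" "\<And>t. \<bar>t - s\<bar> < \<delta> \<Longrightarrow> ind t = ind s + (if t > s then \<kappa> s else 0)"
    using loc[OF s] by blast
  define \<rho> where "\<rho> = min \<delta> (min (s - \<sigma>) (\<tau> - s))"
  have r: "\<rho> > 0" "\<rho> \<le> \<delta>" "\<rho> \<le> s - \<sigma>" "\<rho> \<le> \<tau> - s" using d s by (auto simp: \<rho>_def)
  \<comment> \<open>On either side of \<open>s\<close> the index is locally constant, whereas a jump
    at \<open>t\<close> would be visible immediately to the right of \<open>t\<close>. Hence there
    is no jump at any t \<noteq> s near s.\<close>
  have k0: "\<kappa> t = 0" if t: "t \<noteq> s" "\<bar>t - s\<bar> < \<rho>" for t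
  proof -
    have "t \<in> {\<sigma><..<\<tau>}" using t r by (auto simp: abs_less_iff)
    then obtain e where e: "e > 0" "\<And>t'. \<bar>t' - t\<bar> < e \<Longrightarrow> ind t' = ind t + (if t' > t then \<kappa> t else 0)"
      using loc by blast
    \<comment> \<open>A point to the right of \<open>t\<close>, inside both neighbourhoods and on
      the same side of \<open>s\<close> as \<open>t\<close>.\<close>
    define t' where "t' = t + min (e / 2) ((if t < s then s - t else \<rho> - (t - s)) / 2)"
    define g where "g = (if t < s then s - t else \<rho> - (t - s))"
    have g: "g > 0" using t by (auto simp: g_def abs_if split: if_splits)
    have "t' - t = min (e / 2) (g / 2)" by (simp add: t'_def g_def)
    then have m: "t' - t > 0" "t' - t < e" "t' - t < g" using e(1) g by (auto simp: min_def)
    have t': "t' > t" "\<bar>t' - t\<bar> < e" "\<bar>t' - s\<bar> < \<rho>" "t' > s \<longleftrightarrow> t > s"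
      using m t by (cases "t < s"; auto simp: g_def abs_if split: if_splits)+
    have "ind t' = ind t" using d(2)[of t'] d(2)[of t] t' t r by auto
    then show ?thesis using e(2)[OF t'(2)] t'(1) by simp
  qed
  show "\<exists>d>0. \<forall>a b. a \<le> s \<and> s \<le> b \<and> b - a < d \<longrightarrow>
      finite {t. t \<in> {a..<b} \<and> \<kappa> t \<noteq> 0} \<and> ind b = ind a + (\<Sum>t\<in>{t. t \<in> {a..<b} \<and> \<kappa> t \<noteq> 0}. \<kappa> t)"
  proof (intro exI[of _ \<rho>] conjI allI impI r)
    fix a b assume ab: "a \<le> s \<and> s \<le> b \<and> b - a < \<rho>"
    \<comment> \<open>The point \<open>s\<close> belongs to [a,b) exactly when s < b, which matches
      an index that jumps only to the right of \<open>s\<close>.\<close>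
    have set_eq: "{t. t \<in> {a..<b} \<and> \<kappa> t \<noteq> 0} = (if s < b \<and> \<kappa> s \<noteq> 0 then {s} else {})"
    proof -
      have "t = s" if "t \<in> {a..<b}" "\<kappa> t \<noteq> 0" for t
      proof (rule ccontr)
        assume "t \<noteq> s"
        moreover have "\<bar>t - s\<bar> < \<rho>" using that(1) ab by (simp add: abs_less_iff)
        ultimately show False using k0[of t] that(2) by simp
      qed
      then show ?thesis using ab by auto
    qed
    show "finite {t. t \<in> {a..<b} \<and> \<kappa> t \<noteq> 0}" unfolding set_eq by simp
    have "ind a = ind s" using d(2)[of a] ab r by (auto simp: abs_if split: if_splits)
    moreover have "ind b = ind s + (if b > s then \<kappa> s else 0)" using d(2)[of b] ab r by (auto simp: abs_if)
    ultimately show "ind b = ind a + (\<Sum>t\<in>{t. t \<in> {a..<b} \<and> \<kappa> t \<noteq> 0}. \<kappa> t)" unfolding set_eq by simp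
  qed
qed

section \<open>Index near a degenerate form\<close>

text \<open>\<open>B\<close> is the form at the critical parameter, \<open>R\<close> its derivative
  there and \<open>M\<close> the Sobolev product. The \<open>v i\<close> are diagonal for
  \<open>B\<close>, with entries \<open>d i\<close> of any sign; the \<phi> i are dual functionals,
  and their common kernel is the coercive complement. This finite diagonal part takes the place of a
  spectral decomposition.\<close>

locale critical_form =
  fixes D :: "(real \<Rightarrow> complex) set" and B R M :: "(real \<Rightarrow> complex) \<Rightarrow> (real \<Rightarrow> complex) \<Rightarrow> complex"
    and m :: nat and v :: "nat \<Rightarrow> real \<Rightarrow> complex" and \<phi> :: "nat \<Rightarrow> (real \<Rightarrow> complex) \<Rightarrow> complex"
    and d :: "nat \<Rightarrow> real" and C \<epsilon> :: real
  assumes D: "csubspace D" and B: "hform D B" and R: "hform D R" and M: "hform D M"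
    and M_nonneg: "f \<in> D \<Longrightarrow> Re (M f f) \<ge> 0"
    and M_zero: "f \<in> D \<Longrightarrow> Re (M f f) = 0 \<Longrightarrow> f = (\<lambda>x. 0)"
    and R_bound: "f \<in> D \<Longrightarrow> \<bar>Re (R f f)\<bar> \<le> C * Re (M f f)" and C: "C \<ge> 0"
    and v: "i < m \<Longrightarrow> v i \<in> D"
    and Bv: "i < m \<Longrightarrow> j < m \<Longrightarrow> B (v i) (v j) = (if i = j then complex_of_real (d i) else 0)"
    and phi_add: "i < m \<Longrightarrow> f \<in> D \<Longrightarrow> g \<in> D \<Longrightarrow> \<phi> i (\<lambda>x. f x + g x) = \<phi> i f + \<phi> i g"
    and phi_scale: "i < m \<Longrightarrow> f \<in> D \<Longrightarrow> \<phi> i (\<lambda>x. s * f x) = s * \<phi> i f"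
    and phi_v: "i < m \<Longrightarrow> j < m \<Longrightarrow> \<phi> i (v j) = (if i = j then 1 else 0)"
    and orth: "z \<in> D \<Longrightarrow> \<forall>i<m. \<phi> i z = 0 \<Longrightarrow> j < m \<Longrightarrow> B z (v j) = 0"
    and coer: "z \<in> D \<Longrightarrow> \<forall>i<m. \<phi> i z = 0 \<Longrightarrow> Re (B z z) \<ge> \<epsilon> * Re (M z z)" and eps: "\<epsilon> > 0"
    and R_neg: "\<exists>i<m. d i = 0 \<and> c i \<noteq> 0 \<Longrightarrow>
       Re (R (\<lambda>x. \<Sum>i\<in>{i. i < m \<and> d i = 0}. c i * v i x) (\<lambda>x. \<Sum>i\<in>{i. i < m \<and> d i = 0}. c i * v i x)) < 0"
begin

abbreviation N :: "(real \<Rightarrow> complex) \<Rightarrow> real" where "N f \<equiv> Re (M f f)"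

definition L :: "nat set \<Rightarrow> (nat \<Rightarrow> complex) \<Rightarrow> real \<Rightarrow> complex" where
  "L J c = (\<lambda>x. \<Sum>i\<in>J. c i * v i x)"

definition "Ng = {i. i < m \<and> d i < 0}"
definition "Ze = {i. i < m \<and> d i = 0}"
definition "Po = {i. i < m \<and> d i > 0}"

lemma J_sub: "Ng \<subseteq> {..<m}" "Ze \<subseteq> {..<m}" "Po \<subseteq> {..<m}" "Ng \<union> Ze \<subseteq> {..<m}"
  by (auto simp: Ng_def Ze_def Po_def)

lemma J_fin: "J \<subseteq> {..<m} \<Longrightarrow> finite J"
  using finite_subset by blast

lemma L_D: "J \<subseteq> {..<m} \<Longrightarrow> L J c \<in> D"
  unfolding L_def using v by (intro csubspace_lincomb[OF D] J_fin) auto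

lemma phi_zero: "i < m \<Longrightarrow> \<phi> i (\<lambda>x. 0) = 0"
  using phi_scale[of i "\<lambda>x. 0" 0] csubspaceD(1)[OF D] by simp

lemma phi_sum:
  assumes "i < m" "finite K" "\<And>j. j \<in> K \<Longrightarrow> w j \<in> D"
  shows "\<phi> i (\<lambda>x. \<Sum>j\<in>K. c j * w j x) = (\<Sum>j\<in>K. c j * \<phi> i (w j))"
  using assms(2,3)
proof (induction K rule: finite_induct)
  case empty
  then show ?case using phi_zero[OF assms(1)] by simp
next
  case (insert j K)
  have "\<phi> i (\<lambda>x. c j * w j x + (\<Sum>j\<in>K. c j * w j x)) = \<phi> i (\<lambda>x. c j * w j x) + \<phi> i (\<lambda>x. \<Sum>j\<in>K. c j * w j x)"
    by (intro phi_add assms(1) csubspaceD(3)[OF D] csubspace_lincomb[OF D]) (use insert in auto)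
  then show ?case using insert phi_scale[OF assms(1), of "w j" "c j"] by simp
qed

lemma phi_L:
  assumes "J \<subseteq> {..<m}" "i < m"
  shows "\<phi> i (L J c) = (if i \<in> J then c i else 0)"
proof -
  have "\<phi> i (L J c) = (\<Sum>j\<in>J. c j * \<phi> i (v j))"
    unfolding L_def using assms v by (intro phi_sum J_fin) auto
  also have "\<dots> = (\<Sum>j\<in>J. if j = i then c j else 0)"
  proof (intro sum.cong refl)
    fix j assume "j \<in> J"
    then have "j < m" using assms by auto
    then show "c j * \<phi> i (v j) = (if j = i then c j else 0)" using phi_v[OF assms(2)] by auto
  qed
  finally show ?thesis using J_fin[OF assms(1)] by simp
qed

lemma N_add: "f \<in> D \<Longrightarrow> g \<in> D \<Longrightarrow> N (\<lambda>x. f x + g x) \<le> 2 * N f + 2 * N g"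
proof -
  assume fg: "f \<in> D" "g \<in> D"
  let ?g = "\<lambda>x. (-1) * g x"
  have g: "?g \<in> D" using csubspaceD(3)[OF D fg(2)] .
  have "M f ?g = - M f g" using hform_scale_right[OF D M fg(2,1), of "-1"] by simp
  moreover have "N ?g = N g" using hform_quad_scale[OF D M fg(2), of "-1"] by simp
  moreover have "N (\<lambda>x. f x + ?g x) \<ge> 0" using M_nonneg[OF csubspaceD(2)[OF D fg(1) g]] .
  ultimately show ?thesis
    using hform_quad_add[OF D M fg] hform_quad_add[OF D M fg(1) g] by simp
qed

text \<open>Half of the norm equivalence on the span of the \<open>v i\<close>: it converts lower
  bounds by coefficients into lower bounds by \<open>N\<close>.\<close>

lemma N_L: "J \<subseteq> {..<m} \<Longrightarrow> \<exists>K\<ge>0. \<forall>c. N (L J c) \<le> K * (\<Sum>i\<in>J. (cmod (c i))\<^sup>2)"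
proof -
  assume J: "J \<subseteq> {..<m}"
  from J_fin[OF J] J show ?thesis
  proof (induction J rule: finite_induct)
    case empty
    then show ?case using hform_zero[OF D M csubspaceD(1)[OF D]] by (intro exI[of _ 0]) (simp add: L_def)
  next
    case (insert j J)
    then have J: "J \<subseteq> {..<m}" "j < m" by auto
    obtain K where K: "K \<ge> 0" "\<And>c. N (L J c) \<le> K * (\<Sum>i\<in>J. (cmod (c i))\<^sup>2)" using insert J by blast
    have nj: "N (v j) \<ge> 0" using M_nonneg[OF v[OF J(2)]] .
    show ?case
    proof (intro exI[of _ "2 * K + 2 * N (v j)"] conjI allI)
      show "2 * K + 2 * N (v j) \<ge> 0" using K nj by simp
      fix c
      have "L (insert j J) c = (\<lambda>x. c j * v j x + L J c x)" using insert by (simp add: L_def)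
      then have "N (L (insert j J) c) \<le> 2 * N (\<lambda>x. c j * v j x) + 2 * N (L J c)"
        using N_add[OF csubspaceD(3)[OF D v[OF J(2)]] L_D[OF J(1)]] by simp
      also have "N (\<lambda>x. c j * v j x) = (cmod (c j))\<^sup>2 * N (v j)" by (rule hform_quad_scale[OF D M v[OF J(2)]])
      also have "2 * ((cmod (c j))\<^sup>2 * N (v j)) + 2 * N (L J c) \<le> 2 * ((cmod (c j))\<^sup>2 * N (v j)) + 2 * (K * (\<Sum>i\<in>J. (cmod (c i))\<^sup>2))"
        using K(2)[of c] by simp
      also have "\<dots> \<le> (2 * K + 2 * N (v j)) * ((cmod (c j))\<^sup>2 + (\<Sum>i\<in>J. (cmod (c i))\<^sup>2))"
      proof -
        have "K * (cmod (c j))\<^sup>2 \<ge> 0" "N (v j) * (\<Sum>i\<in>J. (cmod (c i))\<^sup>2) \<ge> 0"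
          using K(1) nj by (auto intro!: mult_nonneg_nonneg sum_nonneg)
        then show ?thesis by (simp add: algebra_simps)
      qed
      finally show "N (L (insert j J) c) \<le> (2 * K + 2 * N (v j)) * (\<Sum>i\<in>insert j J. (cmod (c i))\<^sup>2)"
        using insert by simp
    qed
  qed
qed

text \<open>Duality makes the splitting explicit: subtracting the combination with coefficients
  \<phi> i f lands in the common kernel of the functionals, so no projection theorem is
  involved.\<close>

lemma decomp:
  assumes "f \<in> D"
  shows "\<exists>z\<in>D. (\<forall>i<m. \<phi> i z = 0) \<and> f = (\<lambda>x. L {..<m} (\<lambda>i. \<phi> i f) x + z x)"
proof -
  let ?l = "L {..<m} (\<lambda>i. \<phi> i f)"
  have l: "?l \<in> D" by (rule L_D) simp
  define z where "z = (\<lambda>x. f x + (-1) * ?l x)"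
  have l': "(\<lambda>x. (-1) * ?l x) \<in> D" using csubspaceD(3)[OF D l] .
  have "z \<in> D" unfolding z_def using csubspaceD(2)[OF D assms l'] .
  moreover have "\<phi> i z = 0" if i: "i < m" for i
  proof -
    have "\<phi> i z = \<phi> i f + \<phi> i (\<lambda>x. (-1) * ?l x)" unfolding z_def by (rule phi_add[OF i assms l'])
    also have "\<phi> i (\<lambda>x. (-1) * ?l x) = (-1) * \<phi> i ?l" by (rule phi_scale[OF i l])
    also have "\<phi> i ?l = \<phi> i f" using phi_L[of "{..<m}" i] i by simp
    finally show ?thesis by simp
  qed
  moreover have "f = (\<lambda>x. ?l x + z x)" by (simp add: z_def)
  ultimately show ?thesis by blast
qed

lemma B_LL:
  assumes "J \<subseteq> {..<m}" "J' \<subseteq> {..<m}"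
  shows "B (L J c) (L J' c') = (\<Sum>i\<in>J. if i \<in> J' then c i * cnj (c' i) * d i else 0)"
proof -
  have "B (L J c) (L J' c') = (\<Sum>i\<in>J. c i * B (v i) (L J' c'))"
    unfolding L_def[of J] using assms v by (intro hform_sum_left[OF D B] J_fin L_D) auto
  also have "\<dots> = (\<Sum>i\<in>J. if i \<in> J' then c i * cnj (c' i) * d i else 0)"
  proof (intro sum.cong refl)
    fix i assume "i \<in> J"
    then have i: "i < m" using assms by auto
    have "B (v i) (L J' c') = (\<Sum>j\<in>J'. cnj (c' j) * B (v i) (v j))"
      unfolding L_def using assms v i by (intro hform_sum_right[OF D B] J_fin) auto
    also have "\<dots> = (\<Sum>j\<in>J'. if j = i then cnj (c' j) * d j else 0)"
      using Bv[OF i] assms(2) by (intro sum.cong refl) auto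
    finally show "c i * B (v i) (L J' c') = (if i \<in> J' then c i * cnj (c' i) * d i else 0)"
      using J_fin[OF assms(2)] by simp
  qed
  finally show ?thesis .
qed

lemma B_L: "J \<subseteq> {..<m} \<Longrightarrow> Re (B (L J c) (L J c)) = (\<Sum>i\<in>J. d i * (cmod (c i))\<^sup>2)"
proof -
  assume J: "J \<subseteq> {..<m}"
  have "B (L J c) (L J c) = (\<Sum>i\<in>J. c i * cnj (c i) * d i)"
    unfolding B_LL[OF J J] by (intro sum.cong) auto
  also have "\<dots> = complex_of_real (\<Sum>i\<in>J. d i * (cmod (c i))\<^sup>2)"
    by (simp add: complex_norm_square[symmetric] mult.commute del: of_real_power)
  finally show ?thesis by simp
qed

lemma B_zL: "z \<in> D \<Longrightarrow> \<forall>i<m. \<phi> i z = 0 \<Longrightarrow> J \<subseteq> {..<m} \<Longrightarrow> B (L J c) z = 0"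
proof -
  assume z: "z \<in> D" "\<forall>i<m. \<phi> i z = 0" and J: "J \<subseteq> {..<m}"
  have "B (L J c) z = (\<Sum>i\<in>J. c i * B (v i) z)"
    unfolding L_def using J v z by (intro hform_sum_left[OF D B] J_fin) auto
  also have "\<dots> = 0"
  proof (intro sum.neutral ballI)
    fix i assume "i \<in> J"
    then have i: "i < m" using J by auto
    show "c i * B (v i) z = 0" using hformD(3)[OF B z(1) v[OF i] z(1)] orth[OF z i] by simp
  qed
  finally show ?thesis .
qed

lemma quad_P:
  assumes "z \<in> D" "\<forall>i<m. \<phi> i z = 0"
  shows "Re (B (\<lambda>x. L Po c x + z x) (\<lambda>x. L Po c x + z x)) = (\<Sum>i\<in>Po. d i * (cmod (c i))\<^sup>2) + Re (B z z)"
  using hform_quad_add[OF D B L_D[OF J_sub(3)] assms(1)] B_zL[OF assms J_sub(3)] B_L[OF J_sub(3)] by simp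

lemma quad_ZP:
  assumes "z \<in> D" "\<forall>i<m. \<phi> i z = 0" and p_def: "p = (\<lambda>x. L Po c' x + z x)"
  shows "Re (B (\<lambda>x. L Ze c x + p x) (\<lambda>x. L Ze c x + p x)) = Re (B p p)"
proof -
  have p: "p \<in> D" unfolding p_def by (rule csubspaceD(2)[OF D L_D[OF J_sub(3)] assms(1)])
  have "B (L Ze c) p = B (L Ze c) (L Po c') + B (L Ze c) z"
    unfolding p_def by (rule hform_add_right[OF D B L_D[OF J_sub(3)] assms(1) L_D[OF J_sub(2)]])
  also have "\<dots> = 0" unfolding B_zL[OF assms(1,2) J_sub(2)] B_LL[OF J_sub(2,3)]
    by (simp add: Ze_def Po_def)
  finally have "B (L Ze c) p = 0" .
  moreover have "Re (B (L Ze c) (L Ze c)) = 0" unfolding B_L[OF J_sub(2)] by (simp add: Ze_def)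
  ultimately show ?thesis using hform_quad_add[OF D B L_D[OF J_sub(2)] p] by simp
qed

lemma quad_ZN:
  "Re (B (\<lambda>x. L Ze c x + L Ng c x) (\<lambda>x. L Ze c x + L Ng c x)) = Re (B (L Ng c) (L Ng c))"
proof -
  have "B (L Ze c) (L Ng c) = 0" unfolding B_LL[OF J_sub(2,1)] by (simp add: Ze_def Ng_def)
  moreover have "Re (B (L Ze c) (L Ze c)) = 0" unfolding B_L[OF J_sub(2)] by (simp add: Ze_def)
  ultimately show ?thesis using hform_quad_add[OF D B L_D[OF J_sub(2)] L_D[OF J_sub(1)]] by simp
qed

lemma pos_P: "\<exists>e>0. \<forall>c z. z \<in> D \<longrightarrow> (\<forall>i<m. \<phi> i z = 0) \<longrightarrow>
   Re (B (\<lambda>x. L Po c x + z x) (\<lambda>x. L Po c x + z x)) \<ge> e * N (\<lambda>x. L Po c x + z x)"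
proof -
  obtain K where K: "K \<ge> 0" "\<And>c. N (L Po c) \<le> K * (\<Sum>i\<in>Po. (cmod (c i))\<^sup>2)" using N_L[OF J_sub(3)] by blast
  define \<delta> where "\<delta> = Min (insert 1 (d ` Po))"
  have fin: "finite Po" using J_fin[OF J_sub(3)] .
  have \<delta>: "\<delta> > 0" "\<And>i. i \<in> Po \<Longrightarrow> \<delta> \<le> d i"
    unfolding \<delta>_def using fin by (subst Min_gr_iff) (auto simp: Po_def)
  \<comment> \<open>The factor 2 of \<open>N_add\<close> is paid by the diagonal part, through
    \<open>K\<close>, and by the coercive part separately.\<close>
  define e where "e = min (\<delta> / (2 * K + 2)) (\<epsilon> / 2)"
  have e: "e > 0" "2 * K * e \<le> \<delta>" "2 * e \<le> \<epsilon>"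
  proof -
    show "e > 0" using \<delta> eps K by (simp add: e_def)
    have "e \<le> \<delta> / (2 * K + 2)" by (simp add: e_def)
    then have "e * (2 * K + 2) \<le> \<delta>" using K(1) by (simp add: pos_le_divide_eq)
    then show "2 * K * e \<le> \<delta>" using \<open>e > 0\<close> by (simp add: algebra_simps)
    show "2 * e \<le> \<epsilon>" by (simp add: e_def)
  qed
  show ?thesis
  proof (intro exI[of _ e] conjI allI impI e)
    fix c z assume z: "z \<in> D" "\<forall>i<m. \<phi> i z = 0"
    let ?S = "\<Sum>i\<in>Po. (cmod (c i))\<^sup>2"
    have "e * N (\<lambda>x. L Po c x + z x) \<le> e * (2 * (K * ?S) + 2 * N z)"
      using N_add[OF L_D[OF J_sub(3)] z(1), of c] K(2)[of c] e(1) by (intro mult_left_mono) auto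
    also have "\<dots> = (2 * K * e) * ?S + (2 * e) * N z" by (simp add: algebra_simps)
    also have "\<dots> \<le> \<delta> * ?S + \<epsilon> * N z"
      using e M_nonneg[OF z(1)] by (intro add_mono mult_right_mono sum_nonneg) auto
    also have "\<dots> \<le> (\<Sum>i\<in>Po. d i * (cmod (c i))\<^sup>2) + Re (B z z)"
      using coer[OF z] \<delta>(2) unfolding sum_distrib_left by (intro add_mono sum_mono mult_right_mono) auto
    finally show "e * N (\<lambda>x. L Po c x + z x) \<le> Re (B (\<lambda>x. L Po c x + z x) (\<lambda>x. L Po c x + z x))"
      using quad_P[OF z] by simp
  qed
qed

lemma neg_N: "\<exists>e>0. \<forall>c. Re (B (L Ng c) (L Ng c)) \<le> - e * N (L Ng c)"
proof -
  obtain K where K: "K \<ge> 0" "\<And>c. N (L Ng c) \<le> K * (\<Sum>i\<in>Ng. (cmod (c i))\<^sup>2)" using N_L[OF J_sub(1)] by blast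
  define \<delta> where "\<delta> = Min (insert 1 ((\<lambda>i. - d i) ` Ng))"
  have fin: "finite Ng" using J_fin[OF J_sub(1)] .
  have \<delta>: "\<delta> > 0" unfolding \<delta>_def using fin by (subst Min_gr_iff) (auto simp: Ng_def)
  have \<delta>': "\<delta> \<le> - d i" if "i \<in> Ng" for i unfolding \<delta>_def using fin that by (intro Min_le) auto
  show ?thesis
  proof (intro exI[of _ "\<delta> / (K + 1)"] conjI allI)
    show "\<delta> / (K + 1) > 0" using \<delta> K by simp
    fix c
    let ?S = "\<Sum>i\<in>Ng. (cmod (c i))\<^sup>2"
    have S: "?S \<ge> 0" by (intro sum_nonneg) auto
    have "\<delta> / (K + 1) * N (L Ng c) \<le> \<delta> / (K + 1) * (K * ?S)" using K \<delta> by (intro mult_left_mono) auto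
    also have "\<dots> \<le> \<delta> * ?S"
    proof -
      have "\<delta> / (K + 1) * K \<le> \<delta>" using K(1) \<delta> by (simp add: field_simps)
      from mult_right_mono[OF this S] show ?thesis by (simp add: mult.assoc)
    qed
    also have "\<dots> \<le> (\<Sum>i\<in>Ng. - d i * (cmod (c i))\<^sup>2)"
      using \<delta>' unfolding sum_distrib_left by (intro sum_mono mult_right_mono) auto
    also have "\<dots> = - Re (B (L Ng c) (L Ng c))" unfolding B_L[OF J_sub(1)] by (simp add: sum_negf)
    finally show "Re (B (L Ng c) (L Ng c)) \<le> - (\<delta> / (K + 1)) * N (L Ng c)" by simp
  qed
qed

text \<open>Negativity of \<open>R\<close> on each nonzero null combination has to become a bound
  uniform over a finite-dimensional space; it is read off a negative definite matrix.\<close>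

lemma neg_Z: "\<exists>e>0. \<forall>c. Re (R (L Ze c) (L Ze c)) \<le> - e * N (L Ze c)"
proof -
  \<comment> \<open>The block of \<open>R\<close> on the null directions is completed by -1 on the
    remaining diagonal, so that a negative definite matrix of size \<open>m\<close> results without
    reindexing.\<close>
  define A where "A i j = (if d i = 0 \<and> d j = 0 then R (v j) (v i) else if i = j then -1 else 0)" for i j
  have finZ: "finite Ze" using J_fin[OF J_sub(2)] .
  have RL: "R (L Ze c) (L Ze c) = (\<Sum>j\<in>Ze. \<Sum>i\<in>Ze. cnj (c i) * R (v j) (v i) * c j)" for c
  proof -
    have "R (L Ze c) (L Ze c) = (\<Sum>j\<in>Ze. c j * R (v j) (L Ze c))"
      unfolding L_def[of Ze] using J_sub(2) v L_D[OF J_sub(2), of c, unfolded L_def]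
      by (intro hform_sum_left[OF D R finZ]) auto
    also have "\<dots> = (\<Sum>j\<in>Ze. c j * (\<Sum>i\<in>Ze. cnj (c i) * R (v j) (v i)))"
    proof (intro sum.cong refl arg_cong2[where f = "(*)"])
      fix j assume "j \<in> Ze"
      then have j: "v j \<in> D" using v J_sub(2) by auto
      show "R (v j) (L Ze c) = (\<Sum>i\<in>Ze. cnj (c i) * R (v j) (v i))"
        unfolding L_def using J_sub(2) v j by (intro hform_sum_right[OF D R finZ]) auto
    qed
    finally show ?thesis by (simp add: sum_distrib_left mult_ac)
  qed
  have QA: "(\<Sum>i<m. \<Sum>j<m. cnj (c i) * A i j * c j) = R (L Ze c) (L Ze c) - of_real (\<Sum>i\<in>{..<m} - Ze. (cmod (c i))\<^sup>2)" for c
  proof -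
    have "(\<Sum>j<m. cnj (c i) * A i j * c j) = (if i \<in> Ze then (\<Sum>j\<in>Ze. cnj (c i) * R (v j) (v i) * c j) else - (cnj (c i) * c i))"
      if i: "i < m" for i
    proof (cases "i \<in> Ze")
      case True
      have "(\<Sum>j<m. cnj (c i) * A i j * c j) = (\<Sum>j<m. if j \<in> Ze then cnj (c i) * R (v j) (v i) * c j else 0)"
        using True by (intro sum.cong) (auto simp: A_def Ze_def)
      also have "\<dots> = (\<Sum>j\<in>{..<m} \<inter> Ze. cnj (c i) * R (v j) (v i) * c j)" by (simp add: sum.inter_restrict)
      also have "{..<m} \<inter> Ze = Ze" using J_sub by auto
      finally show ?thesis using True by simp
    next
      case False
      then have "d i \<noteq> 0" using i by (simp add: Ze_def)
      then have "(\<Sum>j<m. cnj (c i) * A i j * c j) = (\<Sum>j<m. if j = i then - (cnj (c i) * c i) else 0)"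
        by (intro sum.cong) (auto simp: A_def)
      then show ?thesis using False i by simp
    qed
    then have "(\<Sum>i<m. \<Sum>j<m. cnj (c i) * A i j * c j) =
        (\<Sum>i<m. if i \<in> Ze then (\<Sum>j\<in>Ze. cnj (c i) * R (v j) (v i) * c j) else - (cnj (c i) * c i))"
      by (intro sum.cong) auto
    also have "\<dots> = (\<Sum>i\<in>{..<m} \<inter> Ze. \<Sum>j\<in>Ze. cnj (c i) * R (v j) (v i) * c j) + (\<Sum>i\<in>{..<m} - Ze. - (cnj (c i) * c i))"
      by (simp add: sum.If_cases Diff_eq)
    also have "{..<m} \<inter> Ze = Ze" using J_sub by auto
    also have "(\<Sum>i\<in>Ze. \<Sum>j\<in>Ze. cnj (c i) * R (v j) (v i) * c j) = R (L Ze c) (L Ze c)"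
      unfolding RL by (rule sum.swap)
    also have "(\<Sum>i\<in>{..<m} - Ze. - (cnj (c i) * c i)) = - of_real (\<Sum>i\<in>{..<m} - Ze. (cmod (c i))\<^sup>2)"
      unfolding of_real_sum complex_norm_square by (simp add: sum_negf mult.commute)
    finally show ?thesis by simp
  qed
  have "\<exists>\<eta>>0. \<forall>c. Re (\<Sum>i<m. \<Sum>j<m. cnj (c i) * A i j * c j) \<le> - \<eta> * (\<Sum>i<m. (cmod (c i))\<^sup>2)"
  proof (rule negdef_matrix_bound)
    fix i j assume ij: "i < m" "j < m"
    show "A j i = cnj (A i j)"
    proof (cases "d i = 0 \<and> d j = 0")
      case True
      then show ?thesis using hformD(3)[OF R v[OF ij(2)] v[OF ij(1)] v[OF ij(1)]] by (simp add: A_def)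
    qed (auto simp: A_def)
  next
    fix c :: "nat \<Rightarrow> complex" assume c: "\<exists>i<m. c i \<noteq> 0"
    have S: "(\<Sum>i\<in>{..<m} - Ze. (cmod (c i))\<^sup>2) \<ge> 0" by (intro sum_nonneg) auto
    show "Re (\<Sum>i<m. \<Sum>j<m. cnj (c i) * A i j * c j) < 0"
    proof (cases "\<exists>i<m. d i = 0 \<and> c i \<noteq> 0")
      case True
      from R_neg[OF this] have "Re (R (L Ze c) (L Ze c)) < 0" by (simp add: L_def Ze_def)
      then show ?thesis using S unfolding QA by simp
    next
      case False
      then have "R (L Ze c) (L Ze c) = 0" unfolding RL by (simp add: Ze_def)
      moreover obtain i where "i \<in> {..<m} - Ze" "c i \<noteq> 0" using c False by (auto simp: Ze_def)
      then have "(\<Sum>i\<in>{..<m} - Ze. (cmod (c i))\<^sup>2) > 0" by (intro sum_pos2[of _ i]) auto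
      ultimately show ?thesis unfolding QA by simp
    qed
  qed
  then obtain \<eta> where \<eta>: "\<eta> > 0" "\<And>c. Re (\<Sum>i<m. \<Sum>j<m. cnj (c i) * A i j * c j) \<le> - \<eta> * (\<Sum>i<m. (cmod (c i))\<^sup>2)" by blast
  obtain K where K: "K \<ge> 0" "\<And>c. N (L Ze c) \<le> K * (\<Sum>i\<in>Ze. (cmod (c i))\<^sup>2)" using N_L[OF J_sub(2)] by blast
  show ?thesis
  proof (intro exI[of _ "\<eta> / (K + 1)"] conjI allI)
    show "\<eta> / (K + 1) > 0" using \<eta> K by simp
    fix c
    let ?S = "\<Sum>i\<in>Ze. (cmod (c i))\<^sup>2"
    let ?c = "\<lambda>i. if i \<in> Ze then c i else 0"
    have S: "?S \<ge> 0" by (intro sum_nonneg) auto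
    have Lc: "L Ze ?c = L Ze c" by (simp add: L_def)
    have S1: "(\<Sum>i\<in>{..<m} - Ze. (cmod (?c i))\<^sup>2) = 0" by (intro sum.neutral) auto
    have S2: "(\<Sum>i<m. (cmod (?c i))\<^sup>2) = ?S"
      using J_sub(2) by (intro sum.mono_neutral_cong_right) auto
    have "Re (R (L Ze c) (L Ze c)) \<le> - \<eta> * ?S" using \<eta>(2)[of ?c] unfolding QA Lc S1 S2 by simp
    moreover have "\<eta> / (K + 1) * N (L Ze c) \<le> \<eta> / (K + 1) * (K * ?S)" using K \<eta> by (intro mult_left_mono) auto
    moreover have "\<eta> / (K + 1) * (K * ?S) \<le> \<eta> * ?S"
    proof -
      have "\<eta> / (K + 1) * K \<le> \<eta>" using K(1) \<eta>(1) by (simp add: field_simps)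
      from mult_right_mono[OF this S] show ?thesis by (simp add: mult.assoc)
    qed
    ultimately show "Re (R (L Ze c) (L Ze c)) \<le> - (\<eta> / (K + 1)) * N (L Ze c)" by simp
  qed
qed

section \<open>Upper and lower bounds for the index\<close>

lemma index_upper:
  assumes J: "J \<subseteq> {..<m}" and pos: "\<And>f. f \<in> D \<Longrightarrow> \<forall>i\<in>J. \<phi> i f = 0 \<Longrightarrow> q f \<ge> 0"
  shows "\<not> neg_family D q (Suc (card J)) w"
proof
  assume w: "neg_family D q (Suc (card J)) w"
  obtain e where e: "bij_betw e {..<card J} J"
    using ex_bij_betw_nat_finite[OF J_fin[OF J]] by (auto simp: atLeast0LessThan)
  obtain c where c: "\<exists>j<Suc (card J). c j \<noteq> 0" "\<forall>i<card J. (\<Sum>j<Suc (card J). \<phi> (e i) (w j) * c j) = 0"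
    using homogeneous_nontrivial[of "card J" "Suc (card J)" "\<lambda>i j. \<phi> (e i) (w j)"] by auto
  let ?f = "\<lambda>x. \<Sum>j<Suc (card J). c j * w j x"
  have wD: "w j \<in> D" if "j \<in> {..<Suc (card J)}" for j
    using conjunct1[OF w[unfolded neg_family_def], rule_format] that by simp
  have f: "?f \<in> D" using wD by (intro csubspace_lincomb[OF D]) auto
  have "\<phi> i ?f = 0" if i: "i \<in> J" for i
  proof -
    from i have "i \<in> e ` {..<card J}" using bij_betw_imp_surj_on[OF e] by simp
    then obtain r where r: "r < card J" "e r = i" by auto
    have "\<phi> i ?f = (\<Sum>j<Suc (card J). c j * \<phi> i (w j))"
      using wD i J by (intro phi_sum) auto
    also have "\<dots> = (\<Sum>j<Suc (card J). \<phi> (e r) (w j) * c j)" by (simp only: r(2) mult.commute)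
    also have "\<dots> = 0" using c(2) r(1) by blast
    finally show ?thesis .
  qed
  then have "q ?f \<ge> 0" by (intro pos[OF f]) blast
  moreover have "\<forall>c. (\<exists>i<Suc (card J). c i \<noteq> 0) \<longrightarrow> q (\<lambda>x. \<Sum>i<Suc (card J). c i * w i x) < 0"
    using conjunct2[OF w[unfolded neg_family_def]] .
  from mp[OF spec[OF this, of c] c(1)] have "q ?f < 0" .
  ultimately show False by simp
qed

text \<open>The preceding bound uses that among card J + 1 functions some nontrivial combination is
  annihilated by the functionals over \<open>J\<close>. Conversely, the \<open>v i\<close> over
  \<open>J\<close>, enumerated by a bijection, are themselves a negative family.\<close>

lemma index_lower:
  assumes J: "J \<subseteq> {..<m}" and neg: "\<And>c. \<exists>i\<in>J. c i \<noteq> 0 \<Longrightarrow> q (L J c) < 0"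
  shows "\<exists>w. neg_family D q (card J) w"
proof -
  obtain e where e: "bij_betw e {..<card J} J"
    using ex_bij_betw_nat_finite[OF J_fin[OF J]] by (auto simp: atLeast0LessThan)
  have "neg_family D q (card J) (\<lambda>i. v (e i))"
    unfolding neg_family_def
  proof (intro conjI allI impI)
    show "v (e i) \<in> D" if "i < card J" for i
      using bij_betw_apply[OF e, of i] that J v[of "e i"] by auto
    fix c :: "nat \<Rightarrow> complex" assume c: "\<exists>i<card J. c i \<noteq> 0"
    let ?c = "\<lambda>j. c (the_inv_into {..<card J} e j)"
    have inv: "the_inv_into {..<card J} e (e i) = i" if "i < card J" for i
      using the_inv_into_f_f[OF bij_betw_imp_inj_on[OF e], of i] that by simp
    have "L J ?c = (\<lambda>x. \<Sum>i<card J. c i * v (e i) x)"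
    proof
      fix x
      have "L J ?c x = (\<Sum>i<card J. ?c (e i) * v (e i) x)"
        unfolding L_def by (rule sum.reindex_bij_betw[OF e, symmetric])
      also have "\<dots> = (\<Sum>i<card J. c i * v (e i) x)" using inv by (intro sum.cong) auto
      finally show "L J ?c x = (\<Sum>i<card J. c i * v (e i) x)" .
    qed
    moreover have "\<exists>i\<in>J. ?c i \<noteq> 0"
    proof -
      obtain i where i: "i < card J" "c i \<noteq> 0" using c by blast
      have "e i \<in> J" using bij_betw_apply[OF e, of i] i by simp
      then show ?thesis using inv[OF i(1)] i(2) by (intro bexI[of _ "e i"]) auto
    qed
    then have "q (L J ?c) < 0" by (rule neg)
    ultimately show "q (\<lambda>x. \<Sum>i<card J. c i * v (e i) x) < 0" by simp
  qed
  then show ?thesis by blast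
qed

text \<open>A combination of norm 0 is the zero function by \<open>M_zero\<close>, and then all its
  dual coefficients vanish.\<close>

lemma N_L_pos:
  assumes "J \<subseteq> {..<m}" "i \<in> J" "c i \<noteq> 0"
  shows "N (L J c) > 0"
proof -
  have "N (L J c) \<noteq> 0"
  proof
    assume "N (L J c) = 0"
    from M_zero[OF L_D[OF assms(1)] this] have "\<phi> i (L J c) = \<phi> i (\<lambda>x. 0)" by simp
    then show False using phi_L[OF assms(1), of i] phi_zero[of i] assms by auto
  qed
  then show ?thesis using M_nonneg[OF L_D[OF assms(1)], of c] by linarith
qed

lemma L_union: "J \<inter> J' = {} \<Longrightarrow> J \<subseteq> {..<m} \<Longrightarrow> J' \<subseteq> {..<m} \<Longrightarrow> L (J \<union> J') c = (\<lambda>x. L J c x + L J' c x)"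
  unfolding L_def by (subst sum.union_disjoint) (auto intro: J_fin)

lemma L_zero: "(\<And>i. i \<in> J \<Longrightarrow> c i = 0) \<Longrightarrow> L J c = (\<lambda>x. 0)"
  by (simp add: L_def)

text \<open>The null directions change sign at t0. To the right of t0 the form is negative on the
  span over \<open>Ng\<close> and \<open>Ze\<close> and nonnegative on the common kernel of these
  functionals; at t0 and to its left it is negative on the span over \<open>Ng\<close> and
  nonnegative on the common kernel of those functionals alone.\<close>

theorem index_near:
  assumes q: "\<And>\<omega>. \<omega> > 0 \<Longrightarrow> \<exists>\<delta>>0. \<forall>t. \<bar>t - t0\<bar> < \<delta> \<longrightarrow>
      (\<forall>f\<in>D. \<bar>q t f - Re (B f f) - (t - t0) * Re (R f f)\<bar> \<le> \<omega> * \<bar>t - t0\<bar> * N f)"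
  shows "\<exists>\<delta>>0. \<forall>t. \<bar>t - t0\<bar> < \<delta> \<longrightarrow> has_index D (q t) (card Ng + (if t > t0 then card Ze else 0))"
proof -
  obtain e1 where e1: "e1 > 0" "\<And>c z. z \<in> D \<Longrightarrow> \<forall>i<m. \<phi> i z = 0 \<Longrightarrow>
     e1 * N (\<lambda>x. L Po c x + z x) \<le> Re (B (\<lambda>x. L Po c x + z x) (\<lambda>x. L Po c x + z x))"
    using pos_P by metis
  obtain e2 where e2: "e2 > 0" "\<And>c. Re (B (L Ng c) (L Ng c)) \<le> - e2 * N (L Ng c)" using neg_N by blast
  obtain \<eta> where \<eta>: "\<eta> > 0" "\<And>c. Re (R (L Ze c) (L Ze c)) \<le> - \<eta> * N (L Ze c)" using neg_Z by blast
  let ?r = "\<lambda>f. Re (R f f)" and ?r' = "\<lambda>f. - Re (R f f)"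
  have cross: "\<bar>?r (\<lambda>x. f x + g x) - ?r f - ?r g\<bar> \<le> C * (s * N f + N g / s)" if "f \<in> D" "g \<in> D" "s > 0" for f g s
    using hform_cross_bound[OF D R M R_bound that] .
  have cross': "\<bar>?r' (\<lambda>x. f x + g x) - ?r' f - ?r' g\<bar> \<le> C * (s * N f + N g / s)" if "f \<in> D" "g \<in> D" "s > 0" for f g s
    using cross[OF that] by linarith
  have bnd': "\<bar>?r' f\<bar> \<le> C * N f" if "f \<in> D" for f using R_bound[OF that] by simp
  have "\<exists>\<delta>>0. \<forall>h k p X Q. \<bar>h\<bar> < \<delta> \<longrightarrow> k \<in> D \<longrightarrow> p \<in> D \<longrightarrow> Q \<ge> e1 * N p \<longrightarrow> h * ?r k \<ge> \<eta> * \<bar>h\<bar> * N k \<longrightarrow>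
     \<bar>X - Q - h * ?r (\<lambda>x. k x + p x)\<bar> \<le> \<eta> / 8 * \<bar>h\<bar> * N (\<lambda>x. k x + p x) \<longrightarrow> X \<ge> \<eta> / 2 * \<bar>h\<bar> * N k + e1 / 2 * N p"
  proof (rule perturb_pos[OF D e1(1) \<eta>(1) C])
    show "N f \<ge> 0" if "f \<in> D" for f by (rule M_nonneg[OF that])
    show "N (\<lambda>x. f x + g x) \<le> 2 * N f + 2 * N g" if "f \<in> D" "g \<in> D" for f g by (rule N_add[OF that])
    show "\<bar>?r f\<bar> \<le> C * N f" if "f \<in> D" for f by (rule R_bound[OF that])
    show "\<bar>?r (\<lambda>x. f x + g x) - ?r f - ?r g\<bar> \<le> C * (s * N f + N g / s)" if "f \<in> D" "g \<in> D" "s > 0" for f g s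
      by (rule cross[OF that])
  qed
  then obtain \<delta>1 where \<delta>1: "\<delta>1 > 0 \<and> (\<forall>h k p X Q. \<bar>h\<bar> < \<delta>1 \<longrightarrow> k \<in> D \<longrightarrow> p \<in> D \<longrightarrow> Q \<ge> e1 * N p \<longrightarrow> h * ?r k \<ge> \<eta> * \<bar>h\<bar> * N k \<longrightarrow>
     \<bar>X - Q - h * ?r (\<lambda>x. k x + p x)\<bar> \<le> \<eta> / 8 * \<bar>h\<bar> * N (\<lambda>x. k x + p x) \<longrightarrow> X \<ge> \<eta> / 2 * \<bar>h\<bar> * N k + e1 / 2 * N p)"
    by (elim exE) (rule that)
  note \<delta>1 = conjunct1[OF \<delta>1] conjunct2[OF \<delta>1, rule_format]
  \<comment> \<open>The same estimate with form and derivative negated; it provides the negative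
    families.\<close>
  have "\<exists>\<delta>>0. \<forall>h k p X Q. \<bar>h\<bar> < \<delta> \<longrightarrow> k \<in> D \<longrightarrow> p \<in> D \<longrightarrow> Q \<ge> e2 * N p \<longrightarrow> h * ?r' k \<ge> \<eta> * \<bar>h\<bar> * N k \<longrightarrow>
     \<bar>X - Q - h * ?r' (\<lambda>x. k x + p x)\<bar> \<le> \<eta> / 8 * \<bar>h\<bar> * N (\<lambda>x. k x + p x) \<longrightarrow> X \<ge> \<eta> / 2 * \<bar>h\<bar> * N k + e2 / 2 * N p"
  proof (rule perturb_pos[OF D e2(1) \<eta>(1) C])
    show "N f \<ge> 0" if "f \<in> D" for f by (rule M_nonneg[OF that])
    show "N (\<lambda>x. f x + g x) \<le> 2 * N f + 2 * N g" if "f \<in> D" "g \<in> D" for f g by (rule N_add[OF that])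
    show "\<bar>?r' f\<bar> \<le> C * N f" if "f \<in> D" for f by (rule bnd'[OF that])
    show "\<bar>?r' (\<lambda>x. f x + g x) - ?r' f - ?r' g\<bar> \<le> C * (s * N f + N g / s)" if "f \<in> D" "g \<in> D" "s > 0" for f g s
      by (rule cross'[OF that])
  qed
  then obtain \<delta>2 where \<delta>2: "\<delta>2 > 0 \<and> (\<forall>h k p X Q. \<bar>h\<bar> < \<delta>2 \<longrightarrow> k \<in> D \<longrightarrow> p \<in> D \<longrightarrow> Q \<ge> e2 * N p \<longrightarrow> h * ?r' k \<ge> \<eta> * \<bar>h\<bar> * N k \<longrightarrow>
     \<bar>X - Q - h * ?r' (\<lambda>x. k x + p x)\<bar> \<le> \<eta> / 8 * \<bar>h\<bar> * N (\<lambda>x. k x + p x) \<longrightarrow> X \<ge> \<eta> / 2 * \<bar>h\<bar> * N k + e2 / 2 * N p)"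
    by (elim exE) (rule that)
  note \<delta>2 = conjunct1[OF \<delta>2] conjunct2[OF \<delta>2, rule_format]
  obtain \<delta>3 where \<delta>3: "\<delta>3 > 0" "\<And>t f. \<bar>t - t0\<bar> < \<delta>3 \<Longrightarrow> f \<in> D \<Longrightarrow>
      \<bar>q t f - Re (B f f) - (t - t0) * ?r f\<bar> \<le> \<eta> / 8 * \<bar>t - t0\<bar> * N f"
    using q[of "\<eta> / 8"] \<eta>(1) by auto
  have z0: "(\<lambda>x. 0) \<in> D" by (rule csubspaceD(1)[OF D])
  have N0: "N (\<lambda>x. 0) = 0" "?r (\<lambda>x. 0) = 0"
    using hform_zero[OF D M z0] hform_zero[OF D R z0] by simp_all
  have ZN: "Ze \<inter> Ng = {}" by (auto simp: Ze_def Ng_def)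
  show ?thesis
  proof (intro exI[of _ "min \<delta>1 (min \<delta>2 \<delta>3)"] conjI allI impI)
    show "min \<delta>1 (min \<delta>2 \<delta>3) > 0" using \<delta>1(1) \<delta>2(1) \<delta>3(1) by simp
    fix t assume "\<bar>t - t0\<bar> < min \<delta>1 (min \<delta>2 \<delta>3)"
    then have t1: "\<bar>t - t0\<bar> < \<delta>1" and t2: "\<bar>t - t0\<bar> < \<delta>2" and t3: "\<bar>t - t0\<bar> < \<delta>3" by simp_all
    define h where "h = t - t0"
    have exp': "\<bar>- q t f - - Re (B f f) - h * ?r' f\<bar> \<le> \<eta> / 8 * \<bar>h\<bar> * N f" if "f \<in> D" for f
      using \<delta>3(2)[OF t3 that] unfolding h_def[symmetric] by (simp add: abs_minus_commute algebra_simps)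
    have split3: "L {..<m} c = (\<lambda>x. L Ze c x + (L Po c x))" if "\<forall>i\<in>Ng. c i = 0" for c
    proof -
      have "{..<m} = Ng \<union> (Ze \<union> Po)" by (auto simp: Ng_def Ze_def Po_def)
      then have "L {..<m} c = L (Ng \<union> (Ze \<union> Po)) c" by simp
      also have "\<dots> = (\<lambda>x. L Ng c x + L (Ze \<union> Po) c x)"
        by (rule L_union) (auto simp: Ng_def Ze_def Po_def)
      also have "L (Ze \<union> Po) c = (\<lambda>x. L Ze c x + L Po c x)"
        by (rule L_union) (auto simp: Ng_def Ze_def Po_def)
      finally show ?thesis using L_zero[of Ng c] that by simp
    qed
    show "has_index D (q t) (card Ng + (if t > t0 then card Ze else 0))"
    proof (cases "t > t0")
      case True
      then have h: "h > 0" "\<bar>h\<bar> = h" by (simp_all add: h_def)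
      have "card Ng + card Ze = card (Ng \<union> Ze)"
        using ZN J_fin[OF J_sub(1)] J_fin[OF J_sub(2)] by (subst card_Un_disjoint) auto
      moreover have "has_index D (q t) (card (Ng \<union> Ze))"
        unfolding has_index_def
      proof (intro conjI allI)
        show "\<not> neg_family D (q t) (Suc (card (Ng \<union> Ze))) w" for w
        proof (rule index_upper[OF J_sub(4)])
          fix f assume f: "f \<in> D" "\<forall>i\<in>Ng \<union> Ze. \<phi> i f = 0"
          obtain z where z: "z \<in> D" "\<forall>i<m. \<phi> i z = 0" "f = (\<lambda>x. L {..<m} (\<lambda>i. \<phi> i f) x + z x)"
            using decomp[OF f(1)] by blast
          have "L {..<m} (\<lambda>i. \<phi> i f) = L Po (\<lambda>i. \<phi> i f)"
            using split3[of "\<lambda>i. \<phi> i f"] L_zero[of Ze "\<lambda>i. \<phi> i f"] f(2) by simp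
          then have fz: "f = (\<lambda>x. L Po (\<lambda>i. \<phi> i f) x + z x)" using z(3) by simp
          have Q: "e1 * N f \<le> Re (B f f)" using e1(2)[OF z(1,2), of "\<lambda>i. \<phi> i f"] fz by simp
          \<comment> \<open>No null component is present, so the estimate is applied with k =
            0.\<close>
          have "q t f \<ge> \<eta> / 2 * \<bar>h\<bar> * N (\<lambda>x. 0) + e1 / 2 * N f"
          proof (rule \<delta>1(2)[OF _ z0 f(1) Q])
            show "\<bar>h\<bar> < \<delta>1" using t1 by (simp add: h_def)
            show "\<eta> * \<bar>h\<bar> * N (\<lambda>x. 0) \<le> h * ?r (\<lambda>x. 0)" by (simp only: N0 mult_zero_right)
            show "\<bar>q t f - Re (B f f) - h * ?r (\<lambda>x. 0 + f x)\<bar> \<le> \<eta> / 8 * \<bar>h\<bar> * N (\<lambda>x. 0 + f x)"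
              using \<delta>3(2)[OF t3 f(1)] by (simp add: h_def)
          qed
          moreover have "e1 / 2 * N f \<ge> 0" using e1(1) M_nonneg[OF f(1)] by simp
          ultimately show "q t f \<ge> 0" unfolding N0 mult_zero_right by linarith
        qed
        show "\<exists>w. neg_family D (q t) (card (Ng \<union> Ze)) w"
        proof (rule index_lower[OF J_sub(4)])
          fix c :: "nat \<Rightarrow> complex" assume "\<exists>i\<in>Ng \<union> Ze. c i \<noteq> 0"
          then obtain i where i: "i \<in> Ng \<or> i \<in> Ze" "c i \<noteq> 0" by blast
          have Lu: "L (Ng \<union> Ze) c = (\<lambda>x. L Ze c x + L Ng c x)"
            using L_union[OF ZN J_sub(2,1)] by (simp add: Un_commute)
          have kD: "L Ze c \<in> D" and nD: "L Ng c \<in> D" using L_D J_sub by auto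
          have LD: "(\<lambda>x. L Ze c x + L Ng c x) \<in> D" using csubspaceD(2)[OF D kD nD] .
          have "- q t (\<lambda>x. L Ze c x + L Ng c x) \<ge> \<eta> / 2 * \<bar>h\<bar> * N (L Ze c) + e2 / 2 * N (L Ng c)"
          proof (rule \<delta>2(2)[OF _ kD nD])
            show "\<bar>h\<bar> < \<delta>2" using t2 by (simp add: h_def)
            show "e2 * N (L Ng c) \<le> - Re (B (L Ng c) (L Ng c))" using e2(2)[of c] by simp
            have "h * (\<eta> * N (L Ze c)) \<le> h * ?r' (L Ze c)"
              using \<eta>(2)[of c] h(1) by (intro mult_left_mono) auto
            then show "\<eta> * \<bar>h\<bar> * N (L Ze c) \<le> h * ?r' (L Ze c)" unfolding h(2) by (simp only: mult_ac)
            show "\<bar>- q t (\<lambda>x. L Ze c x + L Ng c x) - - Re (B (L Ng c) (L Ng c)) - h * ?r' (\<lambda>x. L Ze c x + L Ng c x)\<bar>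
               \<le> \<eta> / 8 * \<bar>h\<bar> * N (\<lambda>x. L Ze c x + L Ng c x)"
              using exp'[OF LD] unfolding quad_ZN .
          qed
          moreover have "\<eta> / 2 * \<bar>h\<bar> * N (L Ze c) \<ge> 0" "e2 / 2 * N (L Ng c) \<ge> 0"
            using M_nonneg[OF kD] M_nonneg[OF nD] \<eta>(1) e2(1) by (auto intro!: mult_nonneg_nonneg)
          moreover have "\<eta> / 2 * \<bar>h\<bar> * N (L Ze c) > 0 \<or> e2 / 2 * N (L Ng c) > 0"
            using i(1)
          proof
            assume "i \<in> Ng"
            from N_L_pos[where c = c, OF J_sub(1) this i(2)] show ?thesis using e2(1) by simp
          next
            assume "i \<in> Ze"
            from N_L_pos[where c = c, OF J_sub(2) this i(2)] show ?thesis using \<eta>(1) h by simp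
          qed
          ultimately show "q t (L (Ng \<union> Ze) c) < 0" unfolding Lu by linarith
        qed
      qed
      ultimately show ?thesis using True by simp
    next
      case False
      then have h: "h \<le> 0" "\<bar>h\<bar> = - h" by (simp_all add: h_def)
      have "has_index D (q t) (card Ng)"
        unfolding has_index_def
      proof (intro conjI allI)
        show "\<not> neg_family D (q t) (Suc (card Ng)) w" for w
        proof (rule index_upper[OF J_sub(1)])
          fix f assume f: "f \<in> D" "\<forall>i\<in>Ng. \<phi> i f = 0"
          obtain z where z: "z \<in> D" "\<forall>i<m. \<phi> i z = 0" "f = (\<lambda>x. L {..<m} (\<lambda>i. \<phi> i f) x + z x)"
            using decomp[OF f(1)] by blast
          define p where "p = (\<lambda>x. L Po (\<lambda>i. \<phi> i f) x + z x)"
          define k where "k = L Ze (\<lambda>i. \<phi> i f)"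
          have fz: "f = (\<lambda>x. k x + p x)" using z(3) split3[of "\<lambda>i. \<phi> i f"] f(2) by (simp add: p_def k_def add.assoc)
          have kD: "k \<in> D" unfolding k_def by (rule L_D[OF J_sub(2)])
          have pD: "p \<in> D" unfolding p_def by (rule csubspaceD(2)[OF D L_D[OF J_sub(3)] z(1)])
          \<comment> \<open>The null part is invisible to \<open>B\<close>, so the unperturbed value
            comes from \<open>p\<close> alone.\<close>
          have Bf: "Re (B f f) = Re (B p p)"
            using quad_ZP[OF z(1,2) p_def, where c = "\<lambda>i. \<phi> i f"] unfolding k_def[symmetric] fz[symmetric] .
          have Q: "e1 * N p \<le> Re (B p p)" unfolding p_def by (rule e1(2)[OF z(1,2)])
          have "q t f \<ge> \<eta> / 2 * \<bar>h\<bar> * N k + e1 / 2 * N p"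
          proof (rule \<delta>1(2)[OF _ kD pD Q])
            show "\<bar>h\<bar> < \<delta>1" using t1 by (simp add: h_def)
            have "(- h) * ?r k \<le> (- h) * (- \<eta> * N k)"
              using \<eta>(2)[of "\<lambda>i. \<phi> i f"] h(1) unfolding k_def by (intro mult_left_mono) auto
            then show "\<eta> * \<bar>h\<bar> * N k \<le> h * ?r k" unfolding h(2) by (simp add: mult_ac)
            show "\<bar>q t f - Re (B p p) - h * ?r (\<lambda>x. k x + p x)\<bar> \<le> \<eta> / 8 * \<bar>h\<bar> * N (\<lambda>x. k x + p x)"
              using \<delta>3(2)[OF t3 f(1)] unfolding Bf fz[symmetric] h_def .
          qed
          moreover have "\<eta> / 2 * \<bar>h\<bar> * N k \<ge> 0" "e1 / 2 * N p \<ge> 0"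
            using M_nonneg[OF kD] M_nonneg[OF pD] \<eta>(1) e1(1) by (auto intro!: mult_nonneg_nonneg)
          ultimately show "q t f \<ge> 0" by linarith
        qed
        show "\<exists>w. neg_family D (q t) (card Ng) w"
        proof (rule index_lower[OF J_sub(1)])
          fix c :: "nat \<Rightarrow> complex" assume "\<exists>i\<in>Ng. c i \<noteq> 0"
          then obtain i where i: "i \<in> Ng" "c i \<noteq> 0" by blast
          have nD: "L Ng c \<in> D" using L_D J_sub by auto
          have "- q t (L Ng c) \<ge> \<eta> / 2 * \<bar>h\<bar> * N (\<lambda>x. 0) + e2 / 2 * N (L Ng c)"
          proof (rule \<delta>2(2)[OF _ z0 nD])
            show "\<bar>h\<bar> < \<delta>2" using t2 by (simp add: h_def)
            show "e2 * N (L Ng c) \<le> - Re (B (L Ng c) (L Ng c))" using e2(2)[of c] by simp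
            show "\<eta> * \<bar>h\<bar> * N (\<lambda>x. 0) \<le> h * ?r' (\<lambda>x. 0)" by (simp only: N0 mult_zero_right minus_zero)
            show "\<bar>- q t (L Ng c) - - Re (B (L Ng c) (L Ng c)) - h * ?r' (\<lambda>x. 0 + L Ng c x)\<bar>
               \<le> \<eta> / 8 * \<bar>h\<bar> * N (\<lambda>x. 0 + L Ng c x)"
              using exp'[OF nD] by simp
          qed
          moreover have "e2 / 2 * N (L Ng c) > 0"
            using N_L_pos[where c = c, OF J_sub(1) i] e2(1) by simp
          ultimately show "q t (L Ng c) < 0" unfolding N0 mult_zero_right by linarith
        qed
      qed
      then show ?thesis using False by simp
    qed
  qed
qed

end

section \<open>The quadratic form of the operator\<close>

definition bw :: "nat \<Rightarrow> real \<Rightarrow> real \<Rightarrow> (real \<Rightarrow> complex) \<Rightarrow> nat \<Rightarrow> complex" where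
  "bw n a b y i = (if i < n then dw a b i y a else dw a b (i - n) y b)"

definition bdry :: "nat \<Rightarrow> (nat \<Rightarrow> nat \<Rightarrow> complex) \<Rightarrow> (nat \<Rightarrow> complex) \<Rightarrow> (nat \<Rightarrow> complex) \<Rightarrow> complex" where
  "bdry N A s t = (\<Sum>i<N. \<Sum>j<N. A i j * s j * cnj (t i))"

text \<open>Coefficients \<open>P\<close> and boundary matrix \<open>A\<close> are free, so that the
  form of the operator, its \<lambda>-derivative, the Sobolev product and the first-order remainder
  are all instances.\<close>

definition qf :: "nat \<Rightarrow> real \<Rightarrow> real \<Rightarrow> (nat \<Rightarrow> real \<Rightarrow> real) \<Rightarrow> (nat \<Rightarrow> nat \<Rightarrow> complex) \<Rightarrow>
    (real \<Rightarrow> complex) \<Rightarrow> (real \<Rightarrow> complex) \<Rightarrow> complex" where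
  "qf n a b P A y z = (\<Sum>k\<le>n. integral {a..b} (\<lambda>x. complex_of_real (P k x) * (dw a b (n - k) y x * cnj (dw a b (n - k) z x))))
     + bdry (2 * n) A (bw n a b y) (bw n a b z)"

text \<open>The set \<open>K\<close> will be the kernel of U - 1, so only the essential boundary
  condition appears; the natural one is encoded in the form. Functions vanish outside [a,b], so that
  agreement on the interval is equality.\<close>

definition form_dom :: "nat \<Rightarrow> real \<Rightarrow> real \<Rightarrow> complex vec set \<Rightarrow> (real \<Rightarrow> complex) set" where
  "form_dom n a b K = {y. Ck_on a b n y \<and> (\<forall>x. x \<notin> {a..b} \<longrightarrow> y x = 0) \<and>
     (\<forall>u\<in>K. (\<Sum>i<2 * n. bw n a b y i * cnj (vec_index u i)) = 0)}"

lemma form_domD: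
  assumes "y \<in> form_dom n a b K"
  shows "Ck_on a b n y" "x \<notin> {a..b} \<Longrightarrow> y x = 0" "u \<in> K \<Longrightarrow> (\<Sum>i<2 * n. bw n a b y i * cnj (vec_index u i)) = 0"
  using assms by (simp_all add: form_dom_def)

lemma bw_add:
  assumes "a < b" "Ck_on a b n y" "Ck_on a b n z" "i < 2 * n"
  shows "bw n a b (\<lambda>x. y x + z x) i = bw n a b y i + bw n a b z i"
  using assms by (simp add: bw_def dw_add)

lemma bw_cmult:
  assumes "a < b" "Ck_on a b n y" "i < 2 * n"
  shows "bw n a b (\<lambda>x. c * y x) i = c * bw n a b y i"
  using assms by (simp add: bw_def dw_cmult)

lemma csubspace_form_dom:
  assumes ab: "a < b"
  shows "csubspace (form_dom n a b K)"
  unfolding csubspace_def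
proof (intro conjI ballI allI)
  have bw0: "bw n a b (\<lambda>x. 0) i = 0" for i using ab by (simp add: bw_def dw_zero)
  show "(\<lambda>x. 0) \<in> form_dom n a b K" by (simp add: form_dom_def Ck_on_zero[OF ab] bw0)
next
  fix f g assume f: "f \<in> form_dom n a b K" and g: "g \<in> form_dom n a b K"
  have "(\<Sum>i<2 * n. bw n a b (\<lambda>x. f x + g x) i * cnj (vec_index u i)) = 0" if "u \<in> K" for u
  proof -
    have "(\<Sum>i<2 * n. bw n a b (\<lambda>x. f x + g x) i * cnj (vec_index u i)) =
        (\<Sum>i<2 * n. bw n a b f i * cnj (vec_index u i)) + (\<Sum>i<2 * n. bw n a b g i * cnj (vec_index u i))"
      unfolding sum.distrib[symmetric]
      by (intro sum.cong refl) (simp add: bw_add[OF ab form_domD(1)[OF f] form_domD(1)[OF g]] distrib_right)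
    then show ?thesis using form_domD(3)[OF f that] form_domD(3)[OF g that] by simp
  qed
  then show "(\<lambda>x. f x + g x) \<in> form_dom n a b K"
    using Ck_on_add[OF ab form_domD(1)[OF f] form_domD(1)[OF g]] form_domD(2)[OF f] form_domD(2)[OF g]
    by (simp add: form_dom_def)
next
  fix c f assume f: "f \<in> form_dom n a b K"
  have "(\<Sum>i<2 * n. bw n a b (\<lambda>x. c * f x) i * cnj (vec_index u i)) = 0" if "u \<in> K" for u
  proof -
    have "(\<Sum>i<2 * n. bw n a b (\<lambda>x. c * f x) i * cnj (vec_index u i)) = c * (\<Sum>i<2 * n. bw n a b f i * cnj (vec_index u i))"
      unfolding sum_distrib_left
      by (intro sum.cong refl) (simp add: bw_cmult[OF ab form_domD(1)[OF f]])
    then show ?thesis using form_domD(3)[OF f that] by simp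
  qed
  then show "(\<lambda>x. c * f x) \<in> form_dom n a b K"
    using Ck_on_cmult[OF ab form_domD(1)[OF f]] form_domD(2)[OF f] by (simp add: form_dom_def)
qed

lemma qf_integrable:
  assumes "Ck_on a b n y" "Ck_on a b n z" "continuous_on {a..b} P" "k \<le> n"
  shows "(\<lambda>x. complex_of_real (P x) * (dw a b (n - k) y x * cnj (dw a b (n - k) z x))) integrable_on {a..b}"
  using assms by (intro integrable_continuous_real continuous_intros Ck_on_cont) auto

lemma bdry_cong:
  "(\<And>i. i < N \<Longrightarrow> s i = s' i) \<Longrightarrow> (\<And>i. i < N \<Longrightarrow> t i = t' i) \<Longrightarrow> bdry N A s t = bdry N A s' t'"
  by (simp add: bdry_def)

text \<open>Symmetry rests on the coefficients being real and on the boundary matrix being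
  Hermitian.\<close>

lemma hform_qf:
  assumes ab: "a < b" and P: "\<And>k. k \<le> n \<Longrightarrow> continuous_on {a..b} (P k)"
    and A: "\<And>i j. i < 2 * n \<Longrightarrow> j < 2 * n \<Longrightarrow> cnj (A j i) = A i j"
  shows "hform (form_dom n a b K) (qf n a b P A)"
  unfolding hform_def
proof (intro conjI ballI allI)
  fix f g h assume "f \<in> form_dom n a b K" "g \<in> form_dom n a b K" "h \<in> form_dom n a b K"
  note C = this[THEN form_domD(1)]
  have "integral {a..b} (\<lambda>x. complex_of_real (P k x) * (dw a b (n - k) (\<lambda>x. f x + g x) x * cnj (dw a b (n - k) h x)))
     = integral {a..b} (\<lambda>x. complex_of_real (P k x) * (dw a b (n - k) f x * cnj (dw a b (n - k) h x)))
     + integral {a..b} (\<lambda>x. complex_of_real (P k x) * (dw a b (n - k) g x * cnj (dw a b (n - k) h x)))" if k: "k \<le> n" for k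
  proof -
    have "integral {a..b} (\<lambda>x. complex_of_real (P k x) * (dw a b (n - k) (\<lambda>x. f x + g x) x * cnj (dw a b (n - k) h x)))
      = integral {a..b} (\<lambda>x. complex_of_real (P k x) * (dw a b (n - k) f x * cnj (dw a b (n - k) h x))
          + complex_of_real (P k x) * (dw a b (n - k) g x * cnj (dw a b (n - k) h x)))"
      by (rule integral_cong) (simp add: dw_add[OF ab C(1,2)] distrib_left distrib_right)
    then show ?thesis
      using integral_add[OF qf_integrable[OF C(1,3) P[OF k] k] qf_integrable[OF C(2,3) P[OF k] k]] by simp
  qed
  moreover have "bdry (2 * n) A (bw n a b (\<lambda>x. f x + g x)) (bw n a b h) =
      bdry (2 * n) A (bw n a b f) (bw n a b h) + bdry (2 * n) A (bw n a b g) (bw n a b h)"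
  proof -
    have "bdry (2 * n) A (bw n a b (\<lambda>x. f x + g x)) (bw n a b h) = bdry (2 * n) A (\<lambda>i. bw n a b f i + bw n a b g i) (bw n a b h)"
      by (intro bdry_cong bw_add[OF ab C(1,2)] refl)
    then show ?thesis by (simp add: bdry_def algebra_simps sum.distrib)
  qed
  ultimately show "qf n a b P A (\<lambda>x. f x + g x) h = qf n a b P A f h + qf n a b P A g h"
    by (simp add: qf_def sum.distrib)
next
  fix c f h assume "f \<in> form_dom n a b K" "h \<in> form_dom n a b K"
  note C = this[THEN form_domD(1)]
  have "integral {a..b} (\<lambda>x. complex_of_real (P k x) * (dw a b (n - k) (\<lambda>x. c * f x) x * cnj (dw a b (n - k) h x)))
     = c * integral {a..b} (\<lambda>x. complex_of_real (P k x) * (dw a b (n - k) f x * cnj (dw a b (n - k) h x)))" for k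
  proof -
    have "integral {a..b} (\<lambda>x. complex_of_real (P k x) * (dw a b (n - k) (\<lambda>x. c * f x) x * cnj (dw a b (n - k) h x)))
      = integral {a..b} (\<lambda>x. c * (complex_of_real (P k x) * (dw a b (n - k) f x * cnj (dw a b (n - k) h x))))"
      by (rule integral_cong) (simp add: dw_cmult[OF ab C(1)])
    then show ?thesis by simp
  qed
  moreover have "bdry (2 * n) A (bw n a b (\<lambda>x. c * f x)) (bw n a b h) = c * bdry (2 * n) A (bw n a b f) (bw n a b h)"
  proof -
    have "bdry (2 * n) A (bw n a b (\<lambda>x. c * f x)) (bw n a b h) = bdry (2 * n) A (\<lambda>i. c * bw n a b f i) (bw n a b h)"
      by (intro bdry_cong bw_cmult[OF ab C(1)] refl)
    then show ?thesis by (simp add: bdry_def sum_distrib_left mult_ac)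
  qed
  ultimately show "qf n a b P A (\<lambda>x. c * f x) h = c * qf n a b P A f h"
    by (simp add: qf_def sum_distrib_left distrib_left)
next
  fix f g assume "f \<in> form_dom n a b K" "g \<in> form_dom n a b K"
  note C = this[THEN form_domD(1)]
  have "cnj (integral {a..b} (\<lambda>x. complex_of_real (P k x) * (dw a b (n - k) f x * cnj (dw a b (n - k) g x))))
     = integral {a..b} (\<lambda>x. complex_of_real (P k x) * (dw a b (n - k) g x * cnj (dw a b (n - k) f x)))" for k
    unfolding integral_cnj by (rule integral_cong) simp
  moreover have "cnj (bdry (2 * n) A (bw n a b f) (bw n a b g)) = bdry (2 * n) A (bw n a b g) (bw n a b f)"
  proof -
    have "cnj (bdry (2 * n) A (bw n a b f) (bw n a b g)) =
        (\<Sum>i<2 * n. \<Sum>j<2 * n. A j i * (bw n a b g i * cnj (bw n a b f j)))"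
      unfolding bdry_def cnj_sum complex_cnj_mult complex_cnj_cnj
      by (intro sum.cong refl) (use A in \<open>simp add: mult_ac\<close>)
    also have "\<dots> = bdry (2 * n) A (bw n a b g) (bw n a b f)"
      unfolding bdry_def by (subst sum.swap) (simp add: mult_ac)
    finally show ?thesis .
  qed
  ultimately show "qf n a b P A g f = cnj (qf n a b P A f g)"
    by (simp add: qf_def)
qed

lemma Re_qf:
  assumes "Ck_on a b n y" "\<And>k. k \<le> n \<Longrightarrow> continuous_on {a..b} (P k)"
  shows "Re (qf n a b P A y y) = (\<Sum>k\<le>n. integral {a..b} (\<lambda>x. P k x * (cmod (dw a b (n - k) y x))\<^sup>2))
     + Re (bdry (2 * n) A (bw n a b y) (bw n a b y))"
proof -
  have "Re (integral {a..b} (\<lambda>x. complex_of_real (P k x) * (dw a b (n - k) y x * cnj (dw a b (n - k) y x))))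
     = integral {a..b} (\<lambda>x. P k x * (cmod (dw a b (n - k) y x))\<^sup>2)" if k: "k \<le> n" for k
  proof -
    have "integral {a..b} (\<lambda>x. Re (complex_of_real (P k x) * (dw a b (n - k) y x * cnj (dw a b (n - k) y x))))
       = Re (integral {a..b} (\<lambda>x. complex_of_real (P k x) * (dw a b (n - k) y x * cnj (dw a b (n - k) y x))))"
      using integral_linear[OF qf_integrable[OF assms(1,1) assms(2)[OF k] k] bounded_linear_Re] by (simp add: o_def)
    moreover have "Re (complex_of_real (P k x) * (dw a b (n - k) y x * cnj (dw a b (n - k) y x))) =
       P k x * (cmod (dw a b (n - k) y x))\<^sup>2" for x
      unfolding complex_norm_square[symmetric] by simp
    ultimately show ?thesis by (simp only:)
  qed
  then show ?thesis by (simp add: qf_def)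
qed

section \<open>Sobolev norm, boundary traces and Garding's inequality\<close>

definition sob :: "nat \<Rightarrow> real \<Rightarrow> real \<Rightarrow> (real \<Rightarrow> complex) \<Rightarrow> (real \<Rightarrow> complex) \<Rightarrow> complex" where
  "sob n a b = qf n a b (\<lambda>k x. 1) (\<lambda>i j. 0)"

lemma bdry_zero [simp]: "bdry N (\<lambda>i j. 0) s t = 0"
  by (simp add: bdry_def)

lemma Re_sob: "Ck_on a b n y \<Longrightarrow> Re (sob n a b y y) = (\<Sum>k\<le>n. energy a b (dw a b (n - k) y))"
  unfolding sob_def by (subst Re_qf) (auto simp: energy_def)

lemma energy_le_sob: "Ck_on a b n y \<Longrightarrow> j \<le> n \<Longrightarrow> energy a b (dw a b j y) \<le> Re (sob n a b y y)"
proof -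
  assume y: "Ck_on a b n y" and j: "j \<le> n"
  have "energy a b (dw a b (n - (n - j)) y) \<le> (\<Sum>k\<le>n. energy a b (dw a b (n - k) y))"
    by (rule member_le_sum[of "n - j" "{..n}" "\<lambda>k. energy a b (dw a b (n - k) y)"]) (auto intro: energy_nonneg)
  then show ?thesis using j Re_sob[OF y] by simp
qed

lemma sob_nonneg: "Ck_on a b n y \<Longrightarrow> Re (sob n a b y y) \<ge> 0"
  by (simp add: Re_sob sum_nonneg energy_nonneg)

lemma energy_zero:
  assumes "a < b" "continuous_on {a..b} y" "energy a b y = 0" "x \<in> {a..b}"
  shows "y x = 0"
proof -
  have "(cmod (y x))\<^sup>2 = 0"
  proof (rule ccontr)
    assume "(cmod (y x))\<^sup>2 \<noteq> 0"
    moreover have "continuous_on {a..b} (\<lambda>x. (cmod (y x))\<^sup>2)" using assms(2) by (intro continuous_intros)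
    ultimately show False
      using integral_eq_0_iff[of a b "\<lambda>x. (cmod (y x))\<^sup>2"] assms unfolding energy_def by auto
  qed
  then show ?thesis by simp
qed

text \<open>Definiteness holds for functions and not merely for classes, because elements of the
  form domain are continuous on [a,b] and vanish outside.\<close>

lemma sob_zero:
  assumes ab: "a < b" and y: "y \<in> form_dom n a b K" and 0: "Re (sob n a b y y) = 0"
  shows "y = (\<lambda>x. 0)"
proof
  fix x
  show "y x = 0"
  proof (cases "x \<in> {a..b}")
    case True
    have "energy a b (dw a b 0 y) \<le> 0" using energy_le_sob[OF form_domD(1)[OF y], of 0] 0 by simp
    then have "energy a b y = 0" using energy_nonneg[of a b y] by simp
    moreover have "continuous_on {a..b} y" using Ck_on_cont[OF form_domD(1)[OF y], of 0] by simp
    ultimately show ?thesis using energy_zero[OF ab] True by blast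
  qed (use form_domD(2)[OF y] in blast)
qed

lemma bw_trace:
  assumes ab: "a < b" and e: "\<epsilon> > 0"
  shows "\<exists>C\<ge>0. \<forall>y. Ck_on a b n y \<longrightarrow> (\<forall>i<2 * n. (cmod (bw n a b y i))\<^sup>2 \<le> \<epsilon> * energy a b (dw a b n y) + C * energy a b y)"
proof -
  have "\<forall>j. \<exists>C. j < n \<longrightarrow> C \<ge> 0 \<and> (\<forall>y. Ck_on a b n y \<longrightarrow> (\<forall>x\<in>{a..b}.
     (cmod (dw a b j y x))\<^sup>2 \<le> \<epsilon> * energy a b (dw a b n y) + C * energy a b y))"
    using trace_interp[OF ab _ e] by blast
  then obtain C where C: "\<And>j. j < n \<Longrightarrow> C j \<ge> 0" "\<And>j y x. j < n \<Longrightarrow> Ck_on a b n y \<Longrightarrow> x \<in> {a..b} \<Longrightarrow>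
     (cmod (dw a b j y x))\<^sup>2 \<le> \<epsilon> * energy a b (dw a b n y) + C j * energy a b y"
    by (elim exE[OF choice]) blast
  have le: "C j \<le> (\<Sum>j<n. C j)" if "j < n" for j using C(1) that by (intro member_le_sum) auto
  have main: "(cmod (dw a b j y x))\<^sup>2 \<le> \<epsilon> * energy a b (dw a b n y) + (\<Sum>j<n. C j) * energy a b y"
    if "j < n" "Ck_on a b n y" "x \<in> {a..b}" for j y x
    using C(2)[OF that] mult_right_mono[OF le[OF that(1)] energy_nonneg[of a b y]] by linarith
  show ?thesis
  proof (intro exI[of _ "\<Sum>j<n. C j"] conjI allI impI)
    show "(\<Sum>j<n. C j) \<ge> 0" using C(1) by (intro sum_nonneg) auto
    fix y :: "real \<Rightarrow> complex" and i assume y: "Ck_on a b n y" and i: "i < 2 * n"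
    show "(cmod (bw n a b y i))\<^sup>2 \<le> \<epsilon> * energy a b (dw a b n y) + (\<Sum>j<n. C j) * energy a b y"
      using main[of i y a] main[of "i - n" y b] y i ab by (auto simp: bw_def)
  qed
qed

lemma bdry_bound:
  assumes "\<And>i j. i < N \<Longrightarrow> j < N \<Longrightarrow> cmod (A i j) \<le> K" "\<And>i. i < N \<Longrightarrow> (cmod (s i))\<^sup>2 \<le> T" "K \<ge> 0"
  shows "\<bar>Re (bdry N A s s)\<bar> \<le> K * (real N * real N * T)"
proof -
  have "\<bar>Re (bdry N A s s)\<bar> \<le> cmod (bdry N A s s)" by (rule abs_Re_le_cmod)
  also have "\<dots> \<le> (\<Sum>i<N. \<Sum>j<N. K * T)"
    unfolding bdry_def
  proof (intro sum_norm_le)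
    fix i j assume "i \<in> {..<N}" "j \<in> {..<N}"
    then have ij: "i < N" "j < N" by auto
    have "cmod (s j) * cmod (s i) \<le> T"
    proof -
      have "2 * (cmod (s j) * cmod (s i)) \<le> (cmod (s j))\<^sup>2 + (cmod (s i))\<^sup>2"
        using sum_squares_bound[of "cmod (s j)" "cmod (s i)"] by simp
      then show ?thesis using assms(2)[OF ij(1)] assms(2)[OF ij(2)] by linarith
    qed
    then show "cmod (A i j * s j * cnj (s i)) \<le> K * T"
      using mult_mono[OF assms(1)[OF ij], of "cmod (s j) * cmod (s i)" T] assms(3)
      by (simp add: norm_mult mult.assoc)
  qed
  finally show ?thesis by (simp add: algebra_simps)
qed

lemma integral_weight_bound:
  fixes P :: "real \<Rightarrow> real"
  assumes "continuous_on {a..b} P" "continuous_on {a..b} f" "\<And>x. x \<in> {a..b} \<Longrightarrow> \<bar>P x\<bar> \<le> K"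
  shows "\<bar>integral {a..b} (\<lambda>x. P x * (cmod (f x))\<^sup>2)\<bar> \<le> K * energy a b f"
proof -
  have "norm (integral {a..b} (\<lambda>x. P x * (cmod (f x))\<^sup>2)) \<le> integral {a..b} (\<lambda>x. K * (cmod (f x))\<^sup>2)"
  proof (rule integral_norm_bound_integral)
    show "(\<lambda>x. P x * (cmod (f x))\<^sup>2) integrable_on {a..b}" "(\<lambda>x. K * (cmod (f x))\<^sup>2) integrable_on {a..b}"
      using assms(1,2) by (auto intro!: integrable_continuous_real continuous_intros)
    show "norm (P x * (cmod (f x))\<^sup>2) \<le> K * (cmod (f x))\<^sup>2" if "x \<in> {a..b}" for x
      using assms(3)[OF that] by (simp add: abs_mult mult_right_mono)
  qed
  then show ?thesis by (simp add: energy_def)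
qed

text \<open>The constant depends neither on \<open>P\<close> nor on \<open>A\<close>. This
  uniformity makes a form with small coefficients small relative to the Sobolev norm.\<close>

lemma qf_bound:
  assumes ab: "a < b"
  shows "\<exists>C\<ge>0. \<forall>P A K y. Ck_on a b n y \<longrightarrow> (\<forall>k\<le>n. continuous_on {a..b} (P k)) \<longrightarrow> K \<ge> 0 \<longrightarrow>
     (\<forall>k\<le>n. \<forall>x\<in>{a..b}. \<bar>P k x\<bar> \<le> K) \<longrightarrow> (\<forall>i<2 * n. \<forall>j<2 * n. cmod (A i j) \<le> K) \<longrightarrow>
     \<bar>Re (qf n a b P A y y)\<bar> \<le> C * K * Re (sob n a b y y)"
proof -
  obtain C where C: "C \<ge> 0" "\<And>y i. Ck_on a b n y \<Longrightarrow> i < 2 * n \<Longrightarrow>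
      (cmod (bw n a b y i))\<^sup>2 \<le> 1 * energy a b (dw a b n y) + C * energy a b y"
    using bw_trace[OF ab, of 1 n] by auto
  define N where "N = real (2 * n)"
  show ?thesis
  proof (intro exI[of _ "1 + N * N * (1 + C)"] conjI allI impI)
    show "1 + N * N * (1 + C) \<ge> 0" using C(1) by simp
    fix P :: "nat \<Rightarrow> real \<Rightarrow> real" and A :: "nat \<Rightarrow> nat \<Rightarrow> complex" and K :: real and y :: "real \<Rightarrow> complex"
    assume y: "Ck_on a b n y" and P: "\<forall>k\<le>n. continuous_on {a..b} (P k)" and K: "K \<ge> 0"
      and bP: "\<forall>k\<le>n. \<forall>x\<in>{a..b}. \<bar>P k x\<bar> \<le> K" and bA: "\<forall>i<2 * n. \<forall>j<2 * n. cmod (A i j) \<le> K"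
    let ?W = "Re (sob n a b y y)"
    have tr: "(cmod (bw n a b y i))\<^sup>2 \<le> (1 + C) * ?W" if "i < 2 * n" for i
    proof -
      have "energy a b (dw a b n y) \<le> ?W" using energy_le_sob[OF y, of n] by simp
      moreover have "C * energy a b y \<le> C * ?W" using energy_le_sob[OF y, of 0] C(1) by (intro mult_left_mono) auto
      ultimately show ?thesis using C(2)[OF y that] by (simp add: algebra_simps)
    qed
    have 1: "\<bar>Re (bdry (2 * n) A (bw n a b y) (bw n a b y))\<bar> \<le> K * (N * N * ((1 + C) * ?W))"
      unfolding N_def using bA tr K by (intro bdry_bound) auto
    have "\<bar>\<Sum>k\<le>n. integral {a..b} (\<lambda>x. P k x * (cmod (dw a b (n - k) y x))\<^sup>2)\<bar>
       \<le> (\<Sum>k\<le>n. \<bar>integral {a..b} (\<lambda>x. P k x * (cmod (dw a b (n - k) y x))\<^sup>2)\<bar>)" by (rule sum_abs)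
    also have "\<dots> \<le> (\<Sum>k\<le>n. K * energy a b (dw a b (n - k) y))"
      using P bP y by (intro sum_mono integral_weight_bound Ck_on_cont) auto
    also have "\<dots> = K * ?W" using Re_sob[OF y] by (simp add: sum_distrib_left)
    finally have 2: "\<bar>\<Sum>k\<le>n. integral {a..b} (\<lambda>x. P k x * (cmod (dw a b (n - k) y x))\<^sup>2)\<bar> \<le> K * ?W" .
    have "\<bar>Re (qf n a b P A y y)\<bar> \<le> K * ?W + K * (N * N * ((1 + C) * ?W))"
      using Re_qf[OF y, of P A] P 1 2 by simp
    also have "\<dots> = (1 + N * N * (1 + C)) * K * ?W" by (simp add: algebra_simps)
    finally show "\<bar>Re (qf n a b P A y y)\<bar> \<le> (1 + N * N * (1 + C)) * K * ?W" .
  qed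
qed

text \<open>The leading coefficient has a positive minimum \<open>c0\<close>. Lower-order energies
  and boundary terms are interpolated between the top energy and the L2 norm, with a weight so small
  that they cost at most half of the leading term.\<close>

lemma garding:
  assumes ab: "a < b" and P: "\<And>k. k \<le> n \<Longrightarrow> continuous_on {a..b} (P k)" and P0: "\<And>x. x \<in> {a..b} \<Longrightarrow> P 0 x > 0"
  shows "\<exists>c>0. \<exists>C\<ge>0. \<forall>y. Ck_on a b n y \<longrightarrow> Re (qf n a b P A y y) \<ge> c * Re (sob n a b y y) - C * energy a b y"
proof -
  have "\<exists>c0>0. \<forall>x\<in>{a..b}. P 0 x \<ge> c0"
  proof -
    obtain x0 where "x0 \<in> {a..b}" "\<And>x. x \<in> {a..b} \<Longrightarrow> P 0 x0 \<le> P 0 x"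
      using continuous_attains_inf[of "{a..b}" "P 0"] P[of 0] ab by auto
    then show ?thesis using P0 by blast
  qed
  then obtain c0 where c0: "c0 > 0" "\<And>x. x \<in> {a..b} \<Longrightarrow> P 0 x \<ge> c0" by blast
  have "\<exists>K\<ge>0. \<forall>k\<le>n. \<forall>x\<in>{a..b}. \<bar>P k x\<bar> \<le> K"
  proof -
    have "\<forall>k. \<exists>K. k \<le> n \<longrightarrow> (\<forall>x\<in>{a..b}. \<bar>P k x\<bar> \<le> K)"
      using P compact_continuous_image[of "{a..b}"] compact_imp_bounded bounded_iff
      by (metis compact_Icc imageI real_norm_def)
    then obtain K where K: "\<And>k x. k \<le> n \<Longrightarrow> x \<in> {a..b} \<Longrightarrow> \<bar>P k x\<bar> \<le> K k" by metis
    have "\<bar>P k x\<bar> \<le> (\<Sum>k\<le>n. \<bar>K k\<bar>)" if "k \<le> n" "x \<in> {a..b}" for k x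
    proof -
      have "\<bar>K k\<bar> \<le> (\<Sum>k\<le>n. \<bar>K k\<bar>)" using that by (intro member_le_sum) auto
      then show ?thesis using K[OF that] by linarith
    qed
    then show ?thesis by (intro exI[of _ "\<Sum>k\<le>n. \<bar>K k\<bar>"]) (auto intro: sum_nonneg)
  qed
  then obtain K where K: "K \<ge> 0" "\<And>k x. k \<le> n \<Longrightarrow> x \<in> {a..b} \<Longrightarrow> \<bar>P k x\<bar> \<le> K" by blast
  define KA where "KA = (\<Sum>i<2 * n. \<Sum>j<2 * n. cmod (A i j))"
  have KA: "KA \<ge> 0" "cmod (A i j) \<le> KA" if "i < 2 * n" "j < 2 * n" for i j
  proof -
    show "KA \<ge> 0" unfolding KA_def by (intro sum_nonneg) auto
    have "cmod (A i j) \<le> (\<Sum>j<2 * n. cmod (A i j))" using that by (intro member_le_sum) auto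
    also have "\<dots> \<le> KA" unfolding KA_def
      using that by (intro member_le_sum[of i _ "\<lambda>i. \<Sum>j<2 * n. cmod (A i j)"]) (auto intro: sum_nonneg)
    finally show "cmod (A i j) \<le> KA" .
  qed
  have KA0: "KA \<ge> 0" unfolding KA_def by (intro sum_nonneg) auto
  define N where "N = real (2 * n)"
  \<comment> \<open>The two summands of the denominator pay for the lower-order coefficients and for
    the boundary matrix, respectively.\<close>
  define s where "s = c0 / (4 * (real n + 1) * (K + 1) + 4 * (N * N * KA + 1))"
  have den: "4 * (real n + 1) * (K + 1) + 4 * (N * N * KA + 1) > 0"
  proof -
    have "4 * (real n + 1) * (K + 1) \<ge> 0" "N * N * KA \<ge> 0" using K(1) KA0 by (simp_all add: mult_nonneg_nonneg)
    moreover have "x \<ge> 0 \<Longrightarrow> y \<ge> 0 \<Longrightarrow> x + 4 * (y + 1) > 0" for x y :: real by (simp add: add_nonneg_pos)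
    ultimately show ?thesis by blast
  qed
  have s: "s > 0" using c0(1) den by (simp add: s_def)
  have s1: "s * (4 * (real n + 1) * (K + 1)) + s * (4 * (N * N * KA + 1)) = c0"
  proof (rule trans[OF distrib_left[symmetric]])
    have "c0 / d * d = c0" if "d > 0" for d using that by simp
    from this[OF den] show "s * (4 * (real n + 1) * (K + 1) + 4 * (N * N * KA + 1)) = c0" unfolding s_def .
  qed
  have "\<forall>j. \<exists>C. j < n \<longrightarrow> C \<ge> 0 \<and> (\<forall>y. Ck_on a b n y \<longrightarrow> energy a b (dw a b j y) \<le> s * energy a b (dw a b n y) + C * energy a b y)"
    using energy_interp[OF ab _ s] by blast
  then obtain Cj where Cj: "\<And>j. j < n \<Longrightarrow> Cj j \<ge> 0" "\<And>j y. j < n \<Longrightarrow> Ck_on a b n y \<Longrightarrow>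
     energy a b (dw a b j y) \<le> s * energy a b (dw a b n y) + Cj j * energy a b y"
    by (elim exE[OF choice]) blast
  define C1 where "C1 = (\<Sum>j<n. Cj j)"
  have C1: "C1 \<ge> 0" unfolding C1_def using Cj(1) by (intro sum_nonneg) auto
  obtain C2 where C2: "C2 \<ge> 0" "\<And>y i. Ck_on a b n y \<Longrightarrow> i < 2 * n \<Longrightarrow>
      (cmod (bw n a b y i))\<^sup>2 \<le> s * energy a b (dw a b n y) + C2 * energy a b y"
    using bw_trace[OF ab s, of n] by blast
  \<comment> \<open>The Sobolev norm is at most \<open>Q\<close> times the top energy plus a
    multiple of the L2 norm; \<open>c\<close> is chosen so that this uses the other half of
    \<open>c0\<close>.\<close>
  define Q where "Q = 1 + real n * s"
  have Q: "Q > 0" using s by (simp add: Q_def add_pos_nonneg)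
  define c where "c = c0 / 2 / Q"
  have c: "c > 0" "c * Q = c0 / 2" using c0(1) Q by (simp_all add: c_def)
  define CC where "CC = K * C1 + KA * (N * N * C2) + c * C1"
  show ?thesis
  proof (rule exI[of _ c], intro conjI, rule c(1), rule exI[of _ CC], intro conjI allI impI)
    show "CC \<ge> 0" using K(1) KA0 C1 C2(1) c(1) by (auto simp: CC_def intro!: add_nonneg_nonneg mult_nonneg_nonneg)
    fix y :: "real \<Rightarrow> complex" assume y: "Ck_on a b n y"
    define En E0 where "En = energy a b (dw a b n y)" and "E0 = energy a b y"
    have E: "En \<ge> 0" "E0 \<ge> 0" by (simp_all add: En_def E0_def energy_nonneg)
    define Lw where "Lw = (\<Sum>j<n. energy a b (dw a b j y))"
    have Lw: "Lw \<le> real n * s * En + C1 * E0" "Lw \<ge> 0"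
    proof -
      have "Lw \<le> (\<Sum>j<n. s * En + Cj j * E0)" unfolding Lw_def En_def E0_def using Cj(2)[OF _ y] by (intro sum_mono) auto
      then show "Lw \<le> real n * s * En + C1 * E0" by (simp add: C1_def sum.distrib sum_distrib_right)
      show "Lw \<ge> 0" unfolding Lw_def by (intro sum_nonneg energy_nonneg)
    qed
    have W: "Re (sob n a b y y) = En + Lw"
    proof -
      have "Re (sob n a b y y) = (\<Sum>k\<le>n. energy a b (dw a b (n - k) y))" by (rule Re_sob[OF y])
      also have "\<dots> = (\<Sum>j\<le>n. energy a b (dw a b j y))"
        by (rule sum.reindex_bij_witness[of _ "\<lambda>j. n - j" "\<lambda>k. n - k"]) auto
      also have "\<dots> = Lw + En" by (simp add: Lw_def En_def lessThan_Suc_atMost[symmetric])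
      finally show ?thesis by simp
    qed
    have "{..n} = insert 0 {1..n}" by auto
    then have "(\<Sum>k\<le>n. integral {a..b} (\<lambda>x. P k x * (cmod (dw a b (n - k) y x))\<^sup>2)) =
      integral {a..b} (\<lambda>x. P 0 x * (cmod (dw a b n y x))\<^sup>2) + (\<Sum>k=1..n. integral {a..b} (\<lambda>x. P k x * (cmod (dw a b (n - k) y x))\<^sup>2))"
      by simp
    moreover have "integral {a..b} (\<lambda>x. P 0 x * (cmod (dw a b n y x))\<^sup>2) \<ge> c0 * En"
    proof -
      have "integral {a..b} (\<lambda>x. c0 * (cmod (dw a b n y x))\<^sup>2) \<le> integral {a..b} (\<lambda>x. P 0 x * (cmod (dw a b n y x))\<^sup>2)"
        using c0(2) P[of 0] Ck_on_cont[OF y, of n]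
        by (intro integral_le integrable_continuous_real continuous_intros mult_right_mono) auto
      then show ?thesis by (simp add: En_def energy_def)
    qed
    moreover have "(\<Sum>k=1..n. integral {a..b} (\<lambda>x. P k x * (cmod (dw a b (n - k) y x))\<^sup>2)) \<ge> - (K * Lw)"
    proof -
      have "\<bar>\<Sum>k=1..n. integral {a..b} (\<lambda>x. P k x * (cmod (dw a b (n - k) y x))\<^sup>2)\<bar>
        \<le> (\<Sum>k=1..n. \<bar>integral {a..b} (\<lambda>x. P k x * (cmod (dw a b (n - k) y x))\<^sup>2)\<bar>)" by (rule sum_abs)
      also have "\<dots> \<le> (\<Sum>k=1..n. K * energy a b (dw a b (n - k) y))"
        using P K(2) y by (intro sum_mono integral_weight_bound Ck_on_cont) auto
      also have "\<dots> = K * (\<Sum>k=1..n. energy a b (dw a b (n - k) y))" by (simp add: sum_distrib_left)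
      also have "(\<Sum>k=1..n. energy a b (dw a b (n - k) y)) = Lw"
        unfolding Lw_def by (rule sum.reindex_bij_witness[of _ "\<lambda>j. n - j" "\<lambda>k. n - k"]) auto
      finally show ?thesis by linarith
    qed
    moreover have "\<bar>Re (bdry (2 * n) A (bw n a b y) (bw n a b y))\<bar> \<le> KA * (N * N * (s * En + C2 * E0))"
      unfolding N_def using KA(2) KA0 C2(2)[OF y] by (intro bdry_bound) (auto simp: En_def E0_def)
    note parts = calculation this
    have q: "Re (qf n a b P A y y) \<ge> c0 * En - K * Lw - KA * (N * N * (s * En + C2 * E0))"
    proof -
      have gen: "q = S + B \<Longrightarrow> S = I0 + Sr \<Longrightarrow> c' \<le> I0 \<Longrightarrow> - k' \<le> Sr \<Longrightarrow> \<bar>B\<bar> \<le> t \<Longrightarrow> c' - k' - t \<le> q"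
        for q S B I0 Sr c' k' t :: real by linarith
      have "Re (qf n a b P A y y) = (\<Sum>k\<le>n. integral {a..b} (\<lambda>x. P k x * (cmod (dw a b (n - k) y x))\<^sup>2))
        + Re (bdry (2 * n) A (bw n a b y) (bw n a b y))" by (rule Re_qf[OF y P])
      from gen[OF this parts] show ?thesis .
    qed
    have K1: "K * Lw \<le> K * (real n * s * En + C1 * E0)" using Lw(1) K(1) by (rule mult_left_mono)
    have c1: "c * Lw \<le> c * (real n * s * En + C1 * E0)" using Lw(1) c(1) by (intro mult_left_mono) auto
    have half: "(K * (real n * s) + KA * (N * N * s)) * En \<le> c0 / 2 * En"
    proof (rule mult_right_mono[OF _ E(1)])
      have "K * (real n * s) \<le> s * ((real n + 1) * (K + 1))"
      proof -
        have "K * real n \<le> (real n + 1) * (K + 1)" using K(1) by (simp add: algebra_simps)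
        from mult_left_mono[OF this, of s] s show ?thesis by (simp add: mult_ac)
      qed
      moreover have "KA * (N * N * s) \<le> s * (N * N * KA + 1)" using s by (simp add: algebra_simps)
      moreover have "s * ((real n + 1) * (K + 1)) + s * (N * N * KA + 1) = c0 / 4" using s1 by (simp add: algebra_simps)
      moreover have "x \<le> x' \<Longrightarrow> y \<le> y' \<Longrightarrow> x' + y' = c0 / 4 \<Longrightarrow> x + y \<le> c0 / 2" for x y x' y' :: real
        using c0(1) by linarith
      ultimately show "K * (real n * s) + KA * (N * N * s) \<le> c0 / 2" by blast
    qed
    have eqc: "c * En + c * (real n * s * En) = c0 * En / 2"
    proof -
      have "c * En + c * (real n * s * En) = (c * Q) * En" by (simp add: Q_def algebra_simps)
      then show ?thesis unfolding c(2) by simp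
    qed
    have gen: "cL \<le> cU + cC \<Longrightarrow> kL \<le> kU + kC \<Longrightarrow> kU + as \<le> h / 2 \<Longrightarrow> cE + cU = h / 2 \<Longrightarrow>
        cE + cL - (kC + aC + cC) \<le> h - kL - (as + aC)" for cL cU cC kL kU kC as aC h cE :: real by linarith
    have "c * En + c * Lw - (K * (C1 * E0) + KA * (N * N * (C2 * E0)) + c * (C1 * E0))
        \<le> c0 * En - K * Lw - (KA * (N * N * (s * En)) + KA * (N * N * (C2 * E0)))"
    proof (rule gen)
      show "c * Lw \<le> c * (real n * s * En) + c * (C1 * E0)" using c1 unfolding distrib_left .
      show "K * Lw \<le> K * (real n * s * En) + K * (C1 * E0)" using K1 unfolding distrib_left .
      show "K * (real n * s * En) + KA * (N * N * (s * En)) \<le> c0 * En / 2" using half by (simp add: algebra_simps)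
      show "c * En + c * (real n * s * En) = c0 * En / 2" by (rule eqc)
    qed
    then have "c * (En + Lw) - CC * E0 \<le> c0 * En - K * Lw - KA * (N * N * (s * En + C2 * E0))"
      unfolding CC_def distrib_left distrib_right by (simp only: mult.assoc)
    then show "Re (qf n a b P A y y) \<ge> c * Re (sob n a b y y) - CC * energy a b y"
      using q unfolding W E0_def[symmetric] by (rule order_trans)
  qed
qed

text \<open>The first-order remainder of a form is again a form of the same type, so the
  coefficient-uniform bound applies to it.\<close>

lemma qf_combine:
  assumes y: "Ck_on a b n y" and P: "\<And>k. k \<le> n \<Longrightarrow> continuous_on {a..b} (P1 k)" "\<And>k. k \<le> n \<Longrightarrow> continuous_on {a..b} (P2 k)"
    "\<And>k. k \<le> n \<Longrightarrow> continuous_on {a..b} (P3 k)"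
  shows "Re (qf n a b (\<lambda>k x. P1 k x - P2 k x - h * P3 k x) (\<lambda>i j. A1 i j - A2 i j - complex_of_real h * A3 i j) y y) =
     Re (qf n a b P1 A1 y y) - Re (qf n a b P2 A2 y y) - h * Re (qf n a b P3 A3 y y)"
proof -
  let ?I = "\<lambda>P k. integral {a..b} (\<lambda>x. P k x * (cmod (dw a b (n - k) y x))\<^sup>2)"
  have I: "?I (\<lambda>k x. P1 k x - P2 k x - h * P3 k x) k = ?I P1 k - ?I P2 k - h * ?I P3 k" if k: "k \<le> n" for k
  proof -
    have i: "(\<lambda>x. P k x * (cmod (dw a b (n - k) y x))\<^sup>2) integrable_on {a..b}" if "continuous_on {a..b} (P k)" for P :: "nat \<Rightarrow> real \<Rightarrow> real"
      using that y by (intro integrable_continuous_real continuous_intros Ck_on_cont) auto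
    have "((\<lambda>x. P1 k x * (cmod (dw a b (n - k) y x))\<^sup>2 - P2 k x * (cmod (dw a b (n - k) y x))\<^sup>2 - h * (P3 k x * (cmod (dw a b (n - k) y x))\<^sup>2))
       has_integral ?I P1 k - ?I P2 k - h * ?I P3 k) {a..b}"
      using i P k by (intro has_integral_diff has_integral_mult_right integrable_integral) auto
    then show ?thesis by (simp add: algebra_simps integral_unique)
  qed
  have sumI: "(\<Sum>k\<le>n. ?I (\<lambda>k x. P1 k x - P2 k x - h * P3 k x) k) = (\<Sum>k\<le>n. ?I P1 k) - (\<Sum>k\<le>n. ?I P2 k) - h * (\<Sum>k\<le>n. ?I P3 k)"
    unfolding sum_distrib_left sum_subtractf[symmetric] by (intro sum.cong refl I) simp
  have bd: "Re (bdry (2 * n) (\<lambda>i j. A1 i j - A2 i j - complex_of_real h * A3 i j) s s) =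
     Re (bdry (2 * n) A1 s s) - Re (bdry (2 * n) A2 s s) - h * Re (bdry (2 * n) A3 s s)" for s
  proof -
    have "bdry (2 * n) (\<lambda>i j. A1 i j - A2 i j - complex_of_real h * A3 i j) s s =
      bdry (2 * n) A1 s s - bdry (2 * n) A2 s s - complex_of_real h * bdry (2 * n) A3 s s"
      unfolding bdry_def sum_distrib_left sum_subtractf[symmetric] by (intro sum.cong refl) (simp add: algebra_simps)
    then show ?thesis by simp
  qed
  have cont: "continuous_on {a..b} (\<lambda>x. P1 k x - P2 k x - h * P3 k x)" if "k \<le> n" for k
    using P that by (intro continuous_intros) auto
  have "Re (qf n a b (\<lambda>k x. P1 k x - P2 k x - h * P3 k x) (\<lambda>i j. A1 i j - A2 i j - complex_of_real h * A3 i j) y y) =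
     (\<Sum>k\<le>n. ?I (\<lambda>k x. P1 k x - P2 k x - h * P3 k x) k) +
     Re (bdry (2 * n) (\<lambda>i j. A1 i j - A2 i j - complex_of_real h * A3 i j) (bw n a b y) (bw n a b y))"
    by (rule Re_qf[OF y cont])
  also have "\<dots> = ((\<Sum>k\<le>n. ?I P1 k) + Re (bdry (2 * n) A1 (bw n a b y) (bw n a b y)))
     - ((\<Sum>k\<le>n. ?I P2 k) + Re (bdry (2 * n) A2 (bw n a b y) (bw n a b y)))
     - h * ((\<Sum>k\<le>n. ?I P3 k) + Re (bdry (2 * n) A3 (bw n a b y) (bw n a b y)))"
    unfolding sumI bd by (simp add: distrib_left)
  also have "\<dots> = Re (qf n a b P1 A1 y y) - Re (qf n a b P2 A2 y y) - h * Re (qf n a b P3 A3 y y)"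
    using Re_qf[OF y P(1)] Re_qf[OF y P(2)] Re_qf[OF y P(3)] by simp
  finally show ?thesis .
qed

section \<open>Green's formula\<close>

lemma sum_lessThan_add: "(\<Sum>i<n + k. f i) = (\<Sum>i<n. f i) + (\<Sum>i<k. f (n + i))"
  for f :: "nat \<Rightarrow> 'a::comm_monoid_add"
  by (induction k) (simp_all add: add.assoc)

lemma S_op_quasi: "S_op n a b p l y x = quasi_deriv n a b p l n y x"
  by (simp add: S_op_def quasi_deriv_def)

text \<open>The recursion of the quasi-derivatives: passing from m to m + 1 differentiates every old
  term and flips its sign, while the new term of index \<open>Suc m\<close> enters
  undifferentiated.\<close>

lemma quasi_deriv_has_derivative:
  assumes ab: "a < b" and p: "\<And>k. k < n \<Longrightarrow> Ck_on a b (n - k) (\<lambda>x. p k x l)"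
    and y: "Ck_on a b (2 * n) y" and m: "m < n" and x: "x \<in> {a..b}"
  shows "(quasi_deriv n a b p l m y has_vector_derivative
     complex_of_real (p (Suc m) x l) * dw a b (n - Suc m) y x - quasi_deriv n a b p l (Suc m) y x) (at x within {a..b})"
proof -
  let ?f = "\<lambda>k t. complex_of_real (p k t l) * dw a b (n - k) y t"
  have Cf: "Ck_on a b (n - k) (?f k)" if "k < n" for k
  proof (rule Ck_on_prod[OF ab p[OF that]])
    show "Ck_on a b (n - k) (dw a b (n - k) y)"
      by (rule Ck_on_dw, rule Ck_on_mono[OF y]) auto
  qed
  have "((\<lambda>x. \<Sum>k=0..m. (-1) ^ (m - k) * dw a b (m - k) (?f k) x) has_vector_derivative
      (\<Sum>k=0..m. (-1) ^ (m - k) * dw a b (Suc (m - k)) (?f k) x)) (at x within {a..b})"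
  proof (intro has_vector_derivative_sum has_vector_derivative_mult_right)
    fix k assume "k \<in> {0..m}"
    then show "(dw a b (m - k) (?f k) has_vector_derivative dw a b (Suc (m - k)) (?f k) x) (at x within {a..b})"
      using m by (intro Ck_on_deriv[OF Cf _ x]) auto
  qed
  moreover have "quasi_deriv n a b p l (Suc m) y x =
      complex_of_real (p (Suc m) x l) * dw a b (n - Suc m) y x - (\<Sum>k=0..m. (-1) ^ (m - k) * dw a b (Suc (m - k)) (?f k) x)"
  proof -
    have "quasi_deriv n a b p l (Suc m) y x = (\<Sum>k=0..m. (-1) ^ (Suc m - k) * dw a b (Suc m - k) (?f k) x) + ?f (Suc m) x"
      by (simp add: quasi_deriv_def)
    also have "(\<Sum>k=0..m. (-1) ^ (Suc m - k) * dw a b (Suc m - k) (?f k) x) = (\<Sum>k=0..m. - ((-1) ^ (m - k) * dw a b (Suc (m - k)) (?f k) x))"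
    proof (intro sum.cong refl)
      fix k assume "k \<in> {0..m}"
      then have "Suc m - k = Suc (m - k)" by auto
      then show "(-1) ^ (Suc m - k) * dw a b (Suc m - k) (?f k) x = - ((-1) ^ (m - k) * dw a b (Suc (m - k)) (?f k) x)"
        by (simp only: power_Suc) simp
    qed
    finally show ?thesis by (simp add: sum_negf)
  qed
  moreover have "quasi_deriv n a b p l m y = (\<lambda>x. \<Sum>k=0..m. (-1) ^ (m - k) * dw a b (m - k) (?f k) x)"
    by (simp add: quasi_deriv_def fun_eq_iff)
  ultimately show ?thesis by simp
qed

lemma S_op_continuous:
  assumes ab: "a < b" and p: "\<And>k. k < n \<Longrightarrow> Ck_on a b (n - k) (\<lambda>x. p k x l)" and pn: "continuous_on {a..b} (\<lambda>x. p n x l)"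
    and y: "Ck_on a b (2 * n) y"
  shows "continuous_on {a..b} (S_op n a b p l y)"
proof -
  have "continuous_on {a..b} (dw a b (n - k) (\<lambda>t. complex_of_real (p k t l) * dw a b (n - k) y t))" if "k \<le> n" for k
  proof (cases "k = n")
    case True
    then show ?thesis using pn Ck_on_cont[OF y, of 0] by (auto intro!: continuous_intros)
  next
    case False
    have "Ck_on a b (n - k) (dw a b (n - k) y)"
      by (rule Ck_on_dw, rule Ck_on_mono[OF y]) auto
    then show ?thesis using False that by (intro Ck_on_cont[OF Ck_on_prod[OF ab p]]) auto
  qed
  then show ?thesis unfolding S_op_def by (intro continuous_intros) auto
qed

text \<open>The boundary expression \<open>F\<close> has a telescoping derivative, namely the
  integrand of the form minus that of the operator.\<close>

lemma green:
  assumes ab: "a < b" and p: "\<And>k. k < n \<Longrightarrow> Ck_on a b (n - k) (\<lambda>x. p k x l)" and pn: "continuous_on {a..b} (\<lambda>x. p n x l)"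
    and y: "Ck_on a b (2 * n) y" and z: "Ck_on a b n z"
  shows "integral {a..b} (\<lambda>x. S_op n a b p l y x * cnj (z x)) =
     (\<Sum>k\<le>n. integral {a..b} (\<lambda>x. complex_of_real (p k x l) * (dw a b (n - k) y x * cnj (dw a b (n - k) z x))))
     + (\<Sum>i<2 * n. vec_index (bv_vee n a b p l y) i * cnj (bw n a b z i))"
proof -
  let ?Q = "\<lambda>m. quasi_deriv n a b p l m y"
  define F where "F x = (\<Sum>m<n. ?Q m x * cnj (dw a b (n - Suc m) z x))" for x
  define I where "I k x = complex_of_real (p k x l) * (dw a b (n - k) y x * cnj (dw a b (n - k) z x))" for k x
  have cp: "continuous_on {a..b} (\<lambda>x. p k x l)" if "k \<le> n" for k
    using pn Ck_on_cont[OF p[of k], of 0] that by (cases "k = n") auto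
  have Ii: "I k integrable_on {a..b}" if "k \<le> n" for k
    unfolding I_def using cp[OF that] y z
    by (intro integrable_continuous_real continuous_intros Ck_on_cont[OF Ck_on_mono[OF y, of n]] Ck_on_cont[OF z]) auto
  have Si: "(\<lambda>x. S_op n a b p l y x * cnj (z x)) integrable_on {a..b}"
    using Ck_on_cont[OF z, of 0] by (intro integrable_continuous_real continuous_intros S_op_continuous[where p = p and l = l, OF ab p pn y]) auto
  have der: "(F has_vector_derivative (\<Sum>k\<le>n. I k x) - S_op n a b p l y x * cnj (z x)) (at x within {a..b})"
    if x: "x \<in> {a..b}" for x
  proof -
    have "(F has_vector_derivative (\<Sum>m<n. ?Q m x * cnj (dw a b (n - m) z x) +
        (complex_of_real (p (Suc m) x l) * dw a b (n - Suc m) y x - ?Q (Suc m) x) * cnj (dw a b (n - Suc m) z x))) (at x within {a..b})"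
      unfolding F_def
    proof (intro has_vector_derivative_sum has_vector_derivative_mult has_vector_derivative_cnj)
      fix m assume "m \<in> {..<n}"
      then have m: "m < n" by simp
      show "(?Q m has_vector_derivative complex_of_real (p (Suc m) x l) * dw a b (n - Suc m) y x - ?Q (Suc m) x) (at x within {a..b})"
        by (rule quasi_deriv_has_derivative[where p = p and l = l, OF ab p y m x])
      have "n - m = Suc (n - Suc m)" using m by simp
      then show "(dw a b (n - Suc m) z has_vector_derivative dw a b (n - m) z x) (at x within {a..b})"
        using Ck_on_deriv[OF z _ x, of "n - Suc m"] m by simp
    qed
    note Fder = this
    have t1: "(\<Sum>m<n. ?Q m x * cnj (dw a b (n - m) z x) +
        (complex_of_real (p (Suc m) x l) * dw a b (n - Suc m) y x - ?Q (Suc m) x) * cnj (dw a b (n - Suc m) z x)) =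
        (\<Sum>m<n. I (Suc m) x) + (\<Sum>m<n. ?Q m x * cnj (dw a b (n - m) z x) - ?Q (Suc m) x * cnj (dw a b (n - Suc m) z x))"
      unfolding sum.distrib[symmetric] I_def by (intro sum.cong refl) (simp add: algebra_simps)
    have t2: "(\<Sum>m<n. ?Q m x * cnj (dw a b (n - m) z x) - ?Q (Suc m) x * cnj (dw a b (n - Suc m) z x)) =
        ?Q 0 x * cnj (dw a b (n - 0) z x) - ?Q n x * cnj (dw a b (n - n) z x)"
      by (rule sum_lessThan_telescope'[of "\<lambda>m. ?Q m x * cnj (dw a b (n - m) z x)"])
    have t3: "?Q 0 x * cnj (dw a b (n - 0) z x) = I 0 x" by (simp add: quasi_deriv_def I_def)
    have t4: "?Q n x * cnj (dw a b (n - n) z x) = S_op n a b p l y x * cnj (z x)" by (simp add: S_op_quasi)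
    have t5: "(\<Sum>k\<le>n. I k x) = I 0 x + (\<Sum>m<n. I (Suc m) x)" by (rule sum.atMost_shift)
    have t6: "s + (i - q) = (i + s) - q" for s i q :: complex by simp
    from Fder show ?thesis unfolding t1 t2 t3 t4 t5 t6 .
  qed
  have "((\<lambda>x. (\<Sum>k\<le>n. I k x) - S_op n a b p l y x * cnj (z x)) has_integral F b - F a) {a..b}"
    using ab der by (intro fundamental_theorem_of_calculus) auto
  moreover have "((\<lambda>x. (\<Sum>k\<le>n. I k x) - S_op n a b p l y x * cnj (z x)) has_integral
      (\<Sum>k\<le>n. integral {a..b} (I k)) - integral {a..b} (\<lambda>x. S_op n a b p l y x * cnj (z x))) {a..b}"
    using Ii Si by (intro has_integral_diff has_integral_sum integrable_integral) auto
  ultimately have "F b - F a = (\<Sum>k\<le>n. integral {a..b} (I k)) - integral {a..b} (\<lambda>x. S_op n a b p l y x * cnj (z x))"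
    by (rule has_integral_unique)
  \<comment> \<open>\<open>bv_vee\<close> lists the quasi-derivatives in descending order and
    negates those at \<open>b\<close>; after reindexing this is F a - F b.\<close>
  moreover have "(\<Sum>i<2 * n. vec_index (bv_vee n a b p l y) i * cnj (bw n a b z i)) = F a - F b"
  proof -
    have Fr: "F x = (\<Sum>i<n. ?Q (n - 1 - i) x * cnj (dw a b i z x))" for x
      unfolding F_def by (rule sum.reindex_bij_witness[of _ "\<lambda>i. n - Suc i" "\<lambda>m. n - Suc m"]) auto
    have "(\<Sum>i<2 * n. vec_index (bv_vee n a b p l y) i * cnj (bw n a b z i)) =
      (\<Sum>i<n. vec_index (bv_vee n a b p l y) i * cnj (bw n a b z i)) + (\<Sum>i<n. vec_index (bv_vee n a b p l y) (n + i) * cnj (bw n a b z (n + i)))"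
      unfolding mult_2 by (rule sum_lessThan_add)
    also have "(\<Sum>i<n. vec_index (bv_vee n a b p l y) i * cnj (bw n a b z i)) = F a"
      unfolding Fr by (intro sum.cong refl) (simp add: bv_vee_def bw_def)
    also have "(\<Sum>i<n. vec_index (bv_vee n a b p l y) (n + i) * cnj (bw n a b z (n + i))) = - F b"
      unfolding Fr sum_negf[symmetric] by (intro sum.cong refl) (simp add: bv_vee_def bw_def)
    finally show ?thesis by simp
  qed
  moreover have "J = S + T" if "u - w = S - J" "T = w - u" for J S T u w :: complex
  proof -
    have "J = S - (S - J)" by simp
    also have "\<dots> = S - (u - w)" unfolding that(1) ..
    finally show ?thesis unfolding that(2) by simp
  qed
  ultimately have "integral {a..b} (\<lambda>x. S_op n a b p l y x * cnj (z x)) = (\<Sum>k\<le>n. integral {a..b} (I k))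
     + (\<Sum>i<2 * n. vec_index (bv_vee n a b p l y) i * cnj (bw n a b z i))" by blast
  then show ?thesis unfolding I_def .
qed

section \<open>The operator as an ordinary differential expression\<close>

definition S_coeffs :: "nat \<Rightarrow> real \<Rightarrow> real \<Rightarrow> (nat \<Rightarrow> real \<Rightarrow> real \<Rightarrow> real) \<Rightarrow> real \<Rightarrow> (nat \<Rightarrow> real \<Rightarrow> complex) \<Rightarrow> bool" where
  "S_coeffs n a b p l c \<longleftrightarrow> (\<forall>i<2 * n. continuous_on {a..b} (c i)) \<and> (\<forall>y x g. Ck_on a b (2 * n - 1) y \<longrightarrow> x \<in> {a..b} \<longrightarrow>
     (dw a b (2 * n - 1) y has_vector_derivative g) (at x within {a..b}) \<longrightarrow>
     S_op n a b p l y x = (\<Sum>i<2 * n. c i x * dw a b i y x) + (-1) ^ n * complex_of_real (p 0 x l) * g)"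

text \<open>Only the highest derivative \<open>g\<close> of \<open>dw (2 n - 1) y\<close> at the point \<open>x\<close> is needed, so the expansion also
  applies at almost every point for \<open>y\<close> in the Sobolev class.\<close>

lemma S_op_expansion:
  assumes ab: "a < b" and n: "n \<ge> 1" and p: "\<And>k. k < n \<Longrightarrow> Ck_on a b (n - k) (\<lambda>x. p k x l)" and pn: "continuous_on {a..b} (\<lambda>x. p n x l)"
  shows "\<exists>c. S_coeffs n a b p l c"
proof -
  define w where "w k j x = (-1) ^ (n - k) * complex_of_real (real (n - k choose j) * dw a b j (\<lambda>x. p k x l) x)" for k j x
  \<comment> \<open>Terms are sorted by the order 2 (n - k) - j of the derivative that falls on
    \<open>y\<close>.\<close>
  define c where "c i x = (\<Sum>k\<le>n. \<Sum>j\<le>n - k. if 2 * (n - k) - j = i then w k j x else 0)" for i x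
  have Cp: "Ck_on a b (n - k) (\<lambda>x. p k x l)" if "k \<le> n" for k
    using p pn that by (cases "k = n") (auto simp: Ck_on_def)
  have "continuous_on {a..b} (w k j)" if "k \<le> n" "j \<le> n - k" for k j
    unfolding w_def using Ck_on_cont[OF Cp[OF that(1)] that(2)] by (intro continuous_intros)
  then have cc: "continuous_on {a..b} (c i)" for i
    unfolding c_def
  proof (intro continuous_on_sum)
    fix k j assume "k \<in> {..n}" "j \<in> {..n - k}"
    then show "continuous_on {a..b} (\<lambda>x. if 2 * (n - k) - j = i then w k j x else 0)"
      using \<open>\<And>k j. k \<le> n \<Longrightarrow> j \<le> n - k \<Longrightarrow> continuous_on {a..b} (w k j)\<close>[of k j] by (cases "2 * (n - k) - j = i") auto
  qed
  have main: "S_op n a b p l y x = (\<Sum>i<2 * n. c i x * dw a b i y x) + (-1) ^ n * complex_of_real (p 0 x l) * g"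
    if y: "Ck_on a b (2 * n - 1) y" and x: "x \<in> {a..b}" and g: "(dw a b (2 * n - 1) y has_vector_derivative g) (at x within {a..b})"
    for y x g
  proof -
    define Y where "Y i = (if i < 2 * n then dw a b i y x else g)" for i
    have expand: "dw a b (n - k) (\<lambda>t. complex_of_real (p k t l) * dw a b (n - k) y t) x =
        (\<Sum>j\<le>n - k. complex_of_real (real (n - k choose j) * dw a b j (\<lambda>x. p k x l) x) * Y (2 * (n - k) - j))" if k: "k \<le> n" for k
    proof (cases "k = 0")
      case False
      have Cy: "Ck_on a b (n - k) (dw a b (n - k) y)"
        using False k by (intro Ck_on_dw Ck_on_mono[OF y]) auto
      have "dw a b (n - k) (\<lambda>t. complex_of_real (p k t l) * dw a b (n - k) y t) x =
        leibniz (\<lambda>j. dw a b j (\<lambda>x. p k x l)) (\<lambda>j. dw a b j (dw a b (n - k) y)) (n - k) x"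
        by (rule dw_prod[OF ab Cp[OF k] Cy order_refl x])
      also have "\<dots> = (\<Sum>j\<le>n - k. complex_of_real (real (n - k choose j) * dw a b j (\<lambda>x. p k x l) x) * Y (2 * (n - k) - j))"
        unfolding leibniz_def
      proof (intro sum.cong refl)
        fix j assume "j \<in> {..n - k}"
        then have "n - k - j + (n - k) = 2 * (n - k) - j" "2 * (n - k) - j < 2 * n" using False k by auto
        then show "real (n - k choose j) *\<^sub>R dw a b j (\<lambda>x. p k x l) x *\<^sub>R dw a b (n - k - j) (dw a b (n - k) y) x =
          complex_of_real (real (n - k choose j) * dw a b j (\<lambda>x. p k x l) x) * Y (2 * (n - k) - j)"
          by (simp add: dw_dw Y_def scaleR_conv_of_real)
      qed
      finally show ?thesis .
    next
      case True
      \<comment> \<open>Only k = 0 reaches order 2 n. The chain of \<open>y\<close> is then one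
        member too short, so the number \<open>g\<close> completes it, and the last derivative of
        the product is taken at the point \<open>x\<close> alone.\<close>
      define G where "G j t = (if j < n then dw a b (j + n) y t else g)" for j t
      let ?P = "\<lambda>j. dw a b j (\<lambda>x. p 0 x l)"
      have C0: "Ck_on a b n (\<lambda>x. p 0 x l)" using Cp[of 0] by simp
      have Cy: "Ck_on a b (n - 1) (dw a b n y)" using n by (intro Ck_on_dw Ck_on_mono[OF y]) auto
      have eq: "dw a b (n - 1) (\<lambda>t. complex_of_real (p 0 t l) * dw a b n y t) t = leibniz ?P G (n - 1) t" if "t \<in> {a..b}" for t
      proof -
        have "dw a b (n - 1) (\<lambda>t. complex_of_real (p 0 t l) * dw a b n y t) t = leibniz ?P (\<lambda>j. dw a b j (dw a b n y)) (n - 1) t"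
          by (rule dw_prod[OF ab Ck_on_mono[OF C0] Cy order_refl that]) simp
        also have "\<dots> = leibniz ?P G (n - 1) t"
          unfolding leibniz_def using n by (intro sum.cong refl) (auto simp: G_def dw_dw)
        finally show ?thesis .
      qed
      have "(leibniz ?P G (n - 1) has_vector_derivative leibniz ?P G (Suc (n - 1)) x) (at x within {a..b})"
      proof (rule leibniz_deriv)
        fix j assume j: "j \<le> n - 1"
        show "(?P j has_vector_derivative ?P (Suc j) x) (at x within {a..b})"
          using j n by (intro Ck_on_deriv[OF C0 _ x]) auto
        have Gj: "G j = dw a b (j + n) y" using j n by (auto simp: G_def fun_eq_iff)
        show "(G j has_vector_derivative G (Suc j) x) (at x within {a..b})"
        proof (cases "Suc j < n")
          case True
          then have "(dw a b (j + n) y has_vector_derivative dw a b (Suc (j + n)) y x) (at x within {a..b})"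
            by (intro Ck_on_deriv[OF y _ x]) auto
          then show ?thesis unfolding Gj using True by (simp add: G_def)
        next
          case False
          then have "j + n = 2 * n - 1" using j n by auto
          then show ?thesis unfolding Gj using g False by (simp add: G_def)
        qed
      qed
      moreover have Suc: "Suc (n - 1) = n" using n by simp
      ultimately have "(leibniz ?P G (n - 1) has_vector_derivative leibniz ?P G n x) (at x within {a..b})" by (simp only:)
      with eq have "(dw a b (n - 1) (\<lambda>t. complex_of_real (p 0 t l) * dw a b n y t) has_vector_derivative leibniz ?P G n x) (at x within {a..b})"
        by - (rule has_vector_derivative_transform[OF x], assumption+)
      from vector_derivative_within_closed_interval[OF ab x this]
      have "dw a b (Suc (n - 1)) (\<lambda>t. complex_of_real (p 0 t l) * dw a b n y t) x = leibniz ?P G n x"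
        unfolding dw.simps(2) .
      then have "dw a b n (\<lambda>t. complex_of_real (p 0 t l) * dw a b n y t) x = leibniz ?P G n x" unfolding Suc .
      moreover have "leibniz ?P G n x = (\<Sum>j\<le>n. complex_of_real (real (n choose j) * ?P j x) * Y (2 * n - j))"
        unfolding leibniz_def
      proof (intro sum.cong refl)
        fix j assume "j \<in> {..n}"
        then have "G (n - j) x = Y (2 * n - j)" using n by (auto simp: G_def Y_def mult_2)
        then show "real (n choose j) *\<^sub>R ?P j x *\<^sub>R G (n - j) x = complex_of_real (real (n choose j) * ?P j x) * Y (2 * n - j)"
          by (simp add: scaleR_conv_of_real)
      qed
      ultimately show ?thesis using True by simp
    qed
    have "S_op n a b p l y x = (\<Sum>k\<le>n. \<Sum>j\<le>n - k. w k j x * Y (2 * (n - k) - j))"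
      unfolding S_op_def atLeast0AtMost w_def using expand by (intro sum.cong refl) (simp add: sum_distrib_left mult.assoc)
    also have "\<dots> = (\<Sum>k\<le>n. \<Sum>j\<le>n - k. \<Sum>i\<le>2 * n. (if 2 * (n - k) - j = i then w k j x else 0) * Y i)"
    proof (intro sum.cong refl)
      fix k j assume "k \<in> {..n}" "j \<in> {..n - k}"
      then have "2 * (n - k) - j \<le> 2 * n" by auto
      then show "w k j x * Y (2 * (n - k) - j) = (\<Sum>i\<le>2 * n. (if 2 * (n - k) - j = i then w k j x else 0) * Y i)"
        by (simp add: if_distrib[of "\<lambda>t. t * _"] cong: if_cong)
    qed
    also have "\<dots> = (\<Sum>k\<le>n. \<Sum>i\<le>2 * n. \<Sum>j\<le>n - k. (if 2 * (n - k) - j = i then w k j x else 0) * Y i)"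
      by (intro sum.cong refl sum.swap)
    also have "\<dots> = (\<Sum>i\<le>2 * n. \<Sum>k\<le>n. \<Sum>j\<le>n - k. (if 2 * (n - k) - j = i then w k j x else 0) * Y i)"
      by (rule sum.swap)
    also have "\<dots> = (\<Sum>i\<le>2 * n. c i x * Y i)"
      unfolding c_def sum_distrib_right ..
    also have "\<dots> = (\<Sum>i<2 * n. c i x * Y i) + c (2 * n) x * Y (2 * n)"
      by (simp add: lessThan_Suc_atMost[symmetric])
    also have "(\<Sum>i<2 * n. c i x * Y i) = (\<Sum>i<2 * n. c i x * dw a b i y x)"
      by (intro sum.cong refl) (simp add: Y_def)
    also have "c (2 * n) x = w 0 0 x"
    proof -
      \<comment> \<open>The order 2 n is attained only for k = j = 0, so this coefficient is the
        leading one.\<close>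
      have "(\<Sum>j\<le>n - k. if 2 * (n - k) - j = 2 * n then w k j x else 0) = (if k = 0 then w 0 0 x else 0)" if "k \<le> n" for k
      proof -
        have "(\<Sum>j\<le>n - k. if 2 * (n - k) - j = 2 * n then w k j x else 0) = (\<Sum>j\<le>n - k. if j = 0 then (if k = 0 then w 0 0 x else 0) else 0)"
          using n that by (intro sum.cong refl) auto
        then show ?thesis by simp
      qed
      then have "c (2 * n) x = (\<Sum>k\<le>n. if k = 0 then w 0 0 x else 0)"
        unfolding c_def by (intro sum.cong) auto
      then show ?thesis by simp
    qed
    also have "w 0 0 x * Y (2 * n) = (-1) ^ n * complex_of_real (p 0 x l) * g" by (simp add: w_def Y_def)
    finally show ?thesis .
  qed
  show ?thesis
    unfolding S_coeffs_def
  proof (intro exI[of _ c] conjI allI impI)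
    show "continuous_on {a..b} (c i)" for i by (rule cc)
  qed (rule main)
qed

section \<open>Regularity\<close>

text \<open>Division by the nonvanishing leading coefficient brings the equation into the normal
  form of a scalar linear equation.\<close>

lemma S_ode:
  assumes ab: "a < b" and n: "n \<ge> 1" and p: "\<And>k. k < n \<Longrightarrow> Ck_on a b (n - k) (\<lambda>x. p k x l)" and pn: "continuous_on {a..b} (\<lambda>x. p n x l)"
    and p0: "\<And>x. x \<in> {a..b} \<Longrightarrow> p 0 x l > 0" and f: "continuous_on {a..b} f"
  shows "\<exists>y. Ck_on a b (2 * n) y \<and> (\<forall>x. x \<notin> {a..b} \<longrightarrow> y x = 0) \<and> (\<forall>i<2 * n. dw a b i y a = \<eta> i) \<and>
     (\<forall>x\<in>{a..b}. S_op n a b p l y x = f x)"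
proof -
  have "\<exists>c. S_coeffs n a b p l c" by (rule S_op_expansion[where p = p and l = l and n = n, OF ab n _ pn]) (rule p)
  then obtain c where coeffs: "S_coeffs n a b p l c" by (elim exE) (rule that)
  note c = conjunct1[OF coeffs[unfolded S_coeffs_def]] and S = conjunct2[OF coeffs[unfolded S_coeffs_def]]
  define q where "q x = (-1) ^ n * complex_of_real (p 0 x l)" for x
  have q0: "q x \<noteq> 0" if "x \<in> {a..b}" for x using p0[OF that] by (simp add: q_def)
  have cp0: "continuous_on {a..b} (\<lambda>x. p 0 x l)" using Ck_on_cont[OF p[of 0], of 0] n by simp
  have cq: "continuous_on {a..b} q" unfolding q_def using cp0 by (intro continuous_intros)
  have "\<exists>y. Ck_on a b (2 * n) y \<and> (\<forall>i<2 * n. dw a b i y a = \<eta> i) \<and>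
     (\<forall>x\<in>{a..b}. dw a b (2 * n) y x = (\<Sum>i<2 * n. (- c i x / q x) * dw a b i y x) + f x / q x)"
  proof (rule linear_ode_scalar[OF ab])
    show "continuous_on {a..b} (\<lambda>x. - c i x / q x)" if "i < 2 * n" for i
      using c that cq q0 by (intro continuous_intros) auto
    show "continuous_on {a..b} (\<lambda>x. f x / q x)" using f cq q0 by (intro continuous_intros) auto
  qed (use n in simp)
  then obtain y0 where y0: "Ck_on a b (2 * n) y0" "\<forall>i<2 * n. dw a b i y0 a = \<eta> i"
     "\<forall>x\<in>{a..b}. dw a b (2 * n) y0 x = (\<Sum>i<2 * n. (- c i x / q x) * dw a b i y0 x) + f x / q x" by (elim exE conjE) (rule that)
  \<comment> \<open>The solution is cut off outside [a,b]; derivatives within the interval are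
    unaffected.\<close>
  define y where "y x = (if x \<in> {a..b} then y0 x else 0)" for x
  have eq: "dw a b i y x = dw a b i y0 x" if "x \<in> {a..b}" for i x
    by (rule dw_cong[OF _ that]) (simp add: y_def)
  have Cy: "Ck_on a b (2 * n) y" using y0(1) Ck_on_cong[of a b y y0 "2 * n"] by (simp add: y_def)
  show ?thesis
  proof (intro exI[of _ y] conjI allI ballI impI)
    show "dw a b i y a = \<eta> i" if "i < 2 * n" for i using eq[of a i] y0(2) that ab by simp
    fix x assume x: "x \<in> {a..b}"
    have "(dw a b (2 * n - 1) y has_vector_derivative dw a b (Suc (2 * n - 1)) y x) (at x within {a..b})"
      using n by (intro Ck_on_deriv[OF Cy _ x]) simp
    moreover have "Suc (2 * n - 1) = 2 * n" using n by simp
    ultimately have "(dw a b (2 * n - 1) y has_vector_derivative dw a b (2 * n) y x) (at x within {a..b})" by (simp del: dw.simps)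
    moreover have "Ck_on a b (2 * n - 1) y" by (rule Ck_on_mono[OF Cy]) simp
    ultimately have "S_op n a b p l y x = (\<Sum>i<2 * n. c i x * dw a b i y x) + q x * dw a b (2 * n) y x"
      using S x unfolding q_def by (simp del: dw.simps)
    also have "dw a b (2 * n) y x = (\<Sum>i<2 * n. (- c i x / q x) * dw a b i y x) + f x / q x"
      using y0(3) x by (simp add: eq del: dw.simps)
    also have "q x * ((\<Sum>i<2 * n. (- c i x / q x) * dw a b i y x) + f x / q x) = - (\<Sum>i<2 * n. c i x * dw a b i y x) + f x"
    proof -
      have "q x * (\<Sum>i<2 * n. (- c i x / q x) * dw a b i y x) = (\<Sum>i<2 * n. - (c i x * dw a b i y x))"
        unfolding sum_distrib_left using q0[OF x] by (intro sum.cong refl) simp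
      moreover have "q x * (f x / q x) = f x" using q0[OF x] by simp
      ultimately show ?thesis unfolding distrib_left by (simp only: sum_negf)
    qed
    finally show "S_op n a b p l y x = f x" by simp
  next
    show "y x = 0" if "x \<notin> {a..b}" for x unfolding y_def by (rule if_not_P[OF that])
  qed (rule Cy)
qed

section \<open>Sobolev class and classical solutions\<close>

lemma W2_of_Ck:
  assumes ab: "a < b" and n: "n \<ge> 1" and y: "Ck_on a b (2 * n) y"
  shows "W2 a b (2 * n) y"
  unfolding W2_def
proof (intro conjI exI[of _ "dw a b (2 * n) y"] ballI)
  show "Ck_on a b (2 * n - 1) y" by (rule Ck_on_mono[OF y]) simp
  have c: "continuous_on {a..b} (dw a b (2 * n) y)" by (rule Ck_on_cont[OF y order_refl])
  show "set_borel_measurable lborel {a..b} (dw a b (2 * n) y)"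
    using borel_integrable_atLeastAtMost'[OF c] unfolding set_integrable_def set_borel_measurable_def
    by (rule borel_measurable_integrable)
  show "set_integrable lborel {a..b} (\<lambda>t. (cmod (dw a b (2 * n) y t))\<^sup>2)"
    by (intro borel_integrable_atLeastAtMost' continuous_intros c)
  fix x assume x: "x \<in> {a..b}"
  have cx: "continuous_on {a..x} (dw a b (2 * n) y)" using c by (rule continuous_on_subset) (use x in auto)
  have "(dw a b (2 * n) y has_integral dw a b (2 * n - 1) y x - dw a b (2 * n - 1) y a) {a..x}"
  proof (rule fundamental_theorem_of_calculus)
    show "a \<le> x" using x by simp
    fix t assume t: "t \<in> {a..x}"
    have "(dw a b (2 * n - 1) y has_vector_derivative dw a b (Suc (2 * n - 1)) y t) (at t within {a..b})"
      using n t x by (intro Ck_on_deriv[OF y]) auto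
    moreover have "Suc (2 * n - 1) = 2 * n" using n by simp
    ultimately show "(dw a b (2 * n - 1) y has_vector_derivative dw a b (2 * n) y t) (at t within {a..x})"
      using x by (auto intro: has_vector_derivative_within_subset simp del: dw.simps)
  qed
  then show "dw a b (2 * n - 1) y x = dw a b (2 * n - 1) y a + (LINT t:{a..x}|lborel. dw a b (2 * n) y t)"
    using set_borel_integral_eq_integral(2)[OF borel_integrable_atLeastAtMost'[OF cx]] by (simp add: integral_unique del: dw.simps)
qed

text \<open>The library only differentiates integrals from the right; the left derivative comes from reflecting.\<close>

lemma integral_has_vector_derivative_ae:
  fixes f :: "real \<Rightarrow> complex"
  assumes f: "f integrable_on {a..b}"
  shows "\<exists>N. negligible N \<and> (\<forall>x\<in>{a<..<b} - N. ((\<lambda>u. integral {a..u} f) has_vector_derivative f x) (at x within {a..b}))"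
proof -
  define g where "g x = (if x \<in> {a..b} then f x else 0)" for x
  have gU: "g integrable_on UNIV" unfolding g_def by (rule integrable_restrict_UNIV[THEN iffD2, OF f])
  have g1: "g integrable_on cbox u v" for u v :: real by (rule integrable_on_subcbox[OF gU]) simp
  have g2: "(\<lambda>x. g (- x)) integrable_on cbox u v" for u v :: real
    using g1[of "- v" "- u"] integrable_reflect[of g "- u" "- v"] by simp
  obtain N1 where N1: "negligible N1" "\<And>x e. \<lbrakk>x \<notin> N1; 0 < e\<rbrakk> \<Longrightarrow> \<exists>d>0. \<forall>h. 0 < h \<and> h < d \<longrightarrow>
       norm (integral (cbox x (x + h *\<^sub>R One)) g /\<^sub>R h ^ DIM(real) - g x) < e"
    using integrable_ccontinuous_explicit[OF g1] by blast
  obtain N2 where N2: "negligible N2" "\<And>x e. \<lbrakk>x \<notin> N2; 0 < e\<rbrakk> \<Longrightarrow> \<exists>d>0. \<forall>h. 0 < h \<and> h < d \<longrightarrow>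
       norm (integral (cbox x (x + h *\<^sub>R One)) (\<lambda>x. g (- x)) /\<^sub>R h ^ DIM(real) - g (- x)) < e"
    using integrable_ccontinuous_explicit[OF g2] by blast
  have neg: "negligible (N1 \<union> uminus ` N2)"
  proof (intro negligible_Un N1(1))
    have "(\<lambda>x. - x) differentiable_on N2" by (intro derivative_intros)
    then show "negligible (uminus ` N2)"
      using negligible_differentiable_image_negligible[OF order_refl N2(1)] by simp
  qed
  have "((\<lambda>u. integral {a..u} f) has_vector_derivative f x) (at x within {a..b})"
    if x: "x \<in> {a<..<b}" "x \<notin> N1" "- x \<notin> N2" for x
  proof -
    have scale: "norm (J - h *\<^sub>R c) \<le> e * h" if "h > 0" "norm (J /\<^sub>R h ^ DIM(real) - c) < e" for J c :: complex and h e :: real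
    proof -
      have "J - h *\<^sub>R c = h *\<^sub>R (J /\<^sub>R h ^ DIM(real) - c)" using that(1) by (simp add: scaleR_diff_right)
      then have "norm (J - h *\<^sub>R c) = h * norm (J /\<^sub>R h ^ DIM(real) - c)" using that(1) by simp
      also have "\<dots> \<le> h * e" using that by (intro mult_left_mono) auto
      finally show ?thesis by (simp add: mult.commute)
    qed
    have ff: "integral {u..w} g = integral {u..w} f" if "a \<le> u" "w \<le> b" for u w
      using that by (intro integral_cong) (auto simp: g_def)
    have fi: "f integrable_on {a..w}" if "w \<le> b" for w
      by (rule integrable_on_subinterval[OF f]) (use that in auto)
    have gx: "g x = f x" using x by (simp add: g_def)
    have "\<exists>d>0. \<forall>u\<in>{a..b}. norm (u - x) < d \<longrightarrow>
       norm (integral {a..u} f - integral {a..x} f - (u - x) *\<^sub>R f x) \<le> e * norm (u - x)" if e: "e > 0" for e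
    proof -
      obtain d1 where d1: "d1 > 0" "\<And>h. 0 < h \<Longrightarrow> h < d1 \<Longrightarrow> norm (integral (cbox x (x + h *\<^sub>R One)) g /\<^sub>R h ^ DIM(real) - g x) < e"
        using N1(2)[OF x(2) e] by blast
      obtain d2 where d2: "d2 > 0" "\<And>h. 0 < h \<Longrightarrow> h < d2 \<Longrightarrow>
         norm (integral (cbox (- x) (- x + h *\<^sub>R One)) (\<lambda>x. g (- x)) /\<^sub>R h ^ DIM(real) - g (- (- x))) < e"
        using N2(2)[OF x(3) e] by blast
      show ?thesis
      proof (intro exI[of _ "min d1 d2"] conjI ballI impI)
        show "min d1 d2 > 0" using d1 d2 by simp
        fix u assume u: "u \<in> {a..b}" and d: "norm (u - x) < min d1 d2"
        consider "u = x" | "u > x" | "u < x" by linarith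
        then show "norm (integral {a..u} f - integral {a..x} f - (u - x) *\<^sub>R f x) \<le> e * norm (u - x)"
        proof cases
          case 2
          define h where "h = u - x"
          have h: "0 < h" "h < d1" "u = x + h" using 2 d by (auto simp: h_def)
          have "integral {a..x} f + integral {x..u} f = integral {a..u} f"
            using x u 2 Henstock_Kurzweil_Integration.integral_combine[of a x u f] fi[of u] by auto
          moreover have "norm (integral {x..u} f - h *\<^sub>R f x) \<le> e * h"
            using scale[OF h(1) d1(2)[OF h(1,2)]] ff[of x u] x u h(3) gx by simp
          moreover have "integral {a..u} f - integral {a..x} f = integral {x..u} f" if "integral {a..x} f + integral {x..u} f = integral {a..u} f"
            using that by (metis add_diff_cancel_left')
          ultimately show ?thesis using h(1) unfolding h_def by simp
        next
          case 3
          define h where "h = x - u"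
          have h: "0 < h" "h < d2" "u = x - h" using 3 d by (auto simp: h_def)
          have comb: "integral {a..u} f + integral {u..x} f = integral {a..x} f"
            using x u 3 Henstock_Kurzweil_Integration.integral_combine[of a u x f] fi[of x] by auto
          have "integral (cbox (- x) (- x + h *\<^sub>R One)) (\<lambda>x. g (- x)) = integral {u..x} g"
            using integral_reflect[of x u g] h(3) by simp
          then have "norm (integral {u..x} f - h *\<^sub>R f x) \<le> e * h"
            using scale[OF h(1) d2(2)[OF h(1,2)]] ff[of u x] x u gx by simp
          moreover have "integral {a..u} f - integral {a..x} f - (u - x) *\<^sub>R f x = - (integral {u..x} f - h *\<^sub>R f x)"
            unfolding comb[symmetric] h_def by (simp add: scaleR_diff_left)
          ultimately show ?thesis using h(1) unfolding h_def by (simp only: norm_minus_cancel) simp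
        qed simp
      qed
    qed
    then show ?thesis
      unfolding has_vector_derivative_def has_derivative_within_alt
      by (auto simp: bounded_linear_scaleR_left)
  qed
  moreover have "- x \<notin> N2" if "x \<notin> uminus ` N2" for x :: real using that by force
  ultimately show ?thesis using neg by (intro exI[of _ "N1 \<union> uminus ` N2"] conjI ballI) auto
qed

text \<open>The equation, valid almost everywhere, determines the weak top derivative as a
  continuous function \<open>G\<close> of the lower derivatives. Hence the derivative of order 2 n -
  1 is an integral of \<open>G\<close>, the function is classical, and the equation holds at every
  point.\<close>

lemma W2_regular:
  assumes ab: "a < b" and n: "n \<ge> 1" and p: "\<And>k. k < n \<Longrightarrow> Ck_on a b (n - k) (\<lambda>x. p k x l)" and pn: "continuous_on {a..b} (\<lambda>x. p n x l)"
    and p0: "\<And>x. x \<in> {a..b} \<Longrightarrow> p 0 x l > 0" and y: "W2 a b (2 * n) y"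
    and ae: "AE x in lborel. x \<in> {a..b} \<longrightarrow> S_op n a b p l y x = \<mu> * y x"
  shows "Ck_on a b (2 * n) y \<and> (\<forall>x\<in>{a..b}. S_op n a b p l y x = \<mu> * y x)"
proof -
  let ?y = "dw a b (2 * n - 1) y"
  have Cy: "Ck_on a b (2 * n - 1) y" using y by (simp add: W2_def)
  obtain g where gm: "set_borel_measurable lborel {a..b} g" and g2: "set_integrable lborel {a..b} (\<lambda>t. (cmod (g t))\<^sup>2)"
    and gy: "\<And>x. x \<in> {a..b} \<Longrightarrow> ?y x = ?y a + (LINT t:{a..x}|lborel. g t)"
    using y unfolding W2_def by blast
  have gi: "set_integrable lborel {a..b} g"
  proof -
    have "set_integrable lborel {a..b} (\<lambda>t. 1 + (cmod (g t))\<^sup>2)"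
      by (intro set_integral_add(1) g2 borel_integrable_atLeastAtMost' continuous_intros)
    then show ?thesis
    proof (rule set_integrable_bound)
      show "AE x in lborel. x \<in> {a..b} \<longrightarrow> norm (g x) \<le> norm (1 + (cmod (g x))\<^sup>2)"
      proof (intro AE_I2 impI)
        fix x
        have "0 \<le> (cmod (g x) - 1)\<^sup>2" by simp
        then have "2 * cmod (g x) \<le> (cmod (g x))\<^sup>2 + 1" by (simp add: power2_diff)
        then have "cmod (g x) \<le> 1 + (cmod (g x))\<^sup>2" using norm_ge_zero[of "g x"] by linarith
        then show "norm (g x) \<le> norm (1 + (cmod (g x))\<^sup>2)" by simp
      qed
    qed (rule gm)
  qed
  have gI: "g integrable_on {a..b}" using set_borel_integral_eq_integral(1)[OF gi] .
  have gy': "?y x = ?y a + integral {a..x} g" if x: "x \<in> {a..b}" for x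
  proof -
    have "set_integrable lborel {a..x} g" by (rule set_integrable_subset[OF gi]) (use x in auto)
    then show ?thesis using gy[OF x] set_borel_integral_eq_integral(2) by metis
  qed
  have "\<exists>c. S_coeffs n a b p l c" by (rule S_op_expansion[where p = p and l = l and n = n, OF ab n _ pn]) (rule p)
  then obtain c where coeffs: "S_coeffs n a b p l c" by (elim exE) (rule that)
  note c = conjunct1[OF coeffs[unfolded S_coeffs_def]] and S = conjunct2[OF coeffs[unfolded S_coeffs_def]]
  define q where "q x = (-1) ^ n * complex_of_real (p 0 x l)" for x
  have q0: "q x \<noteq> 0" if "x \<in> {a..b}" for x using p0[OF that] by (simp add: q_def)
  have cp0: "continuous_on {a..b} (\<lambda>x. p 0 x l)" using Ck_on_cont[OF p[of 0], of 0] n by simp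
  have cq: "continuous_on {a..b} q" unfolding q_def using cp0 by (intro continuous_intros)
  define G where "G x = (\<mu> * y x - (\<Sum>i<2 * n. c i x * dw a b i y x)) / q x" for x
  have cG: "continuous_on {a..b} G"
    unfolding G_def using c cq q0 Ck_on_cont[OF Cy, of 0] Ck_on_cont[OF Cy] by (intro continuous_intros) auto
  obtain N1 where N1: "negligible N1" "\<forall>x\<in>{a<..<b} - N1. ((\<lambda>u. integral {a..u} g) has_vector_derivative g x) (at x within {a..b})"
    using integral_has_vector_derivative_ae[OF gI] by blast
  have "AE x in lebesgue. x \<in> {a..b} \<longrightarrow> S_op n a b p l y x = \<mu> * y x" using ae by (rule AE_completion)
  then obtain N2 where N2: "\<And>x. x \<in> space lebesgue - N2 \<Longrightarrow> x \<in> {a..b} \<longrightarrow> S_op n a b p l y x = \<mu> * y x" "N2 \<in> null_sets lebesgue"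
    by (rule AE_E3) (rule that, assumption+)
  \<comment> \<open>The endpoints are included in the exceptional set because the integral is
    differentiated at interior points only.\<close>
  define N where "N = N1 \<union> N2 \<union> {a, b}"
  have N: "negligible N" unfolding N_def
    using N1(1) N2(2) by (intro negligible_Un) (auto simp: negligible_iff_null_sets)
  have gG: "g x = G x" if x: "x \<in> {a..b} - N" for x
  proof -
    have xx: "x \<in> {a<..<b} - N1" "x \<in> {a..b}" "x \<notin> N2" using x by (auto simp: N_def)
    have "((\<lambda>u. ?y a + integral {a..u} g) has_vector_derivative g x) (at x within {a..b})"
      using N1(2) xx(1) by (auto intro!: derivative_eq_intros)
    with gy' have "(?y has_vector_derivative g x) (at x within {a..b})"
      by - (rule has_vector_derivative_transform[OF xx(2)], assumption+)
    then have "S_op n a b p l y x = (\<Sum>i<2 * n. c i x * dw a b i y x) + q x * g x"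
      using S Cy xx(2) by (simp add: q_def)
    moreover have "S_op n a b p l y x = \<mu> * y x" using N2(1)[of x] xx by simp
    ultimately have "q x * g x = \<mu> * y x - (\<Sum>i<2 * n. c i x * dw a b i y x)" by simp
    then show ?thesis unfolding G_def using q0[OF xx(2)] by (simp add: nonzero_eq_divide_eq mult.commute)
  qed
  have yG: "?y x = ?y a + integral {a..x} G" if x: "x \<in> {a..b}" for x
  proof -
    have "integral {a..x} G = integral {a..x} g"
      by (rule integral_spike[OF N]) (use gG x in auto)
    then show ?thesis using gy'[OF x] by simp
  qed
  have derG: "(?y has_vector_derivative G x) (at x within {a..b})" if x: "x \<in> {a..b}" for x
  proof (rule has_vector_derivative_transform[OF x])
    show "((\<lambda>u. ?y a + integral {a..u} G) has_vector_derivative G x) (at x within {a..b})"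
      using integral_has_vector_derivative[OF cG x] by (auto intro!: derivative_eq_intros)
  qed (rule yG)
  define F where "F i x = (if i < 2 * n then dw a b i y x else G x)" for i x
  have Fd: "(F i has_vector_derivative F (Suc i) x) (at x within {a..b})" if i: "i < 2 * n" and x: "x \<in> {a..b}" for i x
  proof -
    have Fi: "F i = dw a b i y" using i by (auto simp: F_def fun_eq_iff)
    show ?thesis
    proof (cases "Suc i < 2 * n")
      case True
      then have "(dw a b i y has_vector_derivative dw a b (Suc i) y x) (at x within {a..b})"
        by (intro Ck_on_deriv[OF Cy _ x]) simp
      then show ?thesis unfolding Fi using True by (simp add: F_def)
    next
      case False
      then have "i = 2 * n - 1" using i by simp
      then show ?thesis unfolding Fi using derG[OF x] False by (simp add: F_def)
    qed
  qed
  have F0: "F 0 x = y x" for x using n by (simp add: F_def)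
  have "F (2 * n) = G" by (simp add: F_def fun_eq_iff)
  then have "Ck_on a b (2 * n) y"
    using Fd F0 cG by (intro Ck_onI[where F = F, OF ab]) auto
  moreover have "S_op n a b p l y x = \<mu> * y x" if x: "x \<in> {a..b}" for x
  proof -
    have "S_op n a b p l y x = (\<Sum>i<2 * n. c i x * dw a b i y x) + q x * G x"
      using S Cy x derG[OF x] by (simp add: q_def)
    then show ?thesis using q0[OF x] by (simp add: G_def)
  qed
  ultimately show ?thesis by blast
qed

section \<open>Test functionals\<close>

text \<open>Cauchy-Schwarz against the constant 1: the inequality 2 x \<le> t x^2 + 1/t is
  integrated, and \<open>t\<close> is chosen optimally as (w - u) / T.\<close>

lemma norm_integral_sq_le:
  fixes f :: "real \<Rightarrow> complex"
  assumes uw: "u < w" and f: "continuous_on {u..w} f"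
  shows "(integral {u..w} (\<lambda>x. cmod (f x)))\<^sup>2 \<le> (w - u) * energy u w f"
proof -
  define T where "T = integral {u..w} (\<lambda>x. cmod (f x))"
  have T0: "T \<ge> 0" unfolding T_def using f by (intro integral_nonneg integrable_continuous_real continuous_intros) auto
  have "T\<^sup>2 \<le> (w - u) * energy u w f"
  proof (cases "T = 0")
    case True
    then show ?thesis using uw energy_nonneg[of u w f] by simp
  next
    case False
    then have T: "T > 0" using T0 by simp
    define t where "t = (w - u) / T"
    have t: "t > 0" using T uw by (simp add: t_def)
    have "integral {u..w} (\<lambda>x. 2 * cmod (f x)) \<le> integral {u..w} (\<lambda>x. t * (cmod (f x))\<^sup>2 + 1 / t)"
    proof (rule integral_le)
      fix x
      have "0 \<le> (t * cmod (f x) - 1)\<^sup>2" by simp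
      then have "2 * t * cmod (f x) \<le> t\<^sup>2 * (cmod (f x))\<^sup>2 + 1" by (simp add: power2_diff power_mult_distrib)
      then have "(2 * t * cmod (f x)) / t \<le> (t\<^sup>2 * (cmod (f x))\<^sup>2 + 1) / t" using t by (intro divide_right_mono) auto
      then show "2 * cmod (f x) \<le> t * (cmod (f x))\<^sup>2 + 1 / t" using t by (simp add: add_divide_distrib power2_eq_square)
    qed (use f in \<open>auto intro!: integrable_continuous_real continuous_intros\<close>)
    also have "\<dots> = t * energy u w f + (w - u) / t"
      using f uw by (subst integral_add) (auto simp: energy_def intro!: integrable_continuous_real continuous_intros)
    also have "(w - u) / t = T" using T uw by (simp add: t_def)
    finally have "2 * T \<le> t * energy u w f + T" by (simp add: T_def)
    then have "T \<le> t * energy u w f" by simp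
    then have "T * T \<le> T * (t * energy u w f)" using T by (intro mult_left_mono) auto
    also have "T * (t * energy u w f) = (w - u) * energy u w f" using T by (simp add: t_def)
    finally show ?thesis by (simp add: power2_eq_square)
  qed
  then show ?thesis by (simp add: T_def)
qed

text \<open>A cellwise Poincare inequality: a vanishing weighted mean bounds \<open>y\<close> on the
  cell by its variation there, so its energy is at most h^2 times that of y'. The weights are
  continuous bumps and not indicator functions, because they become right-hand sides of a classical
  differential equation; evaluation at cell midpoints gives their independence.\<close>

lemma tent_functionals:
  assumes ab: "a < b" and eps: "\<epsilon> > 0"
  shows "\<exists>(m::nat) (e::nat \<Rightarrow> real \<Rightarrow> real). (\<forall>i<m. continuous_on {a..b} (e i)) \<and>
    (\<forall>c. (\<forall>x\<in>{a..b}. (\<Sum>i<m. c i * complex_of_real (e i x)) = 0) \<longrightarrow> (\<forall>i<m. c i = 0)) \<and>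
    (\<forall>y. Ck_on a b 1 y \<longrightarrow> (\<forall>i<m. integral {a..b} (\<lambda>x. y x * complex_of_real (e i x)) = 0) \<longrightarrow>
       energy a b y \<le> \<epsilon> * energy a b (dw a b 1 y))"
proof -
  \<comment> \<open>The mesh is fine enough for h^2 \<le> \<epsilon>; the successor taken next
    guarantees at least one cell.\<close>
  obtain m0 :: nat where m0: "(b - a) / sqrt \<epsilon> < real m0" using reals_Archimedean2 by blast
  define m where "m = Suc m0"
  define h where "h = (b - a) / real m"
  have h: "h > 0" "h\<^sup>2 \<le> \<epsilon>" "real m * h = b - a"
  proof -
    show "h > 0" using ab by (simp add: h_def m_def)
    have "(b - a) / sqrt \<epsilon> < real m" using m0 by (simp add: m_def)
    then have "b - a < real m * sqrt \<epsilon>" using eps by (simp add: pos_divide_less_eq)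
    then have "h \<le> sqrt \<epsilon>" unfolding h_def by (simp add: pos_divide_le_eq m_def mult.commute)
    then have "h\<^sup>2 \<le> (sqrt \<epsilon>)\<^sup>2" using \<open>h > 0\<close> by (intro power_mono) auto
    then show "h\<^sup>2 \<le> \<epsilon>" using eps by simp
    show "real m * h = b - a" by (simp add: h_def m_def)
  qed
  define X where "X i = a + real i * h" for i
  have X0: "X 0 = a" and Xm: "X m = b" using h(3) by (simp_all add: X_def)
  have XS: "X (Suc i) = X i + h" for i by (simp add: X_def algebra_simps)
  have Xmono: "X i \<le> X j" if "i \<le> j" for i j using that h(1) by (simp add: X_def)
  have XI: "a \<le> X i" "X i \<le> b" if "i \<le> m" for i using Xmono[of 0 i] Xmono[of i m] that X0 Xm by auto
  define e where "e i x = max 0 ((x - X i) * (X (Suc i) - x))" for i x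
  have e0: "e i x \<ge> 0" for i x by (simp add: e_def)
  have ez: "e i x = 0" if "x \<le> X i \<or> X (Suc i) \<le> x" for i x
  proof -
    have "(x - X i) * (X (Suc i) - x) \<le> 0" using that
    proof
      assume "x \<le> X i"
      moreover have "X (Suc i) - x \<ge> 0" using \<open>x \<le> X i\<close> XS[of i] h(1) by linarith
      ultimately show ?thesis by (intro mult_nonpos_nonneg) auto
    next
      assume "X (Suc i) \<le> x"
      moreover have "x - X i \<ge> 0" using \<open>X (Suc i) \<le> x\<close> XS[of i] h(1) by linarith
      ultimately show ?thesis by (intro mult_nonneg_nonpos) auto
    qed
    then show ?thesis by (simp add: e_def)
  qed
  have ce: "continuous_on S (e i)" for S i unfolding e_def by (intro continuous_intros)
  define mid where "mid i = X i + h / 2" for i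
  have epos: "e i (mid i) > 0" for i using h(1) by (simp add: e_def mid_def XS)
  have midI: "mid i \<in> {a..b}" if "i < m" for i
    using XI[of i] XI[of "Suc i"] that h(1) XS[of i] by (auto simp: mid_def)
  have eother: "e j (mid i) = 0" if "j \<noteq> i" for i j
  proof (rule ez)
    show "mid i \<le> X j \<or> X (Suc j) \<le> mid i"
    proof (cases "j < i")
      case True
      then show ?thesis using Xmono[of "Suc j" i] h(1) by (simp add: mid_def)
    next
      case False
      then show ?thesis using that Xmono[of "Suc i" j] h(1) XS[of i] by (simp add: mid_def)
    qed
  qed
  have indep: "c i = 0" if c: "\<forall>x\<in>{a..b}. (\<Sum>i<m. c i * complex_of_real (e i x)) = 0" and i: "i < m" for c i
  proof -
    have "0 = (\<Sum>j<m. c j * complex_of_real (e j (mid i)))" using c midI[OF i] by simp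
    also have "\<dots> = (\<Sum>j<m. if j = i then c i * complex_of_real (e i (mid i)) else 0)"
      by (intro sum.cong refl) (auto simp: eother)
    finally show ?thesis using epos[of i] i by simp
  qed
  have main: "energy a b y \<le> \<epsilon> * energy a b (dw a b 1 y)"
    if y: "Ck_on a b 1 y" and z: "\<forall>i<m. integral {a..b} (\<lambda>x. y x * complex_of_real (e i x)) = 0" for y
  proof -
    let ?y' = "dw a b 1 y"
    have cy: "continuous_on {a..b} y" and cy': "continuous_on {a..b} ?y'"
      using Ck_on_cont[OF y, of 0] Ck_on_cont[OF y, of 1] by simp_all
    have dy: "(y has_vector_derivative ?y' x) (at x within {a..b})" if "x \<in> {a..b}" for x
      using Ck_on_deriv[OF y, of 0 x] that by simp
    have cell: "energy (X i) (X (Suc i)) y \<le> h\<^sup>2 * energy (X i) (X (Suc i)) ?y'" if i: "i < m" for i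
    proof -
      let ?u = "X i" and ?w = "X (Suc i)"
      have uw: "?u < ?w" "a \<le> ?u" "?w \<le> b" "?w - ?u = h" using XS[of i] h(1) XI[of i] XI[of "Suc i"] i by auto
      have sub: "{?u..?w} \<subseteq> {a..b}" using uw by auto
      define T where "T = integral {?u..?w} (\<lambda>x. cmod (?y' x))"
      have T0: "T \<ge> 0" unfolding T_def
        using continuous_on_subset[OF cy' sub] by (intro integral_nonneg integrable_continuous_real continuous_intros) auto
      have incr: "cmod (y t - y s) \<le> T" if "?u \<le> s" "s \<le> t" "t \<le> ?w" for s t
      proof -
        have st: "{s..t} \<subseteq> {a..b}" using that uw by auto
        have hi: "(?y' has_integral y t - y s) {s..t}"
        proof (rule fundamental_theorem_of_calculus)
          show "(y has_vector_derivative ?y' x) (at x within {s..t})" if "x \<in> {s..t}" for x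
            using dy[of x] that st by (auto intro: has_vector_derivative_within_subset simp del: dw.simps)
        qed (use that in simp)
        have "cmod (y t - y s) = cmod (integral {s..t} ?y')" using hi by (simp add: integral_unique del: dw.simps One_nat_def)
        also have "\<dots> \<le> integral {s..t} (\<lambda>x. cmod (?y' x))"
          using hi continuous_on_subset[OF cy' st]
          by (intro integral_norm_bound_integral integrable_continuous_real continuous_intros) auto
        also have "\<dots> \<le> T" unfolding T_def
          using that continuous_on_subset[OF cy' st] continuous_on_subset[OF cy' sub]
          by (intro integral_subset_le integrable_continuous_real continuous_intros) auto
        finally show ?thesis .
      qed
      \<comment> \<open>As \<open>y\<close> has zero mean against \<open>e i\<close>, the product of
        y(x) with the mass \<open>J\<close> of the bump is the integral of (y(x) - y(s)) e(s), and
        the bump vanishes outside the cell.\<close>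
      have ptw: "cmod (y x) \<le> T" if x: "x \<in> {?u..?w}" for x
      proof -
        define J where "J = integral {a..b} (e i)"
        have J: "J > 0"
        proof -
          have "J \<noteq> 0"
          proof
            assume "J = 0"
            then have "\<forall>x\<in>{a..b}. e i x = 0"
              using integral_eq_0_iff[of a b "e i"] ce e0 ab unfolding J_def by auto
            then show False using epos[of i] midI[OF i] by fastforce
          qed
          moreover have "J \<ge> 0" unfolding J_def using ce e0 by (intro integral_nonneg integrable_continuous_real) auto
          ultimately show ?thesis by simp
        qed
        have iy: "(\<lambda>s. y s * complex_of_real (e i s)) integrable_on {a..b}" and ie: "(\<lambda>s. y x * complex_of_real (e i s)) integrable_on {a..b}"
          and ieR: "(\<lambda>s. T * e i s) integrable_on {a..b}"
          using cy ce by (auto intro!: integrable_continuous_real continuous_intros)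
        have eint: "integral {a..b} (\<lambda>s. complex_of_real (e i s)) = complex_of_real J"
        proof -
          have "e i integrable_on {a..b}" using ce by (intro integrable_continuous_real)
          from has_integral_linear[OF integrable_integral[OF this] bounded_linear_of_real]
          show ?thesis unfolding J_def o_def by (rule integral_unique)
        qed
        have i1: "integral {a..b} (\<lambda>s. y x * complex_of_real (e i s) - y s * complex_of_real (e i s)) = y x * complex_of_real J"
          using integral_diff[OF ie iy] z i eint by simp
        have i2: "cmod (integral {a..b} (\<lambda>s. y x * complex_of_real (e i s) - y s * complex_of_real (e i s))) \<le> integral {a..b} (\<lambda>s. T * e i s)"
        proof (rule integral_norm_bound_integral)
          show "(\<lambda>s. y x * complex_of_real (e i s) - y s * complex_of_real (e i s)) integrable_on {a..b}"
            by (rule integrable_diff[OF ie iy])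
          fix s assume "s \<in> {a..b}"
          have "cmod (y x - y s) * e i s \<le> T * e i s"
          proof (cases "?u \<le> s \<and> s \<le> ?w")
            case True
            have "cmod (y x - y s) \<le> T"
            proof (cases "s \<le> x")
              case True
              then show ?thesis using incr[of s x] x \<open>?u \<le> s \<and> s \<le> ?w\<close> by auto
            next
              case False
              then show ?thesis using incr[of x s] x \<open>?u \<le> s \<and> s \<le> ?w\<close> by (auto simp: norm_minus_commute)
            qed
            then show ?thesis using e0 by (intro mult_right_mono) auto
          next
            case False
            then have "e i s = 0" by (intro ez) auto
            then show ?thesis by simp
          qed
          moreover have "y x * complex_of_real (e i s) - y s * complex_of_real (e i s) = (y x - y s) * complex_of_real (e i s)"
            by (simp add: left_diff_distrib)
          ultimately show "cmod (y x * complex_of_real (e i s) - y s * complex_of_real (e i s)) \<le> T * e i s"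
            using e0[of i s] by (simp add: norm_mult)
        qed (rule ieR)
        have i3: "integral {a..b} (\<lambda>s. T * e i s) = T * J" by (simp add: J_def)
        have i4: "cmod (y x * complex_of_real J) = cmod (y x) * J" using J by (simp add: norm_mult)
        have "cmod (y x) * J \<le> T * J" using i2 unfolding i1 i3 i4 .
        then show ?thesis using J by (rule mult_right_le_imp_le)
      qed
      have T2: "T\<^sup>2 \<le> h * energy ?u ?w ?y'"
        using norm_integral_sq_le[OF uw(1) continuous_on_subset[OF cy' sub]] uw(4) by (simp add: T_def del: dw.simps One_nat_def)
      have "energy ?u ?w y \<le> integral {?u..?w} (\<lambda>x. T\<^sup>2)"
        unfolding energy_def
      proof (rule integral_le)
        show "(\<lambda>x. (cmod (y x))\<^sup>2) integrable_on {?u..?w}" by (rule energy_integrable[OF continuous_on_subset[OF cy sub]])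
        show "(cmod (y x))\<^sup>2 \<le> T\<^sup>2" if "x \<in> {?u..?w}" for x using ptw[OF that] by (intro power_mono) auto
      qed auto
      also have "\<dots> = h * T\<^sup>2" using uw by simp
      also have "\<dots> \<le> h * (h * energy ?u ?w ?y')" using T2 h(1) by (intro mult_left_mono) auto
      finally show ?thesis by (simp add: power2_eq_square mult.assoc del: dw.simps One_nat_def)
    qed
    have add: "energy a (X k) f = (\<Sum>i<k. energy (X i) (X (Suc i)) f)" if "k \<le> m" and f: "continuous_on {a..b} f" for k and f :: "real \<Rightarrow> complex"
      using that(1)
    proof (induction k)
      case 0
      then show ?case by (simp add: energy_def X0)
    next
      case (Suc k)
      have "(\<lambda>x. (cmod (f x))\<^sup>2) integrable_on {a..X (Suc k)}"
        using XI(2)[OF Suc.prems] by (intro energy_integrable continuous_on_subset[OF f]) auto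
      then have "energy a (X k) f + energy (X k) (X (Suc k)) f = energy a (X (Suc k)) f"
        unfolding energy_def using XI(1)[of k] Suc.prems Xmono[of k "Suc k"]
        by (intro Henstock_Kurzweil_Integration.integral_combine) auto
      then show ?case using Suc by simp
    qed
    have "energy a b y = (\<Sum>i<m. energy (X i) (X (Suc i)) y)" using add[OF order_refl cy] Xm by simp
    also have "\<dots> \<le> (\<Sum>i<m. h\<^sup>2 * energy (X i) (X (Suc i)) ?y')" using cell by (intro sum_mono) auto
    also have "\<dots> = h\<^sup>2 * energy a b ?y'" using add[OF order_refl cy'] Xm by (simp only: sum_distrib_left)
    also have "\<dots> \<le> \<epsilon> * energy a b ?y'" using h(2) energy_nonneg by (intro mult_right_mono) auto
    finally show ?thesis .
  qed
  have 1: "\<forall>i<m. continuous_on {a..b} (e i)" using ce by simp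
  have 2: "\<forall>c. (\<forall>x\<in>{a..b}. (\<Sum>i<m. c i * complex_of_real (e i x)) = 0) \<longrightarrow> (\<forall>i<m. c i = 0)"
    by (intro allI impI) (rule indep)
  have 3: "\<forall>y. Ck_on a b 1 y \<longrightarrow> (\<forall>i<m. integral {a..b} (\<lambda>x. y x * complex_of_real (e i x)) = 0) \<longrightarrow>
       energy a b y \<le> \<epsilon> * energy a b (dw a b 1 y)"
    by (intro allI impI) (rule main)
  show ?thesis by (rule exI[where x = m], rule exI[where x = e]) (rule conjI[OF 1 conjI[OF 2 3]])
qed

section \<open>The operator at a fixed parameter\<close>

text \<open>Componentwise defect of the boundary condition. It is linear on all classical functions,
  so it can serve as an equation in a linear system before the condition is met.\<close>

definition resid :: "nat \<Rightarrow> real \<Rightarrow> real \<Rightarrow> (nat \<Rightarrow> real \<Rightarrow> real \<Rightarrow> real) \<Rightarrow> complex mat \<Rightarrow> real \<Rightarrow> (real \<Rightarrow> complex) \<Rightarrow> nat \<Rightarrow> complex" where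
  "resid n a b p V l y i = (\<Sum>r<2 * n. (V - 1\<^sub>m (2 * n)) $$ (i, r) * vec_index (bv_vee n a b p l y) r)
     + \<i> * (\<Sum>r<2 * n. (V + 1\<^sub>m (2 * n)) $$ (i, r) * bw n a b y r)"

lemma bv_wedge_index: "i < 2 * n \<Longrightarrow> vec_index (bv_wedge n a b y) i = bw n a b y i"
  by (simp add: bv_wedge_def bw_def)

lemma bc_iff_resid:
  assumes "V \<in> carrier_mat (2 * n) (2 * n)"
  shows "(V - 1\<^sub>m (2 * n)) *\<^sub>v bv_vee n a b p l y + \<i> \<cdot>\<^sub>v ((V + 1\<^sub>m (2 * n)) *\<^sub>v bv_wedge n a b y) = 0\<^sub>v (2 * n)
     \<longleftrightarrow> (\<forall>i<2 * n. resid n a b p V l y i = 0)"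
proof -
  let ?x = "(V - 1\<^sub>m (2 * n)) *\<^sub>v bv_vee n a b p l y + \<i> \<cdot>\<^sub>v ((V + 1\<^sub>m (2 * n)) *\<^sub>v bv_wedge n a b y)"
  have dims: "dim_vec (bv_vee n a b p l y) = 2 * n" "dim_vec (bv_wedge n a b y) = 2 * n"
    by (simp_all add: bv_vee_def bv_wedge_def)
  have mv: "vec_index (M *\<^sub>v x) i = (\<Sum>r<2 * n. M $$ (i, r) * vec_index x r)"
    if "M \<in> carrier_mat (2 * n) (2 * n)" "dim_vec x = 2 * n" "i < 2 * n" for M :: "complex mat" and x i
    using that by (simp add: scalar_prod_def atLeast0LessThan)
  have cm: "V - 1\<^sub>m (2 * n) \<in> carrier_mat (2 * n) (2 * n)" and cp: "V + 1\<^sub>m (2 * n) \<in> carrier_mat (2 * n) (2 * n)"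
    using assms by auto
  have ix: "vec_index ?x i = resid n a b p V l y i" if i: "i < 2 * n" for i
  proof -
    have "vec_index ?x i = vec_index ((V - 1\<^sub>m (2 * n)) *\<^sub>v bv_vee n a b p l y) i + \<i> * vec_index ((V + 1\<^sub>m (2 * n)) *\<^sub>v bv_wedge n a b y) i"
      using i cp by (simp del: index_mult_mat_vec)
    also have "\<dots> = resid n a b p V l y i"
      unfolding mv[OF cm dims(1) i] mv[OF cp dims(2) i] resid_def
      by (intro arg_cong2[where f = "(+)"] arg_cong2[where f = "(*)"] sum.cong refl) (simp add: bv_wedge_index)
    finally show ?thesis .
  qed
  show ?thesis
  proof
    assume "?x = 0\<^sub>v (2 * n)"
    then show "\<forall>i<2 * n. resid n a b p V l y i = 0" using ix by (metis index_zero_vec(1))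
  next
    assume r: "\<forall>i<2 * n. resid n a b p V l y i = 0"
    show "?x = 0\<^sub>v (2 * n)"
    proof (rule eq_vecI)
      fix i assume "i < dim_vec (0\<^sub>v (2 * n) :: complex vec)"
      then have i: "i < 2 * n" by simp
      have "vec_index ?x i = 0" using ix[OF i] r i by metis
      then show "vec_index ?x i = vec_index (0\<^sub>v (2 * n)) i" using i by (simp only: index_zero_vec)
    qed (use cp in simp)
  qed
qed

text \<open>The conditions of \<open>critical_form\<close> on the diagonal part and its complement,
  bundled into one predicate so that the data can be supplied by an existential statement.\<close>

definition nform :: "(real \<Rightarrow> complex) set \<Rightarrow> ((real \<Rightarrow> complex) \<Rightarrow> (real \<Rightarrow> complex) \<Rightarrow> complex) \<Rightarrow>
    ((real \<Rightarrow> complex) \<Rightarrow> (real \<Rightarrow> complex) \<Rightarrow> complex) \<Rightarrow> nat \<Rightarrow> (nat \<Rightarrow> real \<Rightarrow> complex) \<Rightarrow>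
    (nat \<Rightarrow> (real \<Rightarrow> complex) \<Rightarrow> complex) \<Rightarrow> (nat \<Rightarrow> real) \<Rightarrow> real \<Rightarrow> bool" where
  "nform D B M m v \<phi> d \<epsilon> \<longleftrightarrow> \<epsilon> > (0::real) \<and> (\<forall>i<m. v i \<in> D) \<and>
    (\<forall>i<m. \<forall>j<m. B (v i) (v j) = (if i = j then complex_of_real (d i) else 0)) \<and>
    (\<forall>i<m. \<forall>f\<in>D. \<forall>g\<in>D. \<phi> i (\<lambda>x. f x + g x) = \<phi> i f + \<phi> i g) \<and>
    (\<forall>i<m. \<forall>f\<in>D. \<forall>s. \<phi> i (\<lambda>x. s * f x) = s * \<phi> i f) \<and>
    (\<forall>i<m. \<forall>j<m. \<phi> i (v j) = (if i = j then 1 else (0::complex))) \<and>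
    (\<forall>z\<in>D. (\<forall>i<m. \<phi> i z = 0) \<longrightarrow> (\<forall>j<m. B z (v j) = 0) \<and> Re (B z z) \<ge> \<epsilon> * Re (M z z))"

text \<open>One parameter value is frozen and \<open>V\<close> stands for the boundary matrix there;
  the spectral shift, whose matrix is constant, is covered by the same results.\<close>

locale operator_at =
  fixes n :: nat and a b :: real and p :: "nat \<Rightarrow> real \<Rightarrow> real \<Rightarrow> real" and l :: real and V :: "complex mat"
  assumes ab: "a < b" and n: "n \<ge> 1" and p: "\<And>k. k < n \<Longrightarrow> Ck_on a b (n - k) (\<lambda>x. p k x l)"
    and pn: "continuous_on {a..b} (\<lambda>x. p n x l)" and p0: "\<And>x. x \<in> {a..b} \<Longrightarrow> p 0 x l > 0"
    and V: "unitary_mat (2 * n) V"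
begin

definition "D = form_dom n a b (mat_kernel (V - 1\<^sub>m (2 * n)))"
definition "B = qf n a b (\<lambda>k x. p k x l) (\<lambda>i j. A_mat (2 * n) V $$ (i, j))"

text \<open>The classical part of the operator domain; by regularity it contains all
  eigenfunctions.\<close>

definition "G = {y. Ck_on a b (2 * n) y \<and> (\<forall>x. x \<notin> {a..b} \<longrightarrow> y x = 0) \<and> (\<forall>i<2 * n. resid n a b p V l y i = 0)}"

abbreviation "S \<equiv> S_op n a b p l"

lemma V_carrier: "V \<in> carrier_mat (2 * n) (2 * n)"
  using V by (simp add: unitary_mat_def)

lemma cont_p: "k \<le> n \<Longrightarrow> continuous_on {a..b} (\<lambda>x. p k x l)"
  using pn Ck_on_cont[OF p[of k], of 0] by (cases "k = n") auto

lemma D_sub: "csubspace D"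
  unfolding D_def by (rule csubspace_form_dom[OF ab])

lemma B_hform: "hform D B"
  unfolding D_def B_def
proof (rule hform_qf[OF ab])
  show "cnj (A_mat (2 * n) V $$ (j, i)) = A_mat (2 * n) V $$ (i, j)" if "i < 2 * n" "j < 2 * n" for i j
    by (rule A_mat_hermitian[OF V that])
qed (rule cont_p)

lemma sob_hform: "hform D (sob n a b)"
  unfolding D_def sob_def by (rule hform_qf[OF ab]) auto

lemma D_Ck: "y \<in> D \<Longrightarrow> Ck_on a b n y"
  unfolding D_def by (rule form_domD(1))

text \<open>Regularity gives one direction, the inclusion of classical functions in the Sobolev
  class the other. From here on no almost everywhere statement is left.\<close>

lemma eigsp_iff:
  assumes "U l = V"
  shows "y \<in> eigsp n a b p U l \<mu> \<longleftrightarrow> y \<in> G \<and> (\<forall>x\<in>{a..b}. S y x = \<mu> * y x)"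
proof
  assume y: "y \<in> eigsp n a b p U l \<mu>"
  then have W: "W2 a b (2 * n) y" and bc: "\<forall>i<2 * n. resid n a b p V l y i = 0" and z: "\<forall>x. x \<notin> {a..b} \<longrightarrow> y x = 0"
    and ae: "AE x in lborel. x \<in> {a..b} \<longrightarrow> S_op n a b p l y x = \<mu> * y x"
    using bc_iff_resid[OF V_carrier, of a b p l y] assms by (auto simp: eigsp_def dom_S_def)
  have "Ck_on a b (2 * n) y \<and> (\<forall>x\<in>{a..b}. S_op n a b p l y x = \<mu> * y x)"
    by (rule W2_regular[where p = p and l = l, OF ab n _ pn _ W ae]) (rule p p0, assumption)+
  then show "y \<in> G \<and> (\<forall>x\<in>{a..b}. S y x = \<mu> * y x)" using bc z by (simp add: G_def)
next
  assume y: "y \<in> G \<and> (\<forall>x\<in>{a..b}. S y x = \<mu> * y x)"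
  then have "W2 a b (2 * n) y" using W2_of_Ck[OF ab n] by (simp add: G_def)
  then show "y \<in> eigsp n a b p U l \<mu>"
    using y bc_iff_resid[OF V_carrier, of a b p l y] assms by (auto simp: eigsp_def dom_S_def G_def)
qed

text \<open>Since \<open>z\<close> satisfies the essential boundary condition, the pairing of its
  boundary values with the quasi-derivatives of \<open>y\<close> equals the pairing with A applied
  to the boundary values of \<open>y\<close>; this turns Green's formula into the form.\<close>

lemma green_D:
  assumes y: "y \<in> G"
  shows "y \<in> D" "z \<in> D \<Longrightarrow> B y z = integral {a..b} (\<lambda>x. S y x * cnj (z x))"
proof -
  have Cy: "Ck_on a b (2 * n) y" and z0: "\<And>x. x \<notin> {a..b} \<Longrightarrow> y x = 0" and r: "\<forall>i<2 * n. resid n a b p V l y i = 0"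
    using y by (auto simp: G_def)
  have vee: "bv_vee n a b p l y \<in> carrier_vec (2 * n)" and wed: "bv_wedge n a b y \<in> carrier_vec (2 * n)"
    by (auto simp: bv_vee_def bv_wedge_def)
  have bc: "(V - 1\<^sub>m (2 * n)) *\<^sub>v bv_vee n a b p l y + \<i> \<cdot>\<^sub>v ((V + 1\<^sub>m (2 * n)) *\<^sub>v bv_wedge n a b y) = 0\<^sub>v (2 * n)"
    using bc_iff_resid[OF V_carrier] r by blast
  have "(\<Sum>i<2 * n. bw n a b y i * cnj (vec_index u i)) = 0" if "u \<in> mat_kernel (V - 1\<^sub>m (2 * n))" for u
  proof -
    have "(\<Sum>i<2 * n. bw n a b y i * cnj (vec_index u i)) = (\<Sum>i<2 * n. vec_index (bv_wedge n a b y) i * cnj (vec_index u i))"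
      by (intro sum.cong refl) (simp add: bv_wedge_index)
    then show ?thesis using unitary_bc(1)[OF V vee wed bc that] by simp
  qed
  then show "y \<in> D" using Ck_on_mono[OF Cy, of n] z0 by (simp add: D_def form_dom_def)
  assume z: "z \<in> D"
  let ?w = "vec (2 * n) (bw n a b z)"
  have "(\<Sum>i<2 * n. vec_index (bv_vee n a b p l y) i * cnj (vec_index ?w i)) =
      (\<Sum>i<2 * n. vec_index (A_mat (2 * n) V *\<^sub>v bv_wedge n a b y) i * cnj (vec_index ?w i))"
  proof (rule unitary_bc(2)[OF V vee wed bc])
    fix u assume "u \<in> mat_kernel (V - 1\<^sub>m (2 * n))"
    then have "(\<Sum>i<2 * n. bw n a b z i * cnj (vec_index u i)) = 0" using z unfolding D_def by (intro form_domD(3))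
    then show "(\<Sum>i<2 * n. vec_index ?w i * cnj (vec_index u i)) = 0" by simp
  qed simp
  moreover have "vec_index (A_mat (2 * n) V *\<^sub>v bv_wedge n a b y) i = (\<Sum>j<2 * n. A_mat (2 * n) V $$ (i, j) * bw n a b y j)" if "i < 2 * n" for i
  proof -
    have "A_mat (2 * n) V \<in> carrier_mat (2 * n) (2 * n)" by (simp add: A_mat_def Let_def)
    then have "vec_index (A_mat (2 * n) V *\<^sub>v bv_wedge n a b y) i = (\<Sum>j<2 * n. A_mat (2 * n) V $$ (i, j) * vec_index (bv_wedge n a b y) j)"
      using that wed by (simp add: scalar_prod_def atLeast0LessThan)
    also have "\<dots> = (\<Sum>j<2 * n. A_mat (2 * n) V $$ (i, j) * bw n a b y j)" by (intro sum.cong refl) (simp add: bv_wedge_index)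
    finally show ?thesis .
  qed
  ultimately have "(\<Sum>i<2 * n. vec_index (bv_vee n a b p l y) i * cnj (bw n a b z i)) =
     bdry (2 * n) (\<lambda>i j. A_mat (2 * n) V $$ (i, j)) (bw n a b y) (bw n a b z)"
    by (simp add: bdry_def sum_distrib_right)
  then show "B y z = integral {a..b} (\<lambda>x. S y x * cnj (z x))"
    using green[where p = p and l = l, OF ab p pn Cy D_Ck[OF z]] by (simp add: B_def qf_def)
qed

lemma quasi_deriv_lincomb:
  assumes J: "finite J" and u: "\<And>j. j \<in> J \<Longrightarrow> Ck_on a b (2 * n) (u j)" and m: "m \<le> n" and x: "x \<in> {a..b}"
  shows "quasi_deriv n a b p l m (\<lambda>x. \<Sum>j\<in>J. \<alpha> j * u j x) x = (\<Sum>j\<in>J. \<alpha> j * quasi_deriv n a b p l m (u j) x)"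
proof -
  let ?f = "\<lambda>k y t. complex_of_real (p k t l) * dw a b (n - k) y t"
  have "dw a b (m - k) (?f k (\<lambda>x. \<Sum>j\<in>J. \<alpha> j * u j x)) x = (\<Sum>j\<in>J. \<alpha> j * dw a b (m - k) (?f k (u j)) x)"
    if k: "k \<le> m" for k
  proof -
    have Cf: "Ck_on a b (n - k) (?f k (u j))" if "j \<in> J" for j
    proof (cases "k = n")
      case True
      then show ?thesis using pn Ck_on_cont[OF u[OF that], of 0] by (auto simp: Ck_on_def intro!: continuous_intros)
    next
      case False
      have "Ck_on a b (n - k) (dw a b (n - k) (u j))" by (rule Ck_on_dw, rule Ck_on_mono[OF u[OF that]]) auto
      then show ?thesis using False k m by (intro Ck_on_prod[OF ab p]) auto
    qed
    have "dw a b (m - k) (?f k (\<lambda>x. \<Sum>j\<in>J. \<alpha> j * u j x)) x = dw a b (m - k) (\<lambda>t. \<Sum>j\<in>J. \<alpha> j * ?f k (u j) t) x"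
    proof (rule dw_cong[OF _ x])
      fix t assume t: "t \<in> {a..b}"
      have "dw a b (n - k) (\<lambda>x. \<Sum>j\<in>J. \<alpha> j * u j x) t = (\<Sum>j\<in>J. \<alpha> j * dw a b (n - k) (u j) t)"
        by (rule dw_lincomb[OF ab J u _ t]) auto
      then show "?f k (\<lambda>x. \<Sum>j\<in>J. \<alpha> j * u j x) t = (\<Sum>j\<in>J. \<alpha> j * ?f k (u j) t)"
        by (simp add: sum_distrib_left mult_ac)
    qed
    also have "\<dots> = (\<Sum>j\<in>J. \<alpha> j * dw a b (m - k) (?f k (u j)) x)"
      by (rule dw_lincomb[OF ab J Cf _ x]) (use m in auto)
    finally show ?thesis .
  qed
  then have "quasi_deriv n a b p l m (\<lambda>x. \<Sum>j\<in>J. \<alpha> j * u j x) x =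
     (\<Sum>k=0..m. (-1) ^ (m - k) * (\<Sum>j\<in>J. \<alpha> j * dw a b (m - k) (?f k (u j)) x))"
    unfolding quasi_deriv_def by (intro sum.cong refl) auto
  also have "\<dots> = (\<Sum>k=0..m. \<Sum>j\<in>J. \<alpha> j * ((-1) ^ (m - k) * dw a b (m - k) (?f k (u j)) x))"
    by (simp add: sum_distrib_left mult_ac)
  also have "\<dots> = (\<Sum>j\<in>J. \<alpha> j * quasi_deriv n a b p l m (u j) x)"
    unfolding quasi_deriv_def sum_distrib_left by (rule sum.swap)
  finally show ?thesis .
qed

lemma S_lincomb:
  assumes "finite J" "\<And>j. j \<in> J \<Longrightarrow> Ck_on a b (2 * n) (u j)" "x \<in> {a..b}"
  shows "S (\<lambda>x. \<Sum>j\<in>J. \<alpha> j * u j x) x = (\<Sum>j\<in>J. \<alpha> j * S (u j) x)"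
  unfolding S_op_quasi by (rule quasi_deriv_lincomb[OF assms(1,2) order_refl assms(3)])

lemma resid_lincomb:
  assumes J: "finite J" and u: "\<And>j. j \<in> J \<Longrightarrow> Ck_on a b (2 * n) (u j)" and i: "i < 2 * n"
  shows "resid n a b p V l (\<lambda>x. \<Sum>j\<in>J. \<alpha> j * u j x) i = (\<Sum>j\<in>J. \<alpha> j * resid n a b p V l (u j) i)"
proof -
  let ?y = "\<lambda>x. \<Sum>j\<in>J. \<alpha> j * u j x"
  have ends: "a \<in> {a..b}" "b \<in> {a..b}" using ab by auto
  have q: "quasi_deriv n a b p l k ?y x = (\<Sum>j\<in>J. \<alpha> j * quasi_deriv n a b p l k (u j) x)" if "k \<le> n" "x \<in> {a..b}" for k x
    by (rule quasi_deriv_lincomb[OF J _ that]) (rule u)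
  have dq: "dw a b k ?y x = (\<Sum>j\<in>J. \<alpha> j * dw a b k (u j) x)" if "k \<le> 2 * n" "x \<in> {a..b}" for k x
    by (rule dw_lincomb[OF ab J _ that]) (rule u)
  have v: "vec_index (bv_vee n a b p l ?y) r = (\<Sum>j\<in>J. \<alpha> j * vec_index (bv_vee n a b p l (u j)) r)" if r: "r < 2 * n" for r
  proof (cases "r < n")
    case True
    then show ?thesis using r q[OF _ ends(1), of "n - 1 - r"] by (simp add: bv_vee_def)
  next
    case False
    then show ?thesis using r q[OF _ ends(2), of "n - 1 - (r - n)"]
      by (simp add: bv_vee_def sum_negf)
  qed
  have w: "bw n a b ?y r = (\<Sum>j\<in>J. \<alpha> j * bw n a b (u j) r)" if r: "r < 2 * n" for r
    using r dq[OF _ ends(1), of r] dq[OF _ ends(2), of "r - n"] by (simp add: bw_def)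
  have 1: "(\<Sum>r<2 * n. (V - 1\<^sub>m (2 * n)) $$ (i, r) * vec_index (bv_vee n a b p l ?y) r) =
     (\<Sum>j\<in>J. \<alpha> j * (\<Sum>r<2 * n. (V - 1\<^sub>m (2 * n)) $$ (i, r) * vec_index (bv_vee n a b p l (u j)) r))"
  proof -
    have "(\<Sum>r<2 * n. (V - 1\<^sub>m (2 * n)) $$ (i, r) * vec_index (bv_vee n a b p l ?y) r) =
      (\<Sum>r<2 * n. \<Sum>j\<in>J. \<alpha> j * ((V - 1\<^sub>m (2 * n)) $$ (i, r) * vec_index (bv_vee n a b p l (u j)) r))"
    proof (intro sum.cong refl)
      fix r assume "r \<in> {..<2 * n}"
      then have r: "r < 2 * n" by simp
      show "(V - 1\<^sub>m (2 * n)) $$ (i, r) * vec_index (bv_vee n a b p l ?y) r =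
        (\<Sum>j\<in>J. \<alpha> j * ((V - 1\<^sub>m (2 * n)) $$ (i, r) * vec_index (bv_vee n a b p l (u j)) r))"
        unfolding v[OF r] sum_distrib_left by (intro sum.cong refl) (rule mult.left_commute)
    qed
    then show ?thesis unfolding sum_distrib_left by (subst (asm) sum.swap)
  qed
  have 2: "(\<Sum>r<2 * n. (V + 1\<^sub>m (2 * n)) $$ (i, r) * bw n a b ?y r) =
     (\<Sum>j\<in>J. \<alpha> j * (\<Sum>r<2 * n. (V + 1\<^sub>m (2 * n)) $$ (i, r) * bw n a b (u j) r))"
  proof -
    have "(\<Sum>r<2 * n. (V + 1\<^sub>m (2 * n)) $$ (i, r) * bw n a b ?y r) =
      (\<Sum>r<2 * n. \<Sum>j\<in>J. \<alpha> j * ((V + 1\<^sub>m (2 * n)) $$ (i, r) * bw n a b (u j) r))"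
    proof (intro sum.cong refl)
      fix r assume "r \<in> {..<2 * n}"
      then have r: "r < 2 * n" by simp
      show "(V + 1\<^sub>m (2 * n)) $$ (i, r) * bw n a b ?y r = (\<Sum>j\<in>J. \<alpha> j * ((V + 1\<^sub>m (2 * n)) $$ (i, r) * bw n a b (u j) r))"
        unfolding w[OF r] sum_distrib_left by (intro sum.cong refl) (rule mult.left_commute)
    qed
    then show ?thesis unfolding sum_distrib_left by (subst (asm) sum.swap)
  qed
  have 3: "\<i> * (\<Sum>j\<in>J. \<alpha> j * f j) = (\<Sum>j\<in>J. \<alpha> j * (\<i> * f j))" for f :: "_ \<Rightarrow> complex"
    by (simp add: sum_distrib_left mult.left_commute)
  show ?thesis
    unfolding resid_def 1 2 3 distrib_left sum.distrib by (rule refl)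
qed

lemma G_lincomb:
  assumes J: "finite J" and u: "\<And>j. j \<in> J \<Longrightarrow> u j \<in> G"
  shows "(\<lambda>x. \<Sum>j\<in>J. \<alpha> j * u j x) \<in> G"
proof -
  have C: "Ck_on a b (2 * n) (u j)" and r: "\<And>i. i < 2 * n \<Longrightarrow> resid n a b p V l (u j) i = 0" and z: "\<And>x. x \<notin> {a..b} \<Longrightarrow> u j x = 0"
    if "j \<in> J" for j using u[OF that] by (auto simp: G_def)
  show ?thesis
    unfolding G_def mem_Collect_eq
  proof (intro conjI allI impI)
    show "Ck_on a b (2 * n) (\<lambda>x. \<Sum>j\<in>J. \<alpha> j * u j x)" by (rule Ck_on_lincomb[OF ab J C])
    show "(\<Sum>j\<in>J. \<alpha> j * u j x) = 0" if "x \<notin> {a..b}" for x using z[OF _ that] by (intro sum.neutral) auto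
    show "resid n a b p V l (\<lambda>x. \<Sum>j\<in>J. \<alpha> j * u j x) i = 0" if "i < 2 * n" for i
    proof -
      have "resid n a b p V l (\<lambda>x. \<Sum>j\<in>J. \<alpha> j * u j x) i = (\<Sum>j\<in>J. \<alpha> j * resid n a b p V l (u j) i)"
        by (rule resid_lincomb[OF J _ that]) (rule C)
      then show ?thesis using r that by simp
    qed
  qed
qed

end

section \<open>Coercivity off finitely many functionals, dual functions, normal form\<close>

lemma sum_unit:
  "k < N \<Longrightarrow> (\<Sum>i<N. f i * (if k = i then 1 else 0)) = f k" for f :: "nat \<Rightarrow> complex"
  by (subst sum.remove[of _ k]) (auto intro!: sum.neutral)

definition ell :: "real \<Rightarrow> real \<Rightarrow> (nat \<Rightarrow> real \<Rightarrow> real) \<Rightarrow> (real \<Rightarrow> complex) \<Rightarrow> nat \<Rightarrow> complex" where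
  "ell a b e y i = integral {a..b} (\<lambda>x. y x * complex_of_real (e i x))"

lemma ell_lincomb:
  assumes J: "finite J" and u: "\<And>j. j \<in> J \<Longrightarrow> continuous_on {a..b} (u j)" and e: "continuous_on {a..b} (e i)"
  shows "ell a b e (\<lambda>x. \<Sum>j\<in>J. \<alpha> j * u j x) i = (\<Sum>j\<in>J. \<alpha> j * ell a b e (u j) i)"
proof -
  have "ell a b e (\<lambda>x. \<Sum>j\<in>J. \<alpha> j * u j x) i = integral {a..b} (\<lambda>x. \<Sum>j\<in>J. \<alpha> j * (u j x * complex_of_real (e i x)))"
    unfolding ell_def by (simp add: sum_distrib_right mult.assoc)
  also have "\<dots> = (\<Sum>j\<in>J. integral {a..b} (\<lambda>x. \<alpha> j * (u j x * complex_of_real (e i x))))"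
    by (rule integral_sum[OF J]) (use u e in \<open>auto intro!: integrable_continuous_real continuous_intros\<close>)
  finally show ?thesis by (simp add: ell_def)
qed

lemma cnj_ell: "cnj (ell a b e y i) = integral {a..b} (\<lambda>x. complex_of_real (e i x) * cnj (y x))"
  unfolding ell_def by (simp add: integral_cnj mult.commute)

text \<open>A function in the span of the bumps sees \<open>z\<close> only through the functionals
  \<open>ell\<close>. This is the source of all orthogonality to their common kernel.\<close>

lemma integral_span_cnj:
  assumes e: "\<And>i. i < m \<Longrightarrow> continuous_on {a..b} (e i)" and z: "continuous_on {a..b} z"
    and f: "\<And>x. x \<in> {a..b} \<Longrightarrow> f x = (\<Sum>i<m. \<beta> i * complex_of_real (e i x))"
  shows "integral {a..b} (\<lambda>x. f x * cnj (z x)) = (\<Sum>i<m. \<beta> i * cnj (ell a b e z i))"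
proof -
  have "integral {a..b} (\<lambda>x. f x * cnj (z x)) = integral {a..b} (\<lambda>x. \<Sum>i<m. \<beta> i * (complex_of_real (e i x) * cnj (z x)))"
    by (intro integral_cong) (simp add: f sum_distrib_right mult.assoc)
  also have "\<dots> = (\<Sum>i<m. integral {a..b} (\<lambda>x. \<beta> i * (complex_of_real (e i x) * cnj (z x))))"
    by (rule integral_sum) (use e z in \<open>auto intro!: integrable_continuous_real continuous_intros\<close>)
  finally show ?thesis by (simp add: cnj_ell)
qed

context operator_at
begin

text \<open>On the common kernel the L2 norm is at most \<open>t\<close> times the Sobolev norm,
  with \<open>t\<close> so small that the negative term of Garding's inequality costs at most half
  of the positive one.\<close>

lemma coercive_functionals:
  "\<exists>(m::nat) (e::nat \<Rightarrow> real \<Rightarrow> real) \<epsilon>. \<epsilon> > 0 \<and> (\<forall>i<m. continuous_on {a..b} (e i)) \<and>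
    (\<forall>c. (\<forall>x\<in>{a..b}. (\<Sum>i<m. c i * complex_of_real (e i x)) = 0) \<longrightarrow> (\<forall>i<m. c i = 0)) \<and>
    (\<forall>y\<in>D. (\<forall>i<m. ell a b e y i = 0) \<longrightarrow> Re (B y y) \<ge> \<epsilon> * Re (sob n a b y y))"
proof -
  have "\<exists>c>0. \<exists>C\<ge>0. \<forall>y. Ck_on a b n y \<longrightarrow> Re (B y y) \<ge> c * Re (sob n a b y y) - C * energy a b y"
    unfolding B_def by (rule garding[OF ab]) (rule cont_p p0, assumption)+
  then obtain c0 C where c0: "c0 > 0" and C: "C \<ge> 0"
    and g: "\<forall>y. Ck_on a b n y \<longrightarrow> Re (B y y) \<ge> c0 * Re (sob n a b y y) - C * energy a b y" by blast
  define t where "t = c0 / (2 * (C + 1))"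
  have t: "t > 0" "C * t \<le> c0 / 2" using c0 C by (auto simp: t_def field_simps)
  obtain m :: nat and e :: "nat \<Rightarrow> real \<Rightarrow> real" where e1: "\<forall>i<m. continuous_on {a..b} (e i)"
    and e2: "\<forall>c. (\<forall>x\<in>{a..b}. (\<Sum>i<m. c i * complex_of_real (e i x)) = 0) \<longrightarrow> (\<forall>i<m. c i = 0)"
    and e3: "\<forall>y. Ck_on a b 1 y \<longrightarrow> (\<forall>i<m. integral {a..b} (\<lambda>x. y x * complex_of_real (e i x)) = 0) \<longrightarrow>
       energy a b y \<le> t * energy a b (dw a b 1 y)"
    using tent_functionals[OF ab t(1)] by (elim exE conjE) (rule that)
  have "\<forall>y\<in>D. (\<forall>i<m. ell a b e y i = 0) \<longrightarrow> Re (B y y) \<ge> c0 / 2 * Re (sob n a b y y)"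
  proof (intro ballI impI)
    fix y assume y: "y \<in> D" and l: "\<forall>i<m. ell a b e y i = 0"
    have Cy: "Ck_on a b n y" by (rule D_Ck[OF y])
    have "energy a b y \<le> t * energy a b (dw a b 1 y)"
      using e3 Ck_on_mono[OF Cy n] l unfolding ell_def by blast
    also have "\<dots> \<le> t * Re (sob n a b y y)" using energy_le_sob[OF Cy n] t by (intro mult_left_mono) auto
    finally have "C * energy a b y \<le> (C * t) * Re (sob n a b y y)" using C by (simp add: mult_left_mono mult.assoc)
    also have "\<dots> \<le> c0 / 2 * Re (sob n a b y y)" using t sob_nonneg[OF Cy] by (intro mult_right_mono) auto
    moreover have "Re (B y y) \<ge> c0 * Re (sob n a b y y) - C * energy a b y" using g Cy by blast
    ultimately show "Re (B y y) \<ge> c0 / 2 * Re (sob n a b y y)" by (simp add: field_simps)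
  qed
  moreover have "c0 / 2 > 0" using c0 by simp
  ultimately show ?thesis using e1 e2
    by - (rule exI[where x = m], rule exI[where x = e], rule exI[where x = "c0 / 2"], intro conjI)
qed

lemma S_zero: "x \<in> {a..b} \<Longrightarrow> S (\<lambda>x. 0) x = 0"
  using S_lincomb[of "{}::nat set" "\<lambda>_ _. 0" x "\<lambda>_. 0"] by simp

text \<open>A square linear system. Unknowns are the 2 n initial data at \<open>a\<close> and the m
  coefficients of the right-hand side in the bumps; equations are the 2 n boundary residuals and the
  m functional values. A homogeneous solution has B(y,y) = 0 by Green's formula, coercivity forces y
  = 0, and injectivity gives solvability.\<close>

lemma dual_system:
  assumes e: "\<And>i. i < m \<Longrightarrow> continuous_on {a..b} (e i)"
    and indep: "\<And>c. (\<And>x. x \<in> {a..b} \<Longrightarrow> (\<Sum>i<m. c i * complex_of_real (e i x)) = 0) \<Longrightarrow> (\<And>i. i < m \<Longrightarrow> c i = 0)"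
    and coer: "\<And>y. y \<in> D \<Longrightarrow> (\<And>i. i < m \<Longrightarrow> ell a b e y i = 0) \<Longrightarrow> Re (B y y) \<ge> \<epsilon> * Re (sob n a b y y)"
    and eps: "\<epsilon> > 0"
  shows "\<exists>w \<beta>. \<forall>k<m. w k \<in> G \<and> (\<forall>i<m. ell a b e (w k) i = (if i = k then 1 else 0)) \<and>
    (\<forall>x\<in>{a..b}. S (w k) x = (\<Sum>i<m. \<beta> k i * complex_of_real (e i x)))"
proof -
  define N where "N = 2 * n + m"
  define f where "f j x = (if j < 2 * n then 0 else complex_of_real (e (j - 2 * n) x))" for j x
  \<comment> \<open>The first 2 n basis solutions carry unit initial data and right-hand side 0, the
    last m zero initial data and one bump each as right-hand side.\<close>
  define P where "P j y \<longleftrightarrow> Ck_on a b (2 * n) y \<and> (\<forall>x. x \<notin> {a..b} \<longrightarrow> y x = 0) \<and>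
     (\<forall>i<2 * n. dw a b i y a = (if i = j then 1 else 0)) \<and> (\<forall>x\<in>{a..b}. S y x = f j x)" for j y
  have "\<forall>j\<in>{..<N}. \<exists>y. P j y"
  proof
    fix j assume "j \<in> {..<N}"
    then have "continuous_on {a..b} (f j)"
      using e[of "j - 2 * n"] by (cases "j < 2 * n") (auto simp: f_def N_def intro!: continuous_intros)
    then show "\<exists>y. P j y" unfolding P_def
      by (intro S_ode[where \<eta> = "\<lambda>i. if i = j then 1 else 0"] ab n pn) (rule p p0, assumption)+
  qed
  from bchoice[OF this] obtain u where u: "\<forall>j\<in>{..<N}. P j (u j)" by (elim exE)
  have uC: "Ck_on a b (2 * n) (u j)" and u0: "\<And>x. x \<notin> {a..b} \<Longrightarrow> u j x = 0"
    and ud: "\<And>i. i < 2 * n \<Longrightarrow> dw a b i (u j) a = (if i = j then 1 else 0)"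
    and uS: "\<And>x. x \<in> {a..b} \<Longrightarrow> S (u j) x = f j x" if "j \<in> {..<N}" for j
    using bspec[OF u that] by (auto simp: P_def)
  have uc: "continuous_on {a..b} (u j)" if "j \<in> {..<N}" for j
    using Ck_on_cont[OF uC[OF that], of 0] by simp
  define Y where "Y \<alpha> = (\<lambda>x. \<Sum>j<N. \<alpha> j * u j x)" for \<alpha> :: "nat \<Rightarrow> complex"
  define A where "A i j = (if i < 2 * n then resid n a b p V l (u j) i else ell a b e (u j) (i - 2 * n))" for i j
  have YC: "Ck_on a b (2 * n) (Y \<alpha>)" for \<alpha>
    unfolding Y_def by (rule Ck_on_lincomb[OF ab finite_lessThan uC])
  have Y0: "Y \<alpha> x = 0" if "x \<notin> {a..b}" for \<alpha> x
    unfolding Y_def using u0[OF _ that] by (intro sum.neutral) auto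
  have Yr: "resid n a b p V l (Y \<alpha>) i = (\<Sum>j<N. A i j * \<alpha> j)" if i: "i < 2 * n" for \<alpha> i
  proof -
    have "resid n a b p V l (Y \<alpha>) i = (\<Sum>j<N. \<alpha> j * resid n a b p V l (u j) i)"
      unfolding Y_def by (rule resid_lincomb[OF finite_lessThan _ i]) (rule uC)
    then show ?thesis using i by (simp add: A_def mult.commute)
  qed
  have Yl: "ell a b e (Y \<alpha>) i = (\<Sum>j<N. A (2 * n + i) j * \<alpha> j)" if i: "i < m" for \<alpha> i
  proof -
    have "ell a b e (Y \<alpha>) i = (\<Sum>j<N. \<alpha> j * ell a b e (u j) i)"
      unfolding Y_def by (rule ell_lincomb) (auto intro: uc e i)
    then show ?thesis by (simp add: A_def mult.commute)
  qed
  have YS: "S (Y \<alpha>) x = (\<Sum>i<m. \<alpha> (2 * n + i) * complex_of_real (e i x))" if x: "x \<in> {a..b}" for \<alpha> x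
  proof -
    have "S (Y \<alpha>) x = (\<Sum>j<N. \<alpha> j * S (u j) x)"
      unfolding Y_def by (rule S_lincomb[OF finite_lessThan _ x]) (rule uC)
    also have "\<dots> = (\<Sum>j<N. \<alpha> j * f j x)" by (intro sum.cong refl) (simp only: uS[OF _ x])
    also have "\<dots> = (\<Sum>i<m. \<alpha> (2 * n + i) * complex_of_real (e i x))"
      unfolding N_def sum_lessThan_add by (simp add: f_def)
    finally show ?thesis .
  qed
  have YG: "Y \<alpha> \<in> G" if "\<And>i. i < 2 * n \<Longrightarrow> (\<Sum>j<N. A i j * \<alpha> j) = 0" for \<alpha>
    unfolding G_def using YC Y0 Yr that by simp
  have inj: "\<alpha> j = 0" if s: "\<And>i. i < N \<Longrightarrow> (\<Sum>j<N. A i j * \<alpha> j) = 0" and j: "j < N" for \<alpha> j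
  proof -
    have G: "Y \<alpha> \<in> G" by (rule YG) (rule s, simp add: N_def)
    have l0: "ell a b e (Y \<alpha>) i = 0" if "i < m" for i
      unfolding Yl[OF that] by (rule s) (use that in \<open>simp add: N_def\<close>)
    have D: "Y \<alpha> \<in> D" by (rule green_D(1)[OF G])
    have "B (Y \<alpha>) (Y \<alpha>) = integral {a..b} (\<lambda>x. S (Y \<alpha>) x * cnj (Y \<alpha> x))" by (rule green_D(2)[OF G D])
    also have "\<dots> = (\<Sum>i<m. \<alpha> (2 * n + i) * cnj (ell a b e (Y \<alpha>) i))"
      by (rule integral_span_cnj[OF e _ YS]) (use Ck_on_cont[OF YC, of 0 \<alpha>] in auto)
    also have "\<dots> = 0" using l0 by simp
    finally have "\<epsilon> * Re (sob n a b (Y \<alpha>) (Y \<alpha>)) \<le> 0" using coer[OF D l0] by simp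
    then have "Re (sob n a b (Y \<alpha>) (Y \<alpha>)) = 0"
      using eps sob_nonneg[OF D_Ck[OF D]] by (simp add: mult_le_0_iff)
    then have y0: "Y \<alpha> = (\<lambda>x. 0)" using sob_zero[OF ab] D unfolding D_def by blast
    \<comment> \<open>Initial data recover the first 2 n coefficients, independence of the bumps the
      remaining ones.\<close>
    show "\<alpha> j = 0"
    proof (cases "j < 2 * n")
      case True
      have aI: "a \<in> {a..b}" using ab by simp
      have "dw a b j (Y \<alpha>) a = (\<Sum>i<N. \<alpha> i * dw a b j (u i) a)"
        unfolding Y_def by (rule dw_lincomb[OF ab finite_lessThan uC _ aI]) (use True in auto)
      also have "\<dots> = (\<Sum>i<N. \<alpha> i * (if j = i then 1 else 0))"
        by (intro sum.cong refl) (simp only: ud[OF _ True])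
      also have "\<dots> = \<alpha> j" by (rule sum_unit[OF j])
      finally show ?thesis unfolding y0 dw_zero[OF ab aI] by simp
    next
      case False
      have "\<alpha> (2 * n + i) = 0" if "i < m" for i
      proof (rule indep[of "\<lambda>i. \<alpha> (2 * n + i)", OF _ that])
        fix x assume x: "x \<in> {a..b}"
        show "(\<Sum>i<m. \<alpha> (2 * n + i) * complex_of_real (e i x)) = 0"
          using YS[OF x, of \<alpha>] S_zero[OF x] unfolding y0 by simp
      qed
      from this[of "j - 2 * n"] show ?thesis using False j by (simp add: N_def)
    qed
  qed
  have "\<forall>k\<in>{..<m}. \<exists>\<alpha>. \<forall>i<N. (\<Sum>j<N. A i j * \<alpha> j) = (if i = 2 * n + k then 1 else 0)"
  proof
    fix k
    show "\<exists>\<alpha>. \<forall>i<N. (\<Sum>j<N. A i j * \<alpha> j) = (if i = 2 * n + k then 1 else 0)"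
      by (rule square_system_solvable) (rule inj)
  qed
  from bchoice[OF this] obtain X where X: "\<forall>k\<in>{..<m}. \<forall>i<N. (\<Sum>j<N. A i j * X k j) = (if i = 2 * n + k then 1 else 0)"
    by (elim exE)
  have X': "(\<Sum>j<N. A i j * X k j) = (if i = 2 * n + k then 1 else 0)" if "k < m" "i < N" for k i
    using X that by simp
  show ?thesis
  proof (rule exI[where x = "\<lambda>k. Y (X k)"], rule exI[where x = "\<lambda>k i. X k (2 * n + i)"], intro allI impI conjI ballI)
    fix k assume k: "k < m"
    show "Y (X k) \<in> G" by (rule YG) (use X'[OF k] in \<open>simp add: N_def\<close>)
    show "ell a b e (Y (X k)) i = (if i = k then 1 else 0)" if "i < m" for i
      unfolding Yl[OF that] using X'[OF k, of "2 * n + i"] that by (simp add: N_def)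
    show "S (Y (X k)) x = (\<Sum>i<m. X k (2 * n + i) * complex_of_real (e i x))" if "x \<in> {a..b}" for x
      by (rule YS[OF that])
  qed
qed

text \<open>The dual functions \<open>w\<close> are orthogonal in \<open>B\<close> to the common
  kernel of the functionals, because \<open>S\<close> maps them into the span of the bumps. A
  unitary change of basis diagonalises their Gram matrix, and the functionals are transformed along
  with it.\<close>

theorem normal_form:
  "\<exists>m v \<phi> d \<epsilon>. nform D B (sob n a b) m v \<phi> d \<epsilon> \<and> (\<forall>i<m. d i = 0 \<longrightarrow> v i \<in> G \<and> (\<forall>x\<in>{a..b}. S (v i) x = 0)) \<and>
    (\<forall>y\<in>G. (\<forall>x\<in>{a..b}. S y x = 0) \<longrightarrow> (\<exists>c. y = (\<lambda>x. \<Sum>i\<in>{i. i < m \<and> d i = 0}. c i * v i x)))"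
proof -
  obtain m :: nat and e :: "nat \<Rightarrow> real \<Rightarrow> real" and \<epsilon> where eps: "\<epsilon> > 0" and e': "\<forall>i<m. continuous_on {a..b} (e i)"
    and indep': "\<forall>c. (\<forall>x\<in>{a..b}. (\<Sum>i<m. c i * complex_of_real (e i x)) = 0) \<longrightarrow> (\<forall>i<m. c i = 0)"
    and coer': "\<forall>y\<in>D. (\<forall>i<m. ell a b e y i = 0) \<longrightarrow> Re (B y y) \<ge> \<epsilon> * Re (sob n a b y y)"
    using coercive_functionals by (elim exE conjE) (rule that)
  have e: "continuous_on {a..b} (e i)" if "i < m" for i using e' that by simp
  have coer: "Re (B y y) \<ge> \<epsilon> * Re (sob n a b y y)" if "y \<in> D" "\<And>i. i < m \<Longrightarrow> ell a b e y i = 0" for y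
    using coer' that by simp
  have indep: "c i = 0" if "\<And>x. x \<in> {a..b} \<Longrightarrow> (\<Sum>i<m. c i * complex_of_real (e i x)) = 0" "i < m" for c i
    using spec[OF indep', of c] that by simp
  have "\<exists>w \<beta>. \<forall>k<m. w k \<in> G \<and> (\<forall>i<m. ell a b e (w k) i = (if i = k then 1 else 0)) \<and>
    (\<forall>x\<in>{a..b}. S (w k) x = (\<Sum>i<m. \<beta> k i * complex_of_real (e i x)))"
  proof (rule dual_system[of m e \<epsilon>])
    show "continuous_on {a..b} (e i)" if "i < m" for i by (rule e[OF that])
    show "c i = 0" if "\<And>x. x \<in> {a..b} \<Longrightarrow> (\<Sum>i<m. c i * complex_of_real (e i x)) = 0" "i < m" for c i
      by (rule indep[OF that])
    show "Re (B y y) \<ge> \<epsilon> * Re (sob n a b y y)" if "y \<in> D" "\<And>i. i < m \<Longrightarrow> ell a b e y i = 0" for y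
      by (rule coer[OF that])
  qed (rule eps)
  then obtain w \<beta> where w': "\<forall>k<m. w k \<in> G \<and> (\<forall>i<m. ell a b e (w k) i = (if i = k then 1 else 0)) \<and>
    (\<forall>x\<in>{a..b}. S (w k) x = (\<Sum>i<m. \<beta> k i * complex_of_real (e i x)))" by (elim exE) (rule that)
  have wG: "w k \<in> G" and wl: "\<And>i. i < m \<Longrightarrow> ell a b e (w k) i = (if i = k then 1 else 0)"
    and wS: "\<And>x. x \<in> {a..b} \<Longrightarrow> S (w k) x = (\<Sum>i<m. \<beta> k i * complex_of_real (e i x))" if "k < m" for k
    using mp[OF spec[OF w', of k] that] by auto
  have wD: "w k \<in> D" if "k < m" for k by (rule green_D(1)[OF wG[OF that]])
  have cont_D: "continuous_on {a..b} z" if "z \<in> D" for z using Ck_on_cont[OF D_Ck[OF that], of 0] by simp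
  have wC: "Ck_on a b (2 * n) (w k)" if "k < m" for k using wG[OF that] by (simp add: G_def)
  have Bw: "B (w k) z = (\<Sum>i<m. \<beta> k i * cnj (ell a b e z i))" if k: "k < m" and z: "z \<in> D" for k z
    unfolding green_D(2)[OF wG[OF k] z] by (rule integral_span_cnj[OF e cont_D[OF z] wS[OF k]])
  define H where "H i j = B (w i) (w j)" for i j
  have Hh: "H i j = cnj (H j i)" if "i < m" "j < m" for i j
    unfolding H_def by (rule hformD(3)[OF B_hform]) (rule wD that)+
  have nrm: "(\<Sum>k<m. H i k * cnj (H j k)) = (\<Sum>k<m. cnj (H k i) * H k j)" if ij: "i < m" "j < m" for i j
  proof (intro sum.cong refl)
    fix k assume "k \<in> {..<m}"
    then have k: "k < m" by simp
    show "H i k * cnj (H j k) = cnj (H k i) * H k j" using Hh[OF ij(1) k] Hh[OF k ij(2)] by metis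
  qed
  have "\<exists>x z. (\<forall>k<m. \<forall>l<m. (\<Sum>i<m. x k i * cnj (x l i)) = (if k = l then 1 else 0))
    \<and> (\<forall>i<m. \<forall>j<m. (\<Sum>k<m. x k i * cnj (x k j)) = (if i = j then 1 else 0))
    \<and> (\<forall>i<m. \<forall>j<m. H i j = (\<Sum>k<m. z k * x k i * cnj (x k j)))"
    by (rule normal_spectral) (rule nrm)
  then obtain x z where
    x1': "\<forall>k<m. \<forall>l<m. (\<Sum>i<m. x k i * cnj (x l i)) = (if k = l then 1 else 0)"
    and x2': "\<forall>i<m. \<forall>j<m. (\<Sum>k<m. x k i * cnj (x k j)) = (if i = j then 1 else 0)"
    and x3': "\<forall>i<m. \<forall>j<m. H i j = (\<Sum>k<m. z k * x k i * cnj (x k j))"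
    by (elim exE conjE) (rule that)
  have x1: "(\<Sum>i<m. x k i * cnj (x l i)) = (if k = l then 1 else 0)" if "k < m" "l < m" for k l using x1' that by simp
  have x2: "(\<Sum>k<m. x k i * cnj (x k j)) = (if i = j then 1 else 0)" if "i < m" "j < m" for i j using x2' that by simp
  \<comment> \<open>Conjugated coefficients, because the form is conjugate-linear in its second
    argument and \<open>H i j\<close> pairs \<open>w i\<close> with \<open>w j\<close>; the
    functionals take the unconjugated ones to stay dual.\<close>
  define v where "v k = (\<lambda>t. \<Sum>i<m. cnj (x k i) * w i t)" for k
  define \<phi> where "\<phi> k y = (\<Sum>i<m. x k i * ell a b e y i)" for k y
  define d where "d k = Re (z k)" for k
  have vG: "v k \<in> G" for k unfolding v_def by (rule G_lincomb) (auto intro: wG)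
  have vD: "v k \<in> D" for k by (rule green_D(1)[OF vG])
  have wv: "w j = (\<lambda>t. \<Sum>k<m. x k j * v k t)" if j: "j < m" for j
  proof
    fix t
    have "(\<Sum>k<m. x k j * v k t) = (\<Sum>k<m. \<Sum>i<m. x k j * cnj (x k i) * w i t)"
      by (simp add: v_def sum_distrib_left mult.assoc)
    also have "\<dots> = (\<Sum>i<m. \<Sum>k<m. x k j * cnj (x k i) * w i t)" by (rule sum.swap)
    also have "\<dots> = (\<Sum>i<m. (if j = i then 1 else 0) * w i t)"
      by (intro sum.cong refl) (simp only: sum_distrib_right[symmetric] x2[OF j] lessThan_iff)
    also have "\<dots> = w j t" using j by (simp add: if_distrib[of "\<lambda>u. u * _"] cong: if_cong)
    finally show "w j t = (\<Sum>k<m. x k j * v k t)" by simp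
  qed
  have Bv1: "B (v k) h = (\<Sum>i<m. cnj (x k i) * B (w i) h)" if "h \<in> D" for k h
    unfolding v_def by (rule hform_sum_left[OF D_sub B_hform]) (auto intro: wD that)
  have Bvv: "B (v k) (v l) = (if k = l then z k else 0)" if k: "k < m" and l: "l < m" for k l
  proof -
    have "B (w i) (v l) = (\<Sum>r<m. z r * x r i * (if l = r then 1 else 0))" if i: "i < m" for i
    proof -
      have "B (w i) (v l) = (\<Sum>j<m. cnj (cnj (x l j)) * B (w i) (w j))"
        unfolding v_def by (rule hform_sum_right[OF D_sub B_hform]) (auto intro: wD i)
      also have "\<dots> = (\<Sum>j<m. \<Sum>r<m. z r * x r i * (x l j * cnj (x r j)))"
        using x3' i by (intro sum.cong refl) (simp add: H_def sum_distrib_left mult_ac)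
      also have "\<dots> = (\<Sum>r<m. \<Sum>j<m. z r * x r i * (x l j * cnj (x r j)))" by (rule sum.swap)
      also have "\<dots> = (\<Sum>r<m. z r * x r i * (if l = r then 1 else 0))"
        by (intro sum.cong refl) (simp only: sum_distrib_left[symmetric] x1[OF l] lessThan_iff)
      finally show ?thesis .
    qed
    moreover have "(\<Sum>r<m. z r * x r i * (if l = r then 1 else 0)) = z l * x l i" for i by (rule sum_unit[OF l])
    ultimately have w: "B (w i) (v l) = z l * x l i" if "i < m" for i using that by simp
    have "B (v k) (v l) = (\<Sum>i<m. cnj (x k i) * (z l * x l i))"
      unfolding Bv1[OF vD] by (intro sum.cong refl) (simp add: w)
    also have "\<dots> = z l * (\<Sum>i<m. x l i * cnj (x k i))" by (simp add: sum_distrib_left mult_ac)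
    finally show ?thesis using x1[OF l k] by (auto split: if_splits)
  qed
  have zr: "z k = complex_of_real (d k)" if k: "k < m" for k
  proof -
    have "B (v k) (v k) = cnj (B (v k) (v k))" by (rule hformD(3)[OF B_hform vD vD vD])
    then have "z k = cnj (z k)" using Bvv[OF k k] by simp
    then show ?thesis unfolding d_def by (metis Im_complex_of_real Re_complex_of_real cnj.sel(2) complex_eqI equal_neg_zero)
  qed
  have phi_lc: "\<phi> k (\<lambda>x. \<Sum>j\<in>J. c j * g j x) = (\<Sum>j\<in>J. c j * \<phi> k (g j))" if J: "finite J" and g: "\<And>j. j \<in> J \<Longrightarrow> g j \<in> D"
    for k c g and J :: "nat set"
  proof -
    have "ell a b e (\<lambda>x. \<Sum>j\<in>J. c j * g j x) i = (\<Sum>j\<in>J. c j * ell a b e (g j) i)" if "i < m" for i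
      by (rule ell_lincomb) (auto intro: J cont_D g e that)
    then have "\<phi> k (\<lambda>x. \<Sum>j\<in>J. c j * g j x) = (\<Sum>i<m. \<Sum>j\<in>J. c j * (x k i * ell a b e (g j) i))"
      unfolding \<phi>_def by (intro sum.cong refl) (simp add: sum_distrib_left mult_ac)
    also have "\<dots> = (\<Sum>j\<in>J. c j * \<phi> k (g j))" unfolding \<phi>_def sum_distrib_left by (rule sum.swap)
    finally show ?thesis .
  qed
  have phi_add: "\<phi> k (\<lambda>x. f x + g x) = \<phi> k f + \<phi> k g" if "f \<in> D" "g \<in> D" for k f g
    using phi_lc[of "{0, 1::nat}" "\<lambda>j. if j = 0 then f else g" k "\<lambda>j. 1"] that by auto
  have phi_scale: "\<phi> k (\<lambda>x. s * f x) = s * \<phi> k f" if "f \<in> D" for k f s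
    using phi_lc[of "{0::nat}" "\<lambda>j. f" k "\<lambda>j. s"] that by auto
  have phi_v: "\<phi> k (v l) = (if k = l then 1 else 0)" if k: "k < m" and l: "l < m" for k l
  proof -
    have "\<phi> k (w i) = x k i" if "i < m" for i
      using wl[OF that] that unfolding \<phi>_def by (simp add: if_distrib[of "\<lambda>u. _ * u"] cong: if_cong)
    moreover have "\<phi> k (v l) = (\<Sum>i<m. cnj (x l i) * \<phi> k (w i))" unfolding v_def by (rule phi_lc) (auto intro: wD)
    ultimately have "\<phi> k (v l) = (\<Sum>i<m. x k i * cnj (x l i))" by (simp add: mult.commute)
    then show ?thesis using x1[OF k l] by simp
  qed
  \<comment> \<open>The unitary change of functionals preserves their common kernel.\<close>
  have ell0: "ell a b e y i = 0" if p0: "\<forall>k<m. \<phi> k y = 0" and i: "i < m" for y i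
  proof -
    have "(\<Sum>k<m. cnj (x k i) * \<phi> k y) = (\<Sum>k<m. \<Sum>j<m. x k j * cnj (x k i) * ell a b e y j)"
      by (simp add: \<phi>_def sum_distrib_left mult_ac)
    also have "\<dots> = (\<Sum>j<m. \<Sum>k<m. x k j * cnj (x k i) * ell a b e y j)" by (rule sum.swap)
    also have "\<dots> = (\<Sum>j<m. (if j = i then 1 else 0) * ell a b e y j)"
      by (intro sum.cong refl) (simp only: sum_distrib_right[symmetric] x2[OF _ i] lessThan_iff)
    also have "\<dots> = ell a b e y i" using i by (simp add: if_distrib[of "\<lambda>u. u * _"] cong: if_cong)
    finally show ?thesis using p0 by simp
  qed
  have orth: "B y (v j) = 0" if y: "y \<in> D" and p0: "\<forall>k<m. \<phi> k y = 0" for y j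
  proof -
    have "B (w i) y = 0" if "i < m" for i unfolding Bw[OF that y] using ell0[OF p0] by simp
    then have "B (v j) y = 0" unfolding Bv1[OF y] by simp
    moreover have "B y (v j) = cnj (B (v j) y)" by (rule hformD(3)[OF B_hform vD y y])
    ultimately show ?thesis by simp
  qed
  have nf: "nform D B (sob n a b) m v \<phi> d \<epsilon>"
    unfolding nform_def
  proof (intro conjI allI impI ballI)
    show "\<phi> i (\<lambda>x. f x + g x) = \<phi> i f + \<phi> i g" if "f \<in> D" "g \<in> D" for i f g by (rule phi_add[OF that])
    show "\<phi> i (\<lambda>x. s * f x) = s * \<phi> i f" if "f \<in> D" for i f s by (rule phi_scale[OF that])
    show "B (v i) (v j) = (if i = j then complex_of_real (d i) else 0)" if "i < m" "j < m" for i j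
      unfolding Bvv[OF that] zr[OF that(1)] by (rule refl)
    show "B y (v j) = 0" if "y \<in> D" "\<forall>i<m. \<phi> i y = 0" for y j by (rule orth[OF that])
    show "\<epsilon> * Re (sob n a b y y) \<le> Re (B y y)" if "y \<in> D" "\<forall>i<m. \<phi> i y = 0" for y
      by (rule coer[OF that(1) ell0[OF that(2)]])
  qed (auto simp: eps vD phi_v)
  \<comment> \<open>\<open>S (v i)\<close> lies in the span of the bumps, and its coefficients are
    the numbers B(v i, w k), which vanish when d i = 0.\<close>
  have SV: "S (v i) t = 0" if i: "i < m" "d i = 0" and t: "t \<in> {a..b}" for i t
  proof -
    have "S (v i) t = (\<Sum>j<m. cnj (x i j) * S (w j) t)" if t: "t \<in> {a..b}" for t
      unfolding v_def by (rule S_lincomb[OF finite_lessThan _ t]) (simp add: wC)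
    then have "S (v i) t = (\<Sum>j<m. \<Sum>k<m. cnj (x i j) * \<beta> j k * complex_of_real (e k t))" if t: "t \<in> {a..b}" for t
      using t by (simp add: wS sum_distrib_left mult.assoc)
    then have "S (v i) t = (\<Sum>k<m. \<Sum>j<m. cnj (x i j) * \<beta> j k * complex_of_real (e k t))" if t: "t \<in> {a..b}" for t
      unfolding that by (subst sum.swap) (use t in blast)
    then have s: "S (v i) t = (\<Sum>k<m. (\<Sum>j<m. cnj (x i j) * \<beta> j k) * complex_of_real (e k t))" if t: "t \<in> {a..b}" for t
      using t by (simp add: sum_distrib_right)
    have "(\<Sum>j<m. cnj (x i j) * \<beta> j k) = 0" if k: "k < m" for k
    proof -
      have "B (v i) (w k) = (\<Sum>k'<m. (\<Sum>j<m. cnj (x i j) * \<beta> j k') * cnj (ell a b e (w k) k'))"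
        unfolding green_D(2)[OF vG wD[OF k]] by (rule integral_span_cnj[OF e cont_D[OF wD[OF k]] s])
      also have "\<dots> = (\<Sum>k'<m. (\<Sum>j<m. cnj (x i j) * \<beta> j k') * (if k = k' then 1 else 0))"
        by (intro sum.cong refl) (auto simp: wl[OF k])
      also have "\<dots> = (\<Sum>j<m. cnj (x i j) * \<beta> j k)" by (rule sum_unit[OF k])
      finally have 1: "B (v i) (w k) = (\<Sum>j<m. cnj (x i j) * \<beta> j k)" .
      have "B (v i) (\<lambda>t. \<Sum>r<m. x r k * v r t) = (\<Sum>r<m. cnj (x r k) * B (v i) (v r))"
        by (rule hform_sum_right[OF D_sub B_hform]) (auto intro: vD)
      also have "\<dots> = 0" using Bvv[OF i(1)] zr[OF i(1)] i(2) by (intro sum.neutral) auto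
      finally show ?thesis using 1 wv[OF k] by simp
    qed
    then show ?thesis using s[OF t] by simp
  qed
  \<comment> \<open>A null function pairs to 0 with the whole form domain. Pairing with
    \<open>v k\<close> kills the coefficients with d k \<noteq> 0, and pairing with the coercive
    component \<open>h\<close> kills \<open>h\<close>.\<close>
  have sp: "\<exists>c. y = (\<lambda>x. \<Sum>i\<in>{i. i < m \<and> d i = 0}. c i * v i x)" if y: "y \<in> G" and Sy: "\<forall>x\<in>{a..b}. S y x = 0" for y
  proof -
    have yD: "y \<in> D" by (rule green_D(1)[OF y])
    have By: "B y h = 0" if "h \<in> D" for h
    proof -
      have "integral {a..b} (\<lambda>x. S y x * cnj (h x)) = integral {a..b} (\<lambda>x. 0)" by (rule integral_cong) (use Sy in simp)
      then show ?thesis unfolding green_D(2)[OF y that] by simp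
    qed
    define L where "L = (\<lambda>x. \<Sum>i<m. \<phi> i y * v i x)"
    define h where "h = (\<lambda>x. y x + (-1) * L x)"
    have L: "L \<in> D" unfolding L_def by (rule csubspace_lincomb[OF D_sub]) (auto intro: vD)
    have L': "(\<lambda>x. (-1) * L x) \<in> D" by (rule csubspaceD(3)[OF D_sub L])
    have h: "h \<in> D" unfolding h_def by (rule csubspaceD(2)[OF D_sub yD L'])
    have yh: "y = (\<lambda>x. L x + h x)" by (simp add: h_def)
    have phL: "\<phi> k L = \<phi> k y" if "k < m" for k
    proof -
      have "\<phi> k L = (\<Sum>i<m. \<phi> i y * \<phi> k (v i))" unfolding L_def by (rule phi_lc) (auto intro: vD)
      also have "\<dots> = (\<Sum>i<m. \<phi> i y * (if k = i then 1 else 0))" by (intro sum.cong refl) (simp add: phi_v[OF that])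
      also have "\<dots> = \<phi> k y" by (rule sum_unit[OF that])
      finally show ?thesis .
    qed
    have ph: "\<forall>k<m. \<phi> k h = 0"
      unfolding h_def phi_add[OF yD L'] phi_scale[OF L] using phL by simp
    have BLv: "B L (v k) = \<phi> k y * complex_of_real (d k)" if k: "k < m" for k
    proof -
      have "B L (v k) = (\<Sum>i<m. \<phi> i y * B (v i) (v k))" unfolding L_def
        by (rule hform_sum_left[OF D_sub B_hform]) (auto intro: vD)
      also have "\<dots> = (\<Sum>i<m. \<phi> i y * (if i = k then z k else 0))" by (intro sum.cong refl) (use Bvv[OF _ k] in auto)
      also have "\<dots> = \<phi> k y * z k" using k by (subst sum.remove[of _ k]) (auto intro!: sum.neutral)
      finally show ?thesis using zr[OF k] by simp
    qed
    have c0: "\<phi> k y = 0" if k: "k < m" "d k \<noteq> 0" for k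
    proof -
      have "B y (v k) = B L (v k) + B h (v k)" by (subst yh) (rule hformD(1)[OF B_hform L h vD])
      then show ?thesis using By[OF vD] BLv[OF k(1)] orth[OF h ph] k(2) by simp
    qed
    have "B L h = (\<Sum>i<m. \<phi> i y * B (v i) h)" unfolding L_def
      by (rule hform_sum_left[OF D_sub B_hform]) (auto intro: vD h)
    moreover have "B (v i) h = 0" for i
      using hformD(3)[OF B_hform h vD h, of i] orth[OF h ph, of i] by simp
    ultimately have "B L h = 0" by simp
    moreover have "B y h = B L h + B h h" by (subst yh) (rule hformD(1)[OF B_hform L h h])
    ultimately have "B h h = 0" using By[OF h] by simp
    then have "\<epsilon> * Re (sob n a b h h) \<le> 0" using coer[OF h ell0[OF ph]] by simp
    then have "Re (sob n a b h h) = 0" using eps sob_nonneg[OF D_Ck[OF h]] by (simp add: mult_le_0_iff)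
    then have h0: "h = (\<lambda>x. 0)" using sob_zero[OF ab] h unfolding D_def by blast
    have Lx: "L x = (\<Sum>i\<in>{i. i < m \<and> d i = 0}. \<phi> i y * v i x)" for x
      unfolding L_def by (rule sum.mono_neutral_right) (auto simp: c0)
    have "y x = L x" for x using fun_cong[OF yh, of x] fun_cong[OF h0, of x] add.right_neutral[of "L x"] by metis
    then have "y = (\<lambda>x. \<Sum>i\<in>{i. i < m \<and> d i = 0}. \<phi> i y * v i x)" using Lx by (intro ext) (rule trans)
    then show ?thesis by - (rule exI[where x = "\<lambda>i. \<phi> i y"])
  qed
  have 1: "\<forall>i<m. d i = 0 \<longrightarrow> v i \<in> G \<and> (\<forall>x\<in>{a..b}. S (v i) x = 0)"
    using vG SV by blast
  have 2: "\<forall>y\<in>G. (\<forall>x\<in>{a..b}. S y x = 0) \<longrightarrow> (\<exists>c. y = (\<lambda>x. \<Sum>i\<in>{i. i < m \<and> d i = 0}. c i * v i x))"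
    by (intro ballI impI) (rule sp)
  show ?thesis
    by (rule exI[where x = m], rule exI[where x = v], rule exI[where x = \<phi>], rule exI[where x = d], rule exI[where x = \<epsilon>],
      rule conjI[OF nf conjI[OF 1 2]])
qed

end

text \<open>Uniform continuity of the \<lambda>-derivative on the product of [a,b] with a closed
  interval gives one neighbourhood for all \<open>x\<close>; the mean value inequality is applied to
  the function minus its linear part.\<close>

lemma uniform_remainder:
  fixes g :: "real \<Rightarrow> real \<Rightarrow> real"
  assumes d: "\<And>x l. x \<in> {a..b} \<Longrightarrow> l \<in> {\<sigma><..<\<tau>} \<Longrightarrow> (\<lambda>l'. g x l') differentiable (at l)"
    and c: "continuous_on ({a..b} \<times> {\<sigma><..<\<tau>}) (\<lambda>(x, l). deriv (\<lambda>l'. g x l') l)"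
    and t0: "t0 \<in> {\<sigma><..<\<tau>}" and \<eta>: "\<eta> > 0"
  shows "\<forall>\<^sub>F t in nhds t0. \<forall>x\<in>{a..b}. \<bar>g x t - g x t0 - (t - t0) * deriv (\<lambda>l'. g x l') t0\<bar> \<le> \<eta> * \<bar>t - t0\<bar>"
proof -
  define r where "r = min (t0 - \<sigma>) (\<tau> - t0) / 2"
  have rr: "r > 0" "2 * r \<le> t0 - \<sigma>" "2 * r \<le> \<tau> - t0" using t0 by (auto simp: r_def)
  then have r: "r > 0" "cball t0 r \<subseteq> {\<sigma><..<\<tau>}" by (auto simp: dist_real_def abs_le_iff)
  have "uniformly_continuous_on ({a..b} \<times> cball t0 r) (\<lambda>(x, l). deriv (\<lambda>l'. g x l') l)"
    using r(2) by (intro compact_uniformly_continuous continuous_on_subset[OF c] compact_Times) auto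
  then obtain \<delta> where \<delta>: "\<delta> > 0" and u: "\<And>z z'. z \<in> {a..b} \<times> cball t0 r \<Longrightarrow> z' \<in> {a..b} \<times> cball t0 r \<Longrightarrow> dist z' z < \<delta> \<Longrightarrow>
      dist ((\<lambda>(x, l). deriv (\<lambda>l'. g x l') l) z') ((\<lambda>(x, l). deriv (\<lambda>l'. g x l') l) z) < \<eta>"
    using \<eta> unfolding uniformly_continuous_on_def by metis
  define e where "e = min \<delta> r"
  have e: "e > 0" using \<delta> r by (simp add: e_def)
  have sub: "ball t0 e \<subseteq> cball t0 r" by (auto simp: e_def)
  have "\<bar>g x t - g x t0 - (t - t0) * deriv (\<lambda>l'. g x l') t0\<bar> \<le> \<eta> * \<bar>t - t0\<bar>" if x: "x \<in> {a..b}" and t: "dist t t0 < e" for x t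
  proof -
    let ?h = "\<lambda>l. g x l - l * deriv (\<lambda>l'. g x l') t0"
    have "norm (?h t - ?h t0) \<le> \<eta> * norm (t - t0)"
    proof (rule field_differentiable_bound[of "ball t0 e" ?h "\<lambda>l. deriv (\<lambda>l'. g x l') l - deriv (\<lambda>l'. g x l') t0"])
      fix l assume l: "l \<in> ball t0 e"
      then have "l \<in> {\<sigma><..<\<tau>}" using sub r(2) by blast
      then have "((\<lambda>l'. g x l') has_field_derivative deriv (\<lambda>l'. g x l') l) (at l)"
        using d[OF x] by (simp add: DERIV_deriv_iff_real_differentiable)
      from DERIV_diff[OF this DERIV_cmult_right[OF DERIV_ident, of "deriv (\<lambda>l'. g x l') t0"]]
      have "(?h has_field_derivative deriv (\<lambda>l'. g x l') l - deriv (\<lambda>l'. g x l') t0) (at l)" by (simp only: mult_1)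
      then show "(?h has_field_derivative deriv (\<lambda>l'. g x l') l - deriv (\<lambda>l'. g x l') t0) (at l within ball t0 e)"
        by (rule has_field_derivative_at_within)
      have "l \<in> cball t0 r" "t0 \<in> cball t0 r" using l sub r(1) by auto
      then have z: "(x, t0) \<in> {a..b} \<times> cball t0 r" "(x, l) \<in> {a..b} \<times> cball t0 r" using x by blast+
      have "dist (x, l) (x, t0) < \<delta>" using l by (simp add: e_def dist_Pair_Pair dist_commute)
      from u[OF z this] show "norm (deriv (\<lambda>l'. g x l') l - deriv (\<lambda>l'. g x l') t0) \<le> \<eta>"
        by (simp only: dist_norm prod.case less_imp_le)
    qed (use t e in \<open>auto simp: dist_commute\<close>)
    then show ?thesis by (simp add: algebra_simps)
  qed
  then show ?thesis unfolding eventually_nhds_metric using e by blast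
qed

lemma vector_derivative_remainder:
  fixes g :: "real \<Rightarrow> complex"
  assumes "(g has_vector_derivative g') (at t0)" "\<eta> > 0"
  shows "\<forall>\<^sub>F t in nhds t0. cmod (g t - g t0 - complex_of_real (t - t0) * g') \<le> \<eta> * \<bar>t - t0\<bar>"
proof -
  from assms obtain d where "d > 0" "\<forall>t. norm (t - t0) < d \<longrightarrow> norm (g t - g t0 - (t - t0) *\<^sub>R g') \<le> \<eta> * norm (t - t0)"
    unfolding has_vector_derivative_def has_derivative_at_alt by blast
  then show ?thesis unfolding eventually_nhds_metric
    by (intro exI[where x = d]) (simp add: dist_norm scaleR_conv_of_real)
qed

section \<open>Dimension of the eigenspace\<close>

lemma vector_space_fscale: "vector_space fscale"
  by unfold_locales (auto simp: fscale_def fun_eq_iff algebra_simps)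

lemma sum_fun_apply: "(\<Sum>i\<in>J. f i) x = (\<Sum>i\<in>J. f i x)" for f :: "'i \<Rightarrow> 'b \<Rightarrow> 'c::comm_monoid_add"
  by (induction J rule: infinite_finite_induct) auto

lemma nform_phi:
  assumes D: "csubspace D" and nf: "nform D B M m v \<phi> d \<epsilon>" and J: "J \<subseteq> {..<m}" and k: "k \<in> J"
  shows "\<phi> k (\<lambda>x. \<Sum>j\<in>J. c j * v j x) = c k"
proof -
  have v: "v i \<in> D" if "i < m" for i using nf that by (simp add: nform_def)
  have add: "\<phi> k (\<lambda>x. f x + g x) = \<phi> k f + \<phi> k g" if "f \<in> D" "g \<in> D" for f g
    using nf that J k by (auto simp: nform_def)
  have scale: "\<phi> k (\<lambda>x. s * f x) = s * \<phi> k f" if "f \<in> D" for f s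
    using nf that J k by (auto simp: nform_def)
  have pv: "\<phi> k (v j) = (if k = j then 1 else 0)" if "j < m" for j
    using nf that J k by (auto simp: nform_def)
  have fin: "finite J" using J by (rule finite_subset) simp
  have "\<phi> k (\<lambda>x. \<Sum>j\<in>K. c j * v j x) = (\<Sum>j\<in>K. c j * \<phi> k (v j))" if K: "finite K" "K \<subseteq> {..<m}" for K
    using K
  proof (induction K rule: finite_induct)
    case empty
    then show ?case using scale[OF csubspaceD(1)[OF D], of 0] by simp
  next
    case (insert j K)
    have 1: "(\<lambda>x. c j * v j x) \<in> D" using csubspaceD(3)[OF D v] insert by simp
    have 2: "(\<lambda>x. \<Sum>j\<in>K. c j * v j x) \<in> D" by (rule csubspace_lincomb[OF D insert(1)]) (use insert in \<open>auto intro: v\<close>)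
    have "\<phi> k (\<lambda>x. c j * v j x + (\<Sum>j\<in>K. c j * v j x)) = c j * \<phi> k (v j) + (\<Sum>j\<in>K. c j * \<phi> k (v j))"
      unfolding add[OF 1 2] using insert scale[OF v] by simp
    then show ?case using insert by simp
  qed
  from this[OF fin J] have "\<phi> k (\<lambda>x. \<Sum>j\<in>J. c j * v j x) = (\<Sum>j\<in>J. c j * (if k = j then 1 else 0))"
    using J pv by (auto intro!: sum.cong)
  also have "\<dots> = c k" using fin k by (subst sum.remove[of _ k]) (auto intro!: sum.neutral)
  finally show ?thesis .
qed

text \<open>Duality with the functionals makes \<open>v\<close> injective on \<open>J\<close> and
  its values linearly independent, so they form a basis of the span.\<close>

lemma dim_span_nform:
  assumes D: "csubspace D" and nf: "nform D B M m v \<phi> d \<epsilon>" and J: "J \<subseteq> {..<m}"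
  shows "vector_space.dim fscale (range (\<lambda>c x. \<Sum>j\<in>J. c j * v j x)) = card J"
proof -
  interpret vs: vector_space fscale by (rule vector_space_fscale)
  let ?E = "range (\<lambda>c x. \<Sum>j\<in>J. c j * v j x)"
  have fin: "finite J" using J by (rule finite_subset) simp
  have pv: "\<phi> k (v j) = (if k = j then 1 else 0)" if "j < m" "k < m" for j k
    using nf that by (simp add: nform_def)
  have inj: "inj_on v J"
  proof (rule inj_onI)
    fix i j assume ij: "i \<in> J" "j \<in> J" and eq: "v i = v j"
    have "i < m" "j < m" using ij J by auto
    then have "\<phi> i (v i) = 1" "\<phi> i (v j) = (if i = j then 1 else 0)" using pv by auto
    then show "i = j" using eq by (auto split: if_splits)
  qed
  have comb: "(\<Sum>g\<in>v ` J. fscale (s g) g) = (\<lambda>x. \<Sum>j\<in>J. s (v j) * v j x)" for s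
    by (subst sum.reindex[OF inj]) (simp add: fun_eq_iff sum_fun_apply fscale_def)
  have ind: "\<not> vs.dependent (v ` J)"
  proof (rule vs.independent_if_scalars_zero)
    fix s g assume 0: "(\<Sum>g\<in>v ` J. fscale (s g) g) = 0" and "g \<in> v ` J"
    then obtain k where k: "k \<in> J" "g = v k" by blast
    have "\<phi> k (\<lambda>x. \<Sum>j\<in>J. s (v j) * v j x) = s (v k)" by (rule nform_phi[OF D nf J k(1)])
    moreover have "\<phi> k (\<lambda>x. \<Sum>j\<in>J. 0 * v j x) = 0" by (rule nform_phi[OF D nf J k(1), of "\<lambda>_. 0"])
    moreover have "(\<lambda>x. \<Sum>j\<in>J. s (v j) * v j x) = (\<lambda>x. \<Sum>j\<in>J. 0 * v j x)"
      using 0 unfolding comb by (simp add: zero_fun_def)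
    ultimately show "s g = 0" using k by simp
  qed (use fin in simp)
  have sub: "v ` J \<subseteq> ?E"
  proof
    fix g assume "g \<in> v ` J"
    then obtain k where k: "k \<in> J" "g = v k" by blast
    have "(\<Sum>j\<in>J. (if j = k then 1 else 0) * v j x) = v k x" for x
      using fin k by (subst sum.remove[of _ k]) (auto intro!: sum.neutral)
    then show "g \<in> ?E" unfolding k(2) by (intro range_eqI[where x = "\<lambda>j. if j = k then 1 else 0"]) (simp only: )
  qed
  have sp: "?E \<subseteq> vs.span (v ` J)"
  proof
    fix g assume "g \<in> ?E"
    then obtain c where g: "g = (\<lambda>x. \<Sum>j\<in>J. c j * v j x)" by blast
    have "g = (\<Sum>j\<in>J. fscale (c j) (v j))" unfolding g by (simp add: fun_eq_iff sum_fun_apply fscale_def)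
    moreover have "(\<Sum>j\<in>J. fscale (c j) (v j)) \<in> vs.span (v ` J)"
      by (rule vs.span_sum, rule vs.span_scale, rule vs.span_base) (rule imageI)
    ultimately show "g \<in> vs.span (v ` J)" by (simp only: )
  qed
  show ?thesis using vs.dim_unique[OF sub sp ind] card_image[OF inj] by simp
qed

lemma inner_cvec_bdry:
  assumes "A \<in> carrier_mat (2 * n) (2 * n)"
  shows "inner_cvec (A *\<^sub>v bv_wedge n a b y) (bv_wedge n a b y) =
     bdry (2 * n) (\<lambda>i j. A $$ (i, j)) (bw n a b y) (bw n a b y)"
proof -
  have dim: "dim_vec (bv_wedge n a b y) = 2 * n" by (simp add: bv_wedge_def)
  have "vec_index (A *\<^sub>v bv_wedge n a b y) i = (\<Sum>j<2 * n. A $$ (i, j) * bw n a b y j)" if "i < 2 * n" for i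
  proof -
    have "vec_index (A *\<^sub>v bv_wedge n a b y) i = (\<Sum>j<2 * n. A $$ (i, j) * vec_index (bv_wedge n a b y) j)"
      using that assms dim by (simp add: scalar_prod_def atLeast0LessThan)
    also have "\<dots> = (\<Sum>j<2 * n. A $$ (i, j) * bw n a b y j)" by (intro sum.cong refl) (simp add: bv_wedge_index)
    finally show ?thesis .
  qed
  then show ?thesis
    using assms by (simp add: inner_cvec_def bdry_def sum_distrib_right bv_wedge_index del: index_mult_mat_vec)
qed

context operator_at
begin

text \<open>The eigenspace for 0 is the span of the null vectors, so the multiplicity is the number
  of zero diagonal entries. It is nonzero exactly at eigenvalues, which lets the jumps of the index
  and the eigenvalues be counted over the same set.\<close>

theorem eigenspace_normal_form:
  assumes U: "U l = V"
  shows "\<exists>m v \<phi> d \<epsilon>. nform D B (sob n a b) m v \<phi> d \<epsilon> \<and>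
    eigsp n a b p U l 0 = range (\<lambda>c x. \<Sum>i\<in>{i. i < m \<and> d i = 0}. c i * v i x) \<and>
    eig_mult n a b p U l 0 = card {i. i < m \<and> d i = 0} \<and> (is_eig n a b p U l 0 \<longleftrightarrow> eig_mult n a b p U l 0 \<noteq> 0)"
proof -
  obtain m v \<phi> d \<epsilon> where nf: "nform D B (sob n a b) m v \<phi> d \<epsilon>"
    and v: "\<forall>i<m. d i = 0 \<longrightarrow> v i \<in> G \<and> (\<forall>x\<in>{a..b}. S (v i) x = 0)"
    and sp: "\<forall>y\<in>G. (\<forall>x\<in>{a..b}. S y x = 0) \<longrightarrow> (\<exists>c. y = (\<lambda>x. \<Sum>i\<in>{i. i < m \<and> d i = 0}. c i * v i x))"
    using normal_form by (elim exE conjE) (rule that)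
  let ?J = "{i. i < m \<and> d i = 0}"
  have E: "eigsp n a b p U l 0 = range (\<lambda>c x. \<Sum>i\<in>?J. c i * v i x)"
  proof (intro equalityI subsetI)
    fix y assume "y \<in> eigsp n a b p U l 0"
    then have "y \<in> G" "\<forall>x\<in>{a..b}. S y x = 0" using eigsp_iff[of U y 0, OF U] by auto
    then have "\<exists>c. y = (\<lambda>x. \<Sum>i\<in>?J. c i * v i x)" by (rule mp[OF bspec[OF sp]])
    then show "y \<in> range (\<lambda>c x. \<Sum>i\<in>?J. c i * v i x)" by (elim exE) (rule range_eqI)
  next
    fix y assume "y \<in> range (\<lambda>c x. \<Sum>i\<in>?J. c i * v i x)"
    then obtain c where y: "y = (\<lambda>x. \<Sum>i\<in>?J. c i * v i x)" by (elim rangeE)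
    have vJ: "v i \<in> G" "\<And>x. x \<in> {a..b} \<Longrightarrow> S (v i) x = 0" if "i \<in> ?J" for i using v that by auto
    have "y \<in> G" unfolding y by (rule G_lincomb) (auto intro: vJ)
    moreover have "S y x = 0" if x: "x \<in> {a..b}" for x
    proof -
      have "S y x = (\<Sum>i\<in>?J. c i * S (v i) x)"
        unfolding y by (rule S_lincomb[OF _ _ x]) (use vJ(1) in \<open>auto simp: G_def\<close>)
      then show ?thesis using vJ(2)[OF _ x] by simp
    qed
    ultimately show "y \<in> eigsp n a b p U l 0" using eigsp_iff[of U y 0, OF U] by simp
  qed
  have mult: "eig_mult n a b p U l 0 = card ?J"
    unfolding eig_mult_def E by (rule dim_span_nform[OF D_sub nf]) auto
  have "is_eig n a b p U l 0 \<longleftrightarrow> card ?J \<noteq> 0"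
  proof
    assume e: "is_eig n a b p U l 0"
    show "card ?J \<noteq> 0"
    proof
      assume "card ?J = 0"
      then have J: "?J = {}" by simp
      have "eigsp n a b p U l 0 = {0}" unfolding E J by (auto simp: zero_fun_def)
      then show False using e by (simp add: is_eig_def)
    qed
  next
    assume "card ?J \<noteq> 0"
    then have "?J \<noteq> {}" by force
    then obtain k where k: "k \<in> ?J" by blast
    let ?y = "\<lambda>x. \<Sum>i\<in>?J. (\<lambda>_. 1) i * v i x"
    have "?y \<in> eigsp n a b p U l 0" unfolding E by (rule range_eqI[OF refl])
    moreover have "?y \<noteq> 0"
    proof
      assume y0: "?y = 0"
      have "\<phi> k ?y = 1" by (rule nform_phi[OF D_sub nf _ k, of "\<lambda>_. 1"]) auto
      moreover have "\<phi> k (\<lambda>x. \<Sum>i\<in>?J. (\<lambda>_. 0) i * v i x) = 0" by (rule nform_phi[OF D_sub nf _ k, of "\<lambda>_. 0"]) auto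
      ultimately show False using y0 by (simp add: zero_fun_def)
    qed
    ultimately show "is_eig n a b p U l 0" unfolding is_eig_def by blast
  qed
  then show ?thesis using nf E mult
    by - (rule exI[where x = m], rule exI[where x = v], rule exI[where x = \<phi>], rule exI[where x = d], rule exI[where x = \<epsilon>], simp only: )
qed

end

section \<open>Families of operators\<close>

lemma continuous_on_slice:
  assumes "continuous_on (S \<times> T) (\<lambda>(x, l). f x l)" "t \<in> T"
  shows "continuous_on S (\<lambda>x. f x t)"
proof -
  have "continuous_on S (\<lambda>x. (\<lambda>(x, l). f x l) (x, t))"
    by (rule continuous_on_compose2[OF assms(1)]) (use assms(2) in \<open>auto intro!: continuous_intros\<close>)
  then show ?thesis by simp
qed

lemma qf_bounded:
  assumes ab: "a < b" and P: "\<And>k. k \<le> n \<Longrightarrow> continuous_on {a..b} (P k)"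
  shows "\<exists>C\<ge>0. \<forall>y. Ck_on a b n y \<longrightarrow> \<bar>Re (qf n a b P A y y)\<bar> \<le> C * Re (sob n a b y y)"
proof -
  obtain C where C: "C \<ge> 0" and bd: "\<forall>P A K y. Ck_on a b n y \<longrightarrow> (\<forall>k\<le>n. continuous_on {a..b} (P k)) \<longrightarrow> K \<ge> 0 \<longrightarrow>
     (\<forall>k\<le>n. \<forall>x\<in>{a..b}. \<bar>P k x\<bar> \<le> K) \<longrightarrow> (\<forall>i<2 * n. \<forall>j<2 * n. cmod (A i j) \<le> K) \<longrightarrow>
     \<bar>Re (qf n a b P A y y)\<bar> \<le> C * K * Re (sob n a b y y)"
    using qf_bound[OF ab, of n] by (elim exE conjE) (rule that)
  have "\<forall>k\<in>{..n}. \<exists>K\<ge>0. \<forall>x\<in>{a..b}. \<bar>P k x\<bar> \<le> K"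
  proof
    fix k assume "k \<in> {..n}"
    then have "compact (P k ` {a..b})" using P by (intro compact_continuous_image) auto
    then obtain K where "\<forall>x\<in>P k ` {a..b}. norm x \<le> K" using compact_imp_bounded bounded_iff by metis
    then show "\<exists>K\<ge>0. \<forall>x\<in>{a..b}. \<bar>P k x\<bar> \<le> K" by (intro exI[where x = "max K 0"]) (auto simp: le_max_iff_disj)
  qed
  from bchoice[OF this] obtain K where K: "\<forall>k\<in>{..n}. K k \<ge> 0 \<and> (\<forall>x\<in>{a..b}. \<bar>P k x\<bar> \<le> K k)" by (elim exE)
  define KP where "KP = (\<Sum>k\<le>n. K k)"
  define KA where "KA = (\<Sum>i<2 * n. \<Sum>j<2 * n. cmod (A i j))"
  have KP: "KP \<ge> 0" unfolding KP_def using K by (intro sum_nonneg) auto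
  have KA: "KA \<ge> 0" unfolding KA_def by (intro sum_nonneg) auto
  have 1: "\<bar>P k x\<bar> \<le> KP + KA" if "k \<le> n" "x \<in> {a..b}" for k x
  proof -
    have "K k \<le> KP" unfolding KP_def using that(1) K by (intro member_le_sum) auto
    moreover have "\<bar>P k x\<bar> \<le> K k" using bspec[OF K, of k] that by simp
    ultimately show ?thesis using KA by linarith
  qed
  have 2: "cmod (A i j) \<le> KP + KA" if "i < 2 * n" "j < 2 * n" for i j
  proof -
    have "cmod (A i j) \<le> (\<Sum>j<2 * n. cmod (A i j))" using that by (intro member_le_sum) auto
    also have "\<dots> \<le> KA" unfolding KA_def
      using that by (intro member_le_sum[of i _ "\<lambda>i. \<Sum>j<2 * n. cmod (A i j)"]) (auto intro: sum_nonneg)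
    finally show ?thesis using KP by linarith
  qed
  have "\<bar>Re (qf n a b P A y y)\<bar> \<le> C * (KP + KA) * Re (sob n a b y y)" if "Ck_on a b n y" for y
    using spec[OF spec[OF spec[OF spec[OF bd, of P], of A], of "KP + KA"], of y] that P 1 2 KP KA by simp
  then show ?thesis using C KP KA by (intro exI[where x = "C * (KP + KA)"]) simp
qed

lemma q_bounds_aux:
  fixes X C \<eta> h s \<omega> :: real
  assumes "X \<le> C * (\<eta> * h) * s" "C * \<eta> \<le> \<omega>" "h \<ge> 0" "s \<ge> 0"
  shows "X \<le> \<omega> * h * s"
proof -
  have "C * (\<eta> * h) * s = (C * \<eta>) * (h * s)" by simp
  also have "\<dots> \<le> \<omega> * (h * s)" using assms by (intro mult_right_mono) auto
  finally show ?thesis using assms(1) by (simp add: mult.assoc)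
qed

text \<open>Hypotheses met both by the given family and by the spectral shift with constant boundary
  matrix, so that the jump formula is proved once for both.\<close>

locale operator_family =
  fixes n :: nat and a b :: real and p :: "nat \<Rightarrow> real \<Rightarrow> real \<Rightarrow> real" and U :: "real \<Rightarrow> complex mat" and \<sigma> \<tau> :: real
  assumes ab: "a < b" and n: "n \<ge> 1"
    and p_cont: "\<And>k. k \<le> n \<Longrightarrow> continuous_on ({a..b} \<times> {\<sigma><..<\<tau>}) (\<lambda>(x, l). p k x l)"
    and p0: "\<And>l x. l \<in> {\<sigma><..<\<tau>} \<Longrightarrow> x \<in> {a..b} \<Longrightarrow> p 0 x l > 0"
    and p_reg: "\<And>l k. l \<in> {\<sigma><..<\<tau>} \<Longrightarrow> k < n \<Longrightarrow> Ck_on a b (n - k) (\<lambda>x. p k x l)"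
    and U: "\<And>l. l \<in> {\<sigma><..<\<tau>} \<Longrightarrow> unitary_mat (2 * n) (U l)"
    and ker: "\<And>l1 l2. l1 \<in> {\<sigma><..<\<tau>} \<Longrightarrow> l2 \<in> {\<sigma><..<\<tau>} \<Longrightarrow>
        mat_kernel (U l1 - 1\<^sub>m (2 * n)) = mat_kernel (U l2 - 1\<^sub>m (2 * n))"
    and p_diff: "\<And>k x l. k \<le> n \<Longrightarrow> x \<in> {a..b} \<Longrightarrow> l \<in> {\<sigma><..<\<tau>} \<Longrightarrow> (\<lambda>l'. p k x l') differentiable (at l)"
    and p_diff_cont: "\<And>k. k \<le> n \<Longrightarrow> continuous_on ({a..b} \<times> {\<sigma><..<\<tau>}) (\<lambda>(x, l). deriv (\<lambda>l'. p k x l') l)"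
    and U_diff: "\<And>l i j. l \<in> {\<sigma><..<\<tau>} \<Longrightarrow> i < 2 * n \<Longrightarrow> j < 2 * n \<Longrightarrow> (\<lambda>t. U t $$ (i, j)) differentiable (at l)"
    and neg: "\<And>l y. l \<in> {\<sigma><..<\<tau>} \<Longrightarrow> y \<in> eigsp n a b p U l 0 \<Longrightarrow> y \<noteq> 0 \<Longrightarrow>
        (\<Sum>k=0..n. integral {a..b} (\<lambda>x. deriv (\<lambda>l'. p k x l') l * (cmod (dw a b (n - k) y x))\<^sup>2))
          + Re (inner_cvec (A_deriv (2 * n) U l *\<^sub>v bv_wedge n a b y) (bv_wedge n a b y)) < 0"
begin

definition "fdom t = form_dom n a b (mat_kernel (U t - 1\<^sub>m (2 * n)))"
definition "form t = qf n a b (\<lambda>k x. p k x t) (\<lambda>i j. A_mat (2 * n) (U t) $$ (i, j))"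
definition "form' t = qf n a b (\<lambda>k x. deriv (\<lambda>l'. p k x l') t) (\<lambda>i j. A_deriv (2 * n) U t $$ (i, j))"
definition "ind t = index_of (fdom t) (\<lambda>y. Re (form t y y))"

lemma slice: "t \<in> {\<sigma><..<\<tau>} \<Longrightarrow> k \<le> n \<Longrightarrow> continuous_on {a..b} (\<lambda>x. p k x t)"
  by (rule continuous_on_slice[OF p_cont])

lemma slice': "t \<in> {\<sigma><..<\<tau>} \<Longrightarrow> k \<le> n \<Longrightarrow> continuous_on {a..b} (\<lambda>x. deriv (\<lambda>l'. p k x l') t)"
  using continuous_on_slice[where f = "\<lambda>x l. deriv (\<lambda>l'. p k x l') l", OF p_diff_cont] by blast

lemma operator_at: "t \<in> {\<sigma><..<\<tau>} \<Longrightarrow> operator_at n a b p t (U t)"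
  by (rule operator_at.intro) (auto intro: ab n[simplified] p_reg slice p0 U)

lemma A_has_derivative:
  assumes "t \<in> {\<sigma><..<\<tau>}" "i < 2 * n" "j < 2 * n"
  shows "((\<lambda>s. A_mat (2 * n) (U s) $$ (i, j)) has_vector_derivative A_deriv (2 * n) U t $$ (i, j)) (at t)"
proof (rule A_mat_differentiable[of \<sigma> \<tau>])
  show "mat_kernel (U s - 1\<^sub>m (2 * n)) = mat_kernel (U t - 1\<^sub>m (2 * n))" if "s \<in> {\<sigma><..<\<tau>}" for s
    by (rule ker[OF that assms(1)])
  show "(\<lambda>s. U s $$ (i, j)) differentiable (at t)" if "i < 2 * n" "j < 2 * n" for i j
    by (rule U_diff[OF assms(1) that])
qed (use assms U in auto)

text \<open>Conjugate transposition commutes with differentiation, and the derivative is unique;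
  symmetry passes from A to A'.\<close>

lemma A_deriv_hermitian:
  assumes t: "t \<in> {\<sigma><..<\<tau>}" and ij: "i < 2 * n" "j < 2 * n"
  shows "cnj (A_deriv (2 * n) U t $$ (j, i)) = A_deriv (2 * n) U t $$ (i, j)"
proof -
  have "((\<lambda>s. cnj (A_mat (2 * n) (U s) $$ (j, i))) has_vector_derivative cnj (A_deriv (2 * n) U t $$ (j, i))) (at t)"
    by (rule has_vector_derivative_cnj[OF A_has_derivative[OF t ij(2) ij(1)]])
  then have "((\<lambda>s. A_mat (2 * n) (U s) $$ (i, j)) has_vector_derivative cnj (A_deriv (2 * n) U t $$ (j, i))) (at t)"
    by (rule has_vector_derivative_transform_within_open[OF _ open_greaterThanLessThan t]) (rule A_mat_hermitian[OF U ij])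
  then show ?thesis using A_has_derivative[OF t ij] by (rule vector_derivative_unique_at)
qed

text \<open>The remainders of all coefficients and of the boundary matrix are at most \<eta> |t -
  s|, and the coefficient-uniform form bound converts this into a small multiple of the Sobolev
  norm, uniformly over the form domain.\<close>

lemma expansion:
  assumes s: "s \<in> {\<sigma><..<\<tau>}" and w: "\<omega> > 0"
  shows "\<exists>\<delta>>0. \<forall>t. \<bar>t - s\<bar> < \<delta> \<longrightarrow> t \<in> {\<sigma><..<\<tau>} \<and> (\<forall>f\<in>fdom s.
     \<bar>Re (form t f f) - Re (form s f f) - (t - s) * Re (form' s f f)\<bar> \<le> \<omega> * \<bar>t - s\<bar> * Re (sob n a b f f))"
proof -
  obtain C where C: "C \<ge> 0" and bd: "\<forall>P A K y. Ck_on a b n y \<longrightarrow> (\<forall>k\<le>n. continuous_on {a..b} (P k)) \<longrightarrow> K \<ge> 0 \<longrightarrow>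
     (\<forall>k\<le>n. \<forall>x\<in>{a..b}. \<bar>P k x\<bar> \<le> K) \<longrightarrow> (\<forall>i<2 * n. \<forall>j<2 * n. cmod (A i j) \<le> K) \<longrightarrow>
     \<bar>Re (qf n a b P A y y)\<bar> \<le> C * K * Re (sob n a b y y)"
    using qf_bound[OF ab, of n] by (elim exE conjE) (rule that)
  define \<eta> where "\<eta> = \<omega> / (C + 1)"
  have \<eta>: "\<eta> > 0" "C * \<eta> \<le> \<omega>" using C w by (auto simp: \<eta>_def field_simps)
  have 1: "\<forall>\<^sub>F t in nhds s. \<forall>k\<in>{..n}. \<forall>x\<in>{a..b}. \<bar>p k x t - p k x s - (t - s) * deriv (\<lambda>l'. p k x l') s\<bar> \<le> \<eta> * \<bar>t - s\<bar>"
  proof (rule eventually_ball_finite[OF finite_atMost], rule ballI)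
    fix k assume "k \<in> {..n}"
    then have k: "k \<le> n" by simp
    show "\<forall>\<^sub>F t in nhds s. \<forall>x\<in>{a..b}. \<bar>p k x t - p k x s - (t - s) * deriv (\<lambda>l'. p k x l') s\<bar> \<le> \<eta> * \<bar>t - s\<bar>"
      by (rule uniform_remainder[OF p_diff[OF k] p_diff_cont[OF k] s \<eta>(1)])
  qed
  have 2: "\<forall>\<^sub>F t in nhds s. \<forall>i\<in>{..<2 * n}. \<forall>j\<in>{..<2 * n}. cmod (A_mat (2 * n) (U t) $$ (i, j) - A_mat (2 * n) (U s) $$ (i, j)
      - complex_of_real (t - s) * A_deriv (2 * n) U s $$ (i, j)) \<le> \<eta> * \<bar>t - s\<bar>"
    by (intro eventually_ball_finite finite_lessThan ballI vector_derivative_remainder \<eta>(1) A_has_derivative s) auto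
  have 3: "\<forall>\<^sub>F t in nhds s. t \<in> {\<sigma><..<\<tau>}" by (rule eventually_nhds_in_open[OF open_greaterThanLessThan s])
  obtain \<delta> where \<delta>: "\<delta> > 0" and all: "\<And>t. dist t s < \<delta> \<Longrightarrow>
      (\<forall>k\<in>{..n}. \<forall>x\<in>{a..b}. \<bar>p k x t - p k x s - (t - s) * deriv (\<lambda>l'. p k x l') s\<bar> \<le> \<eta> * \<bar>t - s\<bar>) \<and>
      (\<forall>i\<in>{..<2 * n}. \<forall>j\<in>{..<2 * n}. cmod (A_mat (2 * n) (U t) $$ (i, j) - A_mat (2 * n) (U s) $$ (i, j)
        - complex_of_real (t - s) * A_deriv (2 * n) U s $$ (i, j)) \<le> \<eta> * \<bar>t - s\<bar>) \<and> t \<in> {\<sigma><..<\<tau>}"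
    using eventually_conj[OF 1 eventually_conj[OF 2 3]] unfolding eventually_nhds_metric by (elim exE conjE) (rule that, blast+)
  show ?thesis
  proof (intro exI[where x = \<delta>] conjI allI impI ballI)
    fix t assume t: "\<bar>t - s\<bar> < \<delta>"
    then have "dist t s < \<delta>" by (simp add: dist_real_def)
    note a = all[OF this]
    show tI: "t \<in> {\<sigma><..<\<tau>}" using a by blast
    fix f assume "f \<in> fdom s"
    then have f: "Ck_on a b n f" unfolding fdom_def by (rule form_domD(1))
    let ?P = "\<lambda>k x. p k x t - p k x s - (t - s) * deriv (\<lambda>l'. p k x l') s"
    let ?A = "\<lambda>i j. A_mat (2 * n) (U t) $$ (i, j) - A_mat (2 * n) (U s) $$ (i, j) - complex_of_real (t - s) * A_deriv (2 * n) U s $$ (i, j)"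
    have c: "\<forall>k\<le>n. continuous_on {a..b} (?P k)"
      by (intro allI impI continuous_intros slice[OF tI] slice[OF s] slice'[OF s])
    have eq: "Re (qf n a b ?P ?A f f) = Re (form t f f) - Re (form s f f) - (t - s) * Re (form' s f f)"
      unfolding form_def form'_def by (rule qf_combine[OF f slice[OF tI] slice[OF s] slice'[OF s]])
    have "\<bar>Re (qf n a b ?P ?A f f)\<bar> \<le> C * (\<eta> * \<bar>t - s\<bar>) * Re (sob n a b f f)"
      using mp[OF mp[OF mp[OF spec[OF spec[OF spec[OF spec[OF bd, of ?P], of ?A], of "\<eta> * \<bar>t - s\<bar>"], of f] f] c]] a \<eta>(1) by simp
    then show "\<bar>Re (form t f f) - Re (form s f f) - (t - s) * Re (form' s f f)\<bar> \<le> \<omega> * \<bar>t - s\<bar> * Re (sob n a b f f)"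
      unfolding eq by (rule q_bounds_aux[OF _ \<eta>(2)]) (use sob_nonneg[OF f] in auto)
  qed (rule \<delta>)
qed

text \<open>The normal form at \<open>s\<close> supplies the data of \<open>critical_form\<close>;
  the sign condition \<open>neg\<close>, applied to combinations of null vectors, becomes negativity
  of the derivative form.\<close>

lemma jump:
  assumes s: "s \<in> {\<sigma><..<\<tau>}"
  shows "\<exists>k. \<exists>\<delta>>0. \<forall>t. \<bar>t - s\<bar> < \<delta> \<longrightarrow>
    has_index (fdom t) (\<lambda>y. Re (form t y y)) (k + (if t > s then eig_mult n a b p U s 0 else 0))"
proof -
  interpret O: operator_at n a b p s "U s" by (rule operator_at[OF s])
  have DO: "O.D = fdom s" by (simp add: O.D_def fdom_def)
  have BO: "O.B = form s" by (simp add: O.B_def form_def)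
  obtain m v \<phi> d \<epsilon> where nf: "nform (fdom s) (form s) (sob n a b) m v \<phi> d \<epsilon>"
    and E: "eigsp n a b p U s 0 = range (\<lambda>c x. \<Sum>i\<in>{i. i < m \<and> d i = 0}. c i * v i x)"
    and mult: "eig_mult n a b p U s 0 = card {i. i < m \<and> d i = 0}"
    using O.eigenspace_normal_form[of U, OF refl] unfolding DO BO by (elim exE conjE) (rule that)
  have nf1: "\<epsilon> > 0" and nf2: "\<forall>i<m. v i \<in> fdom s"
    and nf3: "\<forall>i<m. \<forall>j<m. form s (v i) (v j) = (if i = j then complex_of_real (d i) else 0)"
    and nf4: "\<forall>i<m. \<forall>f\<in>fdom s. \<forall>g\<in>fdom s. \<phi> i (\<lambda>x. f x + g x) = \<phi> i f + \<phi> i g"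
    and nf5: "\<forall>i<m. \<forall>f\<in>fdom s. \<forall>c. \<phi> i (\<lambda>x. c * f x) = c * \<phi> i f"
    and nf6: "\<forall>i<m. \<forall>j<m. \<phi> i (v j) = (if i = j then 1 else 0)"
    and nf7: "\<forall>z\<in>fdom s. (\<forall>i<m. \<phi> i z = 0) \<longrightarrow> (\<forall>j<m. form s z (v j) = 0) \<and> Re (form s z z) \<ge> \<epsilon> * Re (sob n a b z z)"
    by (insert nf[unfolded nform_def], (elim conjE, assumption)+)
  have Ds: "csubspace (fdom s)" and hB: "hform (fdom s) (form s)" and hM: "hform (fdom s) (sob n a b)"
    using O.D_sub O.B_hform O.sob_hform unfolding DO BO by auto
  have hR: "hform (fdom s) (form' s)"
    unfolding fdom_def form'_def by (rule hform_qf[OF ab slice'[OF s] A_deriv_hermitian[OF s]])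
  have Ck: "Ck_on a b n f" if "f \<in> fdom s" for f using that unfolding fdom_def by (rule form_domD(1))
  obtain C where C: "C \<ge> 0" and Rb: "\<forall>y. Ck_on a b n y \<longrightarrow> \<bar>Re (form' s y y)\<bar> \<le> C * Re (sob n a b y y)"
  proof -
    have "\<exists>C\<ge>0. \<forall>y. Ck_on a b n y \<longrightarrow> \<bar>Re (form' s y y)\<bar> \<le> C * Re (sob n a b y y)"
      unfolding form'_def by (rule qf_bounded[OF ab]) (rule slice'[OF s])
    then show thesis by (elim exE conjE) (rule that)
  qed
  interpret F: critical_form "fdom s" "form s" "form' s" "sob n a b" m v \<phi> d C \<epsilon>
  proof (rule critical_form.intro)
    show "csubspace (fdom s)" "hform (fdom s) (form s)" "hform (fdom s) (form' s)" "hform (fdom s) (sob n a b)" "C \<ge> 0" "\<epsilon> > 0"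
      by (fact Ds hB hR hM C nf1)+
    show "Re (sob n a b f f) \<ge> 0" if "f \<in> fdom s" for f by (rule sob_nonneg[OF Ck[OF that]])
    show "f = (\<lambda>x. 0)" if "f \<in> fdom s" "Re (sob n a b f f) = 0" for f
      using that unfolding fdom_def by (rule sob_zero[OF ab])
    show "\<bar>Re (form' s f f)\<bar> \<le> C * Re (sob n a b f f)" if "f \<in> fdom s" for f
      by (rule mp[OF spec[OF Rb] Ck[OF that]])
    show "v i \<in> fdom s" if "i < m" for i using nf2 that by blast
    show "form s (v i) (v j) = (if i = j then complex_of_real (d i) else 0)" if "i < m" "j < m" for i j
      by (rule mp[OF spec[OF mp[OF spec[OF nf3] that(1)]] that(2)])
    show "\<phi> i (\<lambda>x. f x + g x) = \<phi> i f + \<phi> i g" if "i < m" "f \<in> fdom s" "g \<in> fdom s" for i f g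
      by (rule bspec[OF bspec[OF mp[OF spec[OF nf4] that(1)] that(2)] that(3)])
    show "\<phi> i (\<lambda>x. c * f x) = c * \<phi> i f" if "i < m" "f \<in> fdom s" for i f c
      by (rule spec[OF bspec[OF mp[OF spec[OF nf5] that(1)] that(2)]])
    show "\<phi> i (v j) = (if i = j then 1 else 0)" if "i < m" "j < m" for i j
      by (rule mp[OF spec[OF mp[OF spec[OF nf6] that(1)]] that(2)])
    show "form s z (v j) = 0" if "z \<in> fdom s" "\<forall>i<m. \<phi> i z = 0" "j < m" for z j
      by (rule mp[OF spec[OF conjunct1[OF mp[OF bspec[OF nf7 that(1)] that(2)]]] that(3)])
    show "\<epsilon> * Re (sob n a b z z) \<le> Re (form s z z)" if "z \<in> fdom s" "\<forall>i<m. \<phi> i z = 0" for z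
      by (rule conjunct2[OF mp[OF bspec[OF nf7 that(1)] that(2)]])
    fix c :: "nat \<Rightarrow> complex"
    let ?J = "{i. i < m \<and> d i = 0}"
    let ?y = "\<lambda>x. \<Sum>i\<in>?J. c i * v i x"
    assume "\<exists>i<m. d i = 0 \<and> c i \<noteq> 0"
    then obtain k where k: "k \<in> ?J" "c k \<noteq> 0" by blast
    have y: "?y \<in> eigsp n a b p U s 0" unfolding E by (rule range_eqI[where x = c]) (rule refl)
    have J: "?J \<subseteq> {..<m}" by auto
    \<comment> \<open>The functional \<phi> k detects the nonzero coefficient, so the sign condition
      concerns a genuine eigenfunction.\<close>
    have "?y \<noteq> 0"
    proof
      assume y0: "?y = 0"
      have 1: "\<phi> k ?y = c k" by (rule nform_phi[OF Ds nf J k(1)])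
      have 2: "\<phi> k (\<lambda>x. \<Sum>i\<in>?J. 0 * v i x) = 0" by (rule nform_phi[OF Ds nf J k(1), of "\<lambda>_. 0"])
      have "?y = (\<lambda>x. \<Sum>i\<in>?J. 0 * v i x)" unfolding y0 by (simp add: zero_fun_def)
      then show False using 1 2 k(2) by (simp only: )
    qed
    have Cy: "Ck_on a b n ?y" by (rule Ck[OF csubspace_lincomb[OF Ds]]) (use nf2 in auto)
    have rq: "Re (form' s ?y ?y) = (\<Sum>k\<le>n. integral {a..b} (\<lambda>x. deriv (\<lambda>l'. p k x l') s * (cmod (dw a b (n - k) ?y x))\<^sup>2))
          + Re (bdry (2 * n) (\<lambda>i j. A_deriv (2 * n) U s $$ (i, j)) (bw n a b ?y) (bw n a b ?y))"
      unfolding form'_def by (rule Re_qf[OF Cy]) (rule slice'[OF s])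
    have ic: "inner_cvec (A_deriv (2 * n) U s *\<^sub>v bv_wedge n a b ?y) (bv_wedge n a b ?y) =
        bdry (2 * n) (\<lambda>i j. A_deriv (2 * n) U s $$ (i, j)) (bw n a b ?y) (bw n a b ?y)"
      by (rule inner_cvec_bdry) (simp add: A_deriv_def)
    have "Re (form' s ?y ?y) = (\<Sum>k=0..n. integral {a..b} (\<lambda>x. deriv (\<lambda>l'. p k x l') s * (cmod (dw a b (n - k) ?y x))\<^sup>2))
          + Re (inner_cvec (A_deriv (2 * n) U s *\<^sub>v bv_wedge n a b ?y) (bv_wedge n a b ?y))"
      unfolding rq ic atMost_atLeast0 by (rule refl)
    also have "\<dots> < 0" by (rule neg[OF s y \<open>?y \<noteq> 0\<close>])
    finally show "Re (form' s ?y ?y) < 0" .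
  qed
  have "\<exists>\<delta>>0. \<forall>t. \<bar>t - s\<bar> < \<delta> \<longrightarrow> has_index (fdom s) (\<lambda>y. Re (form t y y)) (card F.Ng + (if t > s then card F.Ze else 0))"
  proof (rule F.index_near)
    fix \<omega> :: real assume w: "\<omega> > 0"
    show "\<exists>\<delta>>0. \<forall>t. \<bar>t - s\<bar> < \<delta> \<longrightarrow>
      (\<forall>f\<in>fdom s. \<bar>Re (form t f f) - Re (form s f f) - (t - s) * Re (form' s f f)\<bar> \<le> \<omega> * \<bar>t - s\<bar> * Re (sob n a b f f))"
      using expansion[OF s w] by blast
  qed
  then obtain \<delta>1 where d1: "\<delta>1 > 0" "\<And>t. \<bar>t - s\<bar> < \<delta>1 \<Longrightarrow> has_index (fdom s) (\<lambda>y. Re (form t y y)) (card F.Ng + (if t > s then card F.Ze else 0))"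
    by blast
  have one: "(1::real) > 0" by simp
  \<comment> \<open>The expansion with weight 1 serves to keep \<open>t\<close> inside the parameter
    interval, where the constant kernel makes the form domains coincide.\<close>
  obtain \<delta>2 where d2: "\<delta>2 > 0" "\<And>t. \<bar>t - s\<bar> < \<delta>2 \<Longrightarrow> t \<in> {\<sigma><..<\<tau>}" using expansion[OF s one] by blast
  have "has_index (fdom t) (\<lambda>y. Re (form t y y)) (card F.Ng + (if t > s then eig_mult n a b p U s 0 else 0))"
    if t: "\<bar>t - s\<bar> < min \<delta>1 \<delta>2" for t
  proof -
    have "fdom t = fdom s" unfolding fdom_def using ker[OF d2(2) s] t by simp
    then show ?thesis using d1(2)[of t] t unfolding mult F.Ze_def by simp
  qed
  then show ?thesis using d1(1) d2(1) by (intro exI[where x = "card F.Ng"] exI[where x = "min \<delta>1 \<delta>2"]) simp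
qed

lemma eigenvalue_iff: "t \<in> {\<sigma><..<\<tau>} \<Longrightarrow> is_eig n a b p U t 0 \<longleftrightarrow> eig_mult n a b p U t 0 \<noteq> 0"
  using operator_at.eigenspace_normal_form[OF operator_at, of t U] by blast

theorem index_difference:
  assumes xy: "\<sigma> < x" "x \<le> y" "y < \<tau>"
  shows "ind y = ind x + N_S n a b p U x y"
proof -
  have "ind y = ind x + (\<Sum>t\<in>{t. t \<in> {x..<y} \<and> eig_mult n a b p U t 0 \<noteq> 0}. eig_mult n a b p U t 0)"
  proof (rule conjunct2[OF index_jump_global[of \<sigma> \<tau> ind "\<lambda>t. eig_mult n a b p U t 0", OF _ xy]])
    fix s assume "s \<in> {\<sigma><..<\<tau>}"
    from jump[OF this] obtain k \<delta> where \<delta>: "\<delta> > 0" and h: "\<And>t. \<bar>t - s\<bar> < \<delta> \<Longrightarrow>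
      has_index (fdom t) (\<lambda>y. Re (form t y y)) (k + (if t > s then eig_mult n a b p U s 0 else 0))" by blast
    have i: "ind t = k + (if t > s then eig_mult n a b p U s 0 else 0)" if "\<bar>t - s\<bar> < \<delta>" for t
      unfolding ind_def by (rule index_of_eq[OF h[OF that]])
    show "\<exists>\<delta>>0. \<forall>t. \<bar>t - s\<bar> < \<delta> \<longrightarrow> ind t = ind s + (if t > s then eig_mult n a b p U s 0 else 0)"
      using \<delta> i i[of s] by (intro exI[where x = \<delta>]) simp
  qed
  moreover have "{t. t \<in> {x..<y} \<and> eig_mult n a b p U t 0 \<noteq> 0} = {t. t \<in> {x..<y} \<and> is_eig n a b p U t 0}"
    using eigenvalue_iff xy by auto
  ultimately show ?thesis by (simp only: N_S_def)
qed

end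

section \<open>The index as a number of negative eigenvalues\<close>

context operator_at
begin

text \<open>The family S - \<mu> in the spectral parameter \<mu>: the shift enters the zero-order
  coefficient \<open>p n\<close> only, and the third argument is \<mu> instead of \<lambda>.\<close>

definition "pshift k x \<mu> = p k x l - (if k = n then \<mu> else 0)"

text \<open>The quasi-derivatives in the boundary vectors stop at m = n - 1 and do not involve
  \<open>p n\<close>; hence the boundary condition is independent of \<mu>.\<close>

lemma pshift_quasi: "m < n \<Longrightarrow> quasi_deriv n a b pshift \<mu> m y x = quasi_deriv n a b p l m y x"
  unfolding quasi_deriv_def by (intro sum.cong refl) (simp add: pshift_def)

lemma pshift_S: "S_op n a b pshift \<mu> y x = S y x - complex_of_real \<mu> * y x"
proof -
  have s: "(\<Sum>k=0..n. f k) = (\<Sum>k=0..<n. f k) + f n" for f :: "nat \<Rightarrow> complex"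
    by (simp add: atLeastLessThanSuc_atLeastAtMost[symmetric])
  have "(\<Sum>k=0..<n. (-1) ^ (n - k) * dw a b (n - k) (\<lambda>t. complex_of_real (pshift k t \<mu>) * dw a b (n - k) y t) x) =
     (\<Sum>k=0..<n. (-1) ^ (n - k) * dw a b (n - k) (\<lambda>t. complex_of_real (p k t l) * dw a b (n - k) y t) x)"
    by (intro sum.cong refl) (simp add: pshift_def)
  then show ?thesis unfolding S_op_def s by (simp add: pshift_def algebra_simps)
qed

lemma eigsp_pshift:
  assumes U: "U l = V"
  shows "eigsp n a b pshift (\<lambda>_. V) \<mu> 0 = eigsp n a b p U l (complex_of_real \<mu>)"
proof -
  have "bv_vee n a b pshift \<mu> y = bv_vee n a b p l y" for y
    using n unfolding bv_vee_def by (intro eq_vecI) (auto simp: pshift_quasi)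
  then show ?thesis using U by (simp add: eigsp_def dom_S_def pshift_S)
qed

lemma garding_B: "\<exists>c>0. \<exists>C\<ge>0. \<forall>y. Ck_on a b n y \<longrightarrow> Re (B y y) \<ge> c * Re (sob n a b y y) - C * energy a b y"
  unfolding B_def by (rule garding[OF ab]) (rule cont_p p0, assumption)+

lemma energy_pos:
  assumes "y \<in> G" "y \<noteq> 0"
  shows "energy a b y > 0"
proof (rule ccontr)
  assume "\<not> energy a b y > 0"
  then have e: "energy a b y = 0" using energy_nonneg[of a b y] by simp
  have c: "continuous_on {a..b} y" using assms(1) Ck_on_cont[of a b "2 * n" y 0] by (simp add: G_def)
  have "y x = 0" for x using energy_zero[OF ab c e, of x] assms(1) by (cases "x \<in> {a..b}") (auto simp: G_def)
  then show False using assms(2) by (simp add: fun_eq_iff)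
qed

lemma pshift_form:
  assumes y: "Ck_on a b n y"
  shows "Re (qf n a b (\<lambda>k x. pshift k x \<mu>) (\<lambda>i j. A_mat (2 * n) V $$ (i, j)) y y) = Re (B y y) - \<mu> * energy a b y"
proof -
  have cont: "continuous_on {a..b} (\<lambda>x. pshift k x \<mu>)" if "k \<le> n" for k
    unfolding pshift_def by (intro continuous_intros cont_p that)
  have s: "(\<Sum>k\<le>n. f k) = (\<Sum>k<n. f k) + f n" for f :: "nat \<Rightarrow> real"
    by (simp add: lessThan_Suc_atMost[symmetric])
  have 1: "(\<Sum>k<n. integral {a..b} (\<lambda>x. pshift k x \<mu> * (cmod (dw a b (n - k) y x))\<^sup>2)) =
     (\<Sum>k<n. integral {a..b} (\<lambda>x. p k x l * (cmod (dw a b (n - k) y x))\<^sup>2))"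
    by (intro sum.cong refl) (simp add: pshift_def)
  have cy: "continuous_on {a..b} y" using Ck_on_cont[OF y, of 0] by simp
  have "integral {a..b} (\<lambda>x. p n x l * (cmod (y x))\<^sup>2 - \<mu> * (cmod (y x))\<^sup>2) =
     integral {a..b} (\<lambda>x. p n x l * (cmod (y x))\<^sup>2) - integral {a..b} (\<lambda>x. \<mu> * (cmod (y x))\<^sup>2)"
    by (rule integral_diff) (intro integrable_continuous_real continuous_intros cy cont_p order_refl)+
  then have 2: "integral {a..b} (\<lambda>x. pshift n x \<mu> * (cmod (dw a b (n - n) y x))\<^sup>2) =
     integral {a..b} (\<lambda>x. p n x l * (cmod (dw a b (n - n) y x))\<^sup>2) - \<mu> * energy a b y"
    by (simp add: pshift_def energy_def left_diff_distrib)
  have 3: "Re (qf n a b (\<lambda>k x. pshift k x \<mu>) (\<lambda>i j. A_mat (2 * n) V $$ (i, j)) y y) =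
      (\<Sum>k\<le>n. integral {a..b} (\<lambda>x. pshift k x \<mu> * (cmod (dw a b (n - k) y x))\<^sup>2))
      + Re (bdry (2 * n) (\<lambda>i j. A_mat (2 * n) V $$ (i, j)) (bw n a b y) (bw n a b y))"
    by (rule Re_qf[OF y]) (rule cont)
  have 4: "Re (B y y) = (\<Sum>k\<le>n. integral {a..b} (\<lambda>x. p k x l * (cmod (dw a b (n - k) y x))\<^sup>2))
      + Re (bdry (2 * n) (\<lambda>i j. A_mat (2 * n) V $$ (i, j)) (bw n a b y) (bw n a b y))"
    unfolding B_def by (rule Re_qf[OF y]) (rule cont_p)
  show ?thesis unfolding 3 4 s 1 2 by simp
qed

lemma Re_B_eigenvector:
  assumes y: "y \<in> G" and S: "\<And>x. x \<in> {a..b} \<Longrightarrow> S y x = complex_of_real \<mu> * y x"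
  shows "Re (B y y) = \<mu> * energy a b y"
proof -
  have cy: "continuous_on {a..b} y" using y Ck_on_cont[of a b "2 * n" y 0] by (simp add: G_def)
  have "B y y = integral {a..b} (\<lambda>x. S y x * cnj (y x))" by (rule green_D(2)[OF y green_D(1)[OF y]])
  also have "\<dots> = integral {a..b} (\<lambda>x. complex_of_real \<mu> * (y x * cnj (y x)))"
    by (rule integral_cong) (simp add: S mult.assoc)
  finally have B: "B y y = integral {a..b} (\<lambda>x. complex_of_real \<mu> * (y x * cnj (y x)))" .
  have "(\<lambda>x. complex_of_real \<mu> * (y x * cnj (y x))) integrable_on {a..b}"
    by (intro integrable_continuous_real continuous_intros cy)
  from integral_linear[OF this bounded_linear_Re, symmetric]
  have "Re (B y y) = integral {a..b} (\<lambda>x. Re (complex_of_real \<mu> * (y x * cnj (y x))))" unfolding B o_def .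
  also have "(\<lambda>x. Re (complex_of_real \<mu> * (y x * cnj (y x)))) = (\<lambda>x. \<mu> * (cmod (y x))\<^sup>2)"
    unfolding complex_norm_square[symmetric] by simp
  finally show ?thesis by (simp add: energy_def)
qed

text \<open>The sign condition is automatic here: the \<mu>-derivative of the form is minus the
  energy, and the constant boundary matrix contributes 0.\<close>

lemma pshift_family: "operator_family n a b pshift (\<lambda>_. V) \<sigma> \<tau>"
proof (rule operator_family.intro)
  have d: "deriv (\<lambda>\<mu>. pshift k x \<mu>) t = (if k = n then -1 else 0)" for k x t
    by (rule DERIV_imp_deriv) (auto simp: pshift_def intro!: derivative_eq_intros)
  show "continuous_on ({a..b} \<times> {\<sigma><..<\<tau>}) (\<lambda>(x, t). pshift k x t)" if k: "k \<le> n" for k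
  proof -
    have "continuous_on ({a..b} \<times> {\<sigma><..<\<tau>}) (\<lambda>z. p k (fst z) l)"
      by (rule continuous_on_compose2[OF cont_p[OF k]]) (auto intro!: continuous_intros)
    then show ?thesis unfolding pshift_def case_prod_unfold by (cases "k = n") (auto intro!: continuous_intros)
  qed
  show "pshift 0 x t > 0" if "x \<in> {a..b}" for x t using p0[OF that] n by (simp add: pshift_def)
  show "Ck_on a b (n - k) (\<lambda>x. pshift k x t)" if "k < n" for k t using p[OF that] that by (simp add: pshift_def)
  show "(\<lambda>t. pshift k x t) differentiable (at t)" for k x t
    unfolding pshift_def by (cases "k = n") (auto intro!: derivative_intros)
  show "continuous_on ({a..b} \<times> {\<sigma><..<\<tau>}) (\<lambda>(x, t). deriv (\<lambda>t. pshift k x t) t)" for k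
    unfolding d by (simp add: case_prod_unfold)
  fix t y assume "y \<in> eigsp n a b pshift (\<lambda>_. V) t 0" and y0: "y \<noteq> 0"
  then have y: "y \<in> G" unfolding eigsp_pshift[of "\<lambda>_. V", OF refl] using eigsp_iff[of "\<lambda>_. V" y "complex_of_real t"] by simp
  have s: "(\<Sum>k=0..n. f k) = (\<Sum>k=0..<n. f k) + f n" for f :: "nat \<Rightarrow> real"
    by (simp add: atLeastLessThanSuc_atLeastAtMost[symmetric])
  have 1: "(\<Sum>k=0..n. integral {a..b} (\<lambda>x. deriv (\<lambda>t. pshift k x t) t * (cmod (dw a b (n - k) y x))\<^sup>2)) = - energy a b y"
    unfolding d s by (simp add: energy_def)
  have "bdry (2 * n) (\<lambda>i j. A_deriv (2 * n) (\<lambda>_. V) t $$ (i, j)) (bw n a b y) (bw n a b y) = 0"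
    unfolding bdry_def by (intro sum.neutral ballI) (simp add: A_deriv_def)
  then have 2: "inner_cvec (A_deriv (2 * n) (\<lambda>_. V) t *\<^sub>v bv_wedge n a b y) (bv_wedge n a b y) = 0"
    by (subst inner_cvec_bdry) (auto simp: A_deriv_def)
  show "(\<Sum>k=0..n. integral {a..b} (\<lambda>x. deriv (\<lambda>t. pshift k x t) t * (cmod (dw a b (n - k) y x))\<^sup>2))
    + Re (inner_cvec (A_deriv (2 * n) (\<lambda>_. V) t *\<^sub>v bv_wedge n a b y) (bv_wedge n a b y)) < 0"
    unfolding 1 2 using energy_pos[OF y y0] by simp
qed (use ab n V in auto)

text \<open>At \<mu> = - C Garding's inequality makes the shifted form nonnegative, so its index is
  0, and the jump formula on [-C, 0) expresses the index of \<open>B\<close> as a number of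
  eigenvalues. None lies below -C, so all negative ones are counted.\<close>

theorem index_eq_nu:
  assumes U: "U l = V"
  shows "index_of D (\<lambda>y. Re (B y y)) = nu_S n a b p U l"
proof -
  obtain c C where c: "c > 0" and C: "C \<ge> 0"
    and g': "\<forall>y. Ck_on a b n y \<longrightarrow> Re (B y y) \<ge> c * Re (sob n a b y y) - C * energy a b y"
    using garding_B by (elim exE conjE) (rule that)
  have g: "Re (B y y) \<ge> c * Re (sob n a b y y) - C * energy a b y" if "Ck_on a b n y" for y
    by (rule mp[OF spec[OF g'] that])
  \<comment> \<open>The bounds -C - 1 and 1 give an open parameter interval around [-C, 0], also
    when C = 0.\<close>
  interpret F: operator_family n a b pshift "\<lambda>_. V" "- C - 1" 1 by (rule pshift_family)
  have dom: "F.fdom t = D" for t by (simp only: F.fdom_def D_def)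
  have q: "Re (F.form t y y) = Re (B y y) - t * energy a b y" if "y \<in> D" for t y
    unfolding F.form_def by (rule pshift_form[OF D_Ck[OF that]])
  have jump: "F.ind 0 = F.ind (- C) + N_S n a b pshift (\<lambda>_. V) (- C) 0"
    by (rule F.index_difference) (use C in auto)
  have "has_index D (\<lambda>y. Re (F.form (- C) y y)) 0"
    unfolding has_index_def
  proof (intro conjI allI notI)
    show "\<exists>v. neg_family D (\<lambda>y. Re (F.form (- C) y y)) 0 v" by (simp add: neg_family_def)
    fix v assume nf: "neg_family D (\<lambda>y. Re (F.form (- C) y y)) (Suc 0) v"
    have vD: "v 0 \<in> D" using conjunct1[OF nf[unfolded neg_family_def]] by simp
    have "Re (F.form (- C) (v 0) (v 0)) < 0"
      using mp[OF spec[OF conjunct2[OF nf[unfolded neg_family_def]], of "\<lambda>_. 1"]] by simp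
    moreover have "c * Re (sob n a b (v 0) (v 0)) \<ge> 0" using c sob_nonneg[OF D_Ck[OF vD]] by simp
    moreover have "Re (F.form (- C) (v 0) (v 0)) = Re (B (v 0) (v 0)) + C * energy a b (v 0)"
      using q[OF vD, of "- C"] by simp
    ultimately show False using g[OF D_Ck[OF vD]] by linarith
  qed
  then have indC: "F.ind (- C) = 0" unfolding F.ind_def dom by (rule index_of_eq)
  have "F.form 0 = B" unfolding F.form_def B_def by (simp add: pshift_def)
  then have ind0: "F.ind 0 = index_of D (\<lambda>y. Re (B y y))" unfolding F.ind_def dom by (simp only: )
  \<comment> \<open>An eigenfunction satisfies B(y,y) = \<mu> times its energy; for \<mu> < - C this
    violates Garding's inequality.\<close>
  have none: "\<not> is_eig n a b p U l (complex_of_real \<mu>)" if \<mu>: "\<mu> < - C" for \<mu>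
  proof
    assume e: "is_eig n a b p U l (complex_of_real \<mu>)"
    have 0: "(\<lambda>x. 0) \<in> G" using G_lincomb[of "{}::nat set" "\<lambda>_ _. 0" "\<lambda>_. 0"] by simp
    have "(\<lambda>x. 0) \<in> eigsp n a b p U l (complex_of_real \<mu>)"
      unfolding eigsp_iff[of U _ "complex_of_real \<mu>", OF U] using 0 S_zero by simp
    then have "0 \<in> eigsp n a b p U l (complex_of_real \<mu>)" by (simp only: zero_fun_def)
    with e obtain y where yE: "y \<in> eigsp n a b p U l (complex_of_real \<mu>)" and y0: "y \<noteq> 0" unfolding is_eig_def by blast
    have "y \<in> G \<and> (\<forall>x\<in>{a..b}. S y x = complex_of_real \<mu> * y x)"
      by (rule iffD1[OF eigsp_iff[of U y "complex_of_real \<mu>", OF U] yE])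
    then have y: "y \<in> G" and S: "\<And>x. x \<in> {a..b} \<Longrightarrow> S y x = complex_of_real \<mu> * y x" by simp_all
    have yC: "Ck_on a b n y" by (rule D_Ck[OF green_D(1)[OF y]])
    have "(\<mu> + C) * energy a b y < 0" using \<mu> energy_pos[OF y y0] by (simp add: mult_less_0_iff)
    moreover have "c * Re (sob n a b y y) \<ge> 0" using c sob_nonneg[OF yC] by simp
    moreover have "Re (B y y) = \<mu> * energy a b y" by (rule Re_B_eigenvector[OF y S])
    moreover have "(\<mu> + C) * energy a b y = \<mu> * energy a b y + C * energy a b y" by (rule distrib_right)
    ultimately show False using g[OF yC] by linarith
  qed
  have e: "is_eig n a b pshift (\<lambda>_. V) \<mu> 0 = is_eig n a b p U l (complex_of_real \<mu>)" for \<mu>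
    by (simp only: is_eig_def eigsp_pshift[of U, OF U])
  \<comment> \<open>The half-open interval fits: the eigenvalue 0 is excluded on both sides.\<close>
  have sets: "{\<mu>. \<mu> < 0 \<and> is_eig n a b p U l (complex_of_real \<mu>)} = {\<mu>. \<mu> \<in> {- C..<0} \<and> is_eig n a b pshift (\<lambda>_. V) \<mu> 0}"
    unfolding e using none by (intro Collect_cong) (metis atLeastLessThan_iff not_le)
  have "nu_S n a b p U l = N_S n a b pshift (\<lambda>_. V) (- C) 0"
    unfolding nu_S_def N_S_def sets by (intro sum.cong refl) (simp only: eig_mult_def eigsp_pshift[of U, OF U])
  then show ?thesis using trans[OF ind0[symmetric] jump] indC by linarith
qed

end

text \<open>The index of the form is identified with the number of negative eigenvalues at both ends
  of the interval. The difference is taken in the integers, since truncated subtraction would hide a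
  negative value.\<close>

theorem theorem6:
  fixes n :: nat and a b \<sigma> \<tau> :: real
    and p :: "nat \<Rightarrow> real \<Rightarrow> real \<Rightarrow> real"
    and U :: "real \<Rightarrow> complex mat"
  assumes n_pos: "n \<ge> 1" and ab: "a < b" and st: "\<sigma> < \<tau>"
    and p_cont: "\<forall>k\<le>n. continuous_on ({a..b} \<times> {\<sigma><..<\<tau>}) (\<lambda>(x, l). p k x l)"
    and p0_pos: "\<forall>l\<in>{\<sigma><..<\<tau>}. \<forall>x\<in>{a..b}. p 0 x l > 0"
    and p_reg: "\<forall>l\<in>{\<sigma><..<\<tau>}. \<forall>k<n. Ck_on a b (n - k) (\<lambda>x. p k x l)"
    and U_unitary: "\<forall>l\<in>{\<sigma><..<\<tau>}. unitary_mat (2 * n) (U l)"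
    and U_cont: "\<forall>i<2 * n. \<forall>j<2 * n. continuous_on {\<sigma><..<\<tau>} (\<lambda>l. U l $$ (i, j))"
    and ker_const: "\<forall>l1\<in>{\<sigma><..<\<tau>}. \<forall>l2\<in>{\<sigma><..<\<tau>}.
                      mat_kernel (U l1 - 1\<^sub>m (2 * n)) = mat_kernel (U l2 - 1\<^sub>m (2 * n))"
    and p_diff: "\<forall>k\<le>n. \<forall>x\<in>{a..b}. \<forall>l\<in>{\<sigma><..<\<tau>}. (\<lambda>l'. p k x l') differentiable (at l)"
    and p_diff_cont: "\<forall>k\<le>n. continuous_on ({a..b} \<times> {\<sigma><..<\<tau>}) (\<lambda>(x, l). deriv (\<lambda>l'. p k x l') l)"
    and U_C1: "\<forall>i<2 * n. \<forall>j<2 * n. \<exists>f'. (\<forall>l\<in>{\<sigma><..<\<tau>}.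
                  ((\<lambda>l'. U l' $$ (i, j)) has_vector_derivative f' l) (at l)) \<and> continuous_on {\<sigma><..<\<tau>} f'"
    and neg: "\<forall>l0\<in>{\<sigma><..<\<tau>}. \<forall>y0\<in>eigsp n a b p U l0 0. y0 \<noteq> 0 \<longrightarrow>
                 (\<Sum>k=0..n. integral {a..b} (\<lambda>x. deriv (\<lambda>l. p k x l) l0 * (cmod (dw a b (n - k) y0 x))\<^sup>2))
                 + Re (inner_cvec (A_deriv (2 * n) U l0 *\<^sub>v bv_wedge n a b y0) (bv_wedge n a b y0)) < 0"
    and xi: "\<sigma> < \<xi>1" "\<xi>1 < \<xi>2" "\<xi>2 < \<tau>"
  shows "N_S n a b p U \<xi>1 \<xi>2 = int (nu_S n a b p U \<xi>2) - int (nu_S n a b p U \<xi>1)"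
proof -
  interpret F: operator_family n a b p U \<sigma> \<tau>
  proof (rule operator_family.intro)
    show "a < b" "n \<ge> 1" by (fact ab n_pos)+
    show "continuous_on ({a..b} \<times> {\<sigma><..<\<tau>}) (\<lambda>(x, l). p k x l)" if "k \<le> n" for k
      by (rule mp[OF spec[OF p_cont] that])
    show "p 0 x l > 0" if "l \<in> {\<sigma><..<\<tau>}" "x \<in> {a..b}" for l x
      by (rule bspec[OF bspec[OF p0_pos that(1)] that(2)])
    show "Ck_on a b (n - k) (\<lambda>x. p k x l)" if "l \<in> {\<sigma><..<\<tau>}" "k < n" for l k
      by (rule mp[OF spec[OF bspec[OF p_reg that(1)]] that(2)])
    show "unitary_mat (2 * n) (U l)" if "l \<in> {\<sigma><..<\<tau>}" for l by (rule bspec[OF U_unitary that])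
    show "mat_kernel (U l1 - 1\<^sub>m (2 * n)) = mat_kernel (U l2 - 1\<^sub>m (2 * n))"
      if "l1 \<in> {\<sigma><..<\<tau>}" "l2 \<in> {\<sigma><..<\<tau>}" for l1 l2 by (rule bspec[OF bspec[OF ker_const that(1)] that(2)])
    show "(\<lambda>l'. p k x l') differentiable (at l)" if "k \<le> n" "x \<in> {a..b}" "l \<in> {\<sigma><..<\<tau>}" for k x l
      by (rule bspec[OF bspec[OF mp[OF spec[OF p_diff] that(1)] that(2)] that(3)])
    show "continuous_on ({a..b} \<times> {\<sigma><..<\<tau>}) (\<lambda>(x, l). deriv (\<lambda>l'. p k x l') l)" if "k \<le> n" for k
      by (rule mp[OF spec[OF p_diff_cont] that])
    show "(\<Sum>k=0..n. integral {a..b} (\<lambda>x. deriv (\<lambda>l'. p k x l') l * (cmod (dw a b (n - k) y x))\<^sup>2))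
          + Re (inner_cvec (A_deriv (2 * n) U l *\<^sub>v bv_wedge n a b y) (bv_wedge n a b y)) < 0"
      if "l \<in> {\<sigma><..<\<tau>}" "y \<in> eigsp n a b p U l 0" "y \<noteq> 0" for l y
      by (rule mp[OF bspec[OF bspec[OF neg that(1)] that(2)] that(3)])
    fix l i j assume l: "l \<in> {\<sigma><..<\<tau>}" and ij: "i < 2 * n" "j < 2 * n"
    from mp[OF spec[OF mp[OF spec[OF U_C1] ij(1)]] ij(2)]
    obtain f' where f': "\<forall>l\<in>{\<sigma><..<\<tau>}. ((\<lambda>l'. U l' $$ (i, j)) has_vector_derivative f' l) (at l)"
      by (elim exE conjE) (rule that)
    show "(\<lambda>t. U t $$ (i, j)) differentiable (at l)" by (rule differentiableI_vector[OF bspec[OF f' l]])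
  qed
  have ind: "F.ind t = nu_S n a b p U t" if t: "t \<in> {\<sigma><..<\<tau>}" for t
  proof -
    interpret O: operator_at n a b p t "U t" by (rule F.operator_at[OF t])
    have D: "O.D = F.fdom t" and B: "O.B = F.form t" unfolding O.D_def O.B_def F.fdom_def F.form_def by (rule refl)+
    show ?thesis using O.index_eq_nu[of U, OF refl] unfolding D B F.ind_def .
  qed
  have x: "\<xi>1 \<in> {\<sigma><..<\<tau>}" "\<xi>2 \<in> {\<sigma><..<\<tau>}" using xi by auto
  have "F.ind \<xi>2 = F.ind \<xi>1 + N_S n a b p U \<xi>1 \<xi>2" by (rule F.index_difference) (use xi in auto)
  then show ?thesis unfolding ind[OF x(1)] ind[OF x(2)] by simp
qed

end
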